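(* Let $n\ge 2$ and $k\ge 2$ be integers and let $\Sigma\subseteq\mathbb{R}^n$ be a compact hypersurface of class $C^k$. Then there exist arbitrarily small $C^k$ perturbations $\Sigma'$ of $\Sigma$ for which the following holds. There is a constant $C\ge 1$ (independent of $R$ and of the size of the perturbation) and there is $R_0\ge 1$ such that for all $R\ge R_0$ there exist $f\in L^2(\Sigma')$ and a measurable weight $w\colon\mathbb{R}^n\to[0,\infty)$ supported on $\mathbb{B}_R^n$, with $\|\mathcal{E}_{\Sigma'}f\|_{L^2(\mathbb{R}^n,w\,dx)}>0$, such that $$R^{\frac{n-1}{n-1+k}}\,\|Xw\|_{L^\infty(\mathrm{AGr}_1(\mathbb{R}^n))}\,\|f\|_{L^2(\Sigma')}^2\,\|\mathcal{E}_{\Sigma'}f\|_{L^2(\mathbb{R}^n,w\,dx)}^{-2}\le C\exp\left(C\sqrt{\log R\,\log\log R}\right).$$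
   Context: $\mathbb{B}_R^n$ is the ball of radius $R$ about the origin in $\mathbb{R}^n$. For a compact hypersurface $S\subseteq\mathbb{R}^n$ with surface measure $\sigma$, the Fourier extension operator is $\mathcal{E}_S f(x)=\int_S e^{2\pi i x\cdot y}f(y)\,d\sigma(y)$ for $f\colon S\to\mathbb{C}$, and $L^2(S)$ is taken with respect to $\sigma$. $\mathrm{AGr}_1(\mathbb{R}^n)$ is the set of affine lines in $\mathbb{R}^n$. The X-ray transform is $Xw(\ell)=\int_\ell w$ (integral with respect to arc length) for $\ell\in\mathrm{AGr}_1(\mathbb{R}^n)$, and $\|Xw\|_{L^\infty(\mathrm{AGr}_1(\mathbb{R}^n))}$ is its supremum over lines. $\|g\|_{L^2(\mathbb{R}^n,w\,dx)}^2=\int|g|^2w\,dx$. Hypersurfaces may have boundary. "There exist arbitrarily small $C^k$ perturbations $\Sigma'$ of $\Sigma$" means: for every $\epsilon>0$ there is a $C^k$ map $\eta\colon\Sigma\to\mathbb{R}^n$ whose $C^k$ norm (measured in a fixed finite family of $C^k$ parametrizations of $\Sigma$) is at most $\epsilon$ and such that $\Sigma'=\{x+\eta(x):x\in\Sigma\}$ is a hypersurface with the stated property. The constant $C$ may depend on $n,k,\Sigma$, and $R_0$ may also depend on $\Sigma'$. *)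

theory Defs
  imports "HOL-Analysis.Analysis"
begin

section \<open>Maps of class $C^k$\<close>

primrec iter_partial ::
  "'a::euclidean_space list \<Rightarrow> ('a \<Rightarrow> 'b::real_normed_vector) \<Rightarrow> 'a \<Rightarrow> 'b" where
  "iter_partial [] f = f"
| "iter_partial (b # bs) f = (\<lambda>x. frechet_derivative (iter_partial bs f) (at x) b)"

definition multi_index :: "nat \<Rightarrow> 'a::euclidean_space list set" where
  "multi_index k = {bs. set bs \<subseteq> Basis \<and> length bs \<le> k}"

text \<open>Only meaningful for open sets, where all derivatives are two-sided.\<close>

definition Ck_on ::
  "nat \<Rightarrow> ('a::euclidean_space \<Rightarrow> 'b::real_normed_vector) \<Rightarrow> 'a set \<Rightarrow> bool" where
  "Ck_on k f U \<longleftrightarrow>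
     (\<forall>bs \<in> multi_index k. continuous_on U (iter_partial bs f) \<and>
        (length bs < k \<longrightarrow> iter_partial bs f differentiable_on U))"

text \<open>A map on an arbitrary (in practice compact) subset of Euclidean space is of class $C^k$
  if it is the restriction of a $C^k$ map on an open neighbourhood; maps on a subset are
  represented by such an extension.\<close>

definition Ck_map ::
  "nat \<Rightarrow> ('a::euclidean_space \<Rightarrow> 'b::real_normed_vector) \<Rightarrow> 'a set \<Rightarrow> bool" where
  "Ck_map k f S \<longleftrightarrow> (\<exists>N. open N \<and> S \<subseteq> N \<and> Ck_on k f N)"


section \<open>Hypersurfaces, possibly with boundary\<close>

text \<open>The space $\mathbb{R}^{n-1}$ is \<open>real^'m\<close> with \<open>CARD('m) = CARD('n) - 1\<close>.
  A chart straightens the ambient space \<open>real^'n\<close> to \<open>(real^'m) \<times> real\<close>, and takes the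
  hypersurface to the hyperplane \<open>UNIV \<times> {0}\<close> or to a closed half of it.\<close>

definition slice_chart ::
  "nat \<Rightarrow> (real^'n) set \<Rightarrow> (real^'n) set \<Rightarrow> ((real^'m) \<times> real) set \<Rightarrow>
   (real^'n \<Rightarrow> (real^'m) \<times> real) \<Rightarrow> ((real^'m) \<times> real \<Rightarrow> real^'n) \<Rightarrow> bool" where
  "slice_chart k S U V \<Phi> \<Psi> \<longleftrightarrow>
     open U \<and> open V \<and> homeomorphism U V \<Phi> \<Psi> \<and> Ck_on k \<Phi> U \<and> Ck_on k \<Psi> V \<and>
     (\<exists>H. (H = UNIV \<or> (\<exists>b\<in>Basis. H = {u. 0 \<le> u \<bullet> b})) \<and> \<Phi> ` (U \<inter> S) = V \<inter> (H \<times> {0}))"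

definition compact_hypersurface ::
  "'m::finite itself \<Rightarrow> nat \<Rightarrow> (real^'n) set \<Rightarrow> bool" where
  "compact_hypersurface _ k S \<longleftrightarrow> compact S \<and> S \<noteq> {} \<and>
     (\<forall>p\<in>S. \<exists>U V \<Phi> (\<Psi> :: (real^'m) \<times> real \<Rightarrow> real^'n). p \<in> U \<and> slice_chart k S U V \<Phi> \<Psi>)"

text \<open>Parametrizations are defined near a compact set \<open>K\<close>, which may touch the boundary of the
  hypersurface. As \<open>K\<close> is the closure of its interior, the derivatives at points of \<open>K\<close>
  of \<open>\<phi>\<close>, and of \<open>g \<circ> \<phi>\<close> for a \<open>C\<^sup>k\<close> map \<open>g\<close>, depend only on the values on \<open>K\<close>.\<close>

definition Ck_parametrization ::
  "nat \<Rightarrow> (real^'n) set \<Rightarrow> (real^'m) set \<Rightarrow> (real^'m \<Rightarrow> real^'n) \<Rightarrow> bool" where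
  "Ck_parametrization k S K \<phi> \<longleftrightarrow>
     compact K \<and> K \<subseteq> closure (interior K) \<and> Ck_map k \<phi> K \<and> inj_on \<phi> K \<and>
     (\<forall>u\<in>K. inj (frechet_derivative \<phi> (at u))) \<and> \<phi> ` K \<subseteq> S"

definition Ck_parametrization_family ::
  "nat \<Rightarrow> (real^'n) set \<Rightarrow> ((real^'m) set \<times> (real^'m \<Rightarrow> real^'n)) set \<Rightarrow> bool" where
  "Ck_parametrization_family k S F \<longleftrightarrow>
     finite F \<and> (\<forall>(K, \<phi>)\<in>F. Ck_parametrization k S K \<phi>) \<and> (\<Union>(K, \<phi>)\<in>F. \<phi> ` K) = S"

definition Ck_norm ::
  "nat \<Rightarrow> ((real^'m) set \<times> (real^'m \<Rightarrow> real^'n)) set \<Rightarrow> (real^'n \<Rightarrow> real^'n) \<Rightarrow> ennreal" where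
  "Ck_norm k F \<eta> =
     (SUP (K, \<phi>)\<in>F. SUP u\<in>K. SUP bs\<in>multi_index k. ennreal (norm (iter_partial bs (\<eta> \<circ> \<phi>) u)))"


section \<open>Surface measure and the Fourier extension operator\<close>

definition area_element :: "(real^'m \<Rightarrow> real^'n) \<Rightarrow> real^'m \<Rightarrow> real" where
  "area_element \<phi> u =
     (let D = matrix (frechet_derivative \<phi> (at u)) in sqrt (det (transpose D ** D)))"

text \<open>The unique Borel measure carried by \<open>S\<close> that is given by the area element in every
  parametrization.\<close>

definition surface_measure :: "'m::finite itself \<Rightarrow> (real^'n) set \<Rightarrow> (real^'n) measure" where
  "surface_measure _ S = (THE \<sigma>. sets \<sigma> = sets borel \<and> emeasure \<sigma> (- S) = 0 \<and>
     (\<forall>K (\<phi> :: real^'m \<Rightarrow> real^'n). Ck_parametrization 1 S K \<phi> \<longrightarrow>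
        (\<forall>A\<in>sets borel. A \<subseteq> \<phi> ` K \<longrightarrow>
           emeasure \<sigma> A = (\<integral>\<^sup>+u. indicator (K \<inter> \<phi> -` A) u * ennreal (area_element \<phi> u) \<partial>lborel))))"

definition square_integrable :: "'a measure \<Rightarrow> ('a \<Rightarrow> complex) set" where
  "square_integrable \<sigma> =
     {f \<in> borel_measurable \<sigma>. integrable \<sigma> (\<lambda>y. (cmod (f y))\<^sup>2)}"

definition L2_norm_sq :: "'a measure \<Rightarrow> ('a \<Rightarrow> complex) \<Rightarrow> ennreal" where
  "L2_norm_sq \<sigma> f = (\<integral>\<^sup>+y. ennreal ((cmod (f y))\<^sup>2) \<partial>\<sigma>)"

definition fourier_extension :: "(real^'n) measure \<Rightarrow> (real^'n \<Rightarrow> complex) \<Rightarrow> real^'n \<Rightarrow> complex" where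
  "fourier_extension \<sigma> f x = (\<integral>y. exp (2 * of_real pi * \<i> * of_real (x \<bullet> y)) * f y \<partial>\<sigma>)"

definition weighted_L2_norm_sq :: "(real^'n \<Rightarrow> real) \<Rightarrow> (real^'n \<Rightarrow> complex) \<Rightarrow> ennreal" where
  "weighted_L2_norm_sq w g = (\<integral>\<^sup>+x. ennreal ((cmod (g x))\<^sup>2 * w x) \<partial>lborel)"


section \<open>The X-ray transform\<close>

definition affine_lines :: "(real^'n) set set" where
  "affine_lines = {l. affine l \<and> aff_dim l = 1}"

text \<open>The value does not depend on the arc-length parametrization of the line.\<close>

definition xray :: "(real^'n \<Rightarrow> real) \<Rightarrow> (real^'n) set \<Rightarrow> ennreal" where
  "xray w l = (THE I. \<forall>a v. norm v = 1 \<and> l = range (\<lambda>t::real. a + t *\<^sub>R v) \<longrightarrow>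
     I = (\<integral>\<^sup>+t. ennreal (w (a + t *\<^sub>R v)) \<partial>lborel))"

definition xray_sup_norm :: "(real^'n \<Rightarrow> real) \<Rightarrow> ennreal" where
  "xray_sup_norm w = (SUP l\<in>affine_lines. xray w l)"

end

theory Submission
  imports Defs "HOL-Computational_Algebra.Primes" "HOL-Real_Asymp.Real_Asymp"
begin

text \<open>
  The weighted inequality is violated by a coincidence of phases. Let \<open>f\<close> put mass one on tiny caps of the hypersurface
  around \<open>N\<close> nodes. Then the extension of \<open>f\<close> is nearly the sum of \<open>N\<close> exponentials, and it has size comparable
  with \<open>N\<close> at each frequency at which all exponentials have nearly the same value. Let \<open>w\<close> be the
  indicator of small balls around a set \<open>Z\<close> of such frequencies in the ball of radius \<open>R\<close>, and suppose that at most
  \<open>M\<close> points of \<open>Z\<close> lie near any line. The caps have radius about \<open>1 / R\<close>, so that the left hand side of the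
  inequality is about $R^\alpha M R^{n-1} / (N |Z|)$ with $\alpha = (n-1)/(n-1+k)$; see \<open>aligned_counterexample\<close> and
  \<open>scale_counterexample\<close>. It remains to make $N$ about $R^\alpha$ and $|Z|$ about $R^{n-1}$, with small \<open>M\<close>, up to
  factors of the order of the right hand side.

  Nodes and frequencies come from a random construction in $(\mathbb{Z}/P)^n$ for a large prime \<open>P\<close>. Choose \<open>d\<close> random
  generators. The frequencies are the integer vectors whose products with all generators are within \<open>\<eta> P\<close> of multiples
  of \<open>P\<close>; there are about $R^n \eta^d$ of them (\<open>bohr_set_large\<close>). The nodes are points of the generalized
  arithmetic progression of side \<open>L\<close> with these generators, divided by \<open>P\<close>; the phases at the
  frequencies are aligned if $d L \eta$ is small (\<open>gap_point_aligned\<close>). By the second moment method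
  (\<open>card_gap_miss\<close>) the progression hits most of any given family of targets of density at least $8 L^{-d}$. With
  \<open>\<eta>\<close> such that $\eta^d$ is about $1/R$ this density is about $1/R$. A target is a box with \<open>n - 1\<close> sides
  of length about \<open>\<delta>\<close> and one side of length about $\delta^k$, around a piece of the hypersurface; so $\delta^{n-1+k}$
  is about $1/R$, and the number of disjoint boxes is about $\delta^{-(n-1)} = R^\alpha$.

  The bound for points near a line is the main difficulty (\<open>card_crowded_generators\<close>). If a tube contained many frequencies,
  then by \<open>multiscale_independent\<close> it would contain independent vectors, some of them very short or with products
  very close to multiples of \<open>P\<close>. By \<open>large_sieve\<close> such vectors impose nearly independent conditions on each of the
  \<open>d\<close> generators. As the direction of a line can be discretized, there are few enough tuples of
  vectors for a union bound. One obtains $M = 3^{H+n+d}$ with $H$ about $\log R / d$, whereas factors $d^d$ are lost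
  elsewhere; both are balanced by taking \<open>d\<close> about $\sqrt{\log R / \log\log R}$ (\<open>scale_parameters\<close>).

  A bump of width \<open>\<delta>\<close> and height $\delta^k$ has bounded $C^k$ norm. Thus the hypersurface can be moved through the nodes
  by adding bumps in a transversal coordinate direction. This is done for all dyadic radii $R = 2^j$ simultaneously, over
  disjoint cubes and with bumps smaller by $1/j^2$; the omission of finitely many radii makes the perturbation as
  small as desired (\<open>node_perturbation\<close>). Since the perturbation is the restriction of a shear of the whole space,
  its image is again a hypersurface. Constants that depend on the perturbed hypersurface are absorbed
  by the exponential factor for large \<open>R\<close>, so that the constant \<open>C\<close> depends on the dimension only.

  A preliminary part shows that the surface measure, defined by a description, exists and is unique.
\<close>

section \<open>Calculus of $C^k$ maps\<close>

lemma Nil_in_multi_index [simp]: "[] \<in> multi_index k"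
  by (simp add: multi_index_def)

lemma multi_index_Suc:
  "multi_index (Suc k) = insert [] {cs @ [b] | cs b. cs \<in> multi_index k \<and> b \<in> (Basis :: 'a::euclidean_space set)}"
proof (rule set_eqI)
  fix bs :: "'a list"
  show "bs \<in> multi_index (Suc k) \<longleftrightarrow> bs \<in> insert [] {cs @ [b] | cs b. cs \<in> multi_index k \<and> b \<in> Basis}"
    by (cases bs rule: rev_cases) (auto simp: multi_index_def)
qed

lemma multi_index_mono: "k \<le> l \<Longrightarrow> multi_index k \<subseteq> multi_index l"
  by (auto simp: multi_index_def)

lemma iter_partial_append: "iter_partial (bs @ cs) f = iter_partial bs (iter_partial cs f)"
  by (induction bs) auto

lemma iter_partial_snoc:
  "iter_partial (bs @ [b]) f = iter_partial bs (\<lambda>x. frechet_derivative f (at x) b)"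
  by (simp add: iter_partial_append)

lemma frechet_derivative_cong_open:
  assumes "open U" "x \<in> U" "\<And>y. y \<in> U \<Longrightarrow> f y = g y"
  shows "frechet_derivative f (at x) = frechet_derivative g (at x)"
proof -
  have "(f has_derivative D) (at x) \<longleftrightarrow> (g has_derivative D) (at x)" for D
    using has_derivative_transform_within_open[OF _ assms(1,2), of f D UNIV g]
      has_derivative_transform_within_open[OF _ assms(1,2), of g D UNIV f] assms(3) by auto
  then show ?thesis by (simp add: frechet_derivative_def)
qed

lemma iter_partial_cong_open:
  assumes "open U" "\<And>y. y \<in> U \<Longrightarrow> f y = g y" "x \<in> U"
  shows "iter_partial bs f x = iter_partial bs g x"
  using assms(3)
proof (induction bs arbitrary: x)
  case Nil
  then show ?case using assms(2) by simp
next
  case (Cons b bs)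
  then show ?case
    using frechet_derivative_cong_open[OF assms(1) Cons.prems, of "iter_partial bs f" "iter_partial bs g"]
    by simp
qed

subsection \<open>The recursive characterization\<close>

lemma Ck_on_0: "Ck_on 0 f U \<longleftrightarrow> continuous_on U f"
  by (auto simp: Ck_on_def multi_index_def)

text \<open>With this characterization closure properties follow by induction on \<open>k\<close> from the rules for first
  derivatives. The induction peels off the innermost derivative, whereas \<open>iter_partial\<close> adds
  derivatives on the outside; hence \<open>iter_partial_snoc\<close>.\<close>

lemma Ck_on_Suc:
  "Ck_on (Suc k) f U \<longleftrightarrow> continuous_on U f \<and> f differentiable_on U \<and>
     (\<forall>b\<in>Basis. Ck_on k (\<lambda>x. frechet_derivative f (at x) b) U)"
proof -
  have "Ck_on (Suc k) f U \<longleftrightarrow> continuous_on U f \<and> f differentiable_on U \<and>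
     (\<forall>b\<in>Basis. \<forall>cs\<in>multi_index k. continuous_on U (iter_partial (cs @ [b]) f) \<and>
        (length (cs @ [b]) < Suc k \<longrightarrow> iter_partial (cs @ [b]) f differentiable_on U))"
    unfolding Ck_on_def multi_index_Suc by auto
  then show ?thesis
    by (simp only: iter_partial_snoc) (auto simp: Ck_on_def)
qed

lemma Ck_on_imp_continuous: "Ck_on k f U \<Longrightarrow> continuous_on U f"
  by (cases k) (auto simp: Ck_on_0 Ck_on_Suc)

lemma Ck_on_le: "Ck_on k f U \<Longrightarrow> l \<le> k \<Longrightarrow> Ck_on l f U"
  unfolding Ck_on_def by (meson in_mono less_le_trans multi_index_mono)

lemma Ck_on_subset: "Ck_on k f U \<Longrightarrow> V \<subseteq> U \<Longrightarrow> Ck_on k f V"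
  unfolding Ck_on_def by (meson continuous_on_subset differentiable_on_subset)

lemma Ck_on_cong:
  assumes "open U" "\<And>y. y \<in> U \<Longrightarrow> f y = g y"
  shows "Ck_on k f U \<longleftrightarrow> Ck_on k g U"
proof -
  have "continuous_on U (iter_partial bs f) \<longleftrightarrow> continuous_on U (iter_partial bs g)" for bs
    by (rule continuous_on_cong) (auto intro: iter_partial_cong_open[OF assms])
  moreover have "iter_partial bs f differentiable_on U \<longleftrightarrow> iter_partial bs g differentiable_on U" for bs
  proof -
    have eq: "iter_partial bs f y = iter_partial bs g y" if "y \<in> U" for y
      by (rule iter_partial_cong_open[OF assms that])
    have "iter_partial bs f differentiable (at x within U) \<longleftrightarrow> iter_partial bs g differentiable (at x within U)"
      if "x \<in> U" for x
    proof
      show "iter_partial bs g differentiable (at x within U)" if "iter_partial bs f differentiable (at x within U)"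
        by (rule differentiable_transform_within[OF that zero_less_one \<open>x \<in> U\<close>]) (rule eq)
      show "iter_partial bs f differentiable (at x within U)" if "iter_partial bs g differentiable (at x within U)"
        by (rule differentiable_transform_within[OF that zero_less_one \<open>x \<in> U\<close>]) (rule eq[symmetric])
    qed
    then show ?thesis by (simp add: differentiable_on_def)
  qed
  ultimately show ?thesis by (simp add: Ck_on_def)
qed

lemma differentiable_onD_open: "f differentiable_on U \<Longrightarrow> open U \<Longrightarrow> x \<in> U \<Longrightarrow> f differentiable (at x)"
  by (simp add: differentiable_on_eq_differentiable_at)

lemma Ck_on_has_derivative:
  assumes "Ck_on (Suc k) f U" "open U" "x \<in> U"
  shows "(f has_derivative frechet_derivative f (at x)) (at x)"
  using assms differentiable_onD_open frechet_derivative_works Ck_on_Suc by blast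

lemma Ck_on_has_derivative':
  assumes "Ck_on k f U" "open U" "x \<in> U" "1 \<le> k"
  shows "(f has_derivative frechet_derivative f (at x)) (at x)"
  using Ck_on_has_derivative[of "k - 1" f U x] assms by simp


text \<open>Over the whole space this is the natural norm for a sum of perturbations at infinitely many
  scales; composition with parametrizations turns it into a bound for \<open>Ck_norm\<close>.\<close>

definition Ck_bound ::
  "nat \<Rightarrow> ('a::euclidean_space \<Rightarrow> 'b::real_normed_vector) \<Rightarrow> 'a set \<Rightarrow> real \<Rightarrow> bool" where
  "Ck_bound k f A B \<longleftrightarrow> (\<forall>bs\<in>multi_index k. \<forall>x\<in>A. norm (iter_partial bs f x) \<le> B)"

lemma Ck_bound_0: "Ck_bound 0 f A B \<longleftrightarrow> (\<forall>x\<in>A. norm (f x) \<le> B)"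
  by (auto simp: Ck_bound_def multi_index_def)

lemma Ck_bound_Suc:
  "Ck_bound (Suc k) f A B \<longleftrightarrow> (\<forall>x\<in>A. norm (f x) \<le> B) \<and>
     (\<forall>b\<in>Basis. Ck_bound k (\<lambda>x. frechet_derivative f (at x) b) A B)"
proof -
  have "Ck_bound (Suc k) f A B \<longleftrightarrow> (\<forall>x\<in>A. norm (f x) \<le> B) \<and>
     (\<forall>b\<in>Basis. \<forall>cs\<in>multi_index k. \<forall>x\<in>A. norm (iter_partial (cs @ [b]) f x) \<le> B)"
    unfolding Ck_bound_def multi_index_Suc by auto
  then show ?thesis
    by (simp only: iter_partial_snoc) (auto simp: Ck_bound_def)
qed

lemma Ck_bound_value: "Ck_bound k f A B \<Longrightarrow> x \<in> A \<Longrightarrow> norm (f x) \<le> B"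
  by (metis Ck_bound_def Nil_in_multi_index iter_partial.simps(1))

lemma Ck_bound_mono: "Ck_bound k f A B \<Longrightarrow> B \<le> C \<Longrightarrow> Ck_bound k f A C"
  unfolding Ck_bound_def by force

lemma Ck_bound_le: "Ck_bound k f A B \<Longrightarrow> l \<le> k \<Longrightarrow> Ck_bound l f A B"
  unfolding Ck_bound_def using multi_index_mono by blast

lemma Ck_bound_cong:
  assumes "open U" "A \<subseteq> U" "\<And>y. y \<in> U \<Longrightarrow> f y = g y"
  shows "Ck_bound k f A B \<longleftrightarrow> Ck_bound k g A B"
proof -
  have "iter_partial bs f x = iter_partial bs g x" if "x \<in> A" for bs x
    using iter_partial_cong_open[of U f g x bs] assms that by blast
  then show ?thesis unfolding Ck_bound_def by metis
qed

subsection \<open>Closure properties\<close>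

lemma Ck_on_const: "Ck_on k (\<lambda>x. c) U"
proof (induction k arbitrary: c)
  case 0
  then show ?case by (simp add: Ck_on_0)
next
  case (Suc k)
  then show ?case by (simp add: Ck_on_Suc frechet_derivative_const)
qed

lemma Ck_bound_zero: "0 \<le> B \<Longrightarrow> Ck_bound k (\<lambda>x. 0) A B"
  by (induction k) (simp_all add: Ck_bound_0 Ck_bound_Suc frechet_derivative_const)

lemma Ck_on_bounded_linear:
  assumes "bounded_linear L"
  shows "Ck_on k L U"
proof (cases k)
  case 0
  then show ?thesis by (simp add: Ck_on_0 assms linear_continuous_on)
next
  case (Suc l)
  have "frechet_derivative L (at x) = L" for x
    using frechet_derivative_at[OF bounded_linear_imp_has_derivative[OF assms]] by metis
  then show ?thesis
    using Suc assms by (simp add: Ck_on_Suc Ck_on_const linear_continuous_on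
        bounded_linear_imp_differentiable_on)
qed

lemma frechet_derivative_linear_left:
  assumes "bounded_linear L" "f differentiable (at x)"
  shows "frechet_derivative (\<lambda>x. L (f x)) (at x) b = L (frechet_derivative f (at x) b)"
proof -
  have "((\<lambda>x. L (f x)) has_derivative (\<lambda>h. L (frechet_derivative f (at x) h))) (at x)"
    using assms bounded_linear.has_derivative frechet_derivative_works by blast
  then show ?thesis using frechet_derivative_at by metis
qed

lemma Ck_on_linear_left:
  assumes "bounded_linear L" "open U" "Ck_on k f U"
  shows "Ck_on k (\<lambda>x. L (f x)) U"
  using assms(3)
proof (induction k arbitrary: f)
  case 0
  then show ?case
    using assms(1) linear_continuous_on bounded_linear.continuous_on by (auto simp: Ck_on_0)
next
  case (Suc k)
  then have d: "f differentiable (at x)" if "x \<in> U" for x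
    using that assms(2) differentiable_onD_open by (auto simp: Ck_on_Suc)
  have "(\<lambda>x. L (f x)) differentiable_on U"
    using d bounded_linear.has_derivative[OF assms(1)] assms(2)
    by (auto simp: differentiable_on_eq_differentiable_at differentiable_def) blast
  moreover have "Ck_on k (\<lambda>x. frechet_derivative (\<lambda>x. L (f x)) (at x) b) U" if "b \<in> Basis" for b
    using Suc that Ck_on_cong[OF assms(2), of "\<lambda>x. frechet_derivative (\<lambda>x. L (f x)) (at x) b"
        "\<lambda>x. L (frechet_derivative f (at x) b)"] frechet_derivative_linear_left[OF assms(1) d]
    by (auto simp: Ck_on_Suc)
  moreover have "continuous_on U (\<lambda>x. L (f x))"
    using Suc.prems assms(1) bounded_linear.continuous_on by (auto simp: Ck_on_Suc)
  ultimately show ?case by (simp add: Ck_on_Suc)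
qed

lemma frechet_derivative_plus':
  assumes "f differentiable (at x)" "g differentiable (at x)"
  shows "frechet_derivative (\<lambda>x. f x + g x) (at x) b = frechet_derivative f (at x) b + frechet_derivative g (at x) b"
  by (simp add: frechet_derivative_at[OF has_derivative_add[OF assms[unfolded frechet_derivative_works]], symmetric])

lemma Ck_on_add:
  assumes "open U" "Ck_on k f U" "Ck_on k g U"
  shows "Ck_on k (\<lambda>x. f x + g x) U"
  using assms(2,3)
proof (induction k arbitrary: f g)
  case 0
  then show ?case by (auto simp: Ck_on_0 intro: continuous_on_add)
next
  case (Suc k)
  then have d: "f differentiable (at x)" "g differentiable (at x)" if "x \<in> U" for x
    using that assms(1) differentiable_onD_open by (auto simp: Ck_on_Suc)
  have "Ck_on k (\<lambda>x. frechet_derivative (\<lambda>x. f x + g x) (at x) b) U" if "b \<in> Basis" for b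
    using Suc that Ck_on_cong[OF assms(1), of "\<lambda>x. frechet_derivative (\<lambda>x. f x + g x) (at x) b"
        "\<lambda>x. frechet_derivative f (at x) b + frechet_derivative g (at x) b"] frechet_derivative_plus'[OF d]
    by (auto simp: Ck_on_Suc)
  then show ?case using Suc.prems by (auto simp: Ck_on_Suc continuous_on_add)
qed

lemma Ck_bound_add:
  assumes "open U" "A \<subseteq> U" "Ck_on k f U" "Ck_on k g U" "Ck_bound k f A B" "Ck_bound k g A C"
  shows "Ck_bound k (\<lambda>x. f x + g x) A (B + C)"
  using assms(3-)
proof (induction k arbitrary: f g)
  case 0
  then show ?case by (auto simp: Ck_bound_0 intro: norm_triangle_mono)
next
  case (Suc k)
  then have d: "f differentiable (at x)" "g differentiable (at x)" if "x \<in> U" for x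
    using that assms(1) differentiable_onD_open by (auto simp: Ck_on_Suc)
  have "Ck_bound k (\<lambda>x. frechet_derivative (\<lambda>x. f x + g x) (at x) b) A (B + C)" if "b \<in> Basis" for b
    using Suc that Ck_bound_cong[OF assms(1,2), of "\<lambda>x. frechet_derivative (\<lambda>x. f x + g x) (at x) b"
        "\<lambda>x. frechet_derivative f (at x) b + frechet_derivative g (at x) b"] frechet_derivative_plus'[OF d]
    by (auto simp: Ck_on_Suc Ck_bound_Suc)
  then show ?case using Suc.prems by (auto simp: Ck_bound_Suc intro: norm_triangle_mono)
qed

lemma Ck_on_sum:
  assumes "open U" "\<And>i. i \<in> I \<Longrightarrow> Ck_on k (f i) U"
  shows "Ck_on k (\<lambda>x. \<Sum>i\<in>I. f i x) U"
  using assms(2)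
  by (induction I rule: infinite_finite_induct) (auto intro: Ck_on_add[OF assms(1)] simp: Ck_on_const)

lemma Ck_bound_sum:
  assumes "open U" "A \<subseteq> U" "\<And>i. i \<in> I \<Longrightarrow> Ck_on k (f i) U" "\<And>i. i \<in> I \<Longrightarrow> Ck_bound k (f i) A (B i)"
  shows "Ck_bound k (\<lambda>x. \<Sum>i\<in>I. f i x) A (\<Sum>i\<in>I. B i)"
  using assms(3,4)
proof (induction I rule: infinite_finite_induct)
  case (insert i I)
  then show ?case
    using Ck_bound_add[OF assms(1,2), of k "f i" "\<lambda>x. \<Sum>i\<in>I. f i x" "B i" "sum B I"]
      Ck_on_sum[OF assms(1), of I k f]
    by simp
qed (auto simp: Ck_bound_zero)

lemma frechet_derivative_scaleR:
  fixes a :: "'a::euclidean_space \<Rightarrow> real"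
  assumes "a differentiable (at x)" "g differentiable (at x)"
  shows "frechet_derivative (\<lambda>x. a x *\<^sub>R g x) (at x) b =
    a x *\<^sub>R frechet_derivative g (at x) b + frechet_derivative a (at x) b *\<^sub>R g x"
  by (simp add: frechet_derivative_at[OF has_derivative_scaleR[OF assms[unfolded frechet_derivative_works]], symmetric])

lemma Ck_on_scaleR:
  fixes a :: "'a::euclidean_space \<Rightarrow> real"
  assumes "open U" "Ck_on k a U" "Ck_on k g U"
  shows "Ck_on k (\<lambda>x. a x *\<^sub>R g x) U"
  using assms(2,3)
proof (induction k arbitrary: a g)
  case 0
  then show ?case by (auto simp: Ck_on_0 intro: continuous_on_scaleR)
next
  case (Suc k)
  then have d: "a differentiable (at x)" "g differentiable (at x)" if "x \<in> U" for x
    using that assms(1) differentiable_onD_open by (auto simp: Ck_on_Suc)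
  have lower: "Ck_on k a U" "Ck_on k g U" using Suc.prems Ck_on_le by (meson le_SucI order_refl)+
  have "Ck_on k (\<lambda>x. frechet_derivative (\<lambda>x. a x *\<^sub>R g x) (at x) b) U" if "b \<in> Basis" for b
  proof -
    have "Ck_on k (\<lambda>x. a x *\<^sub>R frechet_derivative g (at x) b + frechet_derivative a (at x) b *\<^sub>R g x) U"
      using Suc that lower by (intro Ck_on_add[OF assms(1)] Suc.IH) (auto simp: Ck_on_Suc)
    then show ?thesis
      by (subst Ck_on_cong[OF assms(1) frechet_derivative_scaleR[OF d]])
  qed
  moreover have "(\<lambda>x. a x *\<^sub>R g x) differentiable_on U"
    using d assms(1) by (simp add: differentiable_on_eq_differentiable_at)
  ultimately show ?case using Suc.prems by (auto simp: Ck_on_Suc intro: continuous_on_scaleR)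
qed

lemma Ck_bound_scaleR:
  fixes a :: "'a::euclidean_space \<Rightarrow> real"
  assumes "open U" "A \<subseteq> U" "Ck_on k a U" "Ck_on k g U" "Ck_bound k a A B" "Ck_bound k g A C"
    "0 \<le> B" "0 \<le> C"
  shows "Ck_bound k (\<lambda>x. a x *\<^sub>R g x) A (2 ^ k * (B * C))"
  using assms(3-6)
proof (induction k arbitrary: a g)
  case 0
  then show ?case using \<open>0 \<le> B\<close> by (auto simp: Ck_bound_0 intro!: mult_mono)
next
  case (Suc k)
  then have d: "a differentiable (at x)" "g differentiable (at x)" if "x \<in> U" for x
    using that assms(1) differentiable_onD_open by (auto simp: Ck_on_Suc)
  have lower: "Ck_on k a U" "Ck_on k g U" using Suc.prems Ck_on_le by (meson le_SucI order_refl)+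
  have lower': "Ck_bound k a A B" "Ck_bound k g A C"
    using Suc.prems Ck_bound_le by (meson le_SucI order_refl)+
  have "Ck_bound k (\<lambda>x. frechet_derivative (\<lambda>x. a x *\<^sub>R g x) (at x) b) A (2 ^ Suc k * (B * C))"
    if "b \<in> Basis" for b
  proof -
    have "Ck_bound k (\<lambda>x. a x *\<^sub>R frechet_derivative g (at x) b + frechet_derivative a (at x) b *\<^sub>R g x) A
        (2 ^ k * (B * C) + 2 ^ k * (B * C))"
      using Suc.prems that lower lower'
      by (intro Ck_bound_add[OF assms(1,2)] Suc.IH Ck_on_scaleR[OF assms(1)])
        (auto simp: Ck_on_Suc Ck_bound_Suc)
    then show ?thesis
      by (subst Ck_bound_cong[OF assms(1,2) frechet_derivative_scaleR[OF d]]) (simp_all add: mult_ac)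
  qed
  moreover have "norm (a x *\<^sub>R g x) \<le> 2 ^ Suc k * (B * C)" if "x \<in> A" for x
  proof -
    have "norm (a x *\<^sub>R g x) \<le> B * C"
      using Ck_bound_value[OF Suc.prems(3) that] Ck_bound_value[OF Suc.prems(4) that] \<open>0 \<le> B\<close>
      by (auto intro!: mult_mono)
    moreover have "1 * (B * C) \<le> 2 ^ Suc k * (B * C)"
      using assms(7,8) by (intro mult_right_mono one_le_power) auto
    ultimately show ?thesis by linarith
  qed
  ultimately show ?case by (simp add: Ck_bound_Suc)
qed

lemma frechet_derivative_compose_Basis:
  fixes \<phi> :: "'a::euclidean_space \<Rightarrow> 'b::euclidean_space" and f :: "'b \<Rightarrow> 'c::real_normed_vector"
  assumes "\<phi> differentiable (at x)" "f differentiable (at (\<phi> x))"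
  shows "frechet_derivative (f \<circ> \<phi>) (at x) b =
    (\<Sum>c\<in>Basis. (frechet_derivative \<phi> (at x) b \<bullet> c) *\<^sub>R frechet_derivative f (at (\<phi> x)) c)"
proof -
  let ?D = "frechet_derivative f (at (\<phi> x))"
  have D: "linear ?D" using assms(2) by (simp add: linear_frechet_derivative)
  have *: "?D v = (\<Sum>c\<in>Basis. (v \<bullet> c) *\<^sub>R ?D c)" for v
  proof -
    have "?D v = ?D (\<Sum>c\<in>Basis. (v \<bullet> c) *\<^sub>R c)" by (simp add: euclidean_representation)
    also have "\<dots> = (\<Sum>c\<in>Basis. (v \<bullet> c) *\<^sub>R ?D c)"
      using D by (simp add: linear_sum linear_cmul)
    finally show ?thesis .
  qed
  show ?thesis
    unfolding frechet_derivative_compose[OF assms] o_apply by (rule *)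
qed

lemma Ck_on_compose:
  fixes \<phi> :: "'a::euclidean_space \<Rightarrow> 'b::euclidean_space" and f :: "'b \<Rightarrow> 'c::real_normed_vector"
  assumes "open U" "open V" "\<phi> ` U \<subseteq> V" "Ck_on k \<phi> U" "Ck_on k f V"
  shows "Ck_on k (f \<circ> \<phi>) U"
  using assms(4,5)
proof (induction k arbitrary: f)
  case 0
  then show ?case
    using assms(3) by (metis Ck_on_0 continuous_on_compose continuous_on_subset)
next
  case (Suc k)
  have d: "\<phi> differentiable (at x)" "f differentiable (at (\<phi> x))" if "x \<in> U" for x
    using that assms(1-3) Suc.prems differentiable_onD_open by (auto simp: Ck_on_Suc image_subset_iff)
  have lower: "Ck_on k \<phi> U" using Suc.prems(1) Ck_on_le by (meson le_SucI order_refl)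
  have "Ck_on k (\<lambda>x. frechet_derivative (f \<circ> \<phi>) (at x) b) U" if "b \<in> Basis" for b
  proof -
    have "Ck_on k (\<lambda>x. \<Sum>c\<in>Basis. (frechet_derivative \<phi> (at x) b \<bullet> c) *\<^sub>R
       ((\<lambda>y. frechet_derivative f (at y) c) \<circ> \<phi>) x) U"
      using Suc.prems that lower
      by (intro Ck_on_sum[OF assms(1)] Ck_on_scaleR[OF assms(1)] Suc.IH
          Ck_on_linear_left[OF bounded_linear_inner_left assms(1)]) (auto simp: Ck_on_Suc)
    then show ?thesis
      using Ck_on_cong[OF assms(1) frechet_derivative_compose_Basis[OF d]] by (simp add: o_def)
  qed
  moreover have "(f \<circ> \<phi>) differentiable_on U"
    unfolding differentiable_on_eq_differentiable_at[OF assms(1)] using d differentiable_chain_at by blast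
  moreover have "continuous_on U (f \<circ> \<phi>)"
    using Suc.prems assms(3) by (metis Ck_on_Suc continuous_on_compose continuous_on_subset)
  ultimately show ?case unfolding Ck_on_Suc by blast
qed

lemma Ck_bound_linear_left:
  assumes "bounded_linear L" "open U" "A \<subseteq> U" "Ck_on k f U" "\<And>x. norm (L x) \<le> norm x" "Ck_bound k f A B"
  shows "Ck_bound k (\<lambda>x. L (f x)) A B"
  using assms(4,6)
proof (induction k arbitrary: f)
  case 0
  then show ?case using assms(5) by (fastforce simp: Ck_bound_0 intro: order_trans)
next
  case (Suc k)
  then have d: "f differentiable (at x)" if "x \<in> U" for x
    using that assms(2) differentiable_onD_open by (auto simp: Ck_on_Suc)
  have "Ck_bound k (\<lambda>x. frechet_derivative (\<lambda>x. L (f x)) (at x) b) A B" if "b \<in> Basis" for b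
    using Suc that Ck_bound_cong[OF assms(2,3) frechet_derivative_linear_left[OF assms(1) d]]
    by (auto simp: Ck_on_Suc Ck_bound_Suc)
  then show ?case using Suc.prems assms(5) by (fastforce simp: Ck_bound_Suc intro: order_trans)
qed

lemma Ck_bound_exists:
  assumes "compact K" "K \<subseteq> U" "Ck_on k f U"
  shows "\<exists>B\<ge>0. Ck_bound k f K B"
proof -
  have fin: "finite (multi_index k :: 'a list set)"
    using finite_lists_length_le[OF finite_Basis, of k] by (simp add: multi_index_def)
  have "\<exists>B. \<forall>x\<in>K. norm (iter_partial bs f x) \<le> B" if "bs \<in> multi_index k" for bs
  proof -
    have "compact (iter_partial bs f ` K)"
      using assms that compact_continuous_image continuous_on_subset by (metis Ck_on_def)
    then show ?thesis by (meson bounded_iff compact_imp_bounded imageI)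
  qed
  then obtain B where B: "\<And>bs x. bs \<in> multi_index k \<Longrightarrow> x \<in> K \<Longrightarrow> norm (iter_partial bs f x) \<le> B bs"
    by metis
  have "B bs \<le> (\<Sum>bs\<in>multi_index k. \<bar>B bs\<bar>)" if "bs \<in> multi_index k" for bs
    using member_le_sum[OF that, of "\<lambda>bs. \<bar>B bs\<bar>"] fin by auto
  then have "Ck_bound k f K (\<Sum>bs\<in>multi_index k. \<bar>B bs\<bar>)"
    unfolding Ck_bound_def using B order_trans by blast
  then show ?thesis by (meson sum_nonneg abs_ge_zero)
qed

text \<open>The perturbation is estimated in the ambient space, but its size is measured in given parametrizations.
  The chain rule expresses a derivative of \<open>f \<circ> \<phi>\<close> by derivatives of \<open>f\<close> of the same or lower order,
  with coefficients that are bounded on the compact set \<open>K\<close>. The constant does not depend on \<open>f\<close>, so a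
  perturbation can be chosen small after the parametrizations are known.\<close>

lemma Ck_bound_compose:
  fixes \<phi> :: "'a::euclidean_space \<Rightarrow> 'b::euclidean_space"
  assumes "open U" "open V" "\<phi> ` U \<subseteq> V" "compact K" "K \<subseteq> U" "Ck_on k \<phi> U"
  shows "\<exists>M\<ge>0. \<forall>(f :: 'b \<Rightarrow> 'c::real_normed_vector) B. Ck_on k f V \<longrightarrow> Ck_bound k f (\<phi> ` K) B \<longrightarrow> 0 \<le> B \<longrightarrow>
    Ck_bound k (f \<circ> \<phi>) K (M * B)"
  using assms(6)
proof (induction k)
  case 0
  then show ?case by (intro exI[of _ 1]) (auto simp: Ck_bound_0)
next
  case (Suc k)
  have lower: "Ck_on k \<phi> U" using Suc.prems(1) Ck_on_le by (meson le_SucI order_refl)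
  obtain M where M: "M \<ge> 0" "\<And>(f :: 'b \<Rightarrow> 'c) B. Ck_on k f V \<Longrightarrow> Ck_bound k f (\<phi> ` K) B \<Longrightarrow>
      0 \<le> B \<Longrightarrow> Ck_bound k (f \<circ> \<phi>) K (M * B)"
    using Suc.IH[OF lower] by blast
  obtain P where P: "P \<ge> 0" "Ck_bound (Suc k) \<phi> K P"
    using Ck_bound_exists[OF assms(4,5) Suc.prems] by auto
  define M' where "M' = max 1 (real DIM('b) * (2 ^ k * (P * M)))"
  have "Ck_bound (Suc k) (f \<circ> \<phi>) K (M' * B)"
    if f: "Ck_on (Suc k) f V" "Ck_bound (Suc k) f (\<phi> ` K) B" "0 \<le> B" for f :: "'b \<Rightarrow> 'c" and B
  proof -
    have d: "\<phi> differentiable (at x)" "f differentiable (at (\<phi> x))" if "x \<in> U" for x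
      using that assms(1-3) Suc.prems f(1) differentiable_onD_open by (auto simp: Ck_on_Suc image_subset_iff)
    have "Ck_bound k (\<lambda>x. frechet_derivative (f \<circ> \<phi>) (at x) b) K (M' * B)" if b: "b \<in> Basis" for b
    proof -
      have 1: "Ck_on k (\<lambda>x. frechet_derivative \<phi> (at x) b \<bullet> c) U" for c
        using Suc.prems b by (intro Ck_on_linear_left[OF bounded_linear_inner_left assms(1)]) (auto simp: Ck_on_Suc)
      have 2: "Ck_on k ((\<lambda>y. frechet_derivative f (at y) c) \<circ> \<phi>) U" if "c \<in> Basis" for c
        using f that lower by (intro Ck_on_compose[OF assms(1-3)]) (auto simp: Ck_on_Suc)
      have 3: "Ck_bound k (\<lambda>x. frechet_derivative \<phi> (at x) b \<bullet> c) K P" if "c \<in> Basis" for c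
        using Suc.prems b P that 
        by (intro Ck_bound_linear_left[OF bounded_linear_inner_left assms(1,5)])
          (auto simp: Ck_on_Suc Ck_bound_Suc Basis_le_norm)
      have 4: "Ck_bound k ((\<lambda>y. frechet_derivative f (at y) c) \<circ> \<phi>) K (M * B)" if "c \<in> Basis" for c
        using f that by (intro M) (auto simp: Ck_on_Suc Ck_bound_Suc)
      have "Ck_bound k (\<lambda>x. \<Sum>c\<in>Basis. (frechet_derivative \<phi> (at x) b \<bullet> c) *\<^sub>R
         ((\<lambda>y. frechet_derivative f (at y) c) \<circ> \<phi>) x) K (\<Sum>c\<in>(Basis::'b set). 2 ^ k * (P * (M * B)))"
        using 1 2 3 4 P(1) M(1) f(3)
        by (intro Ck_bound_sum[OF assms(1,5)] Ck_bound_scaleR[OF assms(1,5)] Ck_on_scaleR[OF assms(1)]) (simp_all add: o_def)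
      then have "Ck_bound k (\<lambda>x. frechet_derivative (f \<circ> \<phi>) (at x) b) K (real DIM('b) * (2 ^ k * (P * (M * B))))"
        using Ck_bound_cong[OF assms(1,5) frechet_derivative_compose_Basis[OF d]] by (simp add: o_def)
      moreover have "real DIM('b) * (2 ^ k * (P * (M * B))) \<le> M' * B"
      proof -
        have "(real DIM('b) * (2 ^ k * (P * M))) * B \<le> M' * B"
          unfolding M'_def using f(3) by (intro mult_right_mono) auto
        then show ?thesis by (simp add: mult.assoc)
      qed
      ultimately show ?thesis by (rule Ck_bound_mono)
    qed
    moreover have "norm ((f \<circ> \<phi>) x) \<le> M' * B" if "x \<in> K" for x
    proof -
      have "norm (f (\<phi> x)) \<le> B" using Ck_bound_value[OF f(2)] that by auto
      moreover have "1 * B \<le> M' * B" unfolding M'_def using f(3) by (intro mult_right_mono) auto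
      ultimately show ?thesis by simp
    qed
    ultimately show ?thesis by (simp add: Ck_bound_Suc)
  qed
  moreover have "M' \<ge> 0" by (simp add: M'_def)
  ultimately show ?case by blast
qed

subsection \<open>Rescaling and series\<close>

text \<open>Concentrating a function at scale \<open>1 / c\<close> costs one factor \<open>c\<close> per derivative: a bump of width \<open>\<delta>\<close> may
  have height about \<open>\<delta> ^ k\<close> before its $C^k$ norm stops being bounded.\<close>

lemma iter_partial_rescale:
  assumes "Ck_on k f UNIV" "bs \<in> multi_index k"
  shows "iter_partial bs (\<lambda>x. f (c *\<^sub>R (x - y))) x = c ^ length bs *\<^sub>R iter_partial bs f (c *\<^sub>R (x - y))"
  using assms(2)
proof (induction bs arbitrary: x)
  case (Cons b bs)
  let ?g = "iter_partial bs f"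
  have bs: "bs \<in> multi_index k" "length bs < k" using Cons.prems by (auto simp: multi_index_def)
  then have dg: "?g differentiable (at z)" for z
    using assms(1) by (auto simp: Ck_on_def differentiable_on_eq_differentiable_at)
  have eq: "iter_partial bs (\<lambda>x. f (c *\<^sub>R (x - y))) = (\<lambda>x. c ^ length bs *\<^sub>R ?g (c *\<^sub>R (x - y)))"
    using Cons.IH bs by auto
  have D: "((\<lambda>x. c ^ length bs *\<^sub>R ?g (c *\<^sub>R (x - y))) has_derivative
      (\<lambda>h. c ^ length bs *\<^sub>R frechet_derivative ?g (at (c *\<^sub>R (x - y))) (c *\<^sub>R h))) (at x)"
    by (rule has_derivative_scaleR_right, rule has_derivative_compose[where g="?g"])
      (auto intro!: derivative_eq_intros dg[unfolded frechet_derivative_works])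
  have "linear (frechet_derivative ?g (at (c *\<^sub>R (x - y))))"
    using dg by (simp add: linear_frechet_derivative)
  then have "frechet_derivative ?g (at (c *\<^sub>R (x - y))) (c *\<^sub>R b) =
      c *\<^sub>R frechet_derivative ?g (at (c *\<^sub>R (x - y))) b" by (simp add: linear_cmul)
  then show ?case
    by (simp add: eq frechet_derivative_at[OF D, symmetric])
qed simp

lemma Ck_on_rescale:
  assumes "Ck_on k f UNIV"
  shows "Ck_on k (\<lambda>x. f (c *\<^sub>R (x - y))) UNIV"
proof -
  have 1: "Ck_on k (\<lambda>x. c *\<^sub>R x + (- c *\<^sub>R y)) UNIV"
    by (intro Ck_on_add Ck_on_const Ck_on_bounded_linear bounded_linear_scaleR_right open_UNIV)
  show ?thesis
    using Ck_on_compose[OF open_UNIV open_UNIV _ 1 assms] by (simp add: o_def scaleR_diff_right)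
qed

text \<open>Termwise differentiation. For each derivative the Weierstrass test applies with the same majorant, since
  \<open>Ck_bound\<close> controls all orders at once.\<close>

lemma Ck_on_suminf:
  fixes f :: "nat \<Rightarrow> 'a::euclidean_space \<Rightarrow> 'b::banach"
  assumes "\<And>j. Ck_on k (f j) UNIV" "\<And>j. Ck_bound k (f j) UNIV (B j)" "summable B"
  shows "Ck_on k (\<lambda>x. \<Sum>j. f j x) UNIV \<and> Ck_bound k (\<lambda>x. \<Sum>j. f j x) UNIV (suminf B)"
  using assms(1,2)
proof (induction k arbitrary: f)
  case 0
  have b: "norm (f j x) \<le> B j" for j x using 0(2) by (simp add: Ck_bound_0)
  have "uniform_limit UNIV (\<lambda>n x. \<Sum>i<n. f i x) (\<lambda>x. suminf (\<lambda>i. f i x)) sequentially"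
    by (rule Weierstrass_m_test[OF _ assms(3)]) (use b in auto)
  then have "continuous_on UNIV (\<lambda>x. \<Sum>j. f j x)"
    using 0(1) by (intro uniform_limit_theorem[where F=sequentially])
      (auto intro!: always_eventually continuous_on_sum simp: Ck_on_0)
  moreover have "norm (\<Sum>j. f j x) \<le> suminf B" for x
    using b assms(3) by (intro norm_suminf_le) auto
  ultimately show ?case by (simp add: Ck_on_0 Ck_bound_0)
next
  case (Suc k)
  have b: "norm (f j x) \<le> B j" for j x using Ck_bound_value[OF Suc.prems(2)] by simp
  let ?g = "\<lambda>x h. \<Sum>c\<in>Basis. (h \<bullet> c) *\<^sub>R (\<Sum>j. frechet_derivative (f j) (at x) c)"
  have D: "(f j has_derivative frechet_derivative (f j) (at x)) (at x)" for j x
    using Ck_on_has_derivative[OF Suc.prems(1)] by simp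
  have bD: "norm (frechet_derivative (f j) (at x) c) \<le> B j" if "c \<in> Basis" for j x c
    using Suc.prems(2)[of j] that Ck_bound_value by (fastforce simp: Ck_bound_Suc)
  have expand: "frechet_derivative (f j) (at x) h = (\<Sum>c\<in>Basis. (h \<bullet> c) *\<^sub>R frechet_derivative (f j) (at x) c)" for j x h
  proof -
    have "linear (frechet_derivative (f j) (at x))" using D has_derivative_linear by blast
    then have "frechet_derivative (f j) (at x) (\<Sum>c\<in>Basis. (h \<bullet> c) *\<^sub>R c) = (\<Sum>c\<in>Basis. (h \<bullet> c) *\<^sub>R frechet_derivative (f j) (at x) c)"
      by (simp add: linear_sum linear_cmul)
    then show ?thesis by (simp add: euclidean_representation)
  qed
  have unif: "\<forall>\<^sub>F n in sequentially. \<forall>x\<in>UNIV. \<forall>h. norm ((\<Sum>i<n. frechet_derivative (f i) (at x) h) - ?g x h) \<le> e * norm h"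
    if "e > 0" for e
  proof -
    define e' where "e' = e / real DIM('a)"
    have e': "e' > 0" using that by (simp add: e'_def)
    have "\<forall>\<^sub>F n in sequentially. \<forall>x\<in>UNIV. norm ((\<Sum>i<n. frechet_derivative (f i) (at x) c) - (\<Sum>j. frechet_derivative (f j) (at x) c)) < e'"
      if "c \<in> Basis" for c
    proof -
      have "uniform_limit UNIV (\<lambda>n x. \<Sum>i<n. frechet_derivative (f i) (at x) c) (\<lambda>x. suminf (\<lambda>i. frechet_derivative (f i) (at x) c)) sequentially"
        by (rule Weierstrass_m_test[OF _ assms(3)]) (use bD that in auto)
      then show ?thesis using e' by (auto simp: uniform_limit_iff dist_norm)
    qed
    then have "\<forall>\<^sub>F n in sequentially. \<forall>c\<in>(Basis::'a set). \<forall>x\<in>UNIV. norm ((\<Sum>i<n. frechet_derivative (f i) (at x) c) - (\<Sum>j. frechet_derivative (f j) (at x) c)) < e'"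
      by (intro eventually_ball_finite) auto
    then show ?thesis
    proof eventually_elim
      case (elim n)
      show ?case
      proof (intro ballI allI)
        fix x h :: 'a
        have "(\<Sum>i<n. frechet_derivative (f i) (at x) h) - ?g x h =
           (\<Sum>c\<in>Basis. (h \<bullet> c) *\<^sub>R ((\<Sum>i<n. frechet_derivative (f i) (at x) c) - (\<Sum>j. frechet_derivative (f j) (at x) c)))"
          by (subst expand) (simp add: sum.swap[of _ "{..<n}"] scaleR_diff_right sum_subtractf scaleR_sum_right)
        also have "norm \<dots> \<le> (\<Sum>c\<in>(Basis::'a set). norm h * e')"
          unfolding norm_scaleR using elim e'
          by (intro sum_norm_le) (auto simp: less_imp_le intro!: mult_mono Basis_le_norm)
        also have "\<dots> = e * norm h" by (simp add: e'_def)
        finally show "norm ((\<Sum>i<n. frechet_derivative (f i) (at x) h) - ?g x h) \<le> e * norm h" .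
      qed
    qed
  qed
  have sm: "summable (\<lambda>j. f j x)" for x
    by (rule summable_comparison_test'[OF assms(3)]) (use b in auto)
  obtain G where G: "\<And>x. (\<lambda>n. f n x) sums (G x)" "\<And>x. (G has_derivative ?g x) (at x)"
  proof -
    have "\<exists>g. \<forall>x\<in>UNIV. (\<lambda>n. f n x) sums (g x) \<and> (g has_derivative ?g x) (at x within UNIV)"
      by (rule has_derivative_series[where x=0, OF convex_UNIV])
        (use D unif summable_sums[OF sm[of 0]] in auto)
    then show thesis using that by blast
  qed
  have Geq: "G = (\<lambda>x. \<Sum>j. f j x)" using G(1) sums_unique by blast
  have part: "frechet_derivative G (at x) c = (\<Sum>j. frechet_derivative (f j) (at x) c)" if "c \<in> Basis" for x c
    using that unfolding frechet_derivative_at[OF G(2), symmetric]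
    by (simp add: inner_Basis if_distrib[of "\<lambda>r. r *\<^sub>R _"] sum.delta' cong: if_cong)
  have IH: "Ck_on k (\<lambda>x. \<Sum>j. frechet_derivative (f j) (at x) c) UNIV \<and>
      Ck_bound k (\<lambda>x. \<Sum>j. frechet_derivative (f j) (at x) c) UNIV (suminf B)" if "c \<in> Basis" for c
    using Suc that by (intro Suc.IH) (auto simp: Ck_on_Suc Ck_bound_Suc)
  have diff: "G differentiable_on UNIV"
    using G(2) by (auto simp: differentiable_on_def intro: differentiableI)
  have "norm (\<Sum>j. f j x) \<le> suminf B" for x
    using b assms(3) by (intro norm_suminf_le) auto
  then show ?case
    unfolding Geq[symmetric] Ck_on_Suc Ck_bound_Suc
    using IH part diff differentiable_imp_continuous_on[OF diff] by (simp add: Geq)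
qed

section \<open>Change of variables over an arbitrary finite index type\<close>

text \<open>
  Densities of surface measures are computed in \<open>real^'m\<close> for an arbitrary finite type \<open>'m\<close>. The change of
  variables formula for well-ordered index types carries over, because relabelling the coordinates changes
  neither Lebesgue measure nor the determinant of a derivative; \<open>idx\<close> is a well-ordered copy of a finite type.\<close>

typedef ('a::finite) idx = "{..<CARD('a)}"
  by (rule exI[of _ 0]) simp

setup_lifting type_definition_idx

instance idx :: (finite) finite
proof
  have "(UNIV :: 'a idx set) = Abs_idx ` {..<CARD('a)}"
    using Rep_idx_inverse Rep_idx by (metis (no_types, lifting) UNIV_eq_I image_eqI)
  then show "finite (UNIV :: 'a idx set)" by (metis finite_imageI finite_lessThan)
qed

instantiation idx :: (finite) wellorder
begin

lift_definition less_eq_idx :: "'a idx \<Rightarrow> 'a idx \<Rightarrow> bool" is "(\<le>)" .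
lift_definition less_idx :: "'a idx \<Rightarrow> 'a idx \<Rightarrow> bool" is "(<)" .

instance
proof
  fix P :: "'a idx \<Rightarrow> bool" and a
  assume step: "\<And>x. (\<And>y. y < x \<Longrightarrow> P y) \<Longrightarrow> P x"
  show "P a"
  proof (induction "Rep_idx a" arbitrary: a rule: less_induct)
    case less
    show ?case by (rule step) (use less in \<open>simp add: less_idx.rep_eq\<close>)
  qed
qed (transfer; auto)+

end

lemma card_idx: "CARD('a::finite idx) = CARD('a)"
  using type_definition.card[OF type_definition_idx] by simp

definition idx_of :: "'a::finite idx \<Rightarrow> 'a" where
  "idx_of = (SOME k. bij k)"

lemma bij_idx_of: "bij (idx_of :: 'a::finite idx \<Rightarrow> 'a)"
proof -
  have "\<exists>k :: 'a idx \<Rightarrow> 'a. bij_betw k UNIV UNIV"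
    by (rule finite_same_card_bij) (simp_all add: card_idx)
  then show ?thesis unfolding idx_of_def by (rule someI_ex)
qed

lemma det_reindex:
  fixes A :: "real^'m^'m" and k :: "'w::finite \<Rightarrow> 'm::finite"
  assumes k: "bij k"
  shows "det (\<chi> v w. A $ k v $ k w) = det A"
proof -
  let ?f = "map_permutation UNIV k"
  have kinj: "inj_on k UNIV" "bij_betw k UNIV UNIV" using k by (auto simp: bij_def)
  have bij: "bij_betw ?f {p. p permutes UNIV} {q. q permutes UNIV}"
  proof (rule bij_betwI[where g="map_permutation UNIV (inv k)"])
    show "?f \<in> {p. p permutes UNIV} \<rightarrow> {q. q permutes UNIV}"
      using map_permutation_permutes[OF kinj(2)] by blast
    show "map_permutation UNIV (inv k) \<in> {q. q permutes UNIV} \<rightarrow> {p. p permutes UNIV}"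
      using map_permutation_permutes[OF bij_imp_bij_inv[OF k]] by blast
    show "map_permutation UNIV (inv k) (?f p) = p" if "p \<in> {p. p permutes UNIV}" for p
      using that k by (intro map_permutation_compose_inv[OF kinj(2)]) (auto simp: bij_is_inj inv_f_f)
    show "?f (map_permutation UNIV (inv k) q) = q" if "q \<in> {q. q permutes UNIV}" for q
      using that k bij_imp_bij_inv[OF k]
      by (intro map_permutation_compose_inv) (auto simp: bij_is_surj surj_f_inv_f)
  qed
  have "det A = (\<Sum>q | q permutes UNIV. of_int (sign q) * (\<Prod>i\<in>UNIV. A $ i $ q i))" by (simp add: det_def)
  also have "\<dots> = (\<Sum>p | p permutes UNIV. of_int (sign (?f p)) * (\<Prod>i\<in>UNIV. A $ i $ ?f p i))"
    using sum.reindex_bij_betw[OF bij, of "\<lambda>q. of_int (sign q) * (\<Prod>i\<in>UNIV. A $ i $ q i)"] by simp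
  also have "\<dots> = (\<Sum>p | p permutes UNIV. of_int (sign p) * (\<Prod>v\<in>UNIV. A $ k v $ k (p v)))"
  proof (rule sum.cong[OF refl])
    fix p :: "'w \<Rightarrow> 'w" assume "p \<in> {p. p permutes UNIV}"
    then have p: "p permutes UNIV" by simp
    have "sign (?f p) = sign p" by (rule sign_map_permutation) (use kinj p in auto)
    moreover have "(\<Prod>i\<in>UNIV. A $ i $ ?f p i) = (\<Prod>v\<in>UNIV. A $ k v $ ?f p (k v))"
      using prod.reindex_bij_betw[OF kinj(2), of "\<lambda>i. A $ i $ ?f p i"] by simp
    moreover have "?f p (k v) = k (p v)" for v by (rule map_permutation_apply[OF kinj(1)]) simp
    ultimately show "of_int (sign (?f p)) * (\<Prod>i\<in>UNIV. A $ i $ ?f p i) = of_int (sign p) * (\<Prod>v\<in>UNIV. A $ k v $ k (p v))"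
      by simp
  qed
  finally show ?thesis by (simp add: det_def)
qed

definition reindex :: "('w \<Rightarrow> 'm) \<Rightarrow> real^'m \<Rightarrow> real^'w" where
  "reindex k x = (\<chi> w. x $ k w)"

lemma linear_reindex: "linear (reindex k)"
  by (intro linearI) (simp_all add: reindex_def vec_eq_iff)

lemma reindex_inverse: "bij k \<Longrightarrow> reindex (inv k) (reindex k x) = x" "bij k \<Longrightarrow> reindex k (reindex (inv k) y) = y"
  by (simp_all add: reindex_def vec_eq_iff bij_is_surj surj_f_inv_f bij_is_inj)

lemma borel_measurable_linear: "linear (f :: 'a::euclidean_space \<Rightarrow> 'b::euclidean_space) \<Longrightarrow> f \<in> borel_measurable borel"
  by (simp add: borel_measurable_continuous_onI linear_continuous_on linear_conv_bounded_linear)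

lemma lborel_distr_reindex:
  fixes k :: "'w::finite \<Rightarrow> 'm::finite"
  assumes k: "bij k"
  shows "distr lborel borel (reindex k) = lborel"
proof (rule lborel_eqI[symmetric])
  fix l u :: "real^'w"
  assume leB: "\<And>b. b \<in> Basis \<Longrightarrow> l \<bullet> b \<le> u \<bullet> b"
  then have le: "l $ w \<le> u $ w" for w by (metis axis_in_Basis_iff inner_axis' inner_commute inner_real_def insertI1 mult.left_neutral real_inner_1_right Basis_real_def)
  let ?j = "reindex (inv k)"
  have pre: "reindex k -` box l u = box (?j l) (?j u)"
  proof -
    have "(\<forall>i. l $ i < x $ k i \<and> x $ k i < u $ i) \<longleftrightarrow> (\<forall>i. l $ inv k i < x $ i \<and> x $ i < u $ inv k i)" for x :: "real^'m"
      using k by (metis bij_inv_eq_iff)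
    then show ?thesis by (auto simp: mem_box_cart reindex_def)
  qed
  have le': "?j l $ i \<le> ?j u $ i" for i using le by (simp add: reindex_def)
  have "emeasure (distr lborel borel (reindex k)) (box l u) = emeasure lborel (box (?j l) (?j u))"
    using borel_measurable_linear[OF linear_reindex, of k] by (subst emeasure_distr) (simp_all add: pre)
  also have "\<dots> = ennreal (measure lborel (cbox (?j l) (?j u)))"
    by (simp add: emeasure_lborel_box_eq measure_lborel_cbox_eq)
  also have "measure lborel (cbox (?j l) (?j u)) = (\<Prod>i\<in>UNIV. ?j u $ i - ?j l $ i)"
    using le' by (intro content_cbox_cart) (auto simp: interval_ne_empty_cart)
  also have "\<dots> = (\<Prod>w\<in>UNIV. u $ w - l $ w)"
    using prod.reindex_bij_betw[OF bij_imp_bij_inv[OF k], of "\<lambda>w. u $ w - l $ w"] by (simp add: reindex_def)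
  also have "\<dots> = measure lborel (cbox l u)"
    using le by (intro content_cbox_cart[symmetric]) (auto simp: interval_ne_empty_cart)
  also have "\<dots> = (\<Prod>b\<in>Basis. (u - l) \<bullet> b)"
    using leB by (simp add: measure_lborel_cbox_eq)
  finally show "emeasure (distr lborel borel (reindex k)) (box l u) = ennreal (\<Prod>b\<in>Basis. (u - l) \<bullet> b)" .
qed simp

lemma emeasure_differentiable_image_wellorder:
  fixes g :: "real^'w::{finite,wellorder} \<Rightarrow> real^'w::_"
  assumes E: "E \<in> sets borel" and gE: "g ` E \<in> sets borel" "bounded (g ` E)"
    and der: "\<And>x. x \<in> E \<Longrightarrow> (g has_derivative g' x) (at x within E)" and inj: "inj_on g E"
  shows "(\<integral>\<^sup>+x. ennreal (indicator E x * \<bar>det (matrix (g' x))\<bar>) \<partial>lborel) = emeasure lborel (g ` E)"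
proof -
  have E': "E \<in> sets lebesgue" using E by (simp add: sets_completionI_sets)
  have fin: "emeasure lborel (g ` E) < \<infinity>" using gE emeasure_bounded_finite by blast
  have "g ` E \<in> lmeasurable" by (intro bounded_set_imp_lmeasurable gE) (use gE in \<open>simp add: sets_completionI_sets\<close>)
  then have "((\<lambda>x. \<bar>det (matrix (g' x))\<bar>) has_integral measure lebesgue (g ` E)) E"
    using has_measure_differentiable_image[OF E' der inj] by blast
  then have "(\<integral>\<^sup>+x. ennreal (indicator E x * \<bar>det (matrix (g' x))\<bar>) \<partial>lborel) = ennreal (measure lebesgue (g ` E))"
    by (intro nn_integral_has_integral_lebesgue) auto
  also have "\<dots> = emeasure lborel (g ` E)"
    using gE fin by (simp add: measure_completion emeasure_eq_ennreal_measure)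
  finally show ?thesis .
qed

text \<open>Conjugation with the relabelling reduces this to the well-ordered case.\<close>

lemma emeasure_differentiable_image:
  fixes g :: "real^'m::finite \<Rightarrow> real^'m"
  assumes E: "E \<in> sets borel" and gE: "g ` E \<in> sets borel" "bounded (g ` E)"
    and der: "\<And>x. x \<in> E \<Longrightarrow> (g has_derivative g' x) (at x within E)" and inj: "inj_on g E"
    and meas: "(\<lambda>x. indicator E x * \<bar>det (matrix (g' x))\<bar>) \<in> borel_measurable borel"
  shows "(\<integral>\<^sup>+x. ennreal (indicator E x * \<bar>det (matrix (g' x))\<bar>) \<partial>lborel) = emeasure lborel (g ` E)"
proof -
  define k :: "'m idx \<Rightarrow> 'm" where "k = idx_of"
  have k: "bij k" unfolding k_def by (rule bij_idx_of)
  let ?T = "reindex k" and ?I = "reindex (inv k)"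
  note inv = reindex_inverse[OF k]
  have Tm: "?T \<in> borel_measurable borel" "?I \<in> borel_measurable borel"
    by (simp_all add: borel_measurable_linear linear_reindex)
  have injT: "x = y" if "?T x = ?T y" for x y
    using arg_cong[OF that, of ?I] by (simp add: inv)
  have img: "?T ` X = ?I -` X" for X by (auto simp: inv image_iff) (metis inv(2))
  have Tb: "?T ` X \<in> sets borel" if "X \<in> sets borel" for X
    unfolding img using measurable_sets[OF Tm(2) that] by simp
  have vol: "emeasure lborel (?T ` X) = emeasure lborel X" if "X \<in> sets borel" for X
  proof -
    have "emeasure lborel (?T ` X) = emeasure (distr lborel borel ?T) (?T ` X)" by (simp add: lborel_distr_reindex[OF k])
    also have "\<dots> = emeasure lborel (?T -` (?T ` X))" using Tm Tb[OF that] by (subst emeasure_distr) auto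
    also have "?T -` (?T ` X) = X" by (auto dest: injT)
    finally show ?thesis .
  qed
  define g2 where "g2 = ?T \<circ> g \<circ> ?I"
  define g2' where "g2' y = ?T \<circ> g' (?I y) \<circ> ?I" for y
  have g2img: "g2 ` (?T ` E) = ?T ` (g ` E)" by (simp add: g2_def image_image inv)
  have detE: "det (matrix (g2' (?T x))) = det (matrix (g' x))" if "x \<in> E" for x
  proof -
    have lin: "linear (g' x)" using der[OF that] has_derivative_linear by blast
    have axis: "?I (axis w 1) = axis (k w) 1" for w
      using k by (auto simp: reindex_def vec_eq_iff axis_def inv_f_f bij_is_inj surj_f_inv_f bij_is_surj)
    have "matrix (g2' (?T x)) = (\<chi> v w. matrix (g' x) $ k v $ k w)"
      unfolding vec_eq_iff by (simp add: matrix_def g2'_def inv axis) (simp add: reindex_def)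
    then show ?thesis using det_reindex[OF k] by simp
  qed
  have "(\<integral>\<^sup>+x. ennreal (indicator E x * \<bar>det (matrix (g' x))\<bar>) \<partial>lborel) =
    (\<integral>\<^sup>+x. ennreal (indicator (?T ` E) (?T x) * \<bar>det (matrix (g2' (?T x)))\<bar>) \<partial>lborel)"
  proof (rule nn_integral_cong)
    fix x
    have "?T x \<in> ?T ` E \<longleftrightarrow> x \<in> E" by (auto dest: injT)
    then show "ennreal (indicator E x * \<bar>det (matrix (g' x))\<bar>) = ennreal (indicator (?T ` E) (?T x) * \<bar>det (matrix (g2' (?T x)))\<bar>)"
      using detE[of x] by (auto simp: indicator_def)
  qed
  also have "\<dots> = (\<integral>\<^sup>+y. ennreal (indicator (?T ` E) y * \<bar>det (matrix (g2' y))\<bar>) \<partial>distr lborel borel ?T)"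
  proof (rule nn_integral_distr[symmetric])
    show "?T \<in> lborel \<rightarrow>\<^sub>M borel" using Tm by simp
    have "(\<lambda>y. indicator (?T ` E) y * \<bar>det (matrix (g2' y))\<bar>) = (\<lambda>x. indicator E x * \<bar>det (matrix (g' x))\<bar>) \<circ> ?I"
    proof
      fix y
      have "y \<in> ?T ` E \<longleftrightarrow> ?I y \<in> E" by (simp add: img)
      then show "indicator (?T ` E) y * \<bar>det (matrix (g2' y))\<bar> = ((\<lambda>x. indicator E x * \<bar>det (matrix (g' x))\<bar>) \<circ> ?I) y"
        using detE[of "?I y"] by (auto simp: indicator_def inv)
    qed
    also have "\<dots> \<in> borel_measurable borel" by (rule measurable_comp[OF Tm(2) meas])
    finally have "(\<lambda>y. ennreal (indicator (?T ` E) y * \<bar>det (matrix (g2' y))\<bar>)) \<in> borel_measurable borel"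
      by (rule measurable_compose[OF _ measurable_ennreal])
    then show "(\<lambda>y. ennreal (indicator (?T ` E) y * \<bar>det (matrix (g2' y))\<bar>)) \<in> borel_measurable (distr lborel borel ?T)"
      by simp
  qed
  also have "distr lborel borel ?T = lborel" by (rule lborel_distr_reindex[OF k])
  also have "(\<integral>\<^sup>+y. ennreal (indicator (?T ` E) y * \<bar>det (matrix (g2' y))\<bar>) \<partial>lborel) = emeasure lborel (g2 ` (?T ` E))"
  proof (rule emeasure_differentiable_image_wellorder[where g=g2 and E="?T ` E" and g'=g2'])
    show "?T ` E \<in> sets borel" using Tb[OF E] .
    show "g2 ` (?T ` E) \<in> sets borel" using Tb[OF gE(1)] unfolding g2img .
    show "bounded (g2 ` (?T ` E))"
      unfolding g2img using gE(2) linear_reindex[of k] bounded_linear_image linear_conv_bounded_linear by blast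
    have inj2: "g2 (?T x) = ?T (g x)" for x by (simp add: g2_def inv)
    show "inj_on g2 (?T ` E)"
      using inj injT by (auto simp: inj_on_def inj2)
    show "(g2 has_derivative g2' y) (at y within ?T ` E)" if "y \<in> ?T ` E" for y
    proof -
      from \<open>y \<in> ?T ` E\<close> obtain x where x: "y = ?T x" "x \<in> E" by (rule imageE)
      have dT: "(?T has_derivative ?T) (at z within Z)" for z Z
        by (intro linear_imp_has_derivative linear_reindex)
      have dI: "(?I has_derivative ?I) (at z within Z)" for z Z
        by (intro linear_imp_has_derivative linear_reindex)
      have IE: "?I ` ?T ` E = E" by (simp add: image_image inv)
      have "(g \<circ> ?I has_derivative g' x \<circ> ?I) (at y within ?T ` E)"
        using diff_chain_within[OF dI, of g "g' x" y "?T ` E"] der[OF x(2)] IE by (simp add: x(1) inv)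
      then have "(?T \<circ> (g \<circ> ?I) has_derivative ?T \<circ> (g' x \<circ> ?I)) (at y within ?T ` E)"
        by (rule diff_chain_within[OF _ dT])
      then show ?thesis by (simp add: g2_def g2'_def x(1) inv o_assoc)
    qed
  qed
  also have "\<dots> = emeasure lborel (g ` E)" unfolding g2img by (rule vol[OF gE(1)])
  finally show ?thesis .
qed

section \<open>The surface measure\<close>

subsection \<open>Local patches\<close>

text \<open>
  A parametrization \<open>\<psi>\<close> of a piece of the hypersurface with a left inverse \<open>\<rho>\<close> that is defined, and of class
  $C^1$, on an open set of the ambient space. The left inverse turns a comparison of two parametrizations into
  a map between open sets of the parameter space. The set \<open>E\<close> is the part of \<open>W\<close> that is mapped into the hypersurface;
  it differs from \<open>W\<close> near boundary points.\<close>

definition local_patch ::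
  "(real^'n) set \<Rightarrow> (real^'n) set \<Rightarrow> (real^'m) set \<Rightarrow> (real^'m) set \<Rightarrow> (real^'m \<Rightarrow> real^'n) \<Rightarrow> (real^'n \<Rightarrow> real^'m) \<Rightarrow> bool" where
  "local_patch S U W E \<psi> \<rho> \<longleftrightarrow> open U \<and> open W \<and> bounded W \<and> E \<subseteq> W \<and> E \<in> sets borel \<and>
     Ck_on 1 \<psi> W \<and> Ck_on 1 \<rho> U \<and> \<psi> ` W \<subseteq> U \<and> (\<forall>u\<in>W. \<rho> (\<psi> u) = u) \<and> \<psi> ` E = U \<inter> S"

lemma Ck_on_Pair_zero: "Ck_on k (\<lambda>u :: 'a::euclidean_space. (u, 0 :: real)) U"
  by (intro Ck_on_bounded_linear) (simp add: bounded_linear_Pair bounded_linear_ident bounded_linear_zero)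

text \<open>The slice chart straightens the hypersurface to \<open>H \<times> {0}\<close>: its inverse restricted to this slice
  is the parametrization, and the first component of the chart is the left inverse.\<close>

lemma hypersurface_chart:
  fixes S :: "(real^'n) set"
  assumes "compact_hypersurface TYPE('m::finite) k S" "1 \<le> k" "p \<in> S"
  obtains U W E \<rho> v0 and \<psi> :: "real^'m \<Rightarrow> real^'n" and H r
  where "local_patch S U W E \<psi> \<rho>" "Ck_on k \<psi> W" "p = \<psi> v0" "0 < r" "cball v0 r \<subseteq> W" "v0 \<in> H" "E = W \<inter> H"
    "H = UNIV \<or> (\<exists>b\<in>Basis. H = {u. 0 \<le> u \<bullet> b})" "continuous_on U \<rho>" "Ck_on k \<rho> U"
proof -
  obtain U V \<Phi> and \<Psi> :: "(real^'m) \<times> real \<Rightarrow> real^'n" where pU: "p \<in> U" and ch: "slice_chart k S U V \<Phi> \<Psi>"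
    using assms unfolding compact_hypersurface_def by blast
  then obtain H where H: "H = UNIV \<or> (\<exists>b\<in>Basis. H = {u. 0 \<le> u \<bullet> b})" "\<Phi> ` (U \<inter> S) = V \<inter> (H \<times> {0})"
    unfolding slice_chart_def by blast
  have c: "open U" "open V" "homeomorphism U V \<Phi> \<Psi>" "Ck_on k \<Phi> U" "Ck_on k \<Psi> V"
    using ch unfolding slice_chart_def by auto
  have h: "\<And>x. x \<in> U \<Longrightarrow> \<Psi> (\<Phi> x) = x" "\<And>y. y \<in> V \<Longrightarrow> \<Phi> (\<Psi> y) = y" "\<Phi> ` U = V" "\<Psi> ` V = U"
    using c(3) by (auto simp: homeomorphism_def)
  have "\<Phi> p \<in> V \<inter> (H \<times> {0})" using H(2) pU assms(3) by blast
  then obtain v0 where v0: "\<Phi> p = (v0, 0)" "v0 \<in> H" "(v0, 0) \<in> V" by auto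
  define W' where "W' = {u. (u, 0 :: real) \<in> V}"
  have W': "open W'"
  proof -
    have "W' = (\<lambda>u. (u, 0)) -` V" by (auto simp: W'_def)
    moreover have "open ((\<lambda>u. (u, 0 :: real)) -` V)" using c(2) by (intro open_vimage) (auto intro!: continuous_intros)
    ultimately show ?thesis by simp
  qed
  moreover have "v0 \<in> W'" using v0(3) by (simp add: W'_def)
  ultimately obtain r where r: "r > 0" "cball v0 r \<subseteq> W'" using open_contains_cball by blast
  define W where "W = ball v0 r"
  have WW': "W \<subseteq> W'" using r ball_subset_cball by (auto simp: W_def)
  define U0 where "U0 = U \<inter> \<Phi> -` (W \<times> UNIV)"
  have U0: "open U0" unfolding U0_def
    by (rule continuous_open_preimage[OF Ck_on_imp_continuous[OF c(4)] c(1)]) (simp add: W_def open_Times)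
  define \<psi> where "\<psi> = \<Psi> \<circ> (\<lambda>u. (u, 0))"
  define \<rho> where "\<rho> = fst \<circ> \<Phi>"
  have psiW: "Ck_on k \<psi> W" unfolding \<psi>_def
    by (rule Ck_on_compose[OF _ c(2) _ Ck_on_Pair_zero c(5)]) (use WW' in \<open>auto simp: W_def W'_def\<close>)
  have rhoU: "Ck_on k \<rho> U0" unfolding \<rho>_def
  proof (rule Ck_on_subset)
    have "Ck_on k (\<lambda>x. fst (\<Phi> x)) U" by (rule Ck_on_linear_left[OF bounded_linear_fst c(1,4)])
    then show "Ck_on k (fst \<circ> \<Phi>) U" by (simp add: o_def)
  qed (auto simp: U0_def)
  have mapsW: "\<psi> u \<in> U0" "\<rho> (\<psi> u) = u" if "u \<in> W" for u
  proof -
    have V: "(u, 0) \<in> V" using that WW' by (auto simp: W'_def)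
    then have "\<Psi> (u, 0) \<in> U" using h(4) by blast
    then show "\<psi> u \<in> U0" "\<rho> (\<psi> u) = u" using that h(2)[OF V] by (simp_all add: \<psi>_def \<rho>_def U0_def)
  qed
  define E where "E = W \<inter> H"
  have "closed H" using H(1)
  proof (elim disjE bexE)
    fix b :: "real^'m" assume "H = {u. 0 \<le> u \<bullet> b}"
    then show "closed H" using closed_halfspace_ge[of 0 b] by (simp add: inner_commute)
  qed simp
  then have Eb: "E \<in> sets borel" by (simp add: E_def W_def)
  have "\<psi> ` E = U0 \<inter> S"
  proof
    show "\<psi> ` E \<subseteq> U0 \<inter> S"
    proof
      fix x assume "x \<in> \<psi> ` E"
      then obtain u where u: "u \<in> W" "u \<in> H" "x = \<psi> u" by (auto simp: E_def)
      then have "(u, 0) \<in> V \<inter> (H \<times> {0})" using WW' by (auto simp: W'_def)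
      then obtain y where "y \<in> U \<inter> S" "\<Phi> y = (u, 0)" using H(2) by (metis imageE)
      then have "x \<in> S" using u(3) h(1)[of y] by (simp add: \<psi>_def)
      then show "x \<in> U0 \<inter> S" using mapsW u by auto
    qed
    show "U0 \<inter> S \<subseteq> \<psi> ` E"
    proof
      fix x assume x: "x \<in> U0 \<inter> S"
      then have "\<Phi> x \<in> V \<inter> (H \<times> {0})" using H(2) by (auto simp: U0_def)
      then obtain u where u: "\<Phi> x = (u, 0)" "u \<in> H" by auto
      then have "x = \<psi> u" "u \<in> W" using x h(1)[of x] by (auto simp: \<psi>_def U0_def)
      then show "x \<in> \<psi> ` E" using u by (auto simp: E_def)
    qed
  qed
  then have lp: "local_patch S U0 W E \<psi> \<rho>"
    unfolding local_patch_def using U0 Eb mapsW Ck_on_le[OF psiW assms(2)] Ck_on_le[OF rhoU assms(2)]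
    by (auto simp: W_def E_def)
  have "W = ball v0 r" "cball v0 (r / 2) \<subseteq> W" using r by (auto simp: W_def)
  moreover have "p = \<psi> v0" using v0(1) h(1)[OF pU] by (simp add: \<psi>_def)
  ultimately show thesis
    by (intro that[OF lp psiW _ _ _ v0(2) E_def H(1) Ck_on_imp_continuous[OF rhoU] rhoU, of "r / 2"])
      (use r in simp_all)
qed

lemma left_inverse_derivative:
  assumes "open W" "open U" "\<psi> ` W \<subseteq> U" "Ck_on 1 \<psi> W" "Ck_on 1 \<rho> U" "\<And>u. u \<in> W \<Longrightarrow> \<rho> (\<psi> u) = u" "u \<in> W"
  shows "frechet_derivative \<rho> (at (\<psi> u)) (frechet_derivative \<psi> (at u) h) = h"
proof -
  have 1: "(\<psi> has_derivative frechet_derivative \<psi> (at u)) (at u)"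
    using Ck_on_has_derivative'[OF assms(4,1,7)] by simp
  have 2: "(\<rho> has_derivative frechet_derivative \<rho> (at (\<psi> u))) (at (\<psi> u))"
    using Ck_on_has_derivative'[OF assms(5,2)] assms(3,7) by auto
  have "(\<rho> \<circ> \<psi> has_derivative frechet_derivative \<rho> (at (\<psi> u)) \<circ> frechet_derivative \<psi> (at u)) (at u)"
    by (rule diff_chain_at[OF 1 2])
  moreover have "(\<rho> \<circ> \<psi> has_derivative id) (at u)"
    by (rule has_derivative_transform_within_open[OF has_derivative_id assms(1,7)]) (simp add: assms(6))
  ultimately have "frechet_derivative \<rho> (at (\<psi> u)) \<circ> frechet_derivative \<psi> (at u) = id"
    using has_derivative_unique by blast
  then show ?thesis by (metis comp_apply id_apply)
qed

text \<open>The compact parameter sets used to cover the hypersurface, also near its boundary. They satisfy the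
  condition in \<open>Ck_parametrization\<close> that they be the closure of their interior, because they are convex and
  contain a ball. The centre of that ball is obtained by moving inward from \<open>v0\<close>.\<close>

lemma convex_cball_Int_halfspace:
  fixes H :: "(real^'m) set"
  assumes H: "H = UNIV \<or> (\<exists>b\<in>Basis. H = {u. 0 \<le> u \<bullet> b})" and "v0 \<in> H" "0 < r"
  shows "compact (cball v0 r \<inter> H)" "cball v0 r \<inter> H \<subseteq> closure (interior (cball v0 r \<inter> H))"
    "\<exists>c s. 0 < s \<and> cball c s \<subseteq> cball v0 r \<inter> H"
proof -
  have cl: "closed H" "convex H"
    using H closed_halfspace_ge[of 0] convex_halfspace_ge[of 0] by (auto simp: inner_commute)
  then show "compact (cball v0 r \<inter> H)" by (simp add: compact_Int_closed)
  show ex: "\<exists>c s. 0 < s \<and> cball c s \<subseteq> cball v0 r \<inter> H"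
    using H
  proof (elim disjE bexE)
    assume "H = UNIV"
    then show ?thesis using assms(3) by auto
  next
    fix b :: "real^'m" assume b: "b \<in> Basis" "H = {u. 0 \<le> u \<bullet> b}"
    have "cball (v0 + (r / 2) *\<^sub>R b) (r / 2) \<subseteq> cball v0 r \<inter> H"
    proof
      fix x assume x: "x \<in> cball (v0 + (r / 2) *\<^sub>R b) (r / 2)"
      define y where "y = x - (v0 + (r / 2) *\<^sub>R b)"
      have y: "norm y \<le> r / 2" using x by (simp add: y_def dist_norm norm_minus_commute)
      have xeq: "x = v0 + ((r / 2) *\<^sub>R b + y)" by (simp add: y_def)
      have "norm ((r / 2) *\<^sub>R b + y) \<le> r / 2 + r / 2"
        using y b assms(3) by (intro norm_triangle_le add_mono) auto
      moreover have "\<bar>y \<bullet> b\<bar> \<le> r / 2" using Basis_le_norm[OF b(1), of y] y by linarith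
      then have "0 \<le> x \<bullet> b" using assms(2) b unfolding xeq by (simp add: inner_add_left inner_same_Basis)
      ultimately show "x \<in> cball v0 r \<inter> H" using b unfolding xeq by (simp add: dist_norm flip: norm_minus_cancel[of "(r / 2) *\<^sub>R b + y"])
    qed
    then show ?thesis using assms(3) by (intro exI[of _ "v0 + (r / 2) *\<^sub>R b"] exI[of _ "r / 2"]) auto
  qed
  have cv: "convex (cball v0 r \<inter> H)" using cl by (intro convex_Int) auto
  have ne: "interior (cball v0 r \<inter> H) \<noteq> {}"
    using ex by (metis interior_mono interior_cball ball_eq_empty linorder_not_le subset_empty)
  show "cball v0 r \<inter> H \<subseteq> closure (interior (cball v0 r \<inter> H))"
    unfolding convex_closure_interior[OF cv ne] by (rule closure_subset)
qed

lemma local_patch_parametrization: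
  fixes \<psi> :: "real^'m::finite \<Rightarrow> real^'n"
  assumes lp: "local_patch S U W E \<psi> \<rho>" and "E = W \<inter> H" and H: "H = UNIV \<or> (\<exists>b\<in>Basis. H = {u. 0 \<le> u \<bullet> b})"
    and "v0 \<in> H" "0 < r" "cball v0 r \<subseteq> W"
  shows "Ck_parametrization 1 S (cball v0 r \<inter> H) \<psi>"
proof -
  have l: "open U" "open W" "Ck_on 1 \<psi> W" "Ck_on 1 \<rho> U" "\<psi> ` W \<subseteq> U" "\<And>u. u \<in> W \<Longrightarrow> \<rho> (\<psi> u) = u" "\<psi> ` E = U \<inter> S"
    using lp by (auto simp: local_patch_def)
  have "inj (frechet_derivative \<psi> (at u))" if "u \<in> W" for u
    using left_inverse_derivative[OF l(2,1,5,3,4,6) that] by (metis injI)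
  moreover have "inj_on \<psi> (cball v0 r \<inter> H)" using subsetD[OF assms(6)] l(6) by (intro inj_on_inverseI[of _ \<rho>]) blast
  moreover have "\<psi> ` (cball v0 r \<inter> H) \<subseteq> S" using l(7) assms(2,6) by blast
  moreover have "Ck_map 1 \<psi> (cball v0 r \<inter> H)"
    unfolding Ck_map_def by (intro exI[of _ W] conjI l(2,3)) (use assms(6) in blast)
  ultimately show ?thesis
    unfolding Ck_parametrization_def using convex_cball_Int_halfspace[OF H assms(4,5)] assms(6) by auto
qed

subsection \<open>The area element under a change of parametrization\<close>

text \<open>The Gram matrix of \<open>A \<circ> B\<close> is the Gram matrix of \<open>A\<close> conjugated by the square matrix of \<open>B\<close>, so its
  determinant picks up the square of \<open>det B\<close>.\<close>

lemma area_element_compose: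
  fixes \<psi> :: "real^'m::finite \<Rightarrow> real^'n"
  assumes "linear A" "linear B"
    and "frechet_derivative \<phi> (at u) = A \<circ> B" "frechet_derivative \<psi> (at v) = A"
  shows "area_element \<phi> u = area_element \<psi> v * \<bar>det (matrix B)\<bar>"
proof -
  let ?A = "matrix A" and ?B = "matrix B"
  have m: "matrix (A \<circ> B) = ?A ** ?B" by (rule matrix_compose[OF assms(2,1)])
  have "transpose (?A ** ?B) ** (?A ** ?B) = transpose ?B ** (transpose ?A ** ?A) ** ?B"
    by (simp add: matrix_transpose_mul matrix_mul_assoc)
  then have "det (transpose (?A ** ?B) ** (?A ** ?B)) = det (transpose ?A ** ?A) * (det ?B)\<^sup>2"
    by (simp add: det_mul det_transpose power2_eq_square)
  then show ?thesis unfolding area_element_def Let_def assms(3,4) m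
    by (simp add: real_sqrt_mult)
qed

text \<open>The matrices on the segment from the identity to the Gram matrix have positive definite quadratic forms. Hence the
  determinant has no zero there and keeps the sign that it has at the identity.\<close>

lemma gram_det_pos:
  fixes D :: "real^'m^'n"
  assumes "inj ((*v) D)"
  shows "0 < det (transpose D ** D)"
proof -
  let ?G = "transpose D ** D"
  have q: "x \<bullet> (?G *v x) = (D *v x) \<bullet> (D *v x)" for x
    by (simp only: matrix_vector_mul_assoc[symmetric] dot_lmul_matrix[symmetric] vector_transpose_matrix)
  have pos: "det ((1 - t) *\<^sub>R mat 1 + t *\<^sub>R ?G) \<noteq> 0" if t: "0 \<le> t" "t \<le> 1" for t :: real
  proof
    let ?M = "(1 - t) *\<^sub>R mat 1 + t *\<^sub>R ?G"
    assume "det ?M = 0"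
    then have "\<not> (\<exists>B. B ** ?M = mat 1)" using invertible_det_nz[of ?M] by (simp only: invertible_left_inverse not_not)
    then obtain x where x: "?M *v x = 0" "x \<noteq> 0"
      unfolding matrix_left_invertible_ker by blast
    have "x \<bullet> (?M *v x) = (1 - t) * (x \<bullet> x) + t * ((D *v x) \<bullet> (D *v x))"
      by (simp add: matrix_vector_mult_add_rdistrib scaleR_matrix_vector_assoc[symmetric] inner_add_right q)
    moreover have "D *v x \<noteq> 0" using assms x(2) by (metis injD matrix_vector_mult_0_right)
    moreover have "0 < (1 - t) * (x \<bullet> x) + t * ((D *v x) \<bullet> (D *v x))"
    proof (cases "t = 0")
      case False
      then have "0 < t * ((D *v x) \<bullet> (D *v x))" using t \<open>D *v x \<noteq> 0\<close> by simp
      moreover have "0 \<le> (1 - t) * (x \<bullet> x)" using t by simp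
      ultimately show ?thesis by linarith
    qed (use x in simp)
    ultimately show False using x(1) by simp
  qed
  define f where "f t = det ((1 - t) *\<^sub>R mat 1 + t *\<^sub>R ?G)" for t :: real
  have cont: "continuous_on {0..1} f" unfolding f_def det_def by (intro continuous_intros) 
  have f0: "f 0 = 1" by (simp add: f_def)
  show ?thesis
  proof (rule ccontr)
    assume "\<not> ?thesis"
    then have "f 1 \<le> 0" by (simp add: f_def)
    then obtain t where "0 \<le> t" "t \<le> 1" "f t = 0"
      using IVT2'[of f 1 0 0] cont f0 by auto
    then show False using pos by (simp add: f_def)
  qed
qed

lemma area_element_pos:
  assumes "linear (frechet_derivative \<phi> (at u))" "inj (frechet_derivative \<phi> (at u))"
  shows "0 < area_element \<phi> u"
proof -
  have "inj ((*v) (matrix (frechet_derivative \<phi> (at u))))"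
    using assms by (simp add: matrix_vector_mul(2)[symmetric] matrix_works inj_def)
  then show ?thesis unfolding area_element_def Let_def by (simp add: gram_det_pos)
qed

lemma continuous_on_matrix_entry:
  fixes \<phi> :: "real^'m::finite \<Rightarrow> real^'n::finite"
  assumes "Ck_on 1 \<phi> N"
  shows "continuous_on N (\<lambda>u. matrix (frechet_derivative \<phi> (at u)) $ i $ j)"
proof -
  have "continuous_on N (\<lambda>u. frechet_derivative \<phi> (at u) (axis j 1))"
    using assms by (auto simp: One_nat_def Ck_on_Suc Ck_on_0 axis_in_Basis_iff)
  then show ?thesis unfolding matrix_def
    using bounded_linear.continuous_on[OF bounded_linear_vec_nth] by simp
qed

lemma continuous_on_area_element:
  fixes \<phi> :: "real^'m::finite \<Rightarrow> real^'n::finite"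
  assumes "Ck_on 1 \<phi> N"
  shows "continuous_on N (area_element \<phi>)"
proof -
  have "continuous_on N (\<lambda>u. sqrt (\<Sum>p | p permutes UNIV. of_int (sign p) *
      (\<Prod>i\<in>UNIV. \<Sum>l\<in>UNIV. matrix (frechet_derivative \<phi> (at u)) $ l $ i * matrix (frechet_derivative \<phi> (at u)) $ l $ p i)))"
    by (intro continuous_intros continuous_on_matrix_entry[OF assms])
  then show ?thesis
    by (simp add: area_element_def[abs_def] Let_def det_def transpose_def matrix_matrix_mult_def)
qed

lemma continuous_on_det_derivative:
  fixes \<phi> :: "real^'m::finite \<Rightarrow> real^'m"
  assumes "Ck_on 1 \<phi> N"
  shows "continuous_on N (\<lambda>u. det (matrix (frechet_derivative \<phi> (at u))))"
  unfolding det_def by (intro continuous_intros continuous_on_matrix_entry[OF assms])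

subsection \<open>Existence and uniqueness of the surface measure\<close>

lemma borel_preimage_restricted:
  fixes f :: "'a::euclidean_space \<Rightarrow> 'b::euclidean_space"
  assumes "X \<in> sets borel" "continuous_on X f" "A \<in> sets borel"
  shows "X \<inter> f -` A \<in> sets borel"
proof -
  have m: "(\<lambda>x. indicator X x *\<^sub>R f x) \<in> borel_measurable borel"
    by (rule borel_measurable_continuous_on_indicator[OF assms(1,2)])
  have "X \<inter> f -` A = X \<inter> (\<lambda>x. indicator X x *\<^sub>R f x) -` A" by (auto simp: indicator_def)
  also have "\<dots> \<in> sets borel" using measurable_sets[OF m assms(3)] assms(1) by simp
  finally show ?thesis .
qed

text \<open>On the interior of \<open>K\<close> the two maps agree on an open set; continuity of the derivatives extends the
  equality to the closure. This is why parameter sets are required to lie in the closure of their interior.\<close>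

lemma derivative_eq_on_closure_interior:
  fixes \<phi> h :: "'a::euclidean_space \<Rightarrow> 'b::euclidean_space"
  assumes N: "open N" and C1: "Ck_on 1 \<phi> N" "Ck_on 1 h N" 
    and eq: "\<And>u. u \<in> K \<inter> N \<Longrightarrow> \<phi> u = h u" and K: "K \<subseteq> closure (interior K)" and u: "u \<in> K \<inter> N"
  shows "frechet_derivative \<phi> (at u) = frechet_derivative h (at u)"
proof -
  have lin: "linear (frechet_derivative \<phi> (at u))" "linear (frechet_derivative h (at u))"
    using has_derivative_linear[OF Ck_on_has_derivative'[OF C1(1) N]]
      has_derivative_linear[OF Ck_on_has_derivative'[OF C1(2) N]] u by auto
  have "frechet_derivative \<phi> (at u) b = frechet_derivative h (at u) b" if b: "b \<in> Basis" for b
  proof (rule ccontr)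
    assume ne: "frechet_derivative \<phi> (at u) b \<noteq> frechet_derivative h (at u) b"
    define F where "F w = frechet_derivative \<phi> (at w) b - frechet_derivative h (at w) b" for w
    have F: "continuous_on N F" unfolding F_def
      using C1 b by (intro continuous_on_diff) (auto simp: One_nat_def Ck_on_Suc Ck_on_0)
    have op: "open (N \<inter> F -` (- {0}))" by (rule continuous_open_preimage[OF F N open_Compl[OF closed_singleton]])
    have "u \<in> N \<inter> F -` (- {0})" using u ne by (simp add: F_def)
    moreover have "u \<in> closure (interior K)" using u K by blast
    ultimately have "(N \<inter> F -` (- {0})) \<inter> interior K \<noteq> {}"
      using open_Int_closure_eq_empty[OF op, of "interior K"] by blast
    then obtain w where w: "w \<in> N" "F w \<noteq> 0" "w \<in> interior K" by auto
    have "frechet_derivative \<phi> (at w) = frechet_derivative h (at w)"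
      by (rule frechet_derivative_cong_open[of "N \<inter> interior K"]) (use N w eq interior_subset in auto)
    then show False using w by (simp add: F_def)
  qed
  then show ?thesis by (rule linear_eq_stdbasis[OF lin])
qed

text \<open>Consistency of the area elements of two parametrizations of the same piece: this is the change of
  variables formula for the transition map \<open>\<rho> \<circ> \<phi>\<close>. Since \<open>\<phi>\<close> is only given on a compact set \<open>K\<close>, the
  identity \<open>\<phi> = \<psi> \<circ> \<rho> \<circ> \<phi>\<close> holds on \<open>K\<close> only, and the derivatives are compared by
  \<open>derivative_eq_on_closure_interior\<close>.\<close>

lemma patch_consistent:
  fixes \<phi> \<psi> :: "real^'m::finite \<Rightarrow> real^'n::finite"
  assumes lp: "local_patch S U W E \<psi> \<rho>" and par: "Ck_parametrization 1 S K \<phi>"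
    and A: "A \<in> sets borel" "A \<subseteq> \<phi> ` K" "A \<subseteq> U"
  shows "(\<integral>\<^sup>+u. indicator (K \<inter> \<phi> -` A) u * ennreal (area_element \<phi> u) \<partial>lborel) =
    (\<integral>\<^sup>+u. indicator (E \<inter> \<psi> -` A) u * ennreal (area_element \<psi> u) \<partial>lborel)"
proof -
  have l: "open U" "open W" "bounded W" "E \<subseteq> W" "E \<in> sets borel" "Ck_on 1 \<psi> W" "Ck_on 1 \<rho> U" "\<psi> ` W \<subseteq> U"
    "\<And>u. u \<in> W \<Longrightarrow> \<rho> (\<psi> u) = u" "\<psi> ` E = U \<inter> S"
    using lp by (auto simp: local_patch_def)
  have k: "compact K" "K \<subseteq> closure (interior K)" "inj_on \<phi> K" "\<phi> ` K \<subseteq> S"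
    using par by (auto simp: Ck_parametrization_def)
  obtain N where N: "open N" "K \<subseteq> N" "Ck_on 1 \<phi> N"
    using par by (auto simp: Ck_parametrization_def Ck_map_def)
  have contK: "continuous_on K \<phi>" by (rule continuous_on_subset[OF Ck_on_imp_continuous[OF N(3)] N(2)])
  have contE: "continuous_on E \<psi>" by (rule continuous_on_subset[OF Ck_on_imp_continuous[OF l(6)] l(4)])
  define X where "X = K \<inter> \<phi> -` A"
  define Y where "Y = E \<inter> \<psi> -` A"
  have Xb: "X \<in> sets borel" unfolding X_def
    by (rule borel_preimage_restricted[OF _ contK A(1)]) (simp add: k(1) borel_compact)
  have Yb: "Y \<in> sets borel" unfolding Y_def by (rule borel_preimage_restricted[OF l(5) contE A(1)])
  define g where "g = \<rho> \<circ> \<phi>"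
  have returns: "g u \<in> E \<and> \<psi> (g u) = \<phi> u" if "u \<in> K" "\<phi> u \<in> U" for u
  proof -
    have "\<phi> u \<in> \<psi> ` E" using that k(4) l(10) by blast
    then obtain v where "v \<in> E" "\<phi> u = \<psi> v" by blast
    then show ?thesis using l(4,9) by (auto simp: g_def)
  qed
  have gX: "g ` X = Y"
  proof
    show "g ` X \<subseteq> Y" using returns A(3) by (auto simp: X_def Y_def)
    show "Y \<subseteq> g ` X"
    proof
      fix v assume v: "v \<in> Y"
      then have vA: "v \<in> E" "\<psi> v \<in> A" by (auto simp: Y_def)
      then obtain u where u: "u \<in> K" "\<phi> u = \<psi> v" using A(2) by (metis imageE subsetD)
      then have "u \<in> X" "g u = v" using vA l(4,9) by (auto simp: X_def g_def)
      then show "v \<in> g ` X" by blast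
    qed
  qed
  have injX: "inj_on g X"
  proof (rule inj_onI)
    fix u u' assume "u \<in> X" "u' \<in> X" "g u = g u'"
    moreover have "\<phi> u \<in> U" "\<phi> u' \<in> U" "u \<in> K" "u' \<in> K" using calculation A(3) by (auto simp: X_def)
    ultimately have "\<phi> u = \<phi> u'" using returns[of u] returns[of u'] by metis
    then show "u = u'" using \<open>u \<in> X\<close> \<open>u' \<in> X\<close> k(3) by (auto simp: X_def inj_on_def)
  qed
  define N1 where "N1 = N \<inter> \<phi> -` U"
  have N1: "open N1" unfolding N1_def by (rule continuous_open_preimage[OF Ck_on_imp_continuous[OF N(3)] N(1) l(1)])
  have gN1: "Ck_on 1 g N1" unfolding g_def
    by (rule Ck_on_compose[OF N1 l(1) _ Ck_on_subset[OF N(3)] l(7)]) (auto simp: N1_def)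
  define N2 where "N2 = N1 \<inter> g -` W"
  have N2: "open N2" unfolding N2_def by (rule continuous_open_preimage[OF Ck_on_imp_continuous[OF gN1] N1 l(2)])
  have gN2: "Ck_on 1 g N2" by (rule Ck_on_subset[OF gN1]) (auto simp: N2_def)
  have phiN2: "Ck_on 1 \<phi> N2" by (rule Ck_on_subset[OF N(3)]) (auto simp: N2_def N1_def)
  have hN2: "Ck_on 1 (\<psi> \<circ> g) N2"
    by (rule Ck_on_compose[OF N2 l(2) _ gN2 l(6)]) (auto simp: N2_def)
  have XN2: "u \<in> K \<inter> N2" if "u \<in> X" for u
    using that returns[of u] A(3) l(4) N(2) by (auto simp: X_def N1_def N2_def)
  define g' where "g' u = frechet_derivative g (at u)" for u
  have derg: "(g has_derivative g' u) (at u)" if "u \<in> N2" for u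
    unfolding g'_def using Ck_on_has_derivative'[OF gN2 N2 that] by simp
  have area: "area_element \<phi> u = area_element \<psi> (g u) * \<bar>det (matrix (g' u))\<bar>" if u: "u \<in> X" for u
  proof -
    have uN: "u \<in> K \<inter> N2" by (rule XN2[OF u])
    have "frechet_derivative \<phi> (at u) = frechet_derivative (\<psi> \<circ> g) (at u)"
      by (rule derivative_eq_on_closure_interior[OF N2 phiN2 hN2 _ k(2) uN]) (use returns in \<open>auto simp: N2_def N1_def\<close>)
    moreover have gW: "g u \<in> W" using uN by (auto simp: N2_def)
    have d\<psi>: "(\<psi> has_derivative frechet_derivative \<psi> (at (g u))) (at (g u))"
      using Ck_on_has_derivative'[OF l(6,2) gW] by simp
    have "(\<psi> \<circ> g has_derivative frechet_derivative \<psi> (at (g u)) \<circ> g' u) (at u)"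
      by (rule diff_chain_at[OF derg d\<psi>]) (use uN in simp)
    from frechet_derivative_at[OF this]
    have "frechet_derivative (\<psi> \<circ> g) (at u) = frechet_derivative \<psi> (at (g u)) \<circ> g' u" by simp
    ultimately show ?thesis
      using has_derivative_linear[OF d\<psi>] has_derivative_linear[OF derg, of u] uN by (intro area_element_compose) auto
  qed
  define q where "q u = indicator X u *\<^sub>R g u" for u
  define D where "D u = indicator X u * \<bar>det (matrix (g' u))\<bar>" for u
  have XN2': "X \<subseteq> N2" using XN2 by blast
  have qm: "q \<in> borel_measurable borel" unfolding q_def[abs_def]
    by (rule borel_measurable_continuous_on_indicator[OF Xb continuous_on_subset[OF Ck_on_imp_continuous[OF gN2] XN2']])
  have Dm: "D \<in> borel_measurable borel"
  proof -
    have "continuous_on X (\<lambda>u. \<bar>det (matrix (g' u))\<bar>)"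
      unfolding g'_def by (intro continuous_on_rabs continuous_on_subset[OF continuous_on_det_derivative[OF gN2] XN2'])
    from borel_measurable_continuous_on_indicator[OF Xb this] show ?thesis
      by (simp add: D_def[abs_def])
  qed
  \<comment> \<open>The formula for images of sets says that the transition map transports one density to the other; integrals of area elements then follow by transport of measures.\<close>
  have "distr (density lborel (\<lambda>u. ennreal (D u))) borel q = density lborel (indicator Y)"
  proof (rule measure_eqI)
    fix B assume "B \<in> sets (distr (density lborel (\<lambda>u. ennreal (D u))) borel q)"
    then have B: "B \<in> sets borel" by simp
    define XB where "XB = X \<inter> q -` B"
    have XBb: "XB \<in> sets borel" using measurable_sets[OF qm B] Xb by (simp add: XB_def)
    have gXB: "g ` XB = Y \<inter> B" unfolding XB_def using gX by (auto simp: q_def)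
    have "emeasure (distr (density lborel (\<lambda>u. ennreal (D u))) borel q) B = (\<integral>\<^sup>+u. ennreal (D u) * indicator (q -` B) u \<partial>lborel)"
      using qm Dm B measurable_sets[OF qm B] by (subst emeasure_distr, simp, simp) (simp add: emeasure_density)
    also have "\<dots> = (\<integral>\<^sup>+u. ennreal (indicator XB u * \<bar>det (matrix (g' u))\<bar>) \<partial>lborel)"
      by (intro nn_integral_cong) (auto simp: D_def XB_def indicator_def)
    also have "\<dots> = emeasure lborel (g ` XB)"
    proof (rule emeasure_differentiable_image[OF XBb])
      show "g ` XB \<in> sets borel" using Yb B by (simp add: gXB)
      show "bounded (g ` XB)" by (rule bounded_subset[OF l(3)]) (use l(4) in \<open>auto simp: gXB Y_def\<close>)
      show "(g has_derivative g' u) (at u within XB)" if "u \<in> XB" for u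
        by (rule has_derivative_at_withinI[OF derg]) (use XN2' that in \<open>auto simp: XB_def\<close>)
      show "inj_on g XB" using injX by (auto simp: XB_def intro: inj_on_subset)
      have "(\<lambda>u. indicator XB u * D u) \<in> borel_measurable borel" 
        by (intro borel_measurable_times borel_measurable_indicator XBb Dm)
      moreover have "(\<lambda>u. indicator XB u * D u) = (\<lambda>u. indicator XB u * \<bar>det (matrix (g' u))\<bar>)"
        by (auto simp: fun_eq_iff D_def XB_def indicator_def)
      ultimately show "(\<lambda>u. indicator XB u * \<bar>det (matrix (g' u))\<bar>) \<in> borel_measurable borel" by simp
    qed
    also have "\<dots> = emeasure (density lborel (indicator Y)) B"
      using Yb B by (subst gXB, subst emeasure_density) (auto simp: indicator_inter_arith[symmetric])
    finally show "emeasure (distr (density lborel (\<lambda>u. ennreal (D u))) borel q) B = emeasure (density lborel (indicator Y)) B" .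
  qed simp
  note meq = this
  define J where "J v = ennreal (indicator E v * area_element \<psi> v)" for v
  have Jm: "J \<in> borel_measurable borel"
  proof -
    have "continuous_on E (area_element \<psi>)"
      by (rule continuous_on_subset[OF continuous_on_area_element[OF l(6)] l(4)])
    from borel_measurable_continuous_on_indicator[OF l(5) this] show ?thesis
      unfolding J_def[abs_def] by (intro measurable_compose[OF _ measurable_ennreal]) simp
  qed
  have "(\<integral>\<^sup>+u. indicator X u * ennreal (area_element \<phi> u) \<partial>lborel) = (\<integral>\<^sup>+u. ennreal (D u) * J (q u) \<partial>lborel)"
  proof (rule nn_integral_cong)
    fix u
    show "indicator X u * ennreal (area_element \<phi> u) = ennreal (D u) * J (q u)"
    proof (cases "u \<in> X")
      case True
      then have "g u \<in> E" using returns A(3) by (auto simp: X_def)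
      then show ?thesis using True area[OF True]
        by (simp add: D_def J_def q_def ennreal_mult'' mult.commute)
    qed (simp add: D_def)
  qed
  also have "\<dots> = (\<integral>\<^sup>+u. J (q u) \<partial>density lborel (\<lambda>u. ennreal (D u)))"
    using Dm measurable_compose[OF qm Jm] by (simp add: nn_integral_density)
  also have "\<dots> = (\<integral>\<^sup>+v. J v \<partial>distr (density lborel (\<lambda>u. ennreal (D u))) borel q)"
    using qm Jm by (simp add: nn_integral_distr)
  also have "\<dots> = (\<integral>\<^sup>+v. indicator Y v * J v \<partial>lborel)"
    unfolding meq using Yb Jm by (simp add: nn_integral_density)
  also have "\<dots> = (\<integral>\<^sup>+v. indicator Y v * ennreal (area_element \<psi> v) \<partial>lborel)"
    by (intro nn_integral_cong) (auto simp: Y_def J_def indicator_def)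
  finally show ?thesis by (simp add: X_def Y_def)
qed

text \<open>Compactness reduces to finitely many patches. Two covers are needed simultaneously: by the open sets \<open>U i\<close>, on
  which measures are glued, and by the compact pieces \<open>\<psi> i ` K i\<close>, on which a surface measure is prescribed.\<close>

lemma hypersurface_cover:
  fixes S :: "(real^'n::finite) set"
  assumes S: "compact_hypersurface TYPE('m::finite) k S" and k: "1 \<le> k"
  obtains M U W E \<rho> and \<psi> :: "nat \<Rightarrow> real^'m \<Rightarrow> real^'n" and K where
    "\<And>i. i < (M::nat) \<Longrightarrow> local_patch S (U i) (W i) (E i) (\<psi> i) (\<rho> i)"
    "\<And>i. i < M \<Longrightarrow> Ck_parametrization 1 S (K i) (\<psi> i)"
    "S \<subseteq> (\<Union>i<M. U i)" "S \<subseteq> (\<Union>i<M. \<psi> i ` K i)"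
proof -
  define good where "good p = (\<lambda>(U, W, E, \<rho>, \<psi> :: real^'m \<Rightarrow> real^'n, K, U'). local_patch S U W E \<psi> \<rho> \<and>
      Ck_parametrization 1 S K \<psi> \<and> open U' \<and> p \<in> U' \<and> U' \<subseteq> U \<and> U' \<inter> S \<subseteq> \<psi> ` K)" for p
  have "\<exists>x. good p x" if p: "p \<in> S" for p
  proof -
    obtain U W E \<rho> v0 and \<psi> :: "real^'m \<Rightarrow> real^'n" and H r where c: "local_patch S U W E \<psi> \<rho>" "Ck_on k \<psi> W" "p = \<psi> v0" "0 < r"
      "cball v0 r \<subseteq> W" "v0 \<in> H" "E = W \<inter> H" "H = UNIV \<or> (\<exists>b\<in>Basis. H = {u. 0 \<le> u \<bullet> b})" "continuous_on U \<rho>"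
      by (rule hypersurface_chart[OF S k p]) (rule that)
    have l: "open U" "\<And>u. u \<in> W \<Longrightarrow> \<rho> (\<psi> u) = u" "\<psi> ` E = U \<inter> S" "\<psi> ` W \<subseteq> U"
      using c(1) by (auto simp: local_patch_def)
    define U' where "U' = U \<inter> \<rho> -` ball v0 r"
    have "open U'" unfolding U'_def by (rule continuous_open_preimage[OF c(9) l(1)]) simp
    moreover have "v0 \<in> W" using c(4,5) by auto
    then have "p \<in> U'" using l c(3,4) by (auto simp: U'_def)
    moreover have "U' \<inter> S \<subseteq> \<psi> ` (cball v0 r \<inter> H)"
    proof
      fix x assume x: "x \<in> U' \<inter> S"
      then have "x \<in> \<psi> ` E" using l(3) by (auto simp: U'_def)
      then obtain u where u: "u \<in> W" "u \<in> H" "x = \<psi> u" using c(7) by blast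
      then have "u \<in> ball v0 r" using x l(2) by (auto simp: U'_def)
      then show "x \<in> \<psi> ` (cball v0 r \<inter> H)" using u by (auto simp: less_imp_le)
    qed
    moreover have "Ck_parametrization 1 S (cball v0 r \<inter> H) \<psi>"
      by (rule local_patch_parametrization[OF c(1,7,8,6,4,5)])
    moreover have "U' \<subseteq> U" by (simp add: U'_def)
    ultimately have "good p (U, W, E, \<rho>, \<psi>, cball v0 r \<inter> H, U')" using c(1) by (simp add: good_def)
    then show ?thesis by blast
  qed
  then obtain F where F: "\<And>p. p \<in> S \<Longrightarrow> good p (F p)" by metis
  define U where "U p = fst (F p)" for p
  define W where "W p = fst (snd (F p))" for p
  define E where "E p = fst (snd (snd (F p)))" for p
  define \<rho> where "\<rho> p = fst (snd (snd (snd (F p))))" for p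
  define \<psi> where "\<psi> p = fst (snd (snd (snd (snd (F p)))))" for p
  define K where "K p = fst (snd (snd (snd (snd (snd (F p))))))" for p
  define U' where "U' p = snd (snd (snd (snd (snd (snd (F p))))))" for p
  have d: "\<And>p. p \<in> S \<Longrightarrow> local_patch S (U p) (W p) (E p) (\<psi> p) (\<rho> p)" "\<And>p. p \<in> S \<Longrightarrow> Ck_parametrization 1 S (K p) (\<psi> p)"
      "\<And>p. p \<in> S \<Longrightarrow> open (U' p)" "\<And>p. p \<in> S \<Longrightarrow> p \<in> U' p" "\<And>p. p \<in> S \<Longrightarrow> U' p \<subseteq> U p" "\<And>p. p \<in> S \<Longrightarrow> U' p \<inter> S \<subseteq> \<psi> p ` K p"
    using F unfolding good_def U_def W_def E_def \<rho>_def \<psi>_def K_def U'_def by (simp_all add: case_prod_beta)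
  have "compact S" using S by (simp add: compact_hypersurface_def)
  then obtain C where C: "C \<subseteq> S" "finite C" "S \<subseteq> (\<Union>p\<in>C. U' p)"
  proof (rule compactE_image[of S S U'])
    show "S \<subseteq> (\<Union>p\<in>S. U' p)" using d(4) by blast
  qed (use d(3) in auto)
  obtain h where h: "bij_betw h {..<card C} C"
    using ex_bij_betw_nat_finite[OF C(2)] by (auto simp: lessThan_atLeast0)
  have hC: "h i \<in> S" if "i < card C" for i using h C(1) that by (auto simp: bij_betw_def)
  have img: "h ` {..<card C} = C" using h by (simp add: bij_betw_def)
  show thesis
  proof (rule that[of "card C" "\<lambda>i. U (h i)" "\<lambda>i. W (h i)" "\<lambda>i. E (h i)" "\<lambda>i. \<psi> (h i)" "\<lambda>i. \<rho> (h i)" "\<lambda>i. K (h i)"])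
    show "S \<subseteq> (\<Union>i<card C. U (h i))"
    proof -
      have "(\<Union>p\<in>C. U' p) \<subseteq> (\<Union>p\<in>C. U p)" using d(5) C(1) by (intro UN_mono) auto
      then have "S \<subseteq> (\<Union>p\<in>h ` {..<card C}. U p)" using C(3) img by auto
      then show ?thesis by simp
    qed
    show "S \<subseteq> (\<Union>i<card C. \<psi> (h i) ` K (h i))"
    proof -
      have "S \<subseteq> (\<Union>p\<in>h ` {..<card C}. \<psi> p ` K p)" unfolding img using C d(6) by blast
      then show ?thesis by simp
    qed
  qed (use d hC in auto)
qed

definition is_surface_measure :: "'m::finite itself \<Rightarrow> (real^'n) set \<Rightarrow> (real^'n) measure \<Rightarrow> bool" where
  "is_surface_measure _ S \<sigma> \<longleftrightarrow> sets \<sigma> = sets borel \<and> emeasure \<sigma> (- S) = 0 \<and>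
     (\<forall>K (\<phi> :: real^'m \<Rightarrow> real^'n). Ck_parametrization 1 S K \<phi> \<longrightarrow>
        (\<forall>A\<in>sets borel. A \<subseteq> \<phi> ` K \<longrightarrow>
           emeasure \<sigma> A = (\<integral>\<^sup>+u. indicator (K \<inter> \<phi> -` A) u * ennreal (area_element \<phi> u) \<partial>lborel)))"

lemma param_image_borel:
  assumes "Ck_parametrization 1 S K \<phi>"
  shows "\<phi> ` K \<in> sets borel"
proof -
  have "compact K" "continuous_on K \<phi>"
    using assms Ck_on_imp_continuous continuous_on_subset by (auto simp: Ck_parametrization_def Ck_map_def) blast
  then show ?thesis by (simp add: compact_continuous_image borel_compact)
qed

text \<open>The compact pieces of a finite cover determine the measure of every Borel subset of the hypersurface, after the
  pieces have been made disjoint.\<close>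

lemma is_surface_measure_unique:
  fixes S :: "(real^'n::finite) set"
  assumes S: "compact_hypersurface TYPE('m::finite) k S" "1 \<le> k"
    and "is_surface_measure TYPE('m) S \<sigma>" "is_surface_measure TYPE('m) S \<sigma>'"
  shows "\<sigma> = \<sigma>'"
proof -
  obtain M U W E \<rho> and \<psi> :: "nat \<Rightarrow> real^'m \<Rightarrow> real^'n" and K where
    c: "\<And>i. i < (M::nat) \<Longrightarrow> Ck_parametrization 1 S (K i) (\<psi> i)" "S \<subseteq> (\<Union>i<M. \<psi> i ` K i)"
    by (rule hypersurface_cover[OF S]) (rule that)
  have s: "sets \<sigma> = sets borel" "sets \<sigma>' = sets borel" "emeasure \<sigma> (- S) = 0" "emeasure \<sigma>' (- S) = 0"
    using assms(3,4) by (auto simp: is_surface_measure_def)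
  have eq1: "emeasure \<sigma> A = emeasure \<sigma>' A" if "A \<in> sets borel" "i < M" "A \<subseteq> \<psi> i ` K i" for A i
    using assms(3,4) c(1)[OF that(2)] that(1,3) by (auto simp: is_surface_measure_def)
  have eq: "emeasure \<sigma> A = emeasure \<sigma>' A" if "A \<in> sets borel" "A \<subseteq> (\<Union>i<m. \<psi> i ` K i)" "m \<le> M" for A m
    using that
  proof (induction m arbitrary: A)
    case (Suc m)
    define B where "B = A \<inter> \<psi> m ` K m"
    have B: "B \<in> sets borel" "A - B \<in> sets borel"
      using param_image_borel[OF c(1)[of m]] Suc.prems by (auto simp: B_def)
    have "emeasure \<sigma> B = emeasure \<sigma>' B" using eq1[OF B(1), of m] Suc.prems by (simp add: B_def)
    moreover have "emeasure \<sigma> (A - B) = emeasure \<sigma>' (A - B)"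
      using Suc.prems by (intro Suc.IH B) (auto simp: B_def lessThan_Suc)
    moreover have "emeasure \<tau> A = emeasure \<tau> B + emeasure \<tau> (A - B)" if "sets \<tau> = sets borel" for \<tau>
    proof -
      have "B \<union> (A - B) = A" by (auto simp: B_def)
      then show ?thesis using plus_emeasure[of B \<tau> "A - B"] B that by auto
    qed
    ultimately show ?case using s by metis
  qed simp
  show ?thesis
  proof (rule measure_eqI)
    fix A assume "A \<in> sets \<sigma>"
    then have A: "A \<in> sets borel" using s by simp
    have Sb: "S \<in> sets borel" using S by (simp add: compact_hypersurface_def borel_compact)
    have split: "emeasure \<tau> A = emeasure \<tau> (A \<inter> S)" if "sets \<tau> = sets borel" "emeasure \<tau> (- S) = 0" for \<tau>
    proof -
      have "emeasure \<tau> (A - S) \<le> emeasure \<tau> (- S)" using that Sb A by (intro emeasure_mono) auto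
      then have "emeasure \<tau> (A - S) = 0" using that by simp
      moreover have "emeasure \<tau> (A \<inter> S) + emeasure \<tau> (A - S) = emeasure \<tau> A"
        using plus_emeasure[of "A \<inter> S" \<tau> "A - S"] A Sb that by (auto simp: Int_Diff_Un)
      ultimately show ?thesis by simp
    qed
    have "emeasure \<sigma> (A \<inter> S) = emeasure \<sigma>' (A \<inter> S)"
      by (rule eq[of _ M]) (use A Sb c(2) in auto)
    then show "emeasure \<sigma> A = emeasure \<sigma>' A" using split s by metis
  qed (use s in simp)
qed

text \<open>The measures of finitely many patches are glued along the disjoint sets \<open>P i\<close>; by \<open>patch_consistent\<close> the
  result has the prescribed density in every parametrization, not only in those of the cover.\<close>

lemma is_surface_measure_exists:
  fixes S :: "(real^'n::finite) set"
  assumes S: "compact_hypersurface TYPE('m::finite) k S" "1 \<le> k"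
  shows "\<exists>\<sigma>. is_surface_measure TYPE('m) S \<sigma>"
proof -
  obtain M U W E \<rho> and \<psi> :: "nat \<Rightarrow> real^'m \<Rightarrow> real^'n" and K where
    c: "\<And>i. i < (M::nat) \<Longrightarrow> local_patch S (U i) (W i) (E i) (\<psi> i) (\<rho> i)" "S \<subseteq> (\<Union>i<M. U i)"
    by (rule hypersurface_cover[OF S]) (rule that)
  define \<nu> where "\<nu> i = distr (density lborel (\<lambda>u. ennreal (indicator (E i) u * area_element (\<psi> i) u))) borel (\<lambda>u. indicator (E i) u *\<^sub>R \<psi> i u)" for i
  define P where "P i = U i - (\<Union>j<i. U j)" for i
  have Ub: "U i \<in> sets borel" if "i < M" for i using c(1)[OF that] by (auto simp: local_patch_def)
  have Pb: "P i \<in> sets borel" if "i < M" for i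
    unfolding P_def using that by (intro sets.Diff sets.finite_UN Ub) auto
  have \<nu>: "emeasure (\<nu> i) A = (\<integral>\<^sup>+u. indicator (E i \<inter> \<psi> i -` A) u * ennreal (area_element (\<psi> i) u) \<partial>lborel)"
    if i: "i < M" and A: "A \<in> sets borel" for i A
  proof -
    have l: "E i \<in> sets borel" "E i \<subseteq> W i" "Ck_on 1 (\<psi> i) (W i)" using c(1)[OF i] by (auto simp: local_patch_def)
    have m1: "(\<lambda>u. indicator (E i) u *\<^sub>R \<psi> i u) \<in> borel_measurable borel"
      by (intro borel_measurable_continuous_on_indicator l continuous_on_subset[OF Ck_on_imp_continuous[OF l(3)]])
    have m2: "(\<lambda>u. indicator (E i) u *\<^sub>R area_element (\<psi> i) u) \<in> borel_measurable borel"
      by (intro borel_measurable_continuous_on_indicator l continuous_on_subset[OF continuous_on_area_element[OF l(3)]])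
    have "emeasure (\<nu> i) A = (\<integral>\<^sup>+u. ennreal (indicator (E i) u * area_element (\<psi> i) u) * indicator ((\<lambda>u. indicator (E i) u *\<^sub>R \<psi> i u) -` A) u \<partial>lborel)"
      unfolding \<nu>_def using m1 m2 A measurable_sets[OF m1 A]
      by (subst emeasure_distr, simp, simp) (simp add: emeasure_density)
    also have "\<dots> = (\<integral>\<^sup>+u. indicator (E i \<inter> \<psi> i -` A) u * ennreal (area_element (\<psi> i) u) \<partial>lborel)"
      by (intro nn_integral_cong) (auto simp: indicator_def)
    finally show ?thesis .
  qed
  have s\<nu>: "sets (\<nu> i) = sets borel" for i by (simp add: \<nu>_def)
  define \<sigma> where "\<sigma> = measure_of UNIV (sets borel) (\<lambda>A. \<Sum>i<M. emeasure (\<nu> i) (A \<inter> P i))"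
  have sets\<sigma>: "sets \<sigma> = sets borel" unfolding \<sigma>_def using sets.sigma_sets_eq[of borel] by (simp add: sets_measure_of)
  have em: "emeasure \<sigma> A = (\<Sum>i<M. emeasure (\<nu> i) (A \<inter> P i))" if A: "A \<in> sets borel" for A
    unfolding \<sigma>_def
  proof (rule emeasure_measure_of_sigma[OF _ _ _ A])
    show "sigma_algebra UNIV (sets (borel :: (real^'n) measure))" using sets.sigma_algebra_axioms[of borel] by simp
    show "positive (sets borel) (\<lambda>A. \<Sum>i<M. emeasure (\<nu> i) (A \<inter> P i))" by (simp add: positive_def)
    show "countably_additive (sets borel) (\<lambda>A. \<Sum>i<M. emeasure (\<nu> i) (A \<inter> P i))"
    proof (rule countably_additiveI)
      fix A :: "nat \<Rightarrow> (real^'n) set" assume A: "range A \<subseteq> sets borel" "disjoint_family A" "\<Union> (range A) \<in> sets borel"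
      have "(\<Sum>k. \<Sum>i<M. emeasure (\<nu> i) (A k \<inter> P i)) = (\<Sum>i<M. \<Sum>k. emeasure (\<nu> i) (A k \<inter> P i))"
        by (rule suminf_sum) (rule summableI)
      also have "\<dots> = (\<Sum>i<M. emeasure (\<nu> i) (\<Union>k. A k \<inter> P i))"
      proof (intro sum.cong refl suminf_emeasure)
        fix i assume "i \<in> {..<M}"
        then show "range (\<lambda>k. A k \<inter> P i) \<subseteq> sets (\<nu> i)" using A(1) Pb s\<nu> by auto
        show "disjoint_family (\<lambda>k. A k \<inter> P i)" using A(2) by (auto simp: disjoint_family_on_def)
      qed
      also have "\<dots> = (\<Sum>i<M. emeasure (\<nu> i) (\<Union> (range A) \<inter> P i))"
      proof -
        have "(\<Union>k. A k \<inter> P i) = \<Union> (range A) \<inter> P i" for i by blast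
        then show ?thesis by (simp only:)
      qed
      finally show "(\<Sum>k. \<Sum>i<M. emeasure (\<nu> i) (A k \<inter> P i)) = (\<Sum>i<M. emeasure (\<nu> i) (\<Union> (range A) \<inter> P i))" .
    qed
  qed
  have "emeasure \<sigma> (- S) = 0"
  proof -
    have "S \<in> sets borel" using S by (simp add: compact_hypersurface_def borel_compact)
    then have Sb: "- S \<in> sets borel" by (rule borel_comp)
    have "emeasure (\<nu> i) (- S \<inter> P i) = 0" if i: "i < M" for i
    proof -
      have "\<psi> i ` E i \<subseteq> S" using c(1)[OF i] by (auto simp: local_patch_def)
      then have e: "E i \<inter> \<psi> i -` (- S \<inter> P i) = {}" by auto
      have "- S \<inter> P i \<in> sets borel" using Sb Pb[OF i] by blast
      from \<nu>[OF i this] show ?thesis unfolding e by simp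
    qed
    then show ?thesis using em[OF Sb] by simp
  qed
  moreover have "emeasure \<sigma> A = (\<integral>\<^sup>+u. indicator (K \<inter> \<phi> -` A) u * ennreal (area_element \<phi> u) \<partial>lborel)"
    if par: "Ck_parametrization 1 S K \<phi>" and A: "A \<in> sets borel" "A \<subseteq> \<phi> ` K" for K A and \<phi> :: "real^'m \<Rightarrow> real^'n"
  proof -
    have AS: "A \<subseteq> S" using par A(2) by (auto simp: Ck_parametrization_def)
    obtain N where N: "open N" "K \<subseteq> N" "Ck_on 1 \<phi> N" "compact K"
      using par by (auto simp: Ck_parametrization_def Ck_map_def)
    have Kb: "K \<in> sets borel" using N(4) by (simp add: borel_compact)
    have contK: "continuous_on K \<phi>" "continuous_on K (area_element \<phi>)"
      by (rule continuous_on_subset[OF Ck_on_imp_continuous[OF N(3)] N(2)],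
        rule continuous_on_subset[OF continuous_on_area_element[OF N(3)] N(2)])
    have Am: "(\<lambda>u. ennreal (indicator K u *\<^sub>R area_element \<phi> u)) \<in> borel_measurable borel"
      by (intro measurable_compose[OF _ measurable_ennreal] borel_measurable_continuous_on_indicator Kb contK)
    have AP: "A \<inter> P i \<in> sets borel" if "i < M" for i using A(1) Pb[OF that] by blast
    have pre: "K \<inter> \<phi> -` (A \<inter> P i) \<in> sets borel" if "i < M" for i
      by (rule borel_preimage_restricted[OF Kb contK(1) AP[OF that]])
    have "emeasure \<sigma> A = (\<Sum>i<M. \<integral>\<^sup>+u. indicator (E i \<inter> \<psi> i -` (A \<inter> P i)) u * ennreal (area_element (\<psi> i) u) \<partial>lborel)"
      unfolding em[OF A(1)] using \<nu> AP by (intro sum.cong) auto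
    also have "\<dots> = (\<Sum>i<M. \<integral>\<^sup>+u. indicator (K \<inter> \<phi> -` (A \<inter> P i)) u * ennreal (area_element \<phi> u) \<partial>lborel)"
      by (intro sum.cong refl patch_consistent[symmetric, OF c(1) par AP]) (use A in \<open>auto simp: P_def\<close>)
    also have "\<dots> = (\<Sum>i<M. \<integral>\<^sup>+u. indicator (K \<inter> \<phi> -` (A \<inter> P i)) u * ennreal (indicator K u *\<^sub>R area_element \<phi> u) \<partial>lborel)"
      by (intro sum.cong refl nn_integral_cong) (auto simp: indicator_def)
    also have "\<dots> = (\<integral>\<^sup>+u. (\<Sum>i<M. indicator (K \<inter> \<phi> -` (A \<inter> P i)) u * ennreal (indicator K u *\<^sub>R area_element \<phi> u)) \<partial>lborel)"
      using Am pre by (intro nn_integral_sum[symmetric]) auto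
    also have "\<dots> = (\<integral>\<^sup>+u. indicator (K \<inter> \<phi> -` A) u * ennreal (area_element \<phi> u) \<partial>lborel)"
    proof (rule nn_integral_cong)
      fix u
      show "(\<Sum>i<M. indicator (K \<inter> \<phi> -` (A \<inter> P i)) u * ennreal (indicator K u *\<^sub>R area_element \<phi> u)) =
        indicator (K \<inter> \<phi> -` A) u * ennreal (area_element \<phi> u)"
      proof (cases "u \<in> K \<and> \<phi> u \<in> A")
        case True
        define i0 where "i0 = (LEAST i. \<phi> u \<in> U i)"
        obtain i where i: "i < M" "\<phi> u \<in> U i" using True AS c(2) by blast
        have i0: "\<phi> u \<in> U i0" "i0 \<le> i" "\<And>j. j < i0 \<Longrightarrow> \<phi> u \<notin> U j"
          unfolding i0_def using i(2) not_less_Least by (auto intro: LeastI Least_le)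
        have "\<phi> u \<in> P j \<longleftrightarrow> j = i0" for j
        proof
          show "j = i0" if "\<phi> u \<in> P j"
            using that i0(1) i0(3)[of j] by (cases j i0 rule: linorder_cases) (auto simp: P_def)
          show "\<phi> u \<in> P j" if "j = i0" using that i0(1,3) by (auto simp: P_def)
        qed
        then have "(\<Sum>j<M. indicator (K \<inter> \<phi> -` (A \<inter> P j)) u * ennreal (indicator K u *\<^sub>R area_element \<phi> u)) =
          (\<Sum>j<M. if j = i0 then ennreal (area_element \<phi> u) else 0)"
          using True by (intro sum.cong) (auto simp: indicator_def)
        then show ?thesis using True i i0(2) by (simp add: sum.delta')
      qed (auto simp: indicator_def)
    qed
    finally show ?thesis .
  qed
  ultimately have "is_surface_measure TYPE('m) S \<sigma>"
    unfolding is_surface_measure_def using sets\<sigma> by blast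
  then show ?thesis by blast
qed

text \<open>Existence and uniqueness justify the definite description in the definition of \<open>surface_measure\<close>.\<close>

theorem surface_measure:
  fixes S :: "(real^'n::finite) set"
  assumes S: "compact_hypersurface TYPE('m::finite) k S" "1 \<le> k"
  shows "is_surface_measure TYPE('m) S (surface_measure TYPE('m) S)"
proof -
  have "\<exists>!\<sigma>. is_surface_measure TYPE('m) S \<sigma>"
    using is_surface_measure_exists[OF S] is_surface_measure_unique[OF S] by blast
  moreover have "surface_measure TYPE('m) S = (THE \<sigma>. is_surface_measure TYPE('m) S \<sigma>)"
    by (simp add: surface_measure_def is_surface_measure_def)
  ultimately show ?thesis by (metis theI')
qed

section \<open>Bohr sets with few points near every line\<close>

subsection \<open>A large sieve estimate\<close>

text \<open>
  The frequencies are integer vectors and the nodes are rational points with a large prime denominator \<open>P\<close>,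
  so that everything happens in the finite group $(\mathbb{Z}/P)^n$. The residue box is its standard set of
  representatives and \<open>echar P\<close> is the standard additive character.\<close>

definition idot :: "('n::finite \<Rightarrow> int) \<Rightarrow> ('n \<Rightarrow> int) \<Rightarrow> int" where
  "idot z x = (\<Sum>l\<in>UNIV. z l * x l)"

definition residue_box :: "nat \<Rightarrow> ('n::finite \<Rightarrow> int) set" where
  "residue_box P = (UNIV \<rightarrow>\<^sub>E {0..<int P})"

definition echar :: "nat \<Rightarrow> int \<Rightarrow> complex" where
  "echar P s = cis (2 * pi * (real_of_int s / real P))"

lemma residue_box_iff: "x \<in> residue_box P \<longleftrightarrow> (\<forall>l. 0 \<le> x l \<and> x l < int P)"
  by (auto simp: residue_box_def PiE_iff)

lemma finite_residue_box [simp]: "finite (residue_box P)"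
  unfolding residue_box_def by (intro finite_PiE) auto

lemma card_residue_box: "card (residue_box P :: ('n::finite \<Rightarrow> int) set) = P ^ CARD('n)"
  unfolding residue_box_def by (subst card_PiE) auto

lemma echar_add: "echar P (s + t) = echar P s * echar P t"
  by (simp add: echar_def cis_mult add_divide_distrib distrib_left)

lemma echar_0 [simp]: "echar P 0 = 1" by (simp add: echar_def)

lemma echar_sum: "echar P (\<Sum>i\<in>A. s i) = (\<Prod>i\<in>A. echar P (s i))"
  by (induction A rule: infinite_finite_induct) (simp_all add: echar_add)

lemma cnj_echar: "cnj (echar P s) = echar P (- s)"
  by (simp add: echar_def cis_cnj)

lemma norm_echar [simp]: "cmod (echar P s) = 1" by (simp add: echar_def)

lemma echar_power: "echar P s ^ k = echar P (s * int k)"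
  by (induction k) (simp_all add: echar_add algebra_simps)

lemma echar_multiple: "P > 0 \<Longrightarrow> echar P (int P * m) = 1"
  by (simp add: echar_def cis_multiple_2pi)

lemma echar_eq_1_iff:
  assumes "P > 0"
  shows "echar P s = 1 \<longleftrightarrow> int P dvd s"
proof
  assume "echar P s = 1"
  then have "cos (2 * pi * (real_of_int s / real P)) = 1" by (simp add: echar_def complex_eq_iff)
  then obtain k :: int where "2 * pi * (real_of_int s / real P) = of_int k * 2 * pi"
    using cos_one_2pi_int by auto
  then have "(2 * pi) * (real_of_int s / real P) = (2 * pi) * of_int k" by (simp only: mult_ac)
  then have "real_of_int s / real P = of_int k" by (simp only: mult_cancel_left) simp
  then have "real_of_int s = of_int (k * int P)" using assms by (simp add: field_simps)
  then have "s = k * int P" by linarith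
  then show "int P dvd s" by simp
qed (use assms echar_multiple in auto)

lemma norm_cis_minus_1: "cmod (cis t - 1) \<le> \<bar>t\<bar>"
proof -
  have "cmod (cis t - 1) = 2 * \<bar>sin (t / 2)\<bar>"
    using dist_exp_i_1[of t] by (simp add: cis_conv_exp)
  also have "\<dots> \<le> 2 * \<bar>t / 2\<bar>" using abs_sin_x_le_abs_x[of "t / 2"] by (intro mult_left_mono) auto
  finally show ?thesis by simp
qed

lemma norm_echar_minus_1:
  assumes "P > 0" "\<bar>real_of_int s - real_of_int m * real P\<bar> \<le> \<theta> * real P"
  shows "cmod (echar P s - 1) \<le> 2 * pi * \<theta>"
proof -
  have "echar P s = echar P (s - m * int P)"
    using echar_add[of P "s - m * int P" "int P * m"] echar_multiple[OF assms(1), of m] by (simp add: mult.commute)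
  then have "cmod (echar P s - 1) \<le> \<bar>2 * pi * (real_of_int (s - m * int P) / real P)\<bar>"
    unfolding echar_def by (simp only: norm_cis_minus_1)
  also have "\<dots> = 2 * pi * (\<bar>real_of_int s - real_of_int m * real P\<bar> / real P)"
    by (simp add: abs_mult)
  also have "\<dots> \<le> 2 * pi * \<theta>"
    using assms by (intro mult_left_mono) (auto simp: field_simps)
  finally show ?thesis .
qed

lemma sum_echar_zero:
  assumes "P > 0" "\<not> int P dvd a"
  shows "(\<Sum>t\<in>{0..<int P}. echar P (a * t)) = 0"
proof -
  have "(\<Sum>t\<in>{0..<int P}. echar P (a * t)) = (\<Sum>k<P. echar P a ^ k)"
    by (rule sum.reindex_bij_witness[of _ int nat]) (auto simp: echar_power)
  also have "\<dots> = (echar P a ^ P - 1) / (echar P a - 1)"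
    using assms echar_eq_1_iff[OF assms(1), of a] by (intro geometric_sum) auto
  also have "echar P a ^ P = 1" using assms(1) echar_multiple[of P a] by (simp add: echar_power mult.commute)
  finally show ?thesis by simp
qed

lemma sum_residue_box_echar:
  assumes "P > 0" "\<not> int P dvd s l"
  shows "(\<Sum>x\<in>residue_box P. echar P (idot s x)) = 0"
proof -
  have "(\<Sum>x\<in>residue_box P. echar P (idot s x)) = (\<Sum>x\<in>UNIV \<rightarrow>\<^sub>E {0..<int P}. \<Prod>l\<in>UNIV. echar P (s l * x l))"
    by (simp add: residue_box_def idot_def echar_sum)
  also have "\<dots> = (\<Prod>l\<in>UNIV. \<Sum>t\<in>{0..<int P}. echar P (s l * t))"
    by (rule prod_sum_PiE[symmetric]) auto
  also have "\<dots> = 0"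
    using sum_echar_zero[OF assms] by (intro prod_zero) auto
  finally show ?thesis .
qed

text \<open>A dual large sieve. If all products of \<open>x\<close> with the vectors \<open>\<tau> j\<close> are close to multiples of \<open>P\<close>,
  then the exponential sum \<open>S x\<close> over the box of coefficients \<open>c\<close> with \<open>0 \<le> c j < A j\<close> has no cancellation and
  is at least half the number \<open>K\<close> of its terms. Independence makes the characters in this sum distinct, so that the
  mean square of \<open>S\<close> over the group is only \<open>K\<close>. Chebyshev's inequality gives the bound. Heuristically the
  conditions for different \<open>j\<close> behave as independent events of probability about \<open>1 / A j\<close>.\<close>

lemma large_sieve:
  fixes \<tau> :: "'j \<Rightarrow> 'n::finite \<Rightarrow> int" and A :: "'j \<Rightarrow> nat"
  assumes J: "finite J" and P: "P > 0" 
    and indep: "\<And>c. (\<And>j. j \<in> J \<Longrightarrow> \<bar>c j\<bar> < int (A j)) \<Longrightarrow>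
      (\<And>l. int P dvd (\<Sum>j\<in>J. c j * \<tau> j l)) \<Longrightarrow> \<forall>j\<in>J. c j = 0"
    and E: "E \<subseteq> residue_box P"
      "\<And>x j. x \<in> E \<Longrightarrow> j \<in> J \<Longrightarrow> \<exists>m. \<bar>real_of_int (idot (\<tau> j) x) - real_of_int m * real P\<bar> \<le> \<theta> j * real P"
    and small: "(\<Sum>j\<in>J. real (A j) * \<theta> j) \<le> 1 / 13"
  shows "real (card E) * (\<Prod>j\<in>J. real (A j)) \<le> 4 * real P ^ CARD('n)"
proof -
  define C where "C = (\<Pi>\<^sub>E j\<in>J. {0..<int (A j)})"
  define K where "K = (\<Prod>j\<in>J. real (A j))"
  have finC: "finite C" unfolding C_def using J by (intro finite_PiE) auto
  have K: "real (card C) = K" unfolding C_def K_def using J by (subst card_PiE) auto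
  have K0: "K \<ge> 0" unfolding K_def by (intro prod_nonneg) auto
  define f where "f c x = (\<Sum>j\<in>J. c j * idot (\<tau> j) x)" for c and x :: "'n \<Rightarrow> int"
  define S where "S x = (\<Sum>c\<in>C. echar P (f c x))" for x
  have fdiff: "f c x - f c' x = idot (\<lambda>l. \<Sum>j\<in>J. (c j - c' j) * \<tau> j l) x" for c c' x
    unfolding f_def idot_def
    by (simp add: sum_subtractf[symmetric] sum_distrib_left sum_distrib_right algebra_simps sum.swap[of _ J])
  have orth: "(\<Sum>x\<in>residue_box P. echar P (f c x) * cnj (echar P (f c' x))) = (if c = c' then of_nat (P ^ CARD('n)) else 0)"
    if c: "c \<in> C" "c' \<in> C" for c c'
  proof (cases "c = c'")
    case True
    then have "(\<Sum>x\<in>residue_box P. echar P (f c x) * cnj (echar P (f c' x))) = (\<Sum>x\<in>(residue_box P::('n\<Rightarrow>int) set). 1)"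
      by (intro sum.cong refl) (simp add: cnj_echar echar_add[symmetric])
    then show ?thesis using True by (simp add: card_residue_box)
  next
    case False
    then obtain j where j: "j \<in> J" "c j \<noteq> c' j"
      using c unfolding C_def by (meson PiE_ext)
    have "\<exists>l. \<not> int P dvd (\<Sum>j\<in>J. (c j - c' j) * \<tau> j l)"
    proof (rule ccontr)
      assume "\<not> ?thesis"
      moreover have "\<bar>c j - c' j\<bar> < int (A j)" if "j \<in> J" for j
      proof -
        have "c j \<in> {0..<int (A j)}" "c' j \<in> {0..<int (A j)}" using c that by (auto simp: C_def PiE_iff)
        then show ?thesis by auto
      qed
      ultimately have "\<forall>j\<in>J. c j - c' j = 0" by (intro indep) auto
      then show False using j by auto
    qed
    then obtain l where "\<not> int P dvd (\<Sum>j\<in>J. (c j - c' j) * \<tau> j l)" by blast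
    then have "(\<Sum>x\<in>residue_box P. echar P (idot (\<lambda>l. \<Sum>j\<in>J. (c j - c' j) * \<tau> j l) x)) = 0"
      using sum_residue_box_echar[OF P, of "\<lambda>l. \<Sum>j\<in>J. (c j - c' j) * \<tau> j l"] by simp
    then show ?thesis using False by (simp add: cnj_echar echar_add[symmetric] fdiff)
  qed
  have "complex_of_real (\<Sum>x\<in>residue_box P. (cmod (S x))\<^sup>2) = (\<Sum>x\<in>residue_box P. S x * cnj (S x))"
    unfolding of_real_sum by (intro sum.cong refl complex_norm_square)
  also have "\<dots> = (\<Sum>x\<in>residue_box P. \<Sum>c\<in>C. \<Sum>c'\<in>C. echar P (f c x) * cnj (echar P (f c' x)))"
    by (simp add: S_def sum_product)
  also have "\<dots> = (\<Sum>c\<in>C. \<Sum>c'\<in>C. \<Sum>x\<in>residue_box P. echar P (f c x) * cnj (echar P (f c' x)))"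
    by (subst sum.swap, rule sum.cong[OF refl], subst sum.swap, rule refl)
  also have "\<dots> = (\<Sum>c\<in>C. of_nat (P ^ CARD('n)))"
    using finC by (intro sum.cong refl) (simp add: orth sum.delta)
  also have "\<dots> = complex_of_real (K * real P ^ CARD('n))"
    by (simp add: K[symmetric])
  finally have total: "(\<Sum>x\<in>residue_box P. (cmod (S x))\<^sup>2) = K * real P ^ CARD('n)"
    using of_real_eq_iff by blast
  have large: "K / 2 \<le> cmod (S x)" if x: "x \<in> E" for x
  proof -
    have close: "cmod (echar P (f c x) - 1) \<le> 1 / 2" if c: "c \<in> C" for c
    proof -
      obtain m where m: "\<And>j. j \<in> J \<Longrightarrow> \<bar>real_of_int (idot (\<tau> j) x) - real_of_int (m j) * real P\<bar> \<le> \<theta> j * real P"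
        using E(2)[OF x] by metis
      have "\<bar>real_of_int (f c x) - real_of_int (\<Sum>j\<in>J. c j * m j) * real P\<bar> =
        \<bar>\<Sum>j\<in>J. of_int (c j) * (real_of_int (idot (\<tau> j) x) - real_of_int (m j) * real P)\<bar>"
        by (simp add: f_def sum_subtractf sum_distrib_right right_diff_distrib mult.assoc)
      also have "\<dots> \<le> (\<Sum>j\<in>J. real (A j) * (\<theta> j * real P))"
      proof (rule order_trans[OF sum_abs], rule sum_mono)
        fix j assume j: "j \<in> J"
        then have "0 \<le> c j" "c j < int (A j)" using c by (auto simp: C_def PiE_iff)
        then have "\<bar>real_of_int (c j)\<bar> \<le> real (A j)" by linarith
        then show "\<bar>real_of_int (c j) * (real_of_int (idot (\<tau> j) x) - real_of_int (m j) * real P)\<bar> \<le> real (A j) * (\<theta> j * real P)"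
          using m[OF j] unfolding abs_mult by (intro mult_mono) auto
      qed
      also have "\<dots> = (\<Sum>j\<in>J. real (A j) * \<theta> j) * real P" by (simp add: sum_distrib_right mult.assoc)
      also have "\<dots> \<le> 1 / 13 * real P" using small by (intro mult_right_mono) auto
      finally have "cmod (echar P (f c x) - 1) \<le> 2 * pi * (1 / 13)" by (rule norm_echar_minus_1[OF P])
      also have "\<dots> \<le> 1 / 2" using pi_less_4 pi_approx(2) by simp
      finally show ?thesis .
    qed
    have "cmod (S x - of_real K) = cmod (\<Sum>c\<in>C. (echar P (f c x) - 1))"
      by (simp add: S_def sum_subtractf K[symmetric])
    also have "\<dots> \<le> (\<Sum>c\<in>C. 1 / 2)" using close by (intro sum_norm_le) auto
    also have "\<dots> = K / 2" by (simp add: K[symmetric])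
    finally have "cmod (S x - of_real K) \<le> K / 2" .
    moreover have "cmod (of_real K) \<le> cmod (S x) + cmod (S x - of_real K)"
      by (metis norm_minus_commute norm_triangle_sub)
    ultimately show ?thesis using K0 by simp
  qed
  have "real (card E) * (K / 2)\<^sup>2 = (\<Sum>x\<in>E. (K / 2)\<^sup>2)" by simp
  also have "\<dots> \<le> (\<Sum>x\<in>E. (cmod (S x))\<^sup>2)"
    using large K0 by (intro sum_mono power_mono) auto
  also have "\<dots> \<le> (\<Sum>x\<in>residue_box P. (cmod (S x))\<^sup>2)"
    using E(1) by (intro sum_mono2) auto
  finally have *: "real (card E) * (K / 2)\<^sup>2 \<le> K * real P ^ CARD('n)" using total by simp
  show ?thesis
  proof (cases "K = 0")
    case True
    then show ?thesis by (simp add: K_def[symmetric])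
  next
    case False
    then have "K > 0" using K0 by simp
    have "K * (real (card E) * K) \<le> K * (4 * real P ^ CARD('n))"
      using * by (simp add: power2_eq_square field_simps)
    then show ?thesis using \<open>K > 0\<close> by (simp add: K_def[symmetric])
  qed
qed

subsection \<open>Counting lattice points by independent vectors at many scales\<close>

text \<open>
  Independence modulo 3 serves two purposes at once: it implies linear independence over the integers, and
  the expansion of a vector modulo 3 in a maximal independent set has only \<open>3 ^ card B\<close> possible values.\<close>

definition indep3 :: "('i \<Rightarrow> int) set \<Rightarrow> bool" where
  "indep3 B \<longleftrightarrow> finite B \<and> (\<forall>c. (\<forall>i. 3 dvd (\<Sum>b\<in>B. c b * b i)) \<longrightarrow> (\<forall>b\<in>B. 3 dvd c b))"

text \<open>Infinite descent: in a relation all coefficients are divisible by 3, and dividing by 3 gives another relation.\<close>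

lemma indep3_linear_independent:
  assumes "indep3 B" "\<And>i. (\<Sum>b\<in>B. c b * b i) = 0"
  shows "\<forall>b\<in>B. c b = 0"
  using assms(2)
proof (induction "nat (\<Sum>b\<in>B. \<bar>c b\<bar>)" arbitrary: c rule: less_induct)
  case less
  have fin: "finite B" using assms(1) by (simp add: indep3_def)
  have div: "3 dvd c b" if "b \<in> B" for b
    using assms(1) less.prems that by (auto simp: indep3_def)
  define c' where "c' b = c b div 3" for b
  have c': "c b = 3 * c' b" if "b \<in> B" for b using div[OF that] by (simp add: c'_def)
  have rel: "(\<Sum>b\<in>B. c' b * b i) = 0" for i
  proof -
    have "3 * (\<Sum>b\<in>B. c' b * b i) = (\<Sum>b\<in>B. c b * b i)"
      unfolding sum_distrib_left using c' by (intro sum.cong) auto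
    then show ?thesis using less.prems by simp
  qed
  show ?case
  proof (rule ccontr)
    assume "\<not> ?case"
    then have pos: "0 < (\<Sum>b\<in>B. \<bar>c b\<bar>)" using fin by (meson abs_ge_zero sum_pos2 zero_less_abs_iff)
    have "(\<Sum>b\<in>B. \<bar>c b\<bar>) = 3 * (\<Sum>b\<in>B. \<bar>c' b\<bar>)"
      unfolding sum_distrib_left using c' by (intro sum.cong) (auto simp: abs_mult)
    then have "nat (\<Sum>b\<in>B. \<bar>c' b\<bar>) < nat (\<Sum>b\<in>B. \<bar>c b\<bar>)" using pos by linarith
    from less.hyps[OF this rel] have "\<forall>b\<in>B. c' b = 0" .
    then show False using c' \<open>\<not> ?case\<close> by auto
  qed
qed

lemma dvd3_diff_imp_eq: "x \<in> {0..<3::int} \<Longrightarrow> y \<in> {0..<3} \<Longrightarrow> 3 dvd x - y \<Longrightarrow> x = y"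
  by auto presburger

lemma indep3_card_le:
  assumes "indep3 B" "finite I" "\<And>b i. b \<in> B \<Longrightarrow> i \<notin> I \<Longrightarrow> b i = 0"
  shows "card B \<le> card I"
proof -
  have fin: "finite B" using assms(1) by (simp add: indep3_def)
  define g where "g c = (\<lambda>i\<in>I. (\<Sum>b\<in>B. c b * b i) mod 3)" for c :: "('a \<Rightarrow> int) \<Rightarrow> int"
  have "inj_on g (B \<rightarrow>\<^sub>E {0..<3})"
  proof (rule inj_onI)
    fix c c' assume c: "c \<in> B \<rightarrow>\<^sub>E {0..<3}" "c' \<in> B \<rightarrow>\<^sub>E {0..<3}" and eq: "g c = g c'"
    have "3 dvd (\<Sum>b\<in>B. (c b - c' b) * b i)" for i
    proof (cases "i \<in> I")
      case True
      then have "(\<Sum>b\<in>B. c b * b i) mod 3 = (\<Sum>b\<in>B. c' b * b i) mod 3"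
        using fun_cong[OF eq, of i] by (simp add: g_def)
      then have "3 dvd (\<Sum>b\<in>B. c b * b i) - (\<Sum>b\<in>B. c' b * b i)" by (simp add: mod_eq_dvd_iff)
      then show ?thesis by (simp add: left_diff_distrib sum_subtractf)
    next
      case False
      then have "(\<Sum>b\<in>B. (c b - c' b) * b i) = 0" using assms(3) by (intro sum.neutral) auto
      then show ?thesis by simp
    qed
    then have "3 dvd c b - c' b" if "b \<in> B" for b
      using assms(1) that by (auto simp: indep3_def dest: spec[of _ "\<lambda>b. c b - c' b"])
    then show "c = c'"
      using c dvd3_diff_imp_eq by (intro PiE_ext[OF c]) (auto simp: PiE_iff)
  qed
  moreover have "g ` (B \<rightarrow>\<^sub>E {0..<3}) \<subseteq> I \<rightarrow>\<^sub>E {0..<3}" by (auto simp: g_def)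
  moreover have "finite (I \<rightarrow>\<^sub>E {0..<3::int})" using assms(2) by (intro finite_PiE) auto
  ultimately have "card (B \<rightarrow>\<^sub>E {0..<3::int}) \<le> card (I \<rightarrow>\<^sub>E {0..<3::int})" by (rule card_inj_on_le)
  then have "(3::nat) ^ card B \<le> 3 ^ card I" using fin assms(2) by (simp add: card_PiE)
  then show ?thesis by (simp add: power_increasing_iff)
qed

lemma indep3_maximal_spans:
  assumes B: "indep3 B" and x: "x \<notin> B" "\<not> indep3 (insert x B)"
  shows "\<exists>c. \<forall>i. 3 dvd x i - (\<Sum>b\<in>B. c b * b i)"
proof -
  have fin: "finite B" using B by (simp add: indep3_def)
  obtain c where c: "\<And>i. 3 dvd (\<Sum>b\<in>insert x B. c b * b i)" "\<exists>b\<in>insert x B. \<not> 3 dvd c b"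
    using x(2) fin by (auto simp: indep3_def)
  have eq: "(\<Sum>b\<in>insert x B. c b * b i) = c x * x i + (\<Sum>b\<in>B. c b * b i)" for i
    using fin x(1) by simp
  have cx: "\<not> 3 dvd c x"
  proof
    assume d: "3 dvd c x"
    then have "3 dvd (\<Sum>b\<in>B. c b * b i)" for i
      using c(1)[of i] unfolding eq by (metis dvd_add_right_iff dvd_mult2)
    then have "\<forall>b\<in>B. 3 dvd c b" using B by (auto simp: indep3_def)
    then show False using c(2) d by auto
  qed
  have "3 dvd 1 - c x * c x"
  proof -
    have "c x mod 3 = 1 \<or> c x mod 3 = 2" using cx by presburger
    then have "(c x * c x) mod 3 = 1" by (auto simp: mod_mult_left_eq[symmetric, of "c x"] mod_mult_right_eq[symmetric, of _ "c x"])
    then show ?thesis by presburger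
  qed
  then have "3 dvd (1 - c x * c x) * x i + c x * (\<Sum>b\<in>insert x B. c b * b i)" for i
    using c(1)[of i] by (intro dvd_add dvd_mult2 dvd_mult) auto
  moreover have "(1 - c x * c x) * x i + c x * (\<Sum>b\<in>insert x B. c b * b i) = x i - (\<Sum>b\<in>B. (- c x * c b) * b i)" for i
    unfolding eq by (simp add: algebra_simps sum_distrib_left sum_negf)
  ultimately show ?thesis by (intro exI[of _ "\<lambda>b. - c x * c b"]) simp
qed

text \<open>A substitute for Minkowski's theorem on successive minima that needs no convexity. The sets \<open>D i\<close> are a nested
  family of sets that shrink by the factor \<open>2 / 3\<close> in each step; the last hypothesis holds for symmetric convex
  bodies, as \<open>x - y\<close> is then twice as large and a third of it is \<open>2 / 3\<close> as large. If \<open>D 0\<close> has many points, then it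
  contains independent vectors some of which lie deep inside, in the sense that the depths \<open>k b\<close> have a large sum.
  In the induction step an independent set from \<open>D (Suc 0)\<close> is extended to a maximal one in \<open>D 0\<close>. Points of
  \<open>D 0\<close> with the same coefficients modulo 3 differ by three times a point of \<open>D (Suc 0)\<close>.\<close>

lemma multiscale_independent:
  fixes D :: "nat \<Rightarrow> ('i \<Rightarrow> int) set"
  assumes "\<And>i. finite (D i)" "\<And>i. D (Suc i) \<subseteq> D i" "D I \<subseteq> {\<lambda>_. 0}"
    and "\<And>i x y. x \<in> D i \<Longrightarrow> y \<in> D i \<Longrightarrow> (\<And>l. 3 dvd x l - y l) \<Longrightarrow> (\<lambda>l. (x l - y l) div 3) \<in> D (Suc i)"
  shows "\<exists>B k. indep3 B \<and> (\<forall>b\<in>B. b \<in> D (k b) \<and> k b < I) \<and> B \<subseteq> D 0 \<and> card (D 0) \<le> 3 ^ (\<Sum>b\<in>B. k b + 1)"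
  using assms
proof (induction I arbitrary: D)
  case 0
  have "card (D 0) \<le> card {\<lambda>_::'i. 0::int}" using 0 by (intro card_mono) auto
  then show ?case by (intro exI[of _ "{}"]) (auto simp: indep3_def)
next
  case (Suc I)
  have "\<exists>B k. indep3 B \<and> (\<forall>b\<in>B. b \<in> D (Suc (k b)) \<and> k b < I) \<and> B \<subseteq> D (Suc 0) \<and> card (D (Suc 0)) \<le> 3 ^ (\<Sum>b\<in>B. k b + 1)"
    by (rule Suc.IH[of "\<lambda>i. D (Suc i)"]) (use Suc.prems in auto)
  then obtain B1 k1 where B1: "indep3 B1" "\<And>b. b \<in> B1 \<Longrightarrow> b \<in> D (Suc (k1 b)) \<and> k1 b < I" "B1 \<subseteq> D (Suc 0)"
    "card (D (Suc 0)) \<le> 3 ^ (\<Sum>b\<in>B1. k1 b + 1)" by blast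
  define \<B> where "\<B> = {B. B1 \<subseteq> B \<and> B \<subseteq> D 0 \<and> indep3 B}"
  have "finite \<B>" by (rule finite_subset[of _ "Pow (D 0)"]) (use Suc.prems(1) in \<open>auto simp: \<B>_def\<close>)
  moreover have "B1 \<in> \<B>" using B1 Suc.prems(2) by (auto simp: \<B>_def)
  ultimately obtain B where B: "B \<in> \<B>" "\<And>B'. B' \<in> \<B> \<Longrightarrow> card B' \<le> card B"
  proof -
    have "Max (card ` \<B>) \<in> card ` \<B>" using \<open>finite \<B>\<close> \<open>B1 \<in> \<B>\<close> by (intro Max_in) auto
    then obtain B where "B \<in> \<B>" "card B = Max (card ` \<B>)" by auto
    then show thesis using that[of B] \<open>finite \<B>\<close> by (metis Max_ge finite_imageI imageI)
  qed
  have Bi: "indep3 B" "B1 \<subseteq> B" "B \<subseteq> D 0" "finite B" using B(1) by (auto simp: \<B>_def indep3_def)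
  have span: "\<exists>c. \<forall>i. 3 dvd x i - (\<Sum>b\<in>B. c b * b i)" if x: "x \<in> D 0" for x
  proof (cases "x \<in> B")
    case True
    have "x i - (\<Sum>b\<in>B. (if b = x then 1 else 0) * b i) = 0" for i
      using Bi(4) True by (simp add: if_distrib[of "\<lambda>r. r * _"] sum.delta cong: if_cong)
    then show ?thesis by (intro exI[of _ "\<lambda>b. if b = x then 1 else 0"]) simp
  next
    case False
    have "\<not> indep3 (insert x B)"
    proof
      assume "indep3 (insert x B)"
      then have "insert x B \<in> \<B>" using B(1) x by (auto simp: \<B>_def)
      from B(2)[OF this] show False using False Bi(4) by simp
    qed
    then show ?thesis using indep3_maximal_spans[OF Bi(1) False] by blast
  qed
  then obtain c where c: "\<And>x i. x \<in> D 0 \<Longrightarrow> 3 dvd x i - (\<Sum>b\<in>B. c x b * b i)" by metis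
  define \<gamma> where "\<gamma> x = (\<lambda>b\<in>B. c x b mod 3)" for x
  have cong: "3 dvd x i - y i" if "x \<in> D 0" "y \<in> D 0" "\<gamma> x = \<gamma> y" for x y i
  proof -
    have "3 dvd c x b - c y b" if "b \<in> B" for b
      using fun_cong[OF \<open>\<gamma> x = \<gamma> y\<close>, of b] that by (simp add: \<gamma>_def mod_eq_dvd_iff)
    then have "3 dvd (\<Sum>b\<in>B. (c x b - c y b) * b i)" by (intro dvd_sum) auto
    then have "3 dvd (\<Sum>b\<in>B. c x b * b i) - (\<Sum>b\<in>B. c y b * b i)"
      by (simp add: left_diff_distrib sum_subtractf)
    then show ?thesis using c[OF that(1), of i] c[OF that(2), of i] by presburger
  qed
  have fibre: "card {x \<in> D 0. \<gamma> x = g} \<le> card (D (Suc 0))" for g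
  proof (cases "{x \<in> D 0. \<gamma> x = g} = {}")
    case False
    then obtain y where y: "y \<in> D 0" "\<gamma> y = g" by blast
    have "inj_on (\<lambda>x l. (x l - y l) div 3) {x \<in> D 0. \<gamma> x = g}"
    proof (rule inj_onI)
      fix x x' assume xx: "x \<in> {x \<in> D 0. \<gamma> x = g}" "x' \<in> {x \<in> D 0. \<gamma> x = g}"
        and eq: "(\<lambda>l. (x l - y l) div 3) = (\<lambda>l. (x' l - y l) div 3)"
      show "x = x'"
      proof
        fix l
        show "x l = x' l" using cong[of x y l] cong[of x' y l] xx y fun_cong[OF eq, of l] by auto
      qed
    qed
    moreover have "(\<lambda>x l. (x l - y l) div 3) ` {x \<in> D 0. \<gamma> x = g} \<subseteq> D (Suc 0)"
      using Suc.prems(4)[of _ 0 y] cong y by auto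
    ultimately show ?thesis using card_inj_on_le Suc.prems(1) by blast
  next
    case True
    then show ?thesis by (metis card.empty zero_le)
  qed
  have "D 0 = (\<Union>g\<in>B \<rightarrow>\<^sub>E {0..<3}. {x \<in> D 0. \<gamma> x = g})" by (auto simp: \<gamma>_def)
  then have "card (D 0) \<le> (\<Sum>g\<in>B \<rightarrow>\<^sub>E {0..<3}. card {x \<in> D 0. \<gamma> x = g})"
    using card_UN_le[of "B \<rightarrow>\<^sub>E {0..<3::int}" "\<lambda>g. {x \<in> D 0. \<gamma> x = g}"] Bi(4) finite_PiE[of B "\<lambda>_. {0..<3::int}"] by simp
  also have "\<dots> \<le> (\<Sum>g\<in>B \<rightarrow>\<^sub>E {0..<3::int}. card (D (Suc 0)))" by (intro sum_mono fibre)
  also have "\<dots> = 3 ^ card B * card (D (Suc 0))" using Bi(4) by (simp add: card_PiE)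
  also have "\<dots> \<le> 3 ^ card B * 3 ^ (\<Sum>b\<in>B1. k1 b + 1)" using B1(4) by (intro mult_left_mono) auto
  also have "\<dots> = 3 ^ (\<Sum>b\<in>B. (if b \<in> B1 then Suc (k1 b) else 0) + 1)"
  proof -
    have "(\<Sum>b\<in>B. if b \<in> B1 then Suc (k1 b) else 0) = (\<Sum>b\<in>B1. Suc (k1 b))"
      using Bi by (simp add: sum.If_cases Int_absorb1)
    moreover have "(\<Sum>b\<in>B. (if b \<in> B1 then Suc (k1 b) else 0) + 1) =
        (\<Sum>b\<in>B. if b \<in> B1 then Suc (k1 b) else 0) + card B" by (subst sum.distrib) simp
    ultimately show ?thesis by (simp add: power_add[symmetric] ac_simps)
  qed
  finally have "card (D 0) \<le> 3 ^ (\<Sum>b\<in>B. (if b \<in> B1 then Suc (k1 b) else 0) + 1)" .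
  then show ?case
    using Bi B1(2) by (intro exI[of _ B] exI[of _ "\<lambda>b. if b \<in> B1 then Suc (k1 b) else 0"]) auto
qed

subsection \<open>Points of a Bohr set near a line\<close>

definition near_multiple :: "nat \<Rightarrow> real \<Rightarrow> int \<Rightarrow> bool" where
  "near_multiple P \<theta> s \<longleftrightarrow> (\<exists>m. \<bar>real_of_int s - real_of_int m * real P\<bar> \<le> \<theta> * real P)"

text \<open>
  These are the points of the Bohr set of the generators \<open>p\<close> that lie near the line through the origin with
  direction \<open>u\<close>; the coordinate \<open>a\<close> in which the direction is largest serves as parameter on the line. The next definition
  records in addition the nearest multiples of \<open>P\<close> as \<open>d\<close> further integer coordinates. In these
  coordinates all conditions are linear inequalities, so that dilation by \<open>s\<close> makes sense.\<close>

definition tube_points ::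
  "nat \<Rightarrow> real \<Rightarrow> nat \<Rightarrow> (nat \<Rightarrow> 'n::finite \<Rightarrow> int) \<Rightarrow> real \<Rightarrow> 'n \<Rightarrow> ('n \<Rightarrow> real) \<Rightarrow> ('n \<Rightarrow> int) set" where
  "tube_points P \<eta> d p R a u = {z. \<bar>real_of_int (z a)\<bar> \<le> R \<and>
     (\<forall>l. \<bar>real_of_int (z l) - real_of_int (z a) * u l\<bar> \<le> 1 / 4) \<and>
     (\<forall>i<d. near_multiple P \<eta> (idot z (p i)))}"

definition tube_lifts ::
  "nat \<Rightarrow> real \<Rightarrow> nat \<Rightarrow> (nat \<Rightarrow> 'n::finite \<Rightarrow> int) \<Rightarrow> real \<Rightarrow> 'n \<Rightarrow> ('n \<Rightarrow> real) \<Rightarrow> real \<Rightarrow> ('n + nat \<Rightarrow> int) set" where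
  "tube_lifts P \<eta> d p R a u s = {x. \<bar>real_of_int (x (Inl a))\<bar> \<le> s * R \<and>
     (\<forall>l. \<bar>real_of_int (x (Inl l)) - real_of_int (x (Inl a)) * u l\<bar> \<le> s / 4) \<and>
     (\<forall>i<d. \<bar>real_of_int (idot (\<lambda>l. x (Inl l)) (p i)) - real_of_int (x (Inr i)) * real P\<bar> \<le> s * \<eta> * real P) \<and>
     (\<forall>i\<ge>d. x (Inr i) = 0)}"

lemma tube_lifts_mono: 
  assumes "s \<le> t" "0 \<le> R" "0 \<le> \<eta>" 
  shows "tube_lifts P \<eta> d p R a u s \<subseteq> tube_lifts P \<eta> d p R a u t"
proof -
  have "s * R \<le> t * R" "s / 4 \<le> t / 4" "s * \<eta> * real P \<le> t * \<eta> * real P"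
    using assms by (auto intro!: mult_right_mono)
  then show ?thesis unfolding tube_lifts_def by (auto intro: order_trans) 
qed

lemma idot_diff_div3:
  assumes "\<And>l. 3 dvd x l - y l"
  shows "3 * idot (\<lambda>l. (x l - y l) div 3) q = idot x q - idot y q"
  unfolding idot_def sum_distrib_left sum_subtractf[symmetric]
proof (rule sum.cong[OF refl])
  fix l
  have "3 * ((x l - y l) div 3) = x l - y l" using assms by simp
  then show "3 * ((x l - y l) div 3 * q l) = x l * q l - y l * q l"
    by (metis left_diff_distrib mult.assoc)
qed

lemma abs_third_le: "\<bar>a\<bar> \<le> t \<Longrightarrow> \<bar>b\<bar> \<le> t \<Longrightarrow> 3 * c = a - b \<Longrightarrow> t' = 2 / 3 * t \<Longrightarrow> \<bar>c\<bar> \<le> t'" for a b c t t' :: real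
  by linarith

lemma tube_lifts_div3:
  assumes x: "x \<in> tube_lifts P \<eta> d p R a u s" and y: "y \<in> tube_lifts P \<eta> d p R a u s"
    and cong: "\<And>l. 3 dvd x l - y l"
  shows "(\<lambda>l. (x l - y l) div 3) \<in> tube_lifts P \<eta> d p R a u (2 / 3 * s)"
proof -
  let ?w = "\<lambda>l. (x l - y l) div 3"
  have w: "real_of_int (?w l) = (real_of_int (x l) - real_of_int (y l)) / 3" for l
  proof -
    have "3 * ?w l = x l - y l" using cong by simp
    then have "real_of_int (3 * ?w l) = real_of_int (x l - y l)" by (simp only:)
    then show ?thesis by (simp only: of_int_mult of_int_diff) simp
  qed
  have "\<bar>real_of_int (x (Inl a))\<bar> \<le> s * R" "\<bar>real_of_int (y (Inl a))\<bar> \<le> s * R"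
    using x y by (auto simp: tube_lifts_def)
  then have 1: "\<bar>real_of_int (?w (Inl a))\<bar> \<le> 2 / 3 * s * R" unfolding w by (simp add: field_simps)
  have 2: "\<bar>real_of_int (?w (Inl l)) - real_of_int (?w (Inl a)) * u l\<bar> \<le> 2 / 3 * s / 4" for l
  proof -
    have "\<bar>real_of_int (x (Inl l)) - real_of_int (x (Inl a)) * u l\<bar> \<le> s / 4"
      "\<bar>real_of_int (y (Inl l)) - real_of_int (y (Inl a)) * u l\<bar> \<le> s / 4"
      using x y by (auto simp: tube_lifts_def)
    moreover have "3 * (real_of_int (?w (Inl l)) - real_of_int (?w (Inl a)) * u l) =
      ((real_of_int (x (Inl l)) - real_of_int (x (Inl a)) * u l) - (real_of_int (y (Inl l)) - real_of_int (y (Inl a)) * u l))"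
      unfolding w by (simp add: field_simps)
    ultimately show ?thesis by (rule abs_third_le) simp
  qed
  have 3: "\<bar>real_of_int (idot (\<lambda>l. ?w (Inl l)) (p i)) - real_of_int (?w (Inr i)) * real P\<bar> \<le> 2 / 3 * s * \<eta> * real P"
    if "i < d" for i
  proof -
    have ab: "\<bar>real_of_int (idot (\<lambda>l. x (Inl l)) (p i)) - real_of_int (x (Inr i)) * real P\<bar> \<le> s * \<eta> * real P"
      "\<bar>real_of_int (idot (\<lambda>l. y (Inl l)) (p i)) - real_of_int (y (Inr i)) * real P\<bar> \<le> s * \<eta> * real P"
      using x y that by (auto simp: tube_lifts_def)
    have i3: "3 * real_of_int (idot (\<lambda>l. ?w (Inl l)) (p i)) =
       real_of_int (idot (\<lambda>l. x (Inl l)) (p i)) - real_of_int (idot (\<lambda>l. y (Inl l)) (p i))"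
      using idot_diff_div3[of "\<lambda>l. x (Inl l)" "\<lambda>l. y (Inl l)" "p i"] cong
      by (metis (no_types, lifting) of_int_diff of_int_mult of_int_numeral)
    have "3 * (real_of_int (idot (\<lambda>l. ?w (Inl l)) (p i)) - real_of_int (?w (Inr i)) * real P) =
       (real_of_int (idot (\<lambda>l. x (Inl l)) (p i)) - real_of_int (x (Inr i)) * real P) -
       (real_of_int (idot (\<lambda>l. y (Inl l)) (p i)) - real_of_int (y (Inr i)) * real P)"
      unfolding right_diff_distrib i3 w by (simp add: field_simps)
    from abs_third_le[OF ab this refl] show ?thesis by (simp only: mult.assoc)
  qed
  show ?thesis
    unfolding tube_lifts_def mem_Collect_eq
    using 1 2 3 x y by (intro conjI allI impI) (auto simp: tube_lifts_def)
qed

lemma finite_tube_lifts: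
  fixes u :: "'n::finite \<Rightarrow> real"
  assumes "P > 0"
  shows "finite (tube_lifts P \<eta> d p R a u s)"
proof -
  define U where "U = (\<Sum>l\<in>UNIV. \<bar>u l\<bar>)"
  define M where "M = \<bar>s * R\<bar> * U + \<bar>s\<bar>"
  have M0: "M \<ge> 0" by (auto simp: M_def U_def sum_nonneg)
  define M' where "M' = (\<Sum>i<d. \<Sum>l\<in>UNIV. M * \<bar>real_of_int (p i l)\<bar>) + \<bar>s * \<eta> * real P\<bar>"
  have coord: "\<bar>real_of_int (x (Inl l))\<bar> \<le> M" if x: "x \<in> tube_lifts P \<eta> d p R a u s" for x l
  proof -
    have x': "\<bar>real_of_int (x (Inl l)) - real_of_int (x (Inl a)) * u l\<bar> \<le> s / 4" "\<bar>real_of_int (x (Inl a))\<bar> \<le> s * R"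
      using x by (auto simp: tube_lifts_def)
    have "\<bar>u l\<bar> \<le> U" unfolding U_def by (rule member_le_sum) auto
    then have "\<bar>real_of_int (x (Inl a)) * u l\<bar> \<le> \<bar>s * R\<bar> * U"
      using x' unfolding abs_mult[of "real_of_int _"] by (intro mult_mono) auto
    then show ?thesis using x' unfolding M_def by linarith
  qed
  have m: "\<bar>real_of_int (x (Inr i))\<bar> \<le> M'" if x: "x \<in> tube_lifts P \<eta> d p R a u s" and i: "i < d" for x i
  proof -
    have "\<bar>real_of_int (idot (\<lambda>l. x (Inl l)) (p i))\<bar> \<le> (\<Sum>l\<in>UNIV. M * \<bar>real_of_int (p i l)\<bar>)"
      unfolding idot_def of_int_sum of_int_mult
      by (rule order_trans[OF sum_abs], rule sum_mono) (auto simp: abs_mult intro!: mult_right_mono coord[OF x])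
    also have "\<dots> \<le> (\<Sum>i<d. \<Sum>l\<in>UNIV. M * \<bar>real_of_int (p i l)\<bar>)"
      using i M0 by (intro member_le_sum[of i "{..<d}" "\<lambda>i. \<Sum>l\<in>UNIV. M * \<bar>real_of_int (p i l)\<bar>"]) (auto intro!: sum_nonneg)
    finally have 1: "\<bar>real_of_int (idot (\<lambda>l. x (Inl l)) (p i))\<bar> \<le> (\<Sum>i<d. \<Sum>l\<in>UNIV. M * \<bar>real_of_int (p i l)\<bar>)" .
    have "\<bar>real_of_int (idot (\<lambda>l. x (Inl l)) (p i)) - real_of_int (x (Inr i)) * real P\<bar> \<le> s * \<eta> * real P"
      using x i by (auto simp: tube_lifts_def)
    then have "\<bar>real_of_int (x (Inr i)) * real P\<bar> \<le> M'" using 1 unfolding M'_def by linarith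
    moreover have "\<bar>real_of_int (x (Inr i))\<bar> * 1 \<le> \<bar>real_of_int (x (Inr i))\<bar> * real P"
      using assms by (intro mult_left_mono) auto
    ultimately show ?thesis by (simp add: abs_mult)
  qed
  define N where "N = \<lceil>max M M'\<rceil>"
  have "tube_lifts P \<eta> d p R a u s \<subseteq>
     {x. \<forall>i. (i \<in> range Inl \<union> Inr ` {..<d} \<longrightarrow> x i \<in> {-N..N}) \<and> (i \<notin> range Inl \<union> Inr ` {..<d} \<longrightarrow> x i = 0)}"
  proof (rule subsetI, unfold mem_Collect_eq, rule allI)
    fix x i assume x: "x \<in> tube_lifts P \<eta> d p R a u s"
    show "(i \<in> range Inl \<union> Inr ` {..<d} \<longrightarrow> x i \<in> {-N..N}) \<and> (i \<notin> range Inl \<union> Inr ` {..<d} \<longrightarrow> x i = 0)"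
    proof (cases i)
      case (Inl l)
      have "\<bar>real_of_int (x (Inl l))\<bar> \<le> max M M'" using coord[OF x, of l] by linarith
      then have "\<bar>x (Inl l)\<bar> \<le> N" unfolding N_def by linarith
      then show ?thesis using Inl by auto
    next
      case (Inr j)
      show ?thesis
      proof (cases "j < d")
        case True
        have "\<bar>real_of_int (x (Inr j))\<bar> \<le> max M M'" using m[OF x True] by linarith
        then have "\<bar>x (Inr j)\<bar> \<le> N" unfolding N_def by linarith
        then show ?thesis using Inr True by auto
      next
        case False
        then show ?thesis using x Inr by (auto simp: tube_lifts_def)
      qed
    qed
  qed
  moreover have "finite {x :: 'n + nat \<Rightarrow> int. \<forall>i. (i \<in> range Inl \<union> Inr ` {..<d} \<longrightarrow> x i \<in> {-N..N}) \<and> (i \<notin> range Inl \<union> Inr ` {..<d} \<longrightarrow> x i = 0)}"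
    by (rule finite_set_of_finite_funs) auto
  ultimately show ?thesis by (rule finite_subset)
qed

lemma tube_lifts_small:
  assumes "P > 0" "0 \<le> s" "s * R < 1" "s \<le> 1" "0 \<le> \<eta>" "\<eta> < 1"
  shows "tube_lifts P \<eta> d p R a u s \<subseteq> {\<lambda>_. 0}"
proof
  fix x assume x: "x \<in> tube_lifts P \<eta> d p R a u s"
  have a0: "x (Inl a) = 0" using x assms(3) by (auto simp: tube_lifts_def)
  have l0: "x (Inl l) = 0" for l
  proof -
    have "\<bar>real_of_int (x (Inl l))\<bar> \<le> s / 4" using x a0 by (auto simp: tube_lifts_def)
    then show ?thesis using assms(4) by linarith
  qed
  have "x (Inr i) = 0" for i
  proof (cases "i < d")
    case True
    have "idot (\<lambda>l. x (Inl l)) (p i) = 0" by (simp add: idot_def l0)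
    then have "\<bar>real_of_int (x (Inr i)) * real P\<bar> \<le> s * \<eta> * real P"
      using x True by (auto simp: tube_lifts_def)
    then have "\<bar>real_of_int (x (Inr i))\<bar> \<le> s * \<eta>"
      using assms(1) by (simp add: abs_mult)
    also have "\<dots> \<le> 1 * \<eta>" using assms by (intro mult_right_mono) auto
    finally show ?thesis using assms(6) by linarith
  qed (use x in \<open>auto simp: tube_lifts_def\<close>)
  then have "x i = 0" for i using l0 by (cases i) auto
  then show "x \<in> {\<lambda>_. 0}" by auto
qed

lemma tube_points_subset:
  "tube_points P \<eta> d p R a u \<subseteq> (\<lambda>x l. x (Inl l)) ` tube_lifts P \<eta> d p R a u 1"
proof
  fix z assume z: "z \<in> tube_points P \<eta> d p R a u"
  then obtain m where m: "\<And>i. i < d \<Longrightarrow> \<bar>real_of_int (idot z (p i)) - real_of_int (m i) * real P\<bar> \<le> \<eta> * real P"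
    unfolding tube_points_def near_multiple_def mem_Collect_eq by metis
  define x where "x = case_sum z (\<lambda>i. if i < d then m i else 0)"
  have "x \<in> tube_lifts P \<eta> d p R a u 1" using z m by (auto simp: tube_points_def tube_lifts_def x_def)
  moreover have "z = (\<lambda>l. x (Inl l))" by (simp add: x_def)
  ultimately show "z \<in> (\<lambda>x l. x (Inl l)) ` tube_lifts P \<eta> d p R a u 1" by blast
qed

lemma finite_tube_points: "P > 0 \<Longrightarrow> finite (tube_points P \<eta> d p R a u)"
  by (rule finite_subset[OF tube_points_subset]) (intro finite_imageI finite_tube_lifts)

lemma card_tube_points_le:
  "P > 0 \<Longrightarrow> card (tube_points P \<eta> d p R a u) \<le> card (tube_lifts P \<eta> d p R a u 1)"
  by (rule surj_card_le[OF finite_tube_lifts tube_points_subset])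

text \<open>
  Tuples of generators are to be counted for which some tube contains many points. Such a tube yields independent
  vectors in the set of lifts, and a union bound is taken over all possible outcomes. For that purpose the vectors have to
  come from a list that does not depend on the generators and is short. A vector near a line is determined by
  its parameter \<open>t\<close> once the direction is known to precision \<open>1 / G\<close>, where \<open>G\<close> is a multiple of \<open>R\<close>. Directions
  can thus be discretized to \<open>g / G\<close>, and each vector costs only about \<open>R\<close> choices rather than \<open>R ^ n\<close>.
  The range \<open>witness_length\<close> of the coefficients is adapted to the smallness condition of \<open>large_sieve\<close>.\<close>

definition witness_vector :: "nat \<Rightarrow> ('n \<Rightarrow> int) \<Rightarrow> int \<Rightarrow> 'n \<Rightarrow> int" where
  "witness_vector G g t l = round (real_of_int t * real_of_int (g l) / real G)"

definition witness_length :: "nat \<Rightarrow> real \<Rightarrow> nat \<Rightarrow> nat" where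
  "witness_length r \<eta> k = nat \<lfloor>(3 / 2) ^ k / (13 * real r * \<eta>)\<rfloor>"

definition witnessed ::
  "nat \<Rightarrow> real \<Rightarrow> nat \<Rightarrow> nat \<Rightarrow> ('n::finite \<Rightarrow> int) \<Rightarrow> nat \<Rightarrow> (nat \<Rightarrow> int) \<Rightarrow> (nat \<Rightarrow> nat) \<Rightarrow> (nat \<Rightarrow> 'n \<Rightarrow> int) set" where
  "witnessed P \<eta> d G g r t k = {p \<in> {..<d} \<rightarrow>\<^sub>E residue_box P.
     (\<forall>c. (\<forall>j<r. \<bar>c j\<bar> < int (witness_length r \<eta> (k j))) \<longrightarrow>
        (\<forall>l. int P dvd (\<Sum>j<r. c j * witness_vector G g (t j) l)) \<longrightarrow> (\<forall>j<r. c j = 0)) \<and>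
     (\<forall>i<d. \<forall>j<r. near_multiple P ((2 / 3) ^ k j * \<eta>) (idot (witness_vector G g (t j)) (p i)))}"

text \<open>The conditions on the \<open>d\<close> generators are independent of each other, and each generator satisfies its condition
  with the probability given by \<open>large_sieve\<close>; hence the exponent \<open>d\<close>. The gain \<open>(2 / 3) ^ k j\<close> from the depth
  of the \<open>j\<close>-th vector is what makes crowded tubes improbable.\<close>

lemma card_witnessed:
  fixes g :: "'n::finite \<Rightarrow> int"
  assumes P: "P > 0" and \<eta>: "0 < \<eta>" "13 * real r * \<eta> \<le> 1"
  shows "real (card (witnessed P \<eta> d G g r t k)) \<le>
    (real P ^ CARD('n)) ^ d * (4 * (\<Prod>j<r. 26 * real r * \<eta> * (2 / 3) ^ k j)) ^ d"
proof (cases "witnessed P \<eta> d G g r t k = {}")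
  case True
  have "0 \<le> (real P ^ CARD('n)) ^ d * (4 * (\<Prod>j<r. 26 * real r * \<eta> * (2 / 3) ^ k j)) ^ d"
    using \<eta> by (intro mult_nonneg_nonneg zero_le_power prod_nonneg) auto
  then show ?thesis using True by simp
next
  case False
  define A where "A j = witness_length r \<eta> (k j)" for j
  define \<tau> where "\<tau> j = witness_vector G g (t j)" for j
  define E where "E = {x \<in> residue_box P. \<forall>j<r. near_multiple P ((2 / 3) ^ k j * \<eta>) (idot (\<tau> j) x)}"
  have indep: "\<forall>j\<in>{..<r}. c j = 0" if "\<And>j. j \<in> {..<r} \<Longrightarrow> \<bar>c j\<bar> < int (A j)"
    "\<And>l. int P dvd (\<Sum>j\<in>{..<r}. c j * \<tau> j l)" for c
    using False that unfolding witnessed_def A_def \<tau>_def by fastforce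
  have Aub: "real (A j) \<le> (3 / 2) ^ k j / (13 * real r * \<eta>)" for j
    using \<eta> by (simp add: A_def witness_length_def)
  have Alb: "1 / (26 * real r * \<eta> * (2 / 3) ^ k j) \<le> real (A j)" if "r > 0" for j
  proof -
    define q where "q = (3 / 2) ^ k j / (13 * real r * \<eta>)"
    have "1 \<le> (3 / 2 :: real) ^ k j" by (intro one_le_power) auto
    then have "13 * real r * \<eta> \<le> (3 / 2) ^ k j" using \<eta>(2) by linarith
    then have "q \<ge> 1" unfolding q_def using \<eta> that by (subst le_divide_eq_1_pos) simp_all
    then have "1 \<le> \<lfloor>q\<rfloor>" "real (nat \<lfloor>q\<rfloor>) = of_int \<lfloor>q\<rfloor>" by simp_all
    then have "q / 2 \<le> real (nat \<lfloor>q\<rfloor>)" using \<open>q \<ge> 1\<close> by linarith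
    then have "q / 2 \<le> real (A j)" unfolding A_def witness_length_def q_def[symmetric] .
    moreover have "1 / (26 * real r * \<eta> * (2 / 3) ^ k j) = q / 2"
      by (simp add: q_def power_divide field_simps)
    ultimately show ?thesis by (simp only:)
  qed
  have "(\<Sum>j<r. real (A j) * ((2 / 3) ^ k j * \<eta>)) \<le> (\<Sum>j<r. 1 / (13 * real r))"
  proof (rule sum_mono)
    fix j
    have "real (A j) * ((2 / 3) ^ k j * \<eta>) \<le> (3 / 2) ^ k j / (13 * real r * \<eta>) * ((2 / 3) ^ k j * \<eta>)"
      using \<eta> by (intro mult_right_mono Aub) auto
    also have "\<dots> = 1 / (13 * real r)" using \<eta> by (simp add: power_divide field_simps)
    finally show "real (A j) * ((2 / 3) ^ k j * \<eta>) \<le> 1 / (13 * real r)" .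
  qed
  also have "\<dots> \<le> 1 / 13" by simp
  finally have small: "(\<Sum>j<r. real (A j) * ((2 / 3) ^ k j * \<eta>)) \<le> 1 / 13" .
  have sieve: "real (card E) * (\<Prod>j<r. real (A j)) \<le> 4 * real P ^ CARD('n)"
    by (rule large_sieve[of "{..<r}" P A \<tau> E "\<lambda>j. (2 / 3) ^ k j * \<eta>"])
      (use P indep small in \<open>auto simp: E_def near_multiple_def\<close>)
  define Q0 where "Q0 = (\<Prod>j<r. 26 * real r * \<eta> * (2 / 3) ^ k j)"
  have Q0: "Q0 > 0" unfolding Q0_def using \<eta> by (intro prod_pos) auto
  have "1 / Q0 = (\<Prod>j<r. 1 / (26 * real r * \<eta> * (2 / 3) ^ k j))"
    by (simp add: Q0_def prod_dividef)
  also have "\<dots> \<le> (\<Prod>j<r. real (A j))"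
    using \<eta> Alb by (intro prod_mono) auto
  finally have "real (card E) * (1 / Q0) \<le> 4 * real P ^ CARD('n)"
    using sieve by (meson mult_left_mono of_nat_0_le_iff order_trans)
  then have E: "real (card E) \<le> real P ^ CARD('n) * (4 * Q0)" using Q0 by (simp add: field_simps)
  have "witnessed P \<eta> d G g r t k \<subseteq> {..<d} \<rightarrow>\<^sub>E E"
    by (auto simp: witnessed_def E_def \<tau>_def PiE_iff extensional_def)
  moreover have "finite E" by (simp add: E_def)
  ultimately have "card (witnessed P \<eta> d G g r t k) \<le> card ({..<d} \<rightarrow>\<^sub>E E)"
    by (intro card_mono finite_PiE) auto
  then have "real (card (witnessed P \<eta> d G g r t k)) \<le> real (card E) ^ d" 
    by (simp add: card_PiE flip: of_nat_power)
  also have "\<dots> \<le> (real P ^ CARD('n) * (4 * Q0)) ^ d" using E by (intro power_mono) auto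
  finally show ?thesis by (simp add: Q0_def power_mult_distrib)
qed

lemma witness_vector_eq:
  assumes t: "\<bar>real_of_int t\<bar> \<le> real R" and R: "R \<ge> 1"
    and z: "\<bar>real_of_int z - real_of_int t * u\<bar> \<le> 1 / 4"
    and g: "g l = round (u * real (4 * R))"
  shows "witness_vector (4 * R) g t l = z"
proof -
  have G: "real (4 * R) > 0" using R by simp
  have "\<bar>u * real (4 * R) - real_of_int (g l)\<bar> \<le> 1 / 2"
    unfolding g using of_int_round_abs_le[of "u * real (4 * R)"] by (simp add: abs_minus_commute)
  then have "\<bar>u - real_of_int (g l) / real (4 * R)\<bar> \<le> 1 / 2 / real (4 * R)"
    using G by (simp add: field_simps abs_le_iff)
  then have "\<bar>real_of_int t * (u - real_of_int (g l) / real (4 * R))\<bar> \<le> real R * (1 / 2 / real (4 * R))"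
    unfolding abs_mult using t by (intro mult_mono) auto
  also have "\<dots> = 1 / 8" using R by simp
  finally have "\<bar>real_of_int z - real_of_int t * real_of_int (g l) / real (4 * R)\<bar> < 1 / 2"
    using z unfolding right_diff_distrib times_divide_eq_right by linarith
  then show ?thesis unfolding witness_vector_def
    by (intro round_unique') (simp add: abs_minus_commute)
qed

text \<open>The lifts of the points in a crowded tube satisfy the hypotheses of \<open>multiscale_independent\<close>, and the
  resulting vectors are independent in the sense of \<open>witnessed\<close>. The latter is independence of the first \<open>n\<close>
  coordinates modulo \<open>P\<close>, for bounded coefficients. Indeed, a combination of the vectors that vanishes modulo \<open>P\<close>
  is smaller than \<open>P\<close> and so vanishes; and then the same combination of the further \<open>d\<close> coordinates is an integer
  of absolute value below one.\<close>

lemma many_points_witnessed: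
  fixes p :: "nat \<Rightarrow> 'n::finite \<Rightarrow> int" and u :: "'n \<Rightarrow> real"
  assumes P: "(real R + 1) / \<eta> \<le> real P" and R: "R \<ge> 1"
    and \<eta>: "0 < \<eta>" "13 * real (CARD('n) + d) * \<eta> \<le> 1"
    and I: "(2 / 3) ^ I * real R < 1"
    and p: "p \<in> {..<d} \<rightarrow>\<^sub>E residue_box P"
    and u: "u a = 1" "\<And>l. \<bar>u l\<bar> \<le> 1"
    and many: "3 ^ (H + (CARD('n) + d)) < card (tube_points P \<eta> d p R a u)"
  shows "\<exists>g r t k. g \<in> UNIV \<rightarrow>\<^sub>E {- int (4 * R)..int (4 * R)} \<and> r \<le> CARD('n) + d \<and>
    t \<in> {..<r} \<rightarrow>\<^sub>E {- int R..int R} \<and> k \<in> {..<r} \<rightarrow>\<^sub>E {..<I} \<and> H \<le> (\<Sum>j<r. k j) \<and>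
    p \<in> witnessed P \<eta> d (4 * R) g r t k"
proof -
  let ?T = "\<lambda>s. tube_lifts P \<eta> d p R a u s"
  have n1: "1 \<le> real (CARD('n) + d)" using zero_less_card_finite[where 'a='n] by linarith
  then have "13 * 1 * \<eta> \<le> 13 * real (CARD('n) + d) * \<eta>" using \<eta>(1) by (intro mult_right_mono mult_left_mono) auto
  then have \<eta>1: "\<eta> < 1" "13 * \<eta> \<le> 1" using \<eta> by linarith+
  have P0: "P > 0"
  proof -
    have "0 < (real R + 1) / \<eta>" using \<eta> by simp
    then have "0 < real P" using P by linarith
    then show ?thesis by simp
  qed
  have "\<exists>B k. indep3 B \<and> (\<forall>b\<in>B. b \<in> ?T ((2 / 3) ^ k b) \<and> k b < I) \<and> B \<subseteq> ?T ((2 / 3) ^ 0) \<and>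
      card (?T ((2 / 3) ^ 0)) \<le> 3 ^ (\<Sum>b\<in>B. k b + 1)"
  proof (rule multiscale_independent[of "\<lambda>i. ?T ((2 / 3) ^ i)" I])
    show "finite (?T ((2 / 3) ^ i))" for i by (rule finite_tube_lifts[OF P0])
    show "?T ((2 / 3) ^ Suc i) \<subseteq> ?T ((2 / 3) ^ i)" for i
      using \<eta> by (intro tube_lifts_mono) (auto intro!: power_decreasing simp del: power_Suc)
    show "?T ((2 / 3) ^ I) \<subseteq> {\<lambda>_. 0}"
      using P0 I \<eta> \<eta>1 by (intro tube_lifts_small) (auto intro!: power_le_one)
    show "(\<lambda>l. (x l - y l) div 3) \<in> ?T ((2 / 3) ^ Suc i)"
      if "x \<in> ?T ((2 / 3) ^ i)" "y \<in> ?T ((2 / 3) ^ i)" "\<And>l. 3 dvd x l - y l" for i x y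
      using tube_lifts_div3[OF that] by simp
  qed
  then obtain B \<kappa> where B: "indep3 B" "\<And>b. b \<in> B \<Longrightarrow> b \<in> ?T ((2 / 3) ^ \<kappa> b)" "\<And>b. b \<in> B \<Longrightarrow> \<kappa> b < I"
    "B \<subseteq> ?T 1" "card (?T 1) \<le> 3 ^ (\<Sum>b\<in>B. \<kappa> b + 1)" by auto
  have finB: "finite B" using B(1) by (simp add: indep3_def)
  have "card B \<le> card (range Inl \<union> Inr ` {..<d} :: ('n + nat) set)"
  proof (rule indep3_card_le[OF B(1)])
    show "b i = 0" if b: "b \<in> B" and i: "i \<notin> range Inl \<union> Inr ` {..<d}" for b i
    proof (cases i)
      case (Inr j)
      then have "j \<ge> d" using i by auto
      then show ?thesis using B(4) b Inr by (auto simp: tube_lifts_def)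
    qed (use i in auto)
  qed auto
  also have "\<dots> = CARD('n) + d"
    by (subst card_Un_disjoint) (auto simp: card_image)
  finally have rD: "card B \<le> CARD('n) + d" .
  define r where "r = card B"
  obtain h where h: "bij_betw h {..<r} B"
    using ex_bij_betw_nat_finite[OF finB] by (auto simp: r_def lessThan_atLeast0)
  have hB: "h j \<in> B" if "j < r" for j using h that by (auto simp: bij_betw_def)
  define k where "k = (\<lambda>j\<in>{..<r}. \<kappa> (h j))"
  define t where "t = (\<lambda>j\<in>{..<r}. h j (Inl a))"
  define g where "g l = round (u l * real (4 * R))" for l
  define s where "s j = ((2 :: real) / 3) ^ k j" for j
  have s01: "0 < s j" "s j \<le> 1" for j by (auto simp: s_def power_le_one)
  have T: "h j \<in> ?T (s j)" if "j < r" for j using B(2)[OF hB[OF that]] that by (simp add: s_def k_def)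
  have Ta: "\<bar>real_of_int (h j (Inl a))\<bar> \<le> s j * real R" if "j < r" for j
    using T[OF that] by (simp add: tube_lifts_def)
  have Tl: "\<bar>real_of_int (h j (Inl l)) - real_of_int (h j (Inl a)) * u l\<bar> \<le> s j / 4" if "j < r" for j l
    using T[OF that] by (simp add: tube_lifts_def)
  have TR: "\<bar>real_of_int (h j (Inl a))\<bar> \<le> real R" if "j < r" for j
    using Ta[OF that] mult_right_mono[OF s01(2)[of j], of "real R"] by simp
  have wv: "witness_vector (4 * R) g (t j) l = h j (Inl l)" if "j < r" for j l
    unfolding t_def using that
  proof (simp, intro witness_vector_eq[OF TR[OF that] R])
    show "\<bar>real_of_int (h j (Inl l)) - real_of_int (h j (Inl a)) * u l\<bar> \<le> 1 / 4"
      using Tl[OF that, of l] s01(2)[of j] by linarith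
  qed (simp add: g_def)
  have Tz: "\<bar>real_of_int (h j (Inl l))\<bar> \<le> s j * (real R + 1 / 4)" if "j < r" for j l
  proof -
    have "\<bar>real_of_int (h j (Inl a)) * u l\<bar> \<le> (s j * real R) * 1"
      unfolding abs_mult using Ta[OF that] u(2)[of l] by (intro mult_mono) auto
    moreover have "s j * (real R + 1 / 4) = (s j * real R) * 1 + s j / 4" by (simp add: distrib_left)
    ultimately show ?thesis using Tl[OF that, of l] by linarith
  qed
  have indep: "\<forall>j<r. c j = 0"
    if c: "\<And>j. j < r \<Longrightarrow> \<bar>c j\<bar> < int (witness_length r \<eta> (k j))"
      and dv: "\<And>l. int P dvd (\<Sum>j<r. c j * witness_vector (4 * R) g (t j) l)" for c
  proof (cases "r = 0")
    case False
    have cs: "\<bar>real_of_int (c j)\<bar> * s j \<le> 1 / (13 * real r * \<eta>)" if "j < r" for j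
    proof -
      have "real (witness_length r \<eta> (k j)) \<le> (3 / 2) ^ k j / (13 * real r * \<eta>)"
        unfolding witness_length_def using \<eta>(1) by (intro of_nat_floor) simp
      then have "\<bar>real_of_int (c j)\<bar> \<le> (3 / 2) ^ k j / (13 * real r * \<eta>)" using c[OF that] by linarith
      then have "\<bar>real_of_int (c j)\<bar> * s j \<le> (3 / 2) ^ k j / (13 * real r * \<eta>) * s j"
        using s01 by (intro mult_right_mono) (auto simp: less_imp_le)
      also have "\<dots> = 1 / (13 * real r * \<eta>)" by (simp add: s_def power_divide)
      finally show ?thesis .
    qed
    have bound: "(\<Sum>j<r. \<bar>real_of_int (c j)\<bar> * (s j * X)) \<le> X / (13 * \<eta>)" if "X \<ge> 0" for X
    proof -
      have "(\<Sum>j<r. \<bar>real_of_int (c j)\<bar> * (s j * X)) \<le> (\<Sum>j<r. 1 / (13 * real r * \<eta>) * X)"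
      proof (rule sum_mono)
        fix j assume "j \<in> {..<r}"
        then have "(\<bar>real_of_int (c j)\<bar> * s j) * X \<le> 1 / (13 * real r * \<eta>) * X"
          using that by (intro mult_right_mono cs) auto
        then show "\<bar>real_of_int (c j)\<bar> * (s j * X) \<le> 1 / (13 * real r * \<eta>) * X" by (simp only: mult.assoc)
      qed
      also have "\<dots> = real r * (1 / (13 * real r * \<eta>) * X)" by (simp only: sum_constant card_lessThan)
      also have "\<dots> = X / (13 * \<eta>)" using False \<eta>(1) by (simp add: field_simps)
      finally show ?thesis .
    qed
    have z0: "(\<Sum>j<r. c j * h j (Inl l)) = 0" for l
    proof -
      have d: "int P dvd (\<Sum>j<r. c j * h j (Inl l))"
        using dv[of l] by (simp add: wv)
      have "\<bar>real_of_int (\<Sum>j<r. c j * h j (Inl l))\<bar> \<le> (\<Sum>j<r. \<bar>real_of_int (c j)\<bar> * (s j * (real R + 1 / 4)))"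
        unfolding of_int_sum of_int_mult
        by (rule order_trans[OF sum_abs], rule sum_mono) (auto simp: abs_mult intro!: mult_left_mono Tz)
      also have "\<dots> \<le> (real R + 1 / 4) / (13 * \<eta>)" by (rule bound) simp
      also have "\<dots> < (real R + 1) / \<eta>" using \<eta> by (simp add: divide_simps)
      finally have "\<bar>\<Sum>j<r. c j * h j (Inl l)\<bar> < int P" using P by linarith
      then show ?thesis using d dvd_imp_le_int[of "\<Sum>j<r. c j * h j (Inl l)" "int P"] by linarith
    qed
    have m0: "(\<Sum>j<r. c j * h j (Inr i)) = 0" for i
    proof (cases "i < d")
      case True
      have "(\<Sum>j<r. c j * idot (\<lambda>l. h j (Inl l)) (p i)) = (\<Sum>l\<in>UNIV. (\<Sum>j<r. c j * h j (Inl l)) * p i l)"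
      proof -
        have "(\<Sum>j<r. c j * idot (\<lambda>l. h j (Inl l)) (p i)) = (\<Sum>j<r. \<Sum>l\<in>UNIV. c j * h j (Inl l) * p i l)"
          by (simp add: idot_def sum_distrib_left mult.assoc)
        also have "\<dots> = (\<Sum>l\<in>UNIV. \<Sum>j<r. c j * h j (Inl l) * p i l)" by (rule sum.swap)
        finally show ?thesis by (simp add: sum_distrib_right)
      qed
      then have i0: "(\<Sum>j<r. c j * idot (\<lambda>l. h j (Inl l)) (p i)) = 0" by (simp add: z0)
      have "real_of_int (\<Sum>j<r. c j * h j (Inr i)) * real P =
         - (\<Sum>j<r. real_of_int (c j) * (real_of_int (idot (\<lambda>l. h j (Inl l)) (p i)) - real_of_int (h j (Inr i)) * real P))
         + real_of_int (\<Sum>j<r. c j * idot (\<lambda>l. h j (Inl l)) (p i))"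
        by (simp add: right_diff_distrib sum_subtractf sum_distrib_right mult.assoc)
      then have "\<bar>real_of_int (\<Sum>j<r. c j * h j (Inr i)) * real P\<bar> =
         \<bar>\<Sum>j<r. real_of_int (c j) * (real_of_int (idot (\<lambda>l. h j (Inl l)) (p i)) - real_of_int (h j (Inr i)) * real P)\<bar>"
        unfolding i0 by simp
      also have "\<dots> \<le> (\<Sum>j<r. \<bar>real_of_int (c j)\<bar> * (s j * (\<eta> * real P)))"
      proof (rule order_trans[OF sum_abs], rule sum_mono)
        fix j assume "j \<in> {..<r}"
        then have "\<bar>real_of_int (idot (\<lambda>l. h j (Inl l)) (p i)) - real_of_int (h j (Inr i)) * real P\<bar> \<le> s j * (\<eta> * real P)"
          using T[of j] True by (simp add: tube_lifts_def mult.assoc)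
        then show "\<bar>real_of_int (c j) * (real_of_int (idot (\<lambda>l. h j (Inl l)) (p i)) - real_of_int (h j (Inr i)) * real P)\<bar>
            \<le> \<bar>real_of_int (c j)\<bar> * (s j * (\<eta> * real P))"
          unfolding abs_mult[of "real_of_int (c j)"] by (intro mult_left_mono) auto
      qed
      also have "\<dots> \<le> \<eta> * real P / (13 * \<eta>)" using \<eta> by (intro bound) simp
      also have "\<dots> < 1 * real P" using \<eta> P0 by simp
      finally have "\<bar>real_of_int (\<Sum>j<r. c j * h j (Inr i))\<bar> < 1" using P0 by (simp add: abs_mult)
      then show ?thesis by linarith
    next
      case False
      then have "h j (Inr i) = 0" if "j < r" for j using T[OF that] by (simp add: tube_lifts_def)
      then show ?thesis by (intro sum.neutral) auto
    qed
    define c' where "c' b = c (inv_into {..<r} h b)" for b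
    have "(\<Sum>b\<in>B. c' b * b i) = (\<Sum>j<r. c j * h j i)" for i
    proof -
      have "(\<Sum>b\<in>B. c' b * b i) = (\<Sum>j<r. c' (h j) * h j i)"
        by (rule sum.reindex_bij_betw[OF h, symmetric])
      also have "\<dots> = (\<Sum>j<r. c j * h j i)"
        using h by (intro sum.cong) (auto simp: c'_def bij_betw_def inv_into_f_f)
      finally show ?thesis .
    qed
    moreover have "(\<Sum>j<r. c j * h j i) = 0" for i using z0 m0 by (cases i) auto
    ultimately have "\<forall>b\<in>B. c' b = 0" by (intro indep3_linear_independent[OF B(1)]) simp
    then show ?thesis using hB h by (auto simp: c'_def bij_betw_def inv_into_f_f)
  qed simp
  have near: "near_multiple P ((2 / 3) ^ k j * \<eta>) (idot (witness_vector (4 * R) g (t j)) (p i))" if "i < d" "j < r" for i j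
  proof -
    have eq: "witness_vector (4 * R) g (t j) = (\<lambda>l. h j (Inl l))" using wv[OF that(2)] by auto
    show ?thesis using T[OF that(2)] that(1) unfolding eq near_multiple_def
      by (auto simp: tube_lifts_def s_def)
  qed
  have w: "p \<in> witnessed P \<eta> d (4 * R) g r t k"
    unfolding witnessed_def using p indep near by blast
  have "\<bar>g l\<bar> \<le> int (4 * R)" for l
  proof -
    have "\<bar>u l * real (4 * R)\<bar> \<le> real (4 * R)" using u(2)[of l] by (simp add: abs_mult mult_left_le_one_le)
    then have "u l * real (4 * R) \<le> of_int (int (4 * R))" "of_int (- int (4 * R)) \<le> u l * real (4 * R)" by linarith+
    then have "round (u l * real (4 * R)) \<le> round (of_int (int (4 * R)) :: real)"
       "round (of_int (- int (4 * R)) :: real) \<le> round (u l * real (4 * R))" by (metis round_mono)+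
    then show ?thesis unfolding g_def round_of_int by linarith
  qed
  then have g: "g \<in> UNIV \<rightarrow>\<^sub>E {- int (4 * R)..int (4 * R)}" by (auto simp: PiE_iff abs_le_iff minus_le_iff)
  have t: "t \<in> {..<r} \<rightarrow>\<^sub>E {- int R..int R}"
  proof -
    have "- int R \<le> h j (Inl a) \<and> h j (Inl a) \<le> int R" if "j < r" for j using TR[OF that] by linarith
    then show ?thesis unfolding t_def by (auto simp: PiE_iff)
  qed
  have k: "k \<in> {..<r} \<rightarrow>\<^sub>E {..<I}" using B(3) hB by (auto simp: k_def)
  have "H + (CARD('n) + d) < (\<Sum>b\<in>B. \<kappa> b + 1)"
  proof -
    have "(3::nat) ^ (H + (CARD('n) + d)) < 3 ^ (\<Sum>b\<in>B. \<kappa> b + 1)"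
      by (rule less_le_trans[OF many order_trans[OF card_tube_points_le[OF P0] B(5)]])
    then show ?thesis by (simp add: power_strict_increasing_iff)
  qed
  also have "\<dots> = (\<Sum>b\<in>B. \<kappa> b) + r" by (subst sum.distrib) (simp add: r_def)
  also have "(\<Sum>b\<in>B. \<kappa> b) = (\<Sum>j<r. k j)"
    by (subst sum.reindex_bij_betw[OF h, symmetric]) (auto simp: k_def)
  finally have "H \<le> (\<Sum>j<r. k j)" using rD by (simp add: r_def)
  then show ?thesis using g t k w rD by (auto simp: r_def[symmetric])
qed

text \<open>The union bound. A vector has at most \<open>(2 * R + 1) * I\<close> parameters \<open>(t j, k j)\<close>, and its conditions
  have probability about \<open>(26 * (n + d) * \<eta>) ^ d\<close>, so by hypothesis \<open>\<eta>2\<close> each vector pays for its own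
  choice. The choice of the direction is paid for by the total depth of the vectors, according to hypothesis \<open>H\<close>.\<close>

lemma card_crowded_generators:
  assumes P: "(real R + 1) / \<eta> \<le> real P" and R: "R \<ge> 1"
    and \<eta>: "0 < \<eta>" "13 * real (CARD('n::finite) + d) * \<eta> \<le> 1"
    and I: "(2 / 3) ^ I * real R < 1"
    and \<eta>2: "(2 * real R + 1) * real I * (26 * real (CARD('n) + d) * \<eta>) ^ d \<le> 1"
    and H: "4 * (8 * real R + 1) ^ CARD('n) * (real (CARD('n) + d) + 1) * 4 ^ d * (2 / 3) ^ (d * H) \<le> 1"
  shows "4 * real (card {p \<in> {..<d} \<rightarrow>\<^sub>E (residue_box P :: ('n \<Rightarrow> int) set). \<exists>a u. u a = 1 \<and> (\<forall>l. \<bar>u l\<bar> \<le> 1) \<and>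
      3 ^ (H + (CARD('n) + d)) < card (tube_points P \<eta> d p R a u)}) \<le> (real P ^ CARD('n)) ^ d"
    (is "4 * real (card ?bad) \<le> _")
proof -
  define D where "D = CARD('n) + d"
  define Gs where "Gs = ((UNIV :: 'n set) \<rightarrow>\<^sub>E {- int (4 * R)..int (4 * R)})"
  define Ts where "Ts r = ({..<r} \<rightarrow>\<^sub>E {- int R..int R})" for r :: nat
  define Ks where "Ks r = {k \<in> {..<r} \<rightarrow>\<^sub>E {..<I}. H \<le> (\<Sum>j<r. k j)}" for r :: nat
  define W where "W g r t k = witnessed P \<eta> d (4 * R) g r t k" for g :: "'n \<Rightarrow> int" and r t k
  have fin: "finite Gs" "finite (Ts r)" "finite (Ks r)" for r
    by (auto simp: Gs_def Ts_def Ks_def intro!: finite_PiE)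
  have sub: "?bad \<subseteq> (\<Union>g\<in>Gs. \<Union>r\<in>{..D}. \<Union>t\<in>Ts r. \<Union>k\<in>Ks r. W g r t k)"
  proof
    fix p assume "p \<in> ?bad"
    then obtain a and u :: "'n \<Rightarrow> real" where "p \<in> {..<d} \<rightarrow>\<^sub>E residue_box P" "u a = 1" "\<And>l. \<bar>u l\<bar> \<le> 1"
      "3 ^ (H + (CARD('n) + d)) < card (tube_points P \<eta> d p R a u)" by blast
    from many_points_witnessed[OF P R \<eta> I this] obtain g r t k where
      "g \<in> Gs" "r \<in> {..D}" "t \<in> Ts r" "k \<in> Ks r" "p \<in> W g r t k"
      unfolding Gs_def Ts_def Ks_def W_def D_def by auto
    then show "p \<in> (\<Union>g\<in>Gs. \<Union>r\<in>{..D}. \<Union>t\<in>Ts r. \<Union>k\<in>Ks r. W g r t k)"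
      by blast
  qed
  have finW: "finite (W g r t k)" for g r t k
    by (rule finite_subset[of _ "{..<d} \<rightarrow>\<^sub>E residue_box P"]) (auto simp: W_def witnessed_def intro!: finite_PiE)
  define N where "N = (real P ^ CARD('n)) ^ d"
  have N0: "N \<ge> 0" by (simp add: N_def)
  define Z where "Z = 4 ^ d * ((2 :: real) / 3) ^ (d * H)"
  define Y where "Y = (26 * real D * \<eta>) ^ d"
  have Y0: "Y \<ge> 0" using \<eta> by (simp add: Y_def)
  have cW: "real (card (W g r t k)) \<le> N * (Z * Y ^ r)" if "r \<le> D" "k \<in> Ks r" for g r t k
  proof -
    have "13 * real r * \<eta> \<le> 13 * real (CARD('n) + d) * \<eta>"
      using that \<eta> by (intro mult_right_mono mult_left_mono) (auto simp: D_def)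
    then have r1: "13 * real r * \<eta> \<le> 1" using \<eta>(2) by linarith
    have "0 < (real R + 1) / \<eta>" using \<eta>(1) by simp
    then have "0 < real P" using P by linarith
    then have P0: "P > 0" by simp
    have "real (card (W g r t k)) \<le> N * (4 * (\<Prod>j<r. 26 * real r * \<eta> * (2 / 3) ^ k j)) ^ d"
      unfolding W_def N_def by (rule card_witnessed[OF P0 \<eta>(1) r1])
    also have "(\<Prod>j<r. 26 * real r * \<eta> * (2 / 3) ^ k j) = (26 * real r * \<eta>) ^ r * (2 / 3) ^ (\<Sum>j<r. k j)"
      by (simp add: prod.distrib power_sum)
    also have "N * (4 * ((26 * real r * \<eta>) ^ r * (2 / 3) ^ (\<Sum>j<r. k j))) ^ d \<le>
      N * (4 * ((26 * real D * \<eta>) ^ r * (2 / 3) ^ H)) ^ d"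
      using that \<eta> N0
      by (intro mult_left_mono power_mono mult_mono power_decreasing) (auto simp: Ks_def intro!: mult_nonneg_nonneg)
    also have "(4 * ((26 * real D * \<eta>) ^ r * (2 / 3) ^ H)) ^ d = Z * Y ^ r"
    proof -
      have "((26 * real D * \<eta>) ^ r) ^ d = Y ^ r" by (metis Y_def power_mult mult.commute)
      moreover have "((2 / 3 :: real) ^ H) ^ d = (2 / 3) ^ (d * H)" by (metis power_mult mult.commute)
      moreover have "(4 * ((26 * real D * \<eta>) ^ r * (2 / 3) ^ H)) ^ d = 4 ^ d * (((26 * real D * \<eta>) ^ r) ^ d * ((2 / 3) ^ H) ^ d)"
        by (subst power_mult_distrib, subst power_mult_distrib, rule refl)
      ultimately show ?thesis unfolding Z_def by (simp only: mult_ac)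
    qed
    finally show ?thesis .
  qed
  have "real (card ?bad) \<le> real (card (\<Union>g\<in>Gs. \<Union>r\<in>{..D}. \<Union>t\<in>Ts r. \<Union>k\<in>Ks r. W g r t k))"
    using sub fin finW by (intro of_nat_mono card_mono) auto
  also have "\<dots> \<le> real (\<Sum>g\<in>Gs. \<Sum>r\<in>{..D}. \<Sum>t\<in>Ts r. \<Sum>k\<in>Ks r. card (W g r t k))"
    using fin by (intro of_nat_mono order_trans[OF card_UN_le] sum_mono finite_atMost) simp_all
  also have "\<dots> = (\<Sum>g\<in>Gs. \<Sum>r\<in>{..D}. \<Sum>t\<in>Ts r. \<Sum>k\<in>Ks r. real (card (W g r t k)))" by simp
  also have "\<dots> \<le> (\<Sum>g\<in>Gs. \<Sum>r\<in>{..D}. \<Sum>t\<in>Ts r. \<Sum>k\<in>Ks r. N * (Z * Y ^ r))"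
    by (intro sum_mono cW) auto
  also have "\<dots> = (\<Sum>g\<in>Gs. \<Sum>r\<in>{..D}. (real (card (Ts r)) * real (card (Ks r))) * (N * (Z * Y ^ r)))"
    by (simp add: mult.assoc)
  also have "\<dots> \<le> (\<Sum>g\<in>Gs. \<Sum>r\<in>{..D}. N * Z)"
  proof (intro sum_mono)
    fix r
    have "card (Ks r) \<le> card ({..<r} \<rightarrow>\<^sub>E {..<I})" unfolding Ks_def by (intro card_mono finite_PiE) auto
    then have K: "real (card (Ks r)) \<le> real I ^ r" by (simp add: card_PiE flip: of_nat_power)
    have T: "real (card (Ts r)) = (2 * real R + 1) ^ r" by (simp add: Ts_def card_PiE) 
    have "(real (card (Ts r)) * real (card (Ks r))) * (N * (Z * Y ^ r)) \<le> ((2 * real R + 1) ^ r * real I ^ r) * (N * (Z * Y ^ r))"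
      unfolding T using K N0 Y0 by (intro mult_right_mono mult_left_mono) (auto simp: Z_def)
    also have "\<dots> = N * Z * ((2 * real R + 1) * real I * Y) ^ r" by (simp add: power_mult_distrib ac_simps)
    also have "\<dots> \<le> N * Z * 1"
      using \<eta>2 N0 Y0 by (intro mult_left_mono power_le_one) (auto simp: Y_def D_def Z_def)
    finally show "(real (card (Ts r)) * real (card (Ks r))) * (N * (Z * Y ^ r)) \<le> N * Z" by simp
  qed
  also have "\<dots> = N * ((8 * real R + 1) ^ CARD('n) * (real D + 1) * Z)"
    by (simp add: Gs_def card_PiE algebra_simps)
  finally have "4 * real (card ?bad) \<le> N * (4 * (8 * real R + 1) ^ CARD('n) * (real D + 1) * 4 ^ d * (2 / 3) ^ (d * H))"
    by (simp add: Z_def ac_simps)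
  also have "\<dots> \<le> N * 1" using H N0 by (intro mult_left_mono) (auto simp: D_def)
  finally show ?thesis by (simp add: N_def)
qed

subsection \<open>Generalized arithmetic progressions hit most targets\<close>

text \<open>
  Points of a progression with \<open>d\<close> generators have nearly equal phases at each frequency of the Bohr set of the
  generators. All nodes of one scale will be taken from such a progression.\<close>

definition gap_point :: "nat \<Rightarrow> nat \<Rightarrow> ('n::finite \<Rightarrow> int) \<Rightarrow> (nat \<Rightarrow> 'n \<Rightarrow> int) \<Rightarrow> (nat \<Rightarrow> nat) \<Rightarrow> 'n \<Rightarrow> int" where
  "gap_point P d p0 p c l = (p0 l + (\<Sum>i<d. int (c i) * p i l)) mod int P"

lemma mod_eq_imp_eq: "x mod P = y mod P \<Longrightarrow> 0 \<le> x \<Longrightarrow> x < P \<Longrightarrow> 0 \<le> y \<Longrightarrow> y < (P::int) \<Longrightarrow> x = y"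
  by simp

lemma bij_betw_shift_residue_box:
  assumes "P > 0"
  shows "bij_betw (\<lambda>p0 l. (p0 l + s l) mod int P) (residue_box P) (residue_box P)"
proof -
  have "inj_on (\<lambda>p0 l. (p0 l + s l) mod int P) (residue_box P)"
  proof (rule inj_onI, rule ext)
    fix x y l assume xy: "x \<in> residue_box P" "y \<in> residue_box P" and "(\<lambda>l. (x l + s l) mod int P) = (\<lambda>l. (y l + s l) mod int P)"
    then have "(x l + s l) mod int P = (y l + s l) mod int P" by meson
    then have "int P dvd (x l + s l) - (y l + s l)" by (simp add: mod_eq_dvd_iff)
    then have "x l mod int P = y l mod int P" by (simp add: mod_eq_dvd_iff)
    then show "x l = y l" by (rule mod_eq_imp_eq) (use xy in \<open>auto simp: residue_box_iff\<close>)
  qed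
  moreover have "(\<lambda>p0 l. (p0 l + s l) mod int P) ` residue_box P \<subseteq> residue_box P"
    using assms by (auto simp: residue_box_iff)
  ultimately show ?thesis unfolding bij_betw_def using endo_inj_surj finite_residue_box by blast
qed

text \<open>Two points of the progression with different coefficients determine one generator and the base point, given the
  other generators: in the field with \<open>P\<close> elements this is a linear system of two equations whose determinant
  \<open>c i - c' i\<close> is not zero, because \<open>L \<le> P\<close>. Hence random progressions have pairwise independent points.\<close>

lemma gap_point_pair_injective:
  fixes p p' :: "nat \<Rightarrow> 'n::finite \<Rightarrow> int"
  assumes P: "prime P" and L: "L \<le> P"
    and c: "\<And>i. i < d \<Longrightarrow> c i < L" "\<And>i. i < d \<Longrightarrow> c' i < L" and i: "i < d" "c i \<noteq> c' i"
    and box: "p0 \<in> residue_box P" "p0' \<in> residue_box P" "p \<in> {..<d} \<rightarrow>\<^sub>E residue_box P" "p' \<in> {..<d} \<rightarrow>\<^sub>E residue_box P"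
    and eq: "gap_point P d p0 p c = gap_point P d p0' p' c" "gap_point P d p0 p c' = gap_point P d p0' p' c'"
    and rest: "\<And>j. j < d \<Longrightarrow> j \<noteq> i \<Longrightarrow> p j = p' j"
  shows "p0 = p0' \<and> p = p'"
proof -
  have split: "(\<Sum>j<d. int (c j) * p j l) = int (c i) * p i l + (\<Sum>j\<in>{..<d}-{i}. int (c j) * p j l)" for c :: "nat \<Rightarrow> nat" and p :: "nat \<Rightarrow> 'n \<Rightarrow> int" and l
    using i(1) by (intro sum.remove) auto
  have same: "(\<Sum>j\<in>{..<d}-{i}. int (c j) * p j l) = (\<Sum>j\<in>{..<d}-{i}. int (c j) * p' j l)" for c :: "nat \<Rightarrow> nat" and l
    using rest by (intro sum.cong) auto
  have dv: "int P dvd (p0 l - p0' l) + int (c i) * (p i l - p' i l)" if "gap_point P d p0 p c = gap_point P d p0' p' c" for c l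
  proof -
    have "int P dvd (p0 l + (\<Sum>j<d. int (c j) * p j l)) - (p0' l + (\<Sum>j<d. int (c j) * p' j l))"
      using fun_cong[OF that, of l] by (simp add: gap_point_def mod_eq_dvd_iff)
    then show ?thesis unfolding split[of c p] split[of c p'] same by (simp add: algebra_simps)
  qed
  have pi: "p i l = p' i l" for l
  proof -
    have "int P dvd ((p0 l - p0' l) + int (c i) * (p i l - p' i l)) - ((p0 l - p0' l) + int (c' i) * (p i l - p' i l))"
      by (intro dvd_diff dv eq)
    then have "int P dvd (int (c i) - int (c' i)) * (p i l - p' i l)" by (simp add: algebra_simps)
    moreover have "\<not> int P dvd int (c i) - int (c' i)"
    proof
      assume "int P dvd int (c i) - int (c' i)"
      moreover have "\<bar>int (c i) - int (c' i)\<bar> < int P" using c(1)[OF i(1)] c(2)[OF i(1)] L by linarith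
      ultimately show False using dvd_imp_le_int[of "int (c i) - int (c' i)" "int P"] i(2) by linarith
    qed
    ultimately have "int P dvd p i l - p' i l"
      using P by (simp add: prime_dvd_mult_iff prime_int_nat_transfer prime_dvd_mult_eq_int)
    then have "p i l mod int P = p' i l mod int P" by (simp add: mod_eq_dvd_iff)
    then show ?thesis by (rule mod_eq_imp_eq) (use box(3,4) i(1) in \<open>auto simp: PiE_iff residue_box_iff\<close>)
  qed
  then have "p j = p' j" if "j < d" for j using rest[OF that] that by (cases "j = i") auto
  then have "p = p'" by (intro PiE_ext[OF box(3,4)]) auto
  moreover have "p0 l = p0' l" for l
  proof -
    have "int P dvd p0 l - p0' l" using dv[OF eq(1), of l] pi by simp
    then have "p0 l mod int P = p0' l mod int P" by (simp add: mod_eq_dvd_iff)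
    then show ?thesis by (rule mod_eq_imp_eq) (use box(1,2) in \<open>auto simp: residue_box_iff\<close>)
  qed
  ultimately show ?thesis by auto
qed

lemma card_gap_pair_le:
  fixes Y :: "('n::finite \<Rightarrow> int) set"
  assumes P: "prime P" and L: "L \<le> P" and Y: "Y \<subseteq> residue_box P"
    and c: "c \<in> {..<d} \<rightarrow>\<^sub>E {..<L}" "c' \<in> {..<d} \<rightarrow>\<^sub>E {..<L}" "c \<noteq> c'"
  shows "card {(p0, p) \<in> residue_box P \<times> ({..<d} \<rightarrow>\<^sub>E residue_box P). gap_point P d p0 p c \<in> Y \<and> gap_point P d p0 p c' \<in> Y}
     \<le> card Y ^ 2 * (P ^ CARD('n)) ^ (d - 1)"
proof -
  obtain i where i: "i < d" "c i \<noteq> c' i" using c by (metis PiE_ext lessThan_iff)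
  let ?W = "{(p0, p) \<in> residue_box P \<times> ({..<d} \<rightarrow>\<^sub>E residue_box P). gap_point P d p0 p c \<in> Y \<and> gap_point P d p0 p c' \<in> Y}"
  let ?f = "\<lambda>(p0, p). ((gap_point P d p0 p c, gap_point P d p0 p c'), restrict p ({..<d} - {i}))"
  have "inj_on ?f ?W"
  proof (rule inj_onI, clarify)
    fix p0 p0' and p p' :: "nat \<Rightarrow> 'n \<Rightarrow> int"
    assume a: "p0 \<in> residue_box P" "p \<in> {..<d} \<rightarrow>\<^sub>E residue_box P" "p0' \<in> residue_box P" "p' \<in> {..<d} \<rightarrow>\<^sub>E residue_box P"
      and eq: "gap_point P d p0 p c = gap_point P d p0' p' c" "gap_point P d p0 p c' = gap_point P d p0' p' c'"
      and rs: "restrict p ({..<d} - {i}) = restrict p' ({..<d} - {i})"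
    have "p j = p' j" if "j < d" "j \<noteq> i" for j using fun_cong[OF rs, of j] that by simp
    then show "p0 = p0' \<and> p = p'"
      using gap_point_pair_injective[OF P L _ _ i a(1,3,2,4) eq] c by (auto simp: PiE_iff)
  qed
  moreover have "?f ` ?W \<subseteq> (Y \<times> Y) \<times> (({..<d} - {i}) \<rightarrow>\<^sub>E residue_box P)"
    by (auto simp: PiE_iff split: if_split_asm)
  moreover have fY: "finite Y" by (rule finite_subset[OF Y]) simp
  moreover have "finite ((Y \<times> Y) \<times> (({..<d} - {i}) \<rightarrow>\<^sub>E (residue_box P :: ('n \<Rightarrow> int) set)))"
    using fY by (intro finite_cartesian_product finite_PiE) auto
  ultimately have "card ?W \<le> card ((Y \<times> Y) \<times> (({..<d} - {i}) \<rightarrow>\<^sub>E (residue_box P :: ('n \<Rightarrow> int) set)))"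
    by (intro card_inj_on_le)
  also have "\<dots> = card Y ^ 2 * (P ^ CARD('n)) ^ (d - 1)"
    using i(1) by (simp add: card_cartesian_product card_PiE card_residue_box power2_eq_square)
  finally show ?thesis .
qed

lemma card_gap_single:
  fixes Y :: "('n::finite \<Rightarrow> int) set"
  assumes P: "P > 0" and Y: "Y \<subseteq> residue_box P"
  shows "card {(p0, p) \<in> residue_box P \<times> ({..<d} \<rightarrow>\<^sub>E residue_box P). gap_point P d p0 p c \<in> Y}
     = card Y * (P ^ CARD('n)) ^ d"
proof -
  have eq: "{(p0, p) \<in> residue_box P \<times> ({..<d} \<rightarrow>\<^sub>E residue_box P). gap_point P d p0 p c \<in> Y} =
    (\<lambda>(p, p0). (p0, p)) ` (SIGMA p:({..<d} \<rightarrow>\<^sub>E residue_box P). {p0 \<in> residue_box P. gap_point P d p0 p c \<in> Y})"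
    by auto
  have fibre: "card {p0 \<in> residue_box P. gap_point P d p0 p c \<in> Y} = card Y" for p
  proof -
    let ?g = "\<lambda>p0 l. (p0 l + (\<Sum>i<d. int (c i) * p i l)) mod int P"
    have g: "bij_betw ?g (residue_box P) (residue_box P)" by (rule bij_betw_shift_residue_box[OF P])
    have eq: "gap_point P d p0 p c = ?g p0" for p0 by (rule ext) (simp add: gap_point_def)
    have img: "?g ` residue_box P = residue_box P" using g by (simp add: bij_betw_def)
    have im: "?g ` {p0 \<in> residue_box P. gap_point P d p0 p c \<in> Y} = Y"
    proof
      show "?g ` {p0 \<in> residue_box P. gap_point P d p0 p c \<in> Y} \<subseteq> Y" unfolding eq by blast
      show "Y \<subseteq> ?g ` {p0 \<in> residue_box P. gap_point P d p0 p c \<in> Y}"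
      proof
        fix y assume "y \<in> Y"
        then have "y \<in> ?g ` residue_box P" using Y img by blast
        then obtain p0 where p0: "p0 \<in> residue_box P" "y = ?g p0" by (rule imageE)
        then have "p0 \<in> {p0 \<in> residue_box P. gap_point P d p0 p c \<in> Y}"
          using \<open>y \<in> Y\<close> by (simp add: eq)
        then show "y \<in> ?g ` {p0 \<in> residue_box P. gap_point P d p0 p c \<in> Y}"
          using p0(2) by blast
      qed
    qed
    have "inj_on ?g {p0 \<in> residue_box P. gap_point P d p0 p c \<in> Y}"
      using g by (auto simp: bij_betw_def intro: inj_on_subset)
    from card_image[OF this] show ?thesis unfolding im by simp
  qed
  have "card {(p0, p) \<in> residue_box P \<times> ({..<d} \<rightarrow>\<^sub>E residue_box P). gap_point P d p0 p c \<in> Y} =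
    card (SIGMA p:({..<d} \<rightarrow>\<^sub>E residue_box P). {p0 \<in> residue_box P. gap_point P d p0 p c \<in> Y})"
    unfolding eq by (rule card_image) (auto simp: inj_on_def)
  also have "\<dots> = (\<Sum>p\<in>{..<d} \<rightarrow>\<^sub>E (residue_box P :: ('n \<Rightarrow> int) set). card Y)"
    by (subst card_SigmaI) (auto simp: fibre intro!: finite_PiE)
  also have "\<dots> = card Y * (P ^ CARD('n)) ^ d" by (simp add: card_PiE card_residue_box)
  finally show ?thesis .
qed

text \<open>The second moment method: by pairwise independence the number \<open>X\<close> of points of the progression in \<open>Y\<close>
  has variance at most its mean, so it vanishes with probability at most one over its mean.\<close>

lemma card_gap_miss:
  fixes Y :: "('n::finite \<Rightarrow> int) set"
  assumes P: "prime P" and L: "L \<le> P" and d: "d \<ge> 1" and Y: "Y \<subseteq> residue_box P"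
  shows "real (card {(p0, p) \<in> residue_box P \<times> ({..<d} \<rightarrow>\<^sub>E residue_box P). \<forall>c\<in>{..<d} \<rightarrow>\<^sub>E {..<L}. gap_point P d p0 p c \<notin> Y})
     * (real L ^ d * real (card Y)) \<le> (real P ^ CARD('n)) ^ (d + 1) * real P ^ CARD('n)"
proof -
  define \<Omega> where "\<Omega> = (residue_box P :: ('n \<Rightarrow> int) set) \<times> ({..<d} \<rightarrow>\<^sub>E (residue_box P :: ('n \<Rightarrow> int) set))"
  define C where "C = ({..<d} \<rightarrow>\<^sub>E {..<L})"
  define hit where "hit \<omega> c = (case \<omega> of (p0, p) \<Rightarrow> gap_point P d p0 p c \<in> Y)" for \<omega> c
  define X where "X \<omega> = (\<Sum>c\<in>C. of_bool (hit \<omega> c) :: real)" for \<omega>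
  define N where "N = real P ^ CARD('n)"
  define T where "T = N ^ (d + 1)"
  define \<mu> where "\<mu> = real (card Y) / N"
  define M where "M = real L ^ d"
  have P0: "P > 0" using P prime_gt_0_nat by blast
  have N0: "N > 0" using P0 by (simp add: N_def)
  have fin: "finite \<Omega>" "finite C" unfolding \<Omega>_def C_def by (auto intro!: finite_PiE finite_cartesian_product)
  have cardC: "real (card C) = M" by (simp add: C_def card_PiE M_def)
  have card\<Omega>: "real (card \<Omega>) = T" by (simp add: \<Omega>_def card_cartesian_product card_PiE card_residue_box T_def N_def)
  have one: "(\<Sum>\<omega>\<in>\<Omega>. of_bool (hit \<omega> c)) = \<mu> * T" for c
  proof -
    have "(\<Sum>\<omega>\<in>\<Omega>. of_bool (hit \<omega> c)) = real (card {\<omega>\<in>\<Omega>. hit \<omega> c})"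
      using fin(1) by (simp add: sum_of_bool_eq Int_def)
    also have "{\<omega>\<in>\<Omega>. hit \<omega> c} = {(p0, p) \<in> residue_box P \<times> ({..<d} \<rightarrow>\<^sub>E residue_box P). gap_point P d p0 p c \<in> Y}"
      by (auto simp: \<Omega>_def hit_def)
    also have "real (card \<dots>) = \<mu> * T"
      using N0 by (subst card_gap_single[OF P0 Y]) (simp add: \<mu>_def T_def N_def)
    finally show ?thesis .
  qed
  have two: "(\<Sum>\<omega>\<in>\<Omega>. of_bool (hit \<omega> c) * of_bool (hit \<omega> c')) \<le> (if c = c' then \<mu> * T else 0) + \<mu>\<^sup>2 * T"
    if c: "c \<in> C" "c' \<in> C" for c c'
  proof (cases "c = c'")
    case True
    have "(\<Sum>\<omega>\<in>\<Omega>. of_bool (hit \<omega> c) * of_bool (hit \<omega> c')) = \<mu> * T"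
      using one[of c] True by (simp add: of_bool_conj[symmetric] del: of_bool_conj)
    then show ?thesis using True N0 by (simp add: T_def)
  next
    case False
    have "(\<Sum>\<omega>\<in>\<Omega>. of_bool (hit \<omega> c) * of_bool (hit \<omega> c')) = real (card {\<omega>\<in>\<Omega>. hit \<omega> c \<and> hit \<omega> c'})"
      using fin(1) by (simp add: of_bool_conj[symmetric] sum_of_bool_eq Int_def del: of_bool_conj)
    also have "{\<omega>\<in>\<Omega>. hit \<omega> c \<and> hit \<omega> c'} = {(p0, p) \<in> residue_box P \<times> ({..<d} \<rightarrow>\<^sub>E residue_box P). gap_point P d p0 p c \<in> Y \<and> gap_point P d p0 p c' \<in> Y}"
      by (auto simp: \<Omega>_def hit_def)
    also have "real (card \<dots>) \<le> real (card Y ^ 2 * (P ^ CARD('n)) ^ (d - 1))"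
      using c False by (intro of_nat_mono card_gap_pair_le[OF P L Y]) (auto simp: C_def)
    also have "\<dots> = \<mu>\<^sup>2 * T"
    proof -
      have "N ^ (d + 1) = N ^ (d - 1) * N\<^sup>2" using d by (simp add: power_add[symmetric])
      then show ?thesis using N0 by (simp add: \<mu>_def T_def N_def[symmetric] power_divide)
    qed
    finally show ?thesis using False by simp
  qed
  have sumX: "(\<Sum>\<omega>\<in>\<Omega>. X \<omega>) = M * (\<mu> * T)"
    unfolding X_def by (subst sum.swap) (simp add: one cardC)
  have "(\<Sum>\<omega>\<in>\<Omega>. (X \<omega>)\<^sup>2) = (\<Sum>c\<in>C. \<Sum>c'\<in>C. \<Sum>\<omega>\<in>\<Omega>. of_bool (hit \<omega> c) * of_bool (hit \<omega> c'))"
    unfolding X_def power2_eq_square sum_product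
    by (subst sum.swap, rule sum.cong[OF refl], subst sum.swap, rule refl)
  also have "\<dots> \<le> (\<Sum>c\<in>C. \<Sum>c'\<in>C. (if c = c' then \<mu> * T else 0) + \<mu>\<^sup>2 * T)"
    by (intro sum_mono two)
  also have "\<dots> = M * (\<mu> * T) + M\<^sup>2 * (\<mu>\<^sup>2 * T)"
    using fin(2) by (simp add: sum.distrib cardC power2_eq_square algebra_simps)
  finally have sumX2: "(\<Sum>\<omega>\<in>\<Omega>. (X \<omega>)\<^sup>2) \<le> M * (\<mu> * T) + M\<^sup>2 * (\<mu>\<^sup>2 * T)" .
  have "(\<Sum>\<omega>\<in>\<Omega>. (X \<omega> - M * \<mu>)\<^sup>2) = (\<Sum>\<omega>\<in>\<Omega>. (X \<omega>)\<^sup>2) - 2 * (M * \<mu>) * (\<Sum>\<omega>\<in>\<Omega>. X \<omega>) + (M * \<mu>)\<^sup>2 * T"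
    by (simp add: power2_diff sum.distrib sum_subtractf sum_distrib_left sum_distrib_right card\<Omega> algebra_simps)
  also have "\<dots> \<le> M * \<mu> * T" using sumX2 unfolding sumX by (simp add: power2_eq_square algebra_simps)
  finally have var: "(\<Sum>\<omega>\<in>\<Omega>. (X \<omega> - M * \<mu>)\<^sup>2) \<le> M * \<mu> * T" .
  define miss where "miss = {\<omega>\<in>\<Omega>. \<forall>c\<in>C. \<not> hit \<omega> c}"
  have "real (card miss) * (M * \<mu>)\<^sup>2 = (\<Sum>\<omega>\<in>miss. (X \<omega> - M * \<mu>)\<^sup>2)"
    by (simp add: miss_def X_def)
  also have "\<dots> \<le> (\<Sum>\<omega>\<in>\<Omega>. (X \<omega> - M * \<mu>)\<^sup>2)"
    using fin by (intro sum_mono2) (auto simp: miss_def)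
  finally have *: "real (card miss) * (M * \<mu>)\<^sup>2 \<le> M * \<mu> * T" using var by linarith
  have "real (card miss) * (M * \<mu>) \<le> T"
  proof (cases "M * \<mu> = 0")
    case True
    then have "real (card miss) * (M * \<mu>) = 0" by simp
    also have "0 \<le> T" using N0 by (simp add: T_def)
    finally show ?thesis .
  next
    case False
    moreover have "M * \<mu> \<ge> 0" using N0 by (simp add: M_def \<mu>_def)
    ultimately have "M * \<mu> > 0" by linarith
    moreover have "(M * \<mu>) * (real (card miss) * (M * \<mu>)) \<le> (M * \<mu>) * T"
      using * by (simp add: power2_eq_square algebra_simps)
    ultimately show ?thesis by (meson mult_le_cancel_left_pos)
  qed
  moreover have "miss = {(p0, p) \<in> residue_box P \<times> ({..<d} \<rightarrow>\<^sub>E residue_box P). \<forall>c\<in>{..<d} \<rightarrow>\<^sub>E {..<L}. gap_point P d p0 p c \<notin> Y}"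
    by (auto simp: miss_def \<Omega>_def hit_def C_def)
  ultimately show ?thesis using N0 by (simp add: M_def \<mu>_def T_def N_def[symmetric] field_simps)
qed

text \<open>A random choice of base point and generators works: half of the targets \<open>Y q\<close> are hit with probability at least
  \<open>3 / 4\<close>, by \<open>card_gap_miss\<close> and Markov's inequality, and no tube is crowded with probability at
  least \<open>3 / 4\<close>.\<close>

theorem exists_good_generators:
  fixes Y :: "'q \<Rightarrow> ('n::finite \<Rightarrow> int) set"
  assumes prime: "prime P" and L: "L \<le> P" and d: "d \<ge> 1"
    and Q: "finite Q" "\<And>q. q \<in> Q \<Longrightarrow> Y q \<subseteq> residue_box P" 
      "\<And>q. q \<in> Q \<Longrightarrow> 8 * real P ^ CARD('n) \<le> real L ^ d * real (card (Y q))"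
    and P: "(real R + 1) / \<eta> \<le> real P" and R: "R \<ge> 1"
    and \<eta>: "0 < \<eta>" "13 * real (CARD('n) + d) * \<eta> \<le> 1"
    and I: "(2 / 3) ^ I * real R < 1"
    and \<eta>2: "(2 * real R + 1) * real I * (26 * real (CARD('n) + d) * \<eta>) ^ d \<le> 1"
    and H: "4 * (8 * real R + 1) ^ CARD('n) * (real (CARD('n) + d) + 1) * 4 ^ d * (2 / 3) ^ (d * H) \<le> 1"
  shows "\<exists>p0 p. real (card Q) \<le> 2 * real (card {q\<in>Q. \<exists>c\<in>{..<d} \<rightarrow>\<^sub>E {..<L}. gap_point P d p0 p c \<in> Y q}) \<and>
     (\<forall>a u. u a = 1 \<and> (\<forall>l. \<bar>u l\<bar> \<le> 1) \<longrightarrow> card (tube_points P \<eta> d p R a u) \<le> 3 ^ (H + (CARD('n) + d)))"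
proof (cases "Q = {}")
  case True
  define \<Omega>1 where "\<Omega>1 = ({..<d} \<rightarrow>\<^sub>E (residue_box P :: ('n \<Rightarrow> int) set))"
  define bad where "bad = {p \<in> \<Omega>1. \<exists>a u. u a = 1 \<and> (\<forall>l. \<bar>u l\<bar> \<le> 1) \<and>
      3 ^ (H + (CARD('n) + d)) < card (tube_points P \<eta> d p R a u)}"
  have "4 * real (card bad) \<le> (real P ^ CARD('n)) ^ d"
    unfolding bad_def \<Omega>1_def by (rule card_crowded_generators[OF P R \<eta> I \<eta>2 H])
  moreover have "real (card \<Omega>1) = (real P ^ CARD('n)) ^ d" by (simp add: \<Omega>1_def card_PiE card_residue_box)
  moreover have "(real P ^ CARD('n)) ^ d > 0" using prime prime_gt_0_nat by simp
  ultimately have "card bad < card \<Omega>1" by linarith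
  then have "bad \<noteq> \<Omega>1" by auto
  moreover have "bad \<subseteq> \<Omega>1" by (auto simp: bad_def)
  ultimately obtain p where "p \<in> \<Omega>1" "p \<notin> bad" by blast
  then show ?thesis using True
    by (intro exI[of _ "\<lambda>_. 0"] exI[of _ p]) (auto simp: bad_def not_less)
next
  case False
  define V where "V = (residue_box P :: ('n \<Rightarrow> int) set)"
  define \<Omega>1 where "\<Omega>1 = ({..<d} \<rightarrow>\<^sub>E V)"
  define \<Omega> where "\<Omega> = V \<times> \<Omega>1"
  define N where "N = real P ^ CARD('n)"
  define T where "T = N ^ (d + 1)"
  define hit where "hit \<omega> q = (\<exists>c\<in>{..<d} \<rightarrow>\<^sub>E {..<L}. gap_point P d (fst \<omega>) (snd \<omega>) c \<in> Y q)" for \<omega> q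
  define bad1 where "bad1 = {\<omega>\<in>\<Omega>. real (card {q\<in>Q. hit \<omega> q}) < real (card Q) / 2}"
  define bad where "bad = {p \<in> \<Omega>1. \<exists>a u. u a = 1 \<and> (\<forall>l. \<bar>u l\<bar> \<le> 1) \<and>
      3 ^ (H + (CARD('n) + d)) < card (tube_points P \<eta> d p R a u)}"
  have N0: "N > 0" using prime prime_gt_0_nat by (simp add: N_def)
  have T0: "T > 0" using N0 by (simp add: T_def)
  have finV: "finite V" by (simp add: V_def)
  have fin: "finite \<Omega>" "finite \<Omega>1" unfolding \<Omega>_def \<Omega>1_def using finV by (auto intro!: finite_PiE)
  have card1: "real (card V) = N" by (simp add: V_def card_residue_box N_def)
  then have card2: "real (card \<Omega>) = T" by (simp add: \<Omega>_def \<Omega>1_def card_cartesian_product card_PiE T_def)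
  have bad4: "4 * real (card bad) \<le> N ^ d"
    unfolding bad_def \<Omega>1_def V_def N_def by (rule card_crowded_generators[OF P R \<eta> I \<eta>2 H])
  have miss: "8 * real (card {\<omega>\<in>\<Omega>. \<not> hit \<omega> q}) \<le> T" if q: "q \<in> Q" for q
  proof -
    have eq: "{\<omega>\<in>\<Omega>. \<not> hit \<omega> q} = {(p0, p) \<in> residue_box P \<times> ({..<d} \<rightarrow>\<^sub>E residue_box P). \<forall>c\<in>{..<d} \<rightarrow>\<^sub>E {..<L}. gap_point P d p0 p c \<notin> Y q}"
      by (auto simp: \<Omega>_def \<Omega>1_def V_def hit_def)
    have "real (card {\<omega>\<in>\<Omega>. \<not> hit \<omega> q}) * (8 * N) \<le> real (card {\<omega>\<in>\<Omega>. \<not> hit \<omega> q}) * (real L ^ d * real (card (Y q)))"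
      using Q(3)[OF q] by (intro mult_left_mono) (auto simp: N_def)
    also have "\<dots> \<le> T * N"
      unfolding eq T_def N_def by (rule card_gap_miss[OF prime L d Q(2)[OF q]])
    finally have "N * (8 * real (card {\<omega>\<in>\<Omega>. \<not> hit \<omega> q})) \<le> N * T" by (simp add: algebra_simps)
    then show ?thesis using N0 by (meson mult_le_cancel_left_pos)
  qed
  have "real (card bad1) * (real (card Q) / 2) \<le> (\<Sum>\<omega>\<in>bad1. real (card {q\<in>Q. \<not> hit \<omega> q}))"
  proof -
    have "real (card Q) / 2 \<le> real (card {q\<in>Q. \<not> hit \<omega> q})" if "\<omega> \<in> bad1" for \<omega>
    proof -
      have "card Q = card {q\<in>Q. hit \<omega> q} + card {q\<in>Q. \<not> hit \<omega> q}"
        using Q(1) by (subst card_Un_disjoint[symmetric]) (auto intro!: arg_cong[of _ _ card])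
      then show ?thesis using that by (simp add: bad1_def)
    qed
    then show ?thesis using sum_mono[of bad1 "\<lambda>_. real (card Q) / 2"] by simp
  qed
  also have "\<dots> \<le> (\<Sum>\<omega>\<in>\<Omega>. real (card {q\<in>Q. \<not> hit \<omega> q}))"
    using fin by (intro sum_mono2) (auto simp: bad1_def)
  also have "\<dots> = (\<Sum>\<omega>\<in>\<Omega>. \<Sum>q\<in>Q. of_bool (\<not> hit \<omega> q))"
    using Q(1) by (simp add: sum_of_bool_eq Int_def)
  also have "\<dots> = (\<Sum>q\<in>Q. real (card {\<omega>\<in>\<Omega>. \<not> hit \<omega> q}))"
    using fin(1) by (subst sum.swap) (simp add: sum_of_bool_eq Int_def)
  also have "\<dots> \<le> (\<Sum>q\<in>Q. T / 8)" using miss by (intro sum_mono) (auto simp: field_simps)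
  finally have "real (card Q) * (real (card bad1) * 4) \<le> real (card Q) * T" by (simp add: algebra_simps)
  moreover have "real (card Q) > 0" using False Q(1) by (simp add: card_gt_0_iff)
  ultimately have bad1: "real (card bad1) * 4 \<le> T" by (meson mult_le_cancel_left_pos)
  have "real (card (V \<times> bad)) * 4 \<le> T"
  proof -
    have "real (card (V \<times> bad)) * 4 = N * (4 * real (card bad))" by (simp add: card_cartesian_product card1)
    also have "\<dots> \<le> N * N ^ d" using bad4 N0 by (intro mult_left_mono) auto
    finally show ?thesis by (simp add: T_def)
  qed
  then have "real (card bad1) + real (card (V \<times> bad)) < real (card \<Omega>)" using bad1 T0 card2 by linarith
  moreover have "card (bad1 \<union> V \<times> bad) \<le> card bad1 + card (V \<times> bad)" by (rule card_Un_le)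
  ultimately have "card (bad1 \<union> V \<times> bad) < card \<Omega>" by linarith
  then have "\<not> \<Omega> \<subseteq> bad1 \<union> V \<times> bad"
    using card_mono[of "bad1 \<union> V \<times> bad" \<Omega>] fin finV by (auto simp: bad1_def bad_def)
  then obtain p0 p where w: "(p0, p) \<in> \<Omega>" "(p0, p) \<notin> bad1" "p \<notin> bad" by (auto simp: \<Omega>_def)
  have "real (card Q) \<le> 2 * real (card {q\<in>Q. hit (p0, p) q})" using w by (auto simp: bad1_def not_less)
  moreover have "\<forall>a u. u a = 1 \<and> (\<forall>l. \<bar>u l\<bar> \<le> 1) \<longrightarrow> card (tube_points P \<eta> d p R a u) \<le> 3 ^ (H + (CARD('n) + d))"
    using w by (auto simp: bad_def \<Omega>_def not_less)
  ultimately show ?thesis unfolding hit_def by auto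
qed

section \<open>From well distributed points to functions and weights\<close>

subsection \<open>The X-ray transform of a union of small balls\<close>

lemma affine_line_parametrization:
  fixes l :: "(real^'n::finite) set"
  assumes "l \<in> affine_lines"
  obtains a v where "norm v = 1" "l = range (\<lambda>t::real. a + t *\<^sub>R v)"
proof -
  have l: "affine l" "aff_dim l = 1" using assms by (auto simp: affine_lines_def)
  then have "l \<noteq> {}" by auto
  then obtain a where a: "a \<in> l" by blast
  define V where "V = (\<lambda>x. - a + x) ` l"
  have V: "subspace V" unfolding V_def using affine_diffs_subspace_subtract[OF l(1) a] by simp
  have "aff_dim V = 1" unfolding V_def by (simp only: aff_dim_translation_eq l(2))
  then have dimV: "dim V = 1" using V aff_dim_subspace[OF V] by simp
  then obtain B where B: "B \<subseteq> V" "independent B" "V \<subseteq> span B" "card B = 1"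
    using basis_exists[of V] by metis
  then obtain b where b: "B = {b}" using card_1_singletonE by blast
  have b0: "b \<noteq> 0" using B(2) b dependent_zero by blast
  define v where "v = b /\<^sub>R norm b"
  have "V = span {b}" using B(1,3) V b span_minimal by (metis subset_antisym)
  then have "V = range (\<lambda>t. t *\<^sub>R b)" by (simp add: span_singleton)
  also have "\<dots> = range (\<lambda>t. t *\<^sub>R v)"
  proof
    show "range (\<lambda>t. t *\<^sub>R b) \<subseteq> range (\<lambda>t. t *\<^sub>R v)"
    proof
      fix x assume "x \<in> range (\<lambda>t. t *\<^sub>R b)"
      then obtain t where "x = t *\<^sub>R b" by blast
      then have "x = (t * norm b) *\<^sub>R v" using b0 by (simp add: v_def)
      then show "x \<in> range (\<lambda>t. t *\<^sub>R v)" by blast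
    qed
    show "range (\<lambda>t. t *\<^sub>R v) \<subseteq> range (\<lambda>t. t *\<^sub>R b)"
      by (auto simp: v_def)
  qed
  finally have "V = range (\<lambda>t. t *\<^sub>R v)" .
  moreover have "l = (\<lambda>x. a + x) ` V" by (simp add: V_def image_image)
  ultimately have "l = range (\<lambda>t. a + t *\<^sub>R v)" by (simp add: image_image)
  moreover have "norm v = 1" using b0 by (simp add: v_def)
  ultimately show thesis using that by blast
qed

text \<open>Two arc length parametrizations of the same line differ by a translation and possibly a reflection of the
  parameter.\<close>

lemma xray_eq:
  fixes w :: "real^'n::finite \<Rightarrow> real"
  assumes w: "w \<in> borel_measurable borel" and v: "norm v = 1"
  shows "xray w (range (\<lambda>t::real. a + t *\<^sub>R v)) = (\<integral>\<^sup>+t. ennreal (w (a + t *\<^sub>R v)) \<partial>lborel)"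
  unfolding xray_def
proof (rule the_equality)
  show "\<forall>a' v'. norm v' = 1 \<and> range (\<lambda>t. a + t *\<^sub>R v) = range (\<lambda>t::real. a' + t *\<^sub>R v') \<longrightarrow>
     (\<integral>\<^sup>+t. ennreal (w (a + t *\<^sub>R v)) \<partial>lborel) = (\<integral>\<^sup>+t. ennreal (w (a' + t *\<^sub>R v')) \<partial>lborel)"
  proof (intro allI impI, elim conjE)
    fix a' v' assume v': "norm v' = 1" and eq: "range (\<lambda>t. a + t *\<^sub>R v) = range (\<lambda>t::real. a' + t *\<^sub>R v')"
    have "a' + 0 *\<^sub>R v' \<in> range (\<lambda>t. a + t *\<^sub>R v)" "a' + 1 *\<^sub>R v' \<in> range (\<lambda>t. a + t *\<^sub>R v)" unfolding eq by blast+
    then obtain s s1 where "a' + 0 *\<^sub>R v' = a + s *\<^sub>R v" "a' + 1 *\<^sub>R v' = a + s1 *\<^sub>R v" by blast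
    then have s: "a' = a + s *\<^sub>R v" "a' + v' = a + s1 *\<^sub>R v" by simp_all
    define c where "c = s1 - s"
    have vc: "v' = c *\<^sub>R v" using s by (simp add: c_def algebra_simps)
    then have c: "\<bar>c\<bar> = 1" using v v' by simp
    have m: "(\<lambda>t. ennreal (w (a + t *\<^sub>R v))) \<in> borel_measurable borel"
    proof -
      have "(\<lambda>t::real. a + t *\<^sub>R v) \<in> borel_measurable borel"
        by (intro borel_measurable_continuous_onI continuous_intros)
      from measurable_compose[OF measurable_compose[OF this w] measurable_ennreal] show ?thesis .
    qed
    have "(\<integral>\<^sup>+t. ennreal (w (a + t *\<^sub>R v)) \<partial>lborel) = \<bar>c\<bar> * (\<integral>\<^sup>+t. ennreal (w (a + (s + c * t) *\<^sub>R v)) \<partial>lborel)"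
      by (rule nn_integral_real_affine) (use m c in auto)
    also have "\<dots> = (\<integral>\<^sup>+t. ennreal (w (a' + t *\<^sub>R v')) \<partial>lborel)"
      using c by (simp add: s(1) vc scaleR_add_left add.assoc mult.commute)
    finally show "(\<integral>\<^sup>+t. ennreal (w (a + t *\<^sub>R v)) \<partial>lborel) = (\<integral>\<^sup>+t. ennreal (w (a' + t *\<^sub>R v')) \<partial>lborel)" .
  qed
qed (use v in blast)

text \<open>A line meets a ball of radius \<open>\<rho>\<close> in a segment of length at most \<open>2 * \<rho>\<close>.\<close>

lemma xray_sup_norm_balls_le:
  fixes Z :: "(real^'n::finite) set"
  assumes Z: "finite Z" and \<rho>: "0 < \<rho>"
    and lines: "\<And>a v. norm v = 1 \<Longrightarrow> real (card {z\<in>Z. \<exists>t::real. norm (a + t *\<^sub>R v - z) < \<rho>}) \<le> M"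
  shows "xray_sup_norm (\<lambda>x. indicator (\<Union>z\<in>Z. ball z \<rho>) x) \<le> ennreal (2 * \<rho> * M)"
  unfolding xray_sup_norm_def
proof (rule SUP_least)
  fix l :: "(real^'n) set" assume "l \<in> affine_lines"
  then obtain a v where v: "norm v = 1" and l: "l = range (\<lambda>t::real. a + t *\<^sub>R v)"
    by (rule affine_line_parametrization)
  define Zl where "Zl = {z\<in>Z. \<exists>t::real. norm (a + t *\<^sub>R v - z) < \<rho>}"
  define I where "I z = {v \<bullet> (z - a) - \<rho>..v \<bullet> (z - a) + \<rho>}" for z
  have wm: "(\<lambda>x :: real^'n. indicator (\<Union>z\<in>Z. ball z \<rho>) x :: real) \<in> borel_measurable borel"
    by (intro borel_measurable_indicator borel_open open_UN) auto
  have "xray (\<lambda>x. indicator (\<Union>z\<in>Z. ball z \<rho>) x) l = (\<integral>\<^sup>+t. ennreal (indicator (\<Union>z\<in>Z. ball z \<rho>) (a + t *\<^sub>R v)) \<partial>lborel)"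
    unfolding l by (rule xray_eq[OF wm v])
  also have "\<dots> \<le> (\<integral>\<^sup>+t. (\<Sum>z\<in>Zl. indicator (I z) t) \<partial>lborel)"
  proof (rule nn_integral_mono)
    fix t :: real
    show "ennreal (indicator (\<Union>z\<in>Z. ball z \<rho>) (a + t *\<^sub>R v)) \<le> (\<Sum>z\<in>Zl. indicator (I z) t)"
    proof (cases "a + t *\<^sub>R v \<in> (\<Union>z\<in>Z. ball z \<rho>)")
      case True
      then obtain z where z: "z \<in> Z" "norm (a + t *\<^sub>R v - z) < \<rho>" by (auto simp: dist_norm norm_minus_commute)
      then have zl: "z \<in> Zl" by (auto simp: Zl_def)
      have "v \<bullet> v = 1" using v by (simp add: norm_eq_1)
      then have "t - v \<bullet> (z - a) = v \<bullet> (a + t *\<^sub>R v - z)" by (simp add: inner_add_right inner_diff_right)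
      then have "\<bar>t - v \<bullet> (z - a)\<bar> \<le> norm (a + t *\<^sub>R v - z)" using Cauchy_Schwarz_ineq2[of v "a + t *\<^sub>R v - z"] v by simp
      then have "t \<in> I z" using z(2) unfolding I_def by auto
      then have "(1 :: ennreal) = indicator (I z) t" by simp
      also have "\<dots> \<le> (\<Sum>z\<in>Zl. indicator (I z) t)" 
        using Z zl by (intro member_le_sum) (auto simp: Zl_def)
      finally show ?thesis using True by simp
    qed simp
  qed
  also have "\<dots> = (\<Sum>z\<in>Zl. emeasure lborel (I z))"
    by (subst nn_integral_sum) (auto simp: I_def)
  also have "\<dots> = (\<Sum>z\<in>Zl. ennreal (2 * \<rho>))" using \<rho> by (simp add: I_def)
  also have "\<dots> = ennreal (real (card Zl) * (2 * \<rho>))" using \<rho> by (simp add: ennreal_mult ennreal_of_nat_eq_real_of_nat)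
  also have "\<dots> \<le> ennreal (2 * \<rho> * M)"
    using lines[OF v, of a] \<rho> by (intro ennreal_leI) (simp add: Zl_def mult.commute)
  finally show "xray (\<lambda>x. indicator (\<Union>z\<in>Z. ball z \<rho>) x) l \<le> ennreal (2 * \<rho> * M)" .
qed

subsection \<open>Aligned phases\<close>

lemma norm_cis_diff: "cmod (cis s - cis t) \<le> \<bar>s - t\<bar>"
proof -
  have "cis s - cis t = cis t * (cis (s - t) - 1)" by (simp add: cis_mult right_diff_distrib)
  then have "cmod (cis s - cis t) = cmod (cis (s - t) - 1)" by (simp add: norm_mult)
  then show ?thesis using norm_cis_minus_1 by simp
qed

lemma fourier_extension_cis:
  "fourier_extension \<sigma> f x = (\<integral>y. cis (2 * pi * (x \<bullet> y)) * f y \<partial>\<sigma>)"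
  unfolding fourier_extension_def cis_conv_exp by (simp add: mult_ac)

lemma cis_inner_measurable:
  fixes x :: "real^'n::finite"
  shows "(\<lambda>y. cis (2 * pi * (x \<bullet> y))) \<in> borel_measurable borel"
  by (intro borel_measurable_continuous_onI) (auto intro!: continuous_intros simp: cis_conv_exp)

text \<open>The function \<open>f\<close> puts mass one on each cap, and the weight is the indicator of the \<open>\<rho>\<close>-neighbourhood of \<open>Z\<close>.
  Three errors of size \<open>1 / 8\<close> occur in the phases: the alignment at \<open>z\<close>, the motion from \<open>z\<close> to a point
  at distance \<open>\<rho>\<close>, and the motion from \<open>y q\<close> to a point of the cap. They leave at least half of the sum of
  \<open>card Q\<close> terms of modulus one.\<close>

lemma aligned_counterexample:
  fixes \<sigma> :: "(real^'n::finite) measure" and y :: "'q \<Rightarrow> real^'n"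
  assumes \<sigma>: "sets \<sigma> = sets borel" and Q: "finite Q" "Q \<noteq> {}"
    and cap: "\<And>q. q \<in> Q \<Longrightarrow> cap q \<in> sets borel" "\<And>q. q \<in> Q \<Longrightarrow> cap q \<subseteq> ball (y q) r" "disjoint_family_on cap Q"
    and v: "0 < v" "\<And>q. q \<in> Q \<Longrightarrow> ennreal v \<le> emeasure \<sigma> (cap q)" "\<And>q. q \<in> Q \<Longrightarrow> emeasure \<sigma> (cap q) < \<infinity>"
    and Z: "finite Z" "\<And>z. z \<in> Z \<Longrightarrow> norm z + \<rho> \<le> R" "\<And>z z'. z \<in> Z \<Longrightarrow> z' \<in> Z \<Longrightarrow> z \<noteq> z' \<Longrightarrow> 2 * \<rho> \<le> norm (z - z')"
    and \<rho>: "0 < \<rho>"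
    and phase: "\<And>z. z \<in> Z \<Longrightarrow> \<exists>\<omega>. cmod \<omega> = 1 \<and> (\<forall>q\<in>Q. cmod (cis (2 * pi * (z \<bullet> y q)) - \<omega>) \<le> 1 / 8)"
    and B: "\<And>q. q \<in> Q \<Longrightarrow> norm (y q) \<le> B" "2 * pi * (\<rho> * B) \<le> 1 / 8" "2 * pi * (R * r) \<le> 1 / 8" "0 \<le> R"
    and lines: "\<And>a v. norm v = 1 \<Longrightarrow> real (card {z\<in>Z. \<exists>t::real. norm (a + t *\<^sub>R v - z) < \<rho>}) \<le> M"
  shows "\<exists>f w. f \<in> square_integrable \<sigma> \<and> w \<in> borel_measurable borel \<and> (\<forall>x. 0 \<le> w x) \<and>
     (\<forall>x. x \<notin> ball 0 R \<longrightarrow> w x = 0) \<and> xray_sup_norm w \<le> ennreal (2 * \<rho> * M) \<and>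
     L2_norm_sq \<sigma> f \<le> ennreal (real (card Q) / v) \<and>
     ennreal ((real (card Q) / 2)\<^sup>2 * (real (card Z) * measure lborel (ball (0::real^'n) \<rho>))) \<le> weighted_L2_norm_sq w (fourier_extension \<sigma> f) \<and>
     weighted_L2_norm_sq w (fourier_extension \<sigma> f) < \<infinity>"
proof -
  define N where "N = real (card Q)"
  define m where "m q = measure \<sigma> (cap q)" for q
  have em: "emeasure \<sigma> (cap q) = ennreal (m q)" if "q \<in> Q" for q
    unfolding m_def using v(3)[OF that] by (simp add: emeasure_eq_ennreal_measure less_top[symmetric])
  have mv: "v \<le> m q" if "q \<in> Q" for q
  proof -
    have "ennreal v \<le> ennreal (m q)" using v(2)[OF that] by (simp add: em[OF that])
    then show ?thesis by (simp add: m_def ennreal_le_iff)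
  qed
  have m0: "m q > 0" if "q \<in> Q" for q using mv[OF that] v(1) by linarith
  have caps: "cap q \<in> sets \<sigma>" if "q \<in> Q" for q using cap(1)[OF that] \<sigma> by simp
  define f where "f y = (\<Sum>q\<in>Q. complex_of_real (indicator (cap q) y / m q))" for y
  have bm: "borel_measurable \<sigma> = borel_measurable (borel :: (real^'n) measure)" 
    by (rule measurable_cong_sets) (simp_all add: \<sigma>)
  have f_eq: "f y = complex_of_real (1 / m q)" if "q \<in> Q" "y \<in> cap q" for q y
  proof -
    have "indicator (cap q') y / m q' = (if q' = q then 1 / m q else 0)" if "q' \<in> Q" for q'
      using cap(3) \<open>q \<in> Q\<close> \<open>y \<in> cap q\<close> that by (auto simp: disjoint_family_on_def indicator_def)
    then have "f y = (\<Sum>q'\<in>Q. complex_of_real (if q' = q then 1 / m q else 0))"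
      unfolding f_def by (intro sum.cong) auto
    also have "\<dots> = (\<Sum>q'\<in>Q. if q' = q then complex_of_real (1 / m q) else 0)"
      by (intro sum.cong) auto
    also have "\<dots> = complex_of_real (1 / m q)" using Q(1) that(1) by (simp add: sum.delta')
    finally show ?thesis .
  qed
  have f_sq: "(cmod (f y))\<^sup>2 = (\<Sum>q\<in>Q. indicator (cap q) y * (1 / m q)\<^sup>2)" for y
  proof (cases "\<exists>q\<in>Q. y \<in> cap q")
    case True
    then obtain q where q: "q \<in> Q" "y \<in> cap q" by blast
    have "(\<Sum>q'\<in>Q. indicator (cap q') y * (1 / m q')\<^sup>2) = (\<Sum>q'\<in>Q. if q' = q then (1 / m q)\<^sup>2 else 0)"
      using cap(3) q by (intro sum.cong) (auto simp: disjoint_family_on_def indicator_def)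
    also have "\<dots> = (1 / m q)\<^sup>2" using Q(1) q(1) by (simp add: sum.delta')
    finally show ?thesis using m0[OF q(1)] by (simp add: f_eq[OF q] norm_divide)
  next
    case False
    then show ?thesis by (simp add: f_def)
  qed
  have fm: "f \<in> borel_measurable \<sigma>" unfolding f_def[abs_def] using caps by measurable
  have int_ind: "integrable \<sigma> (indicator (cap q) :: _ \<Rightarrow> real)" if "q \<in> Q" for q
    using caps[OF that] v(3)[OF that] by (simp add: integrable_indicator_iff)
  have "integrable \<sigma> (\<lambda>y. (cmod (f y))\<^sup>2)"
    unfolding f_sq using int_ind by auto
  then have L2f: "f \<in> square_integrable \<sigma>"
    unfolding square_integrable_def using fm by simp
  have "L2_norm_sq \<sigma> f = (\<Sum>q\<in>Q. \<integral>\<^sup>+y. ennreal (indicator (cap q) y * (1 / m q)\<^sup>2) \<partial>\<sigma>)"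
    unfolding L2_norm_sq_def f_sq using caps Q(1)
    by (subst nn_integral_sum[symmetric]) (auto intro!: nn_integral_cong simp: sum_ennreal)
  also have "\<dots> = (\<Sum>q\<in>Q. ennreal (1 / m q))"
  proof (rule sum.cong[OF refl])
    fix q assume q: "q \<in> Q"
    have "(\<integral>\<^sup>+y. ennreal (indicator (cap q) y * (1 / m q)\<^sup>2) \<partial>\<sigma>) = (\<integral>\<^sup>+y. ennreal ((1 / m q)\<^sup>2) * indicator (cap q) y \<partial>\<sigma>)"
      by (intro nn_integral_cong) (auto simp: indicator_def)
    also have "\<dots> = ennreal ((1 / m q)\<^sup>2) * ennreal (m q)" using caps[OF q] em[OF q] by (simp add: nn_integral_cmult_indicator)
    also have "\<dots> = ennreal (1 / m q)" using m0[OF q] by (subst ennreal_mult[symmetric]) (simp_all add: power2_eq_square)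
    finally show "(\<integral>\<^sup>+y. ennreal (indicator (cap q) y * (1 / m q)\<^sup>2) \<partial>\<sigma>) = ennreal (1 / m q)" .
  qed
  also have "\<dots> \<le> (\<Sum>q\<in>Q. ennreal (1 / v))"
    using mv v(1) by (intro sum_mono ennreal_leI) (auto intro!: divide_left_mono mult_pos_pos m0)
  also have "\<dots> = ennreal (real (card Q) / v)"
    using v(1) by (simp add: ennreal_of_nat_eq_real_of_nat ennreal_mult[symmetric])
  finally have L2: "L2_norm_sq \<sigma> f \<le> ennreal (real (card Q) / v)" .
  define E where "E = fourier_extension \<sigma> f"
  have int_cis: "integrable \<sigma> (\<lambda>y. indicator (cap q) y *\<^sub>R cis (2 * pi * (x \<bullet> y)))" if "q \<in> Q" for q x
  proof (rule Bochner_Integration.integrable_bound[OF int_ind[OF that]])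
    show "(\<lambda>y. indicator (cap q) y *\<^sub>R cis (2 * pi * (x \<bullet> y))) \<in> borel_measurable \<sigma>"
      using cap(1)[OF that] cis_inner_measurable[of x] unfolding bm by (intro borel_measurable_scaleR borel_measurable_indicator)
  qed (auto simp: indicator_def)
  have E_eq: "E x = (\<Sum>q\<in>Q. (1 / m q) *\<^sub>R (\<integral>y. indicator (cap q) y *\<^sub>R cis (2 * pi * (x \<bullet> y)) \<partial>\<sigma>))" for x
  proof -
    have "E x = (\<integral>y. (\<Sum>q\<in>Q. (1 / m q) *\<^sub>R (indicator (cap q) y *\<^sub>R cis (2 * pi * (x \<bullet> y)))) \<partial>\<sigma>)"
      unfolding E_def fourier_extension_cis
      by (intro Bochner_Integration.integral_cong refl) (simp add: f_def sum_distrib_left scaleR_conv_of_real mult_ac)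
    also have "\<dots> = (\<Sum>q\<in>Q. \<integral>y. (1 / m q) *\<^sub>R (indicator (cap q) y *\<^sub>R cis (2 * pi * (x \<bullet> y))) \<partial>\<sigma>)"
      by (intro Bochner_Integration.integral_sum integrable_scaleR_right int_cis)
    also have "\<dots> = (\<Sum>q\<in>Q. (1 / m q) *\<^sub>R (\<integral>y. indicator (cap q) y *\<^sub>R cis (2 * pi * (x \<bullet> y)) \<partial>\<sigma>))"
      by (simp only: integral_scaleR_right)
    finally show ?thesis .
  qed
  have near: "cmod ((1 / m q) *\<^sub>R (\<integral>y. indicator (cap q) y *\<^sub>R cis (2 * pi * (x \<bullet> y)) \<partial>\<sigma>) - \<omega>) \<le> \<delta>"
    if q: "q \<in> Q" and d: "\<And>y. y \<in> cap q \<Longrightarrow> cmod (cis (2 * pi * (x \<bullet> y)) - \<omega>) \<le> \<delta>" for q x \<omega> \<delta>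
  proof -
    have "(\<integral>y. indicator (cap q) y *\<^sub>R \<omega> \<partial>\<sigma>) = m q *\<^sub>R \<omega>"
      using caps[OF q] v(3)[OF q] by (simp add: m_def)
    then have "(1 / m q) *\<^sub>R (\<integral>y. indicator (cap q) y *\<^sub>R cis (2 * pi * (x \<bullet> y)) \<partial>\<sigma>) - \<omega> =
      (1 / m q) *\<^sub>R ((\<integral>y. indicator (cap q) y *\<^sub>R cis (2 * pi * (x \<bullet> y)) \<partial>\<sigma>) - (\<integral>y. indicator (cap q) y *\<^sub>R \<omega> \<partial>\<sigma>))"
      using m0[OF q] by (simp add: scaleR_diff_right)
    also have "\<dots> = (1 / m q) *\<^sub>R (\<integral>y. indicator (cap q) y *\<^sub>R cis (2 * pi * (x \<bullet> y)) - indicator (cap q) y *\<^sub>R \<omega> \<partial>\<sigma>)"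
      using int_cis[OF q] int_ind[OF q] by (subst Bochner_Integration.integral_diff) auto
    also have "cmod \<dots> \<le> (1 / m q) * (\<integral>y. indicator (cap q) y * \<delta> \<partial>\<sigma>)"
      unfolding norm_scaleR
    proof (rule mult_mono)
      have "cmod (\<integral>y. indicator (cap q) y *\<^sub>R cis (2 * pi * (x \<bullet> y)) - indicator (cap q) y *\<^sub>R \<omega> \<partial>\<sigma>) \<le>
        (\<integral>y. cmod (indicator (cap q) y *\<^sub>R cis (2 * pi * (x \<bullet> y)) - indicator (cap q) y *\<^sub>R \<omega>) \<partial>\<sigma>)"
        by (rule integral_norm_bound)
      also have "\<dots> \<le> (\<integral>y. indicator (cap q) y * \<delta> \<partial>\<sigma>)"
        by (intro integral_mono integrable_norm Bochner_Integration.integrable_diff int_cis[OF q]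
            integrable_scaleR_left integrable_mult_left int_ind[OF q])
          (use d in \<open>auto simp: indicator_def\<close>)
      finally show "cmod (\<integral>y. indicator (cap q) y *\<^sub>R cis (2 * pi * (x \<bullet> y)) - indicator (cap q) y *\<^sub>R \<omega> \<partial>\<sigma>) \<le> (\<integral>y. indicator (cap q) y * \<delta> \<partial>\<sigma>)" .
    qed (use m0[OF q] in auto)
    also have "(\<integral>y. indicator (cap q) y * \<delta> \<partial>\<sigma>) = m q * \<delta>"
      using caps[OF q] v(3)[OF q] int_ind[OF q] by (simp add: m_def)
    also have "1 / m q * (m q * \<delta>) = \<delta>" using m0[OF q] by simp
    finally show ?thesis .
  qed
  have E_le: "cmod (E x) \<le> N" for x
  proof -
    have "cmod (E x) \<le> (\<Sum>q\<in>Q. 1)" unfolding E_eq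
      by (rule sum_norm_le) (use near[of _ x 0 1] in simp)
    then show ?thesis by (simp add: N_def)
  qed
  have E_ge: "N / 2 \<le> cmod (E x)" if z: "z \<in> Z" and x: "x \<in> ball z \<rho>" for x z
  proof -
    obtain \<omega> where \<omega>: "cmod \<omega> = 1" "\<And>q. q \<in> Q \<Longrightarrow> cmod (cis (2 * pi * (z \<bullet> y q)) - \<omega>) \<le> 1 / 8"
      using phase[OF z] by blast
    have xz: "norm (x - z) \<le> \<rho>" using x by (simp add: dist_norm norm_minus_commute)
    have xR: "norm x \<le> R" using xz Z(2)[OF z] norm_triangle_ineq2[of x z] by linarith
    have "cmod ((1 / m q) *\<^sub>R (\<integral>y. indicator (cap q) y *\<^sub>R cis (2 * pi * (x \<bullet> y)) \<partial>\<sigma>) - \<omega>) \<le> 1 / 2" if q: "q \<in> Q" for q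
    proof (rule near[OF q])
      fix y' assume "y' \<in> cap q"
      then have y': "norm (y' - y q) \<le> r" using cap(2)[OF q] by (auto simp: dist_norm norm_minus_commute)
      have "cmod (cis (2 * pi * (x \<bullet> y')) - cis (2 * pi * (x \<bullet> y q))) \<le> 2 * pi * \<bar>x \<bullet> (y' - y q)\<bar>"
        using norm_cis_diff[of "2 * pi * (x \<bullet> y')" "2 * pi * (x \<bullet> y q)"]
        by (simp add: inner_diff_right abs_mult flip: right_diff_distrib)
      also have "\<dots> \<le> 2 * pi * (R * r)"
        using Cauchy_Schwarz_ineq2[of x "y' - y q"] mult_mono[OF xR y' B(4)] by (intro mult_left_mono) auto
      finally have 1: "cmod (cis (2 * pi * (x \<bullet> y')) - cis (2 * pi * (x \<bullet> y q))) \<le> 1 / 8" using B(3) by linarith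
      have "cmod (cis (2 * pi * (x \<bullet> y q)) - cis (2 * pi * (z \<bullet> y q))) \<le> 2 * pi * \<bar>(x - z) \<bullet> y q\<bar>"
        using norm_cis_diff[of "2 * pi * (x \<bullet> y q)" "2 * pi * (z \<bullet> y q)"]
        by (simp add: inner_diff_left abs_mult flip: right_diff_distrib)
      also have "\<dots> \<le> 2 * pi * (\<rho> * B)"
        using Cauchy_Schwarz_ineq2[of "x - z" "y q"] mult_mono[OF xz B(1)[OF q]] \<rho> by (intro mult_left_mono) auto
      finally have 2: "cmod (cis (2 * pi * (x \<bullet> y q)) - cis (2 * pi * (z \<bullet> y q))) \<le> 1 / 8" using B(2) by linarith
      have "cis (2 * pi * (x \<bullet> y')) - \<omega> = (cis (2 * pi * (x \<bullet> y')) - cis (2 * pi * (x \<bullet> y q))) +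
        ((cis (2 * pi * (x \<bullet> y q)) - cis (2 * pi * (z \<bullet> y q))) + (cis (2 * pi * (z \<bullet> y q)) - \<omega>))" by simp
      also have "cmod \<dots> \<le> 1 / 8 + (1 / 8 + 1 / 8)"
        by (intro norm_triangle_mono 1 2 \<omega>(2)[OF q])
      finally show "cmod (cis (2 * pi * (x \<bullet> y')) - \<omega>) \<le> 1 / 2" by simp
    qed
    then have "cmod (\<Sum>q\<in>Q. (1 / m q) *\<^sub>R (\<integral>y. indicator (cap q) y *\<^sub>R cis (2 * pi * (x \<bullet> y)) \<partial>\<sigma>) - \<omega>) \<le> (\<Sum>q\<in>Q. 1 / 2)"
      by (intro sum_norm_le)
    then have "cmod (E x - of_real N * \<omega>) \<le> N / 2"
      by (simp add: E_eq N_def sum_subtractf)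
    moreover have "cmod (of_real N * \<omega>) = N" using \<omega>(1) by (simp add: norm_mult N_def)
    moreover have "cmod (of_real N * \<omega>) \<le> cmod (E x) + cmod (E x - of_real N * \<omega>)"
      by (metis norm_minus_commute norm_triangle_sub)
    ultimately show ?thesis by linarith
  qed
  define W where "W = (\<Union>z\<in>Z. ball z \<rho>)"
  define w where "w x = (indicator W x :: real)" for x
  have Wb: "W \<in> sets borel" unfolding W_def by (intro borel_open open_UN) auto
  have WR: "x \<in> ball 0 R" if "x \<in> W" for x
  proof -
    obtain z where z: "z \<in> Z" "dist z x < \<rho>" using \<open>x \<in> W\<close> by (auto simp: W_def)
    then have "norm x < norm z + \<rho>" using norm_triangle_ineq2[of x z] by (simp add: dist_norm norm_minus_commute)
    then show ?thesis using Z(2)[OF z(1)] by simp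
  qed
  have "emeasure lborel W = (\<Sum>z\<in>Z. emeasure lborel (ball z \<rho>))"
    unfolding W_def
  proof (rule sum_emeasure[symmetric])
    show "disjoint_family_on (\<lambda>z. ball z \<rho>) Z"
      unfolding disjoint_family_on_def
    proof (intro ballI impI)
      fix z z' assume "z \<in> Z" "z' \<in> Z" "z \<noteq> z'"
      then have "2 * \<rho> \<le> dist z z'" using Z(3) by (simp add: dist_norm)
      then show "ball z \<rho> \<inter> ball z' \<rho> = {}" using disjoint_ballI[of \<rho> \<rho> z z'] by simp
    qed
  qed (use Z in auto)
  also have "\<dots> = (\<Sum>z\<in>Z. ennreal (measure lborel (ball (0::real^'n) \<rho>)))"
  proof (rule sum.cong[OF refl])
    fix z :: "real^'n"
    have "emeasure lborel (ball z \<rho>) = emeasure lborel (ball (0::real^'n) \<rho>)"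
      using \<rho> by (simp add: emeasure_ball)
    also have "\<dots> = ennreal (measure lborel (ball (0::real^'n) \<rho>))"
      by (intro emeasure_eq_ennreal_measure) (simp add: emeasure_ball \<rho> less_imp_le ennreal_mult_eq_top_iff)
    finally show "emeasure lborel (ball z \<rho>) = ennreal (measure lborel (ball (0::real^'n) \<rho>))" .
  qed
  also have "\<dots> = ennreal (real (card Z) * measure lborel (ball (0::real^'n) \<rho>))"
    by (simp add: ennreal_of_nat_eq_real_of_nat ennreal_mult)
  finally have volW: "emeasure lborel W = ennreal (real (card Z) * measure lborel (ball (0::real^'n) \<rho>))" .
  have "ennreal ((N / 2)\<^sup>2 * (real (card Z) * measure lborel (ball (0::real^'n) \<rho>))) = (\<integral>\<^sup>+x. ennreal ((N / 2)\<^sup>2) * indicator W x \<partial>lborel)"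
    using Wb by (simp add: nn_integral_cmult_indicator volW ennreal_mult)
  also have "\<dots> \<le> weighted_L2_norm_sq w E"
    unfolding weighted_L2_norm_sq_def
  proof (rule nn_integral_mono)
    fix x
    show "ennreal ((N / 2)\<^sup>2) * indicator W x \<le> ennreal ((cmod (E x))\<^sup>2 * w x)"
    proof (cases "x \<in> W")
      case True
      then have "N / 2 \<le> cmod (E x)" using E_ge by (auto simp: W_def)
      then have "(N / 2)\<^sup>2 \<le> (cmod (E x))\<^sup>2" by (intro power_mono) (auto simp: N_def)
      then show ?thesis using True by (simp add: w_def ennreal_leI)
    qed simp
  qed
  finally have lower: "ennreal ((N / 2)\<^sup>2 * (real (card Z) * measure lborel (ball (0::real^'n) \<rho>))) \<le> weighted_L2_norm_sq w E" .
  have "weighted_L2_norm_sq w E \<le> (\<integral>\<^sup>+x. ennreal (N\<^sup>2) * indicator W x \<partial>lborel)"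
    unfolding weighted_L2_norm_sq_def
  proof (rule nn_integral_mono)
    fix x
    have "(cmod (E x))\<^sup>2 \<le> N\<^sup>2" using E_le by (intro power_mono) auto
    then show "ennreal ((cmod (E x))\<^sup>2 * w x) \<le> ennreal (N\<^sup>2) * indicator W x"
      by (auto simp: w_def indicator_def intro: ennreal_leI)
  qed
  also have "\<dots> < \<infinity>"
    using Wb by (simp add: nn_integral_cmult_indicator volW ennreal_mult_less_top)
  finally have fin: "weighted_L2_norm_sq w E < \<infinity>" .
  have "xray_sup_norm w \<le> ennreal (2 * \<rho> * M)"
    using xray_sup_norm_balls_le[OF Z(1) \<rho> lines] by (simp add: w_def[abs_def] W_def)
  moreover have "w \<in> borel_measurable borel" unfolding w_def[abs_def] using Wb by simp
  moreover have "\<forall>x. x \<notin> ball 0 R \<longrightarrow> w x = 0" using WR by (auto simp: w_def indicator_def)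
  ultimately show ?thesis
    using L2f L2 lower fin by (intro exI[of _ f] exI[of _ w]) (auto simp: E_def N_def w_def)
qed

section \<open>Nodes near a graph and aligned frequencies\<close>

definition int_vec :: "('n::finite \<Rightarrow> int) \<Rightarrow> real^'n" where
  "int_vec z = (\<chi> l. real_of_int (z l))"

lemma int_vec_nth [simp]: "int_vec z $ l = real_of_int (z l)"
  by (simp add: int_vec_def)

lemma inj_int_vec: "inj int_vec"
  by (auto simp: inj_def vec_eq_iff)

lemma card_int_interval:
  fixes lo hi :: real
  shows "(hi - lo) - 1 \<le> real (card {x :: int. lo \<le> of_int x \<and> of_int x \<le> hi})"
proof -
  have eq: "{x :: int. lo \<le> of_int x \<and> of_int x \<le> hi} = {\<lceil>lo\<rceil>..\<lfloor>hi\<rfloor>}"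
    by (auto simp: ceiling_le_iff le_floor_iff)
  show ?thesis unfolding eq by simp linarith
qed

lemma finite_int_interval: "finite {x :: int. (lo::real) \<le> of_int x \<and> of_int x \<le> (hi::real)}"
proof -
  have eq: "{x :: int. lo \<le> of_int x \<and> of_int x \<le> hi} = {\<lceil>lo\<rceil>..\<lfloor>hi\<rfloor>}"
    by (auto simp: ceiling_le_iff le_floor_iff)
  show ?thesis unfolding eq by simp
qed

text \<open>The number of integer points, modulo \<open>P\<close>, near the graph of \<open>g\<close> over a cube. Any function will do as \<open>g\<close>, because
  the points are counted over each point of the cube separately. The small size of the region makes
  reduction modulo \<open>P\<close> injective.\<close>

lemma card_targets_ge:
  fixes i0 :: "'n::finite" and g :: "('n \<Rightarrow> int) \<Rightarrow> real" and lo :: "'n \<Rightarrow> real"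
  assumes w: "0 < w" and \<kappa>: "0 < \<kappa>" and P: "12 \<le> w * real P" "1 \<le> \<kappa> * real P"
    and small: "w < 1" "\<kappa> \<le> 1 / 4"
    and g: "\<And>x x'. (\<And>i. i \<noteq> i0 \<Longrightarrow> x i = x' i) \<Longrightarrow> g x = g x'"
  defines "T \<equiv> {x. (\<forall>i. i \<noteq> i0 \<longrightarrow> lo i * real P \<le> of_int (x i) \<and> of_int (x i) \<le> (lo i + w) * real P) \<and>
      \<bar>real_of_int (x i0) - g x * real P\<bar> \<le> \<kappa> * real P}"
  shows "(3 / 4 * w) ^ (CARD('n) - 1) * \<kappa> * real P ^ CARD('n) \<le> real (card ((\<lambda>x l. x l mod int P) ` T))"
proof -
  have P0: "P > 0" using P(1) w by (intro Nat.gr0I) auto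
  define J where "J = - {i0}"
  have cardJ: "card J = CARD('n) - 1" by (simp add: J_def card_Diff_singleton Compl_eq_Diff_UNIV)
  define D where "D i = {x :: int. lo i * real P \<le> of_int x \<and> of_int x \<le> (lo i + w) * real P}" for i
  define A where "A = (\<Pi>\<^sub>E i\<in>J. D i)"
  define ext where "ext x t = (\<lambda>i. if i = i0 then t else x i)" for x :: "'n \<Rightarrow> int" and t
  define V where "V x = {t :: int. (g (ext x 0) - \<kappa>) * real P \<le> of_int t \<and> of_int t \<le> (g (ext x 0) + \<kappa>) * real P}" for x
  have finA: "finite A" unfolding A_def D_def J_def by (intro finite_PiE finite_int_interval) auto
  have finV: "finite (V x)" for x unfolding V_def by (rule finite_int_interval)
  have inT: "ext x t \<in> T" if "x \<in> A" "t \<in> V x" for x t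
  proof -
    have "g (ext x t) = g (ext x 0)" by (rule g) (simp add: ext_def)
    then have "\<bar>real_of_int t - g (ext x t) * real P\<bar> \<le> \<kappa> * real P"
      using that(2) by (auto simp: V_def algebra_simps abs_le_iff)
    moreover have "lo i * real P \<le> of_int (x i) \<and> of_int (x i) \<le> (lo i + w) * real P" if "i \<noteq> i0" for i
      using \<open>x \<in> A\<close> that by (auto simp: A_def D_def J_def PiE_iff)
    ultimately show ?thesis unfolding T_def by (simp add: ext_def)
  qed
  let ?m = "\<lambda>(x, t) l. ext x t l mod int P"
  have inj: "inj_on ?m (SIGMA x:A. V x)"
  proof (rule inj_onI, clarify)
    fix x t x' t' assume x: "x \<in> A" "t \<in> V x" "x' \<in> A" "t' \<in> V x'"
      and eq: "(\<lambda>l. ext x t l mod int P) = (\<lambda>l. ext x' t' l mod int P)"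
    have eql: "int P dvd ext x t l - ext x' t' l" for l using fun_cong[OF eq, of l] by (simp add: mod_eq_dvd_iff)
    have close: "a = b" if "int P dvd a - b" "\<bar>real_of_int (a - b)\<bar> < real P" for a b :: int
    proof (rule ccontr)
      assume "a \<noteq> b"
      then have "int P \<le> \<bar>a - b\<bar>" using dvd_imp_le_int[of "a - b" "int P"] that(1) by simp
      then show False using that(2) by linarith
    qed
    have "x i = x' i" if i: "i \<in> J" for i
    proof (rule close)
      show "int P dvd x i - x' i" using eql[of i] i by (simp add: ext_def J_def)
      have "x i \<in> D i" "x' i \<in> D i" using x i by (auto simp: A_def)
      then have "\<bar>real_of_int (x i) - real_of_int (x' i)\<bar> \<le> w * real P" by (auto simp: D_def algebra_simps abs_le_iff)
      also have "\<dots> < 1 * real P" using small(1) P0 by (intro mult_strict_right_mono) auto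
      finally show "\<bar>real_of_int (x i - x' i)\<bar> < real P" by simp
    qed
    then have xx: "x = x'" using x by (intro PiE_ext[of x J D x']) (auto simp: A_def)
    have "t = t'"
    proof (rule close)
      show "int P dvd t - t'" using eql[of i0] by (simp add: ext_def)
      have "\<bar>real_of_int t - real_of_int t'\<bar> \<le> 2 * (\<kappa> * real P)" using x xx by (auto simp: V_def algebra_simps abs_le_iff)
      also have "\<dots> \<le> 2 * (1 / 4 * real P)" using small(2) by (intro mult_left_mono mult_right_mono) auto
      finally show "\<bar>real_of_int (t - t')\<bar> < real P" using P0 by simp
    qed
    then show "x = x' \<and> t = t'" using xx by simp
  qed
  have sub: "?m ` (SIGMA x:A. V x) \<subseteq> (\<lambda>x l. x l mod int P) ` T"
  proof (clarify, rule image_eqI)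
    fix x t assume "x \<in> A" "t \<in> V x"
    then show "ext x t \<in> T" by (rule inT)
  qed simp
  have finT: "finite ((\<lambda>x l. x l mod int P) ` T)"
    by (rule finite_subset[OF _ finite_residue_box[of P]]) (use P0 in \<open>auto simp: residue_box_iff\<close>)
  have "card (SIGMA x:A. V x) \<le> card ((\<lambda>x l. x l mod int P) ` T)"
    by (rule card_inj_on_le[OF inj sub finT])
  moreover have "card (SIGMA x:A. V x) = (\<Sum>x\<in>A. card (V x))" using finA finV by (intro card_SigmaI) auto
  ultimately have "(\<Sum>x\<in>A. card (V x)) \<le> card ((\<lambda>x l. x l mod int P) ` T)" by (simp only:)
  then have "real (\<Sum>x\<in>A. card (V x)) \<le> real (card ((\<lambda>x l. x l mod int P) ` T))" by (rule of_nat_mono)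
  moreover have "(3 / 4 * w) ^ (CARD('n) - 1) * \<kappa> * real P ^ CARD('n) \<le> real (\<Sum>x\<in>A. card (V x))"
  proof -
    have V: "\<kappa> * real P \<le> real (card (V x))" for x
    proof -
      have "2 * (\<kappa> * real P) - 1 \<le> real (card (V x))"
        using card_int_interval[of "(g (ext x 0) + \<kappa>) * real P" "(g (ext x 0) - \<kappa>) * real P"]
        by (simp add: V_def algebra_simps)
      then show ?thesis using P(2) by linarith
    qed
    have D: "3 / 4 * w * real P \<le> real (card (D i))" for i
    proof -
      have "w * real P - 1 \<le> real (card (D i))"
        using card_int_interval[of "(lo i + w) * real P" "lo i * real P"] by (simp add: D_def algebra_simps)
      then show ?thesis using P(1) by linarith
    qed
    have "(3 / 4 * w * real P) ^ card J \<le> (\<Prod>i\<in>J. real (card (D i)))"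
      using prod_mono[of J "\<lambda>_. 3 / 4 * w * real P" "\<lambda>i. real (card (D i))"] D w by simp
    also have "\<dots> = real (card A)" unfolding A_def by (subst card_PiE) (auto simp: J_def)
    finally have A: "(3 / 4 * w * real P) ^ card J \<le> real (card A)" .
    have "(3 / 4 * w) ^ (CARD('n) - 1) * \<kappa> * real P ^ CARD('n) = (3 / 4 * w * real P) ^ card J * (\<kappa> * real P)"
    proof -
      have "CARD('n) = Suc (CARD('n) - 1)" by simp
      then have "real P ^ CARD('n) = real P ^ (CARD('n) - 1) * real P" by (metis power_Suc2)
      then show ?thesis unfolding cardJ power_mult_distrib[of "3 / 4 * w" "real P"] by (simp only: mult_ac)
    qed
    also have "\<dots> \<le> real (card A) * (\<kappa> * real P)" using A \<kappa> by (intro mult_right_mono) auto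
    also have "\<dots> = (\<Sum>x\<in>A. \<kappa> * real P)" by simp
    also have "\<dots> \<le> (\<Sum>x\<in>A. real (card (V x)))" by (intro sum_mono V)
    finally show ?thesis by simp
  qed
  ultimately show ?thesis by linarith
qed

text \<open>The pigeonhole principle: the differences of those points of a box whose products with the
  generators fall into the most popular cell of the torus.\<close>

lemma bohr_set_large:
  fixes p :: "nat \<Rightarrow> 'n::finite \<Rightarrow> int"
  assumes P: "P > 0" and \<eta>: "0 < \<eta>" "\<eta> \<le> 1"
  shows "\<exists>Z :: ('n \<Rightarrow> int) set. finite Z \<and> (\<forall>z\<in>Z. \<forall>l. \<bar>z l\<bar> \<le> int r) \<and> (\<forall>z\<in>Z. \<forall>i<d. near_multiple P \<eta> (idot z (p i))) \<and>
     real (r + 1) ^ CARD('n) * (\<eta> / 2) ^ d \<le> real (card Z)"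
proof -
  define A where "A = (UNIV \<rightarrow>\<^sub>E {0..int r} :: ('n \<Rightarrow> int) set)"
  define B where "B = nat \<lceil>1 / \<eta>\<rceil>"
  have "1 / \<eta> \<ge> 1" using \<eta> by simp
  then have ceil: "real B = of_int \<lceil>1 / \<eta>\<rceil>" unfolding B_def by simp
  have B1: "1 / \<eta> \<le> real B" unfolding ceil by (rule le_of_int_ceiling)
  have B0: "real B > 0" using B1 \<open>1 / \<eta> \<ge> 1\<close> by linarith
  have B2: "real B \<le> 2 / \<eta>" using \<open>1 / \<eta> \<ge> 1\<close> unfolding ceil by linarith
  define cell where "cell z i = nat \<lfloor>real_of_int (idot z (p i) mod int P) * real B / real P\<rfloor>" for z :: "'n \<Rightarrow> int" and i
  have cellB: "cell z i < B" for z i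
  proof -
    have "real_of_int (idot z (p i) mod int P) < real P"
      using pos_mod_bound[of "int P" "idot z (p i)"] P by linarith
    then have "real_of_int (idot z (p i) mod int P) * real B / real P < real B" using B0 P by (simp add: field_simps)
    then have "\<lfloor>real_of_int (idot z (p i) mod int P) * real B / real P\<rfloor> < int B" by linarith
    moreover have "0 < B" using B0 by simp
    ultimately show ?thesis unfolding cell_def by linarith
  qed
  define F where "F z = (\<lambda>i\<in>{..<d}. cell z i)" for z
  have finA: "finite A" unfolding A_def by (intro finite_PiE) auto
  have cardA: "card A = (r + 1) ^ CARD('n)" unfolding A_def by (subst card_PiE) (auto simp: nat_add_distrib)
  have FA: "F ` A \<subseteq> {..<d} \<rightarrow>\<^sub>E {..<B}" unfolding F_def using cellB by (intro image_subsetI) (simp add: restrict_PiE_iff)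
  have finT: "finite ({..<d} \<rightarrow>\<^sub>E {..<B})" by (intro finite_PiE) auto
  have "(\<lambda>_. 0) \<in> A" by (auto simp: A_def)
  then have Ane: "A \<noteq> {}" by blast
  have "\<exists>c\<in>F ` A. real (card A) \<le> real B ^ d * real (card {z\<in>A. F z = c})"
  proof (rule ccontr)
    assume neg: "\<not> ?thesis"
    have cover: "(\<Union>c\<in>F ` A. {z\<in>A. F z = c}) = A" by blast
    have "card A \<le> (\<Sum>c\<in>F ` A. card {z\<in>A. F z = c})"
      using card_UN_le[of "F ` A" "\<lambda>c. {z\<in>A. F z = c}"] finA unfolding cover by blast
    then have "real B ^ d * real (card A) \<le> (\<Sum>c\<in>F ` A. real B ^ d * real (card {z\<in>A. F z = c}))"
      unfolding sum_distrib_left[symmetric] using B0 by (intro mult_left_mono) (auto simp flip: of_nat_sum)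
    also have "\<dots> < (\<Sum>c\<in>F ` A. real (card A))"
      using neg finA Ane by (intro sum_strict_mono) (auto simp: not_le)
    also have "\<dots> \<le> real B ^ d * real (card A)"
    proof -
      have "card (F ` A) \<le> card ({..<d} \<rightarrow>\<^sub>E {..<B})" by (rule card_mono[OF finT FA])
      then have "real (card (F ` A)) \<le> real B ^ d" by (simp add: card_PiE flip: of_nat_power)
      then show ?thesis by (simp add: mult_right_mono)
    qed
    finally show False by simp
  qed
  then obtain z0 where z0: "z0 \<in> A" "real (card A) \<le> real B ^ d * real (card {z\<in>A. F z = F z0})" by blast
  define Z where "Z = (\<lambda>z l. z l - z0 l) ` {z\<in>A. F z = F z0}"
  have cardZ: "card Z = card {z\<in>A. F z = F z0}" unfolding Z_def
    by (rule card_image) (auto simp: inj_on_def fun_eq_iff)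
  have bound: "\<bar>z l\<bar> \<le> int r" if "z \<in> Z" for z l
  proof -
    obtain x where x: "x \<in> A" "z = (\<lambda>l. x l - z0 l)" using \<open>z \<in> Z\<close> by (auto simp: Z_def)
    have "x l \<in> {0..int r}" "z0 l \<in> {0..int r}" using x(1) z0(1) by (auto simp: A_def PiE_iff)
    then show ?thesis unfolding x(2) by auto
  qed
  have near: "near_multiple P \<eta> (idot z (p i))" if "z \<in> Z" "i < d" for z i
  proof -
    obtain x where x: "x \<in> A" "F x = F z0" "z = (\<lambda>l. x l - z0 l)" using \<open>z \<in> Z\<close> by (auto simp: Z_def)
    have c: "cell x i = cell z0 i" using fun_cong[OF x(2), of i] that(2) by (simp add: F_def)
    define a where "a = idot x (p i) mod int P"
    define b where "b = idot z0 (p i) mod int P"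
    have ab0: "0 \<le> a" "0 \<le> b" using P by (auto simp: a_def b_def)
    have fl: "\<lfloor>real_of_int a * real B / real P\<rfloor> = \<lfloor>real_of_int b * real B / real P\<rfloor>"
    proof -
      have "0 \<le> \<lfloor>real_of_int a * real B / real P\<rfloor>" "0 \<le> \<lfloor>real_of_int b * real B / real P\<rfloor>" using ab0 by auto
      then show ?thesis using c unfolding cell_def a_def[symmetric] b_def[symmetric] by (simp add: eq_nat_nat_iff)
    qed
    then have "\<bar>real_of_int a * real B / real P - real_of_int b * real B / real P\<bar> \<le> 1" by linarith
    then have "\<bar>(real_of_int a - real_of_int b) * real B / real P\<bar> \<le> 1" by (simp add: left_diff_distrib diff_divide_distrib)
    define D where "D = \<bar>real_of_int a - real_of_int b\<bar>"
    have "\<bar>(real_of_int a - real_of_int b) * real B / real P\<bar> = D * real B / real P" by (simp add: D_def abs_mult)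
    then have "D * real B / real P \<le> 1" using \<open>\<bar>(real_of_int a - real_of_int b) * real B / real P\<bar> \<le> 1\<close> by linarith
    then have "D \<le> real P / real B" using B0 P by (simp add: field_simps)
    then have "\<bar>real_of_int a - real_of_int b\<bar> \<le> real P / real B" by (simp only: D_def)
    also have "\<dots> \<le> \<eta> * real P"
    proof -
      have "1 \<le> \<eta> * real B" using B1 \<eta> by (simp add: field_simps)
      then have "real P * 1 \<le> real P * (\<eta> * real B)" by (intro mult_left_mono) auto
      then show ?thesis using B0 by (simp add: field_simps)
    qed
    finally have ab: "\<bar>real_of_int a - real_of_int b\<bar> \<le> \<eta> * real P" .
    have "idot z (p i) = idot x (p i) - idot z0 (p i)"
      unfolding x(3) idot_def by (simp add: left_diff_distrib sum_subtractf)
    also have "\<dots> = (a - b) + (idot x (p i) div int P - idot z0 (p i) div int P) * int P"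
      unfolding a_def b_def by (simp add: left_diff_distrib minus_div_mult_eq_mod[symmetric])
    finally have "real_of_int (idot z (p i)) - real_of_int (idot x (p i) div int P - idot z0 (p i) div int P) * real P = real_of_int a - real_of_int b"
      by simp
    then show ?thesis unfolding near_multiple_def using ab by metis
  qed
  have "real (r + 1) ^ CARD('n) * (\<eta> / 2) ^ d \<le> real (card Z)"
  proof -
    have "real (r + 1) ^ CARD('n) \<le> real B ^ d * real (card Z)" using z0(2) unfolding cardZ cardA by simp
    then have "real (r + 1) ^ CARD('n) * (\<eta> / 2) ^ d \<le> (real B ^ d * real (card Z)) * (\<eta> / 2) ^ d"
      using \<eta> by (intro mult_right_mono) auto
    also have "\<dots> = (real B * (\<eta> / 2)) ^ d * real (card Z)" by (simp only: power_mult_distrib mult_ac)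
    also have "\<dots> \<le> 1 * real (card Z)"
    proof (intro mult_right_mono power_le_one)
      have "real B * (\<eta> / 2) \<le> 2 / \<eta> * (\<eta> / 2)" using B2 \<eta> by (intro mult_right_mono) auto
      then show "real B * (\<eta> / 2) \<le> 1" using \<eta> by simp
    qed (use \<eta> in auto)
    finally show ?thesis by simp
  qed
  moreover have "finite Z" unfolding Z_def using finA by simp
  moreover have "\<forall>z\<in>Z. \<forall>l. \<bar>z l\<bar> \<le> int r" using bound by simp
  moreover have "\<forall>z\<in>Z. \<forall>i<d. near_multiple P \<eta> (idot z (p i))" using near by simp
  ultimately show ?thesis by (intro exI[of _ Z] conjI)
qed

lemma near_multiple_diff:
  assumes "near_multiple P \<eta> a" "near_multiple P \<eta> b"
  shows "near_multiple P (2 * \<eta>) (a - b)"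
proof -
  obtain m m' where m: "\<bar>real_of_int a - real_of_int m * real P\<bar> \<le> \<eta> * real P" "\<bar>real_of_int b - real_of_int m' * real P\<bar> \<le> \<eta> * real P"
    using assms by (auto simp: near_multiple_def)
  have "real_of_int (a - b) - real_of_int (m - m') * real P = (real_of_int a - real_of_int m * real P) - (real_of_int b - real_of_int m' * real P)"
    by (simp add: left_diff_distrib)
  then have "\<bar>real_of_int (a - b) - real_of_int (m - m') * real P\<bar> \<le> 2 * \<eta> * real P" using m by linarith
  then show ?thesis unfolding near_multiple_def by blast
qed

text \<open>After subtraction of one of the points the line passes near the origin. The difference lies in the Bohr set with the
  doubled parameter, which is why the hypothesis on \<open>Z\<close> involves \<open>\<eta> / 2\<close>.\<close>

lemma card_near_line_le:
  fixes Z :: "('n::finite \<Rightarrow> int) set" and a v :: "real^'n"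
  assumes Z: "finite Z" "\<And>z l. z \<in> Z \<Longrightarrow> \<bar>z l\<bar> \<le> int r" "\<And>z i. z \<in> Z \<Longrightarrow> i < d \<Longrightarrow> near_multiple P (\<eta> / 2) (idot z (p i))"
    and R: "2 * r \<le> R" and \<rho>: "0 < \<rho>" "\<rho> \<le> 1 / 16" and v: "norm v = 1"
    and tube: "\<And>a u. u a = 1 \<Longrightarrow> (\<forall>l. \<bar>u l\<bar> \<le> 1) \<Longrightarrow> finite (tube_points P \<eta> d p (real R) a u) \<and> card (tube_points P \<eta> d p (real R) a u) \<le> M"
  shows "card {z\<in>int_vec ` Z. \<exists>t::real. norm (a + t *\<^sub>R v - z) < \<rho>} \<le> M"
proof (cases "{z\<in>Z. \<exists>t::real. norm (a + t *\<^sub>R v - int_vec z) < \<rho>} = {}")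
  case True
  then have "{z\<in>int_vec ` Z. \<exists>t::real. norm (a + t *\<^sub>R v - z) < \<rho>} = {}" by auto
  then show ?thesis by (metis card.empty zero_le)
next
  case False
  define Zl where "Zl = {z\<in>Z. \<exists>t::real. norm (a + t *\<^sub>R v - int_vec z) < \<rho>}"
  obtain z0 where z0: "z0 \<in> Zl" using False by (auto simp: Zl_def)
  have "finite (range (\<lambda>l. \<bar>v $ l\<bar>))" by simp
  then obtain c where c: "\<And>l. \<bar>v $ l\<bar> \<le> \<bar>v $ c\<bar>"
    using Max_ge Max_in by (metis (no_types, lifting) UNIV_not_empty image_iff image_is_empty rangeI)
  have vc: "v $ c \<noteq> 0"
  proof
    assume "v $ c = 0"
    then have "v $ l = 0" for l using c[of l] by simp
    then have "v = 0" by (simp add: vec_eq_iff)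
    then show False using v by simp
  qed
  define u where "u l = v $ l / v $ c" for l
  have u1: "u c = 1" using vc by (simp add: u_def)
  have ul: "\<bar>u l\<bar> \<le> 1" for l using c[of l] vc by (simp add: u_def abs_divide)
  have T: "finite (tube_points P \<eta> d p (real R) c u)" "card (tube_points P \<eta> d p (real R) c u) \<le> M"
    using tube[of u c] u1 ul by auto
  have sub: "(\<lambda>z l. z l - z0 l) ` Zl \<subseteq> tube_points P \<eta> d p (real R) c u"
  proof
    fix w assume "w \<in> (\<lambda>z l. z l - z0 l) ` Zl"
    then obtain z where z: "z \<in> Zl" "w = (\<lambda>l. z l - z0 l)" by blast
    obtain t where t: "norm (a + t *\<^sub>R v - int_vec z) < \<rho>" using z(1) by (auto simp: Zl_def)
    obtain t0 where t0: "norm (a + t0 *\<^sub>R v - int_vec z0) < \<rho>" using z0 by (auto simp: Zl_def)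
    define e where "e = (a + t0 *\<^sub>R v - int_vec z0) - (a + t *\<^sub>R v - int_vec z)"
    have "norm e < \<rho> + \<rho>" unfolding e_def
      using norm_triangle_ineq4[of "a + t0 *\<^sub>R v - int_vec z0" "a + t *\<^sub>R v - int_vec z"] t t0 by linarith
    then have el: "\<bar>e $ l\<bar> \<le> 1 / 8" for l using component_le_norm_cart[of e l] \<rho>(2) by linarith
    have wl: "real_of_int (w l) = (t - t0) * v $ l + e $ l" for l
      unfolding z(2) e_def by (simp add: algebra_simps)
    have "\<bar>real_of_int (w l) - real_of_int (w c) * u l\<bar> \<le> 1 / 4" for l
    proof -
      have "real_of_int (w l) - real_of_int (w c) * u l = e $ l - e $ c * u l"
        unfolding wl using vc by (simp add: u_def field_simps)
      moreover have "\<bar>e $ c * u l\<bar> \<le> 1 / 8 * 1" unfolding abs_mult by (intro mult_mono el ul) auto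
      ultimately show ?thesis using el[of l] by linarith
    qed
    moreover have "\<bar>real_of_int (w c)\<bar> \<le> real R"
    proof -
      have "\<bar>z c\<bar> \<le> int r" "\<bar>z0 c\<bar> \<le> int r" using Z(2) z z0 by (auto simp: Zl_def)
      then have "\<bar>w c\<bar> \<le> int (2 * r)" unfolding z(2) by linarith
      then show ?thesis using R by linarith
    qed
    moreover have "near_multiple P \<eta> (idot w (p i))" if "i < d" for i
    proof -
      have "idot w (p i) = idot z (p i) - idot z0 (p i)"
        unfolding z(2) idot_def by (simp add: left_diff_distrib sum_subtractf)
      then show ?thesis using near_multiple_diff[of P "\<eta> / 2" "idot z (p i)" "idot z0 (p i)"] Z(3)[of _ i] z z0 that
        by (auto simp: Zl_def)
    qed
    ultimately show "w \<in> tube_points P \<eta> d p (real R) c u" by (simp add: tube_points_def)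
  qed
  have "card Zl = card ((\<lambda>z l. z l - z0 l) ` Zl)"
    by (rule card_image[symmetric]) (auto simp: inj_on_def fun_eq_iff)
  also have "\<dots> \<le> M" using card_mono[OF T(1) sub] T(2) by linarith
  finally have "card Zl \<le> M" .
  moreover have "{z\<in>int_vec ` Z. \<exists>t::real. norm (a + t *\<^sub>R v - z) < \<rho>} = int_vec ` Zl" by (auto simp: Zl_def)
  moreover have "card (int_vec ` Zl) = card Zl" by (rule card_image) (rule inj_on_subset[OF inj_int_vec], simp)
  ultimately show ?thesis by simp
qed

lemma echar_cong: "P > 0 \<Longrightarrow> int P dvd a - b \<Longrightarrow> echar P a = echar P b"
  using echar_add[of P b "a - b"] echar_eq_1_iff[of P "a - b"] by simp

text \<open>The product of \<open>z\<close> with a point of the progression differs from that with the base point by a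
  combination of the products with the generators, which are all near multiples of \<open>P\<close>; the common phase is that of
  the base point.\<close>

lemma gap_point_aligned:
  fixes z :: "'n::finite \<Rightarrow> int"
  assumes P: "P > 0" and X: "\<And>l. X l mod int P = gap_point P d p0 p c l"
    and near: "\<And>i. i < d \<Longrightarrow> near_multiple P \<theta> (idot z (p i))" and c: "\<And>i. i < d \<Longrightarrow> c i < L"
    and \<theta>: "0 \<le> \<theta>" "64 * real d * real L * \<theta> \<le> 1"
  shows "cmod (cis (2 * pi * (int_vec z \<bullet> ((1 / real P) *\<^sub>R int_vec X))) - echar P (idot z p0)) \<le> 1 / 8"
proof -
  define t where "t = (\<Sum>i<d. int (c i) * idot z (p i))"
  have inn: "int_vec z \<bullet> ((1 / real P) *\<^sub>R int_vec X) = real_of_int (idot z X) / real P"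
    by (simp add: inner_vec_def idot_def sum_divide_distrib)
  have e1: "cis (2 * pi * (int_vec z \<bullet> ((1 / real P) *\<^sub>R int_vec X))) = echar P (idot z X)"
    unfolding inn echar_def ..
  have "int P dvd idot z X - (idot z p0 + t)"
  proof -
    have "idot z X - (idot z p0 + t) = (\<Sum>l\<in>UNIV. z l * (X l - (p0 l + (\<Sum>i<d. int (c i) * p i l))))"
    proof -
      have "t = (\<Sum>i<d. \<Sum>l\<in>UNIV. int (c i) * (z l * p i l))" by (simp add: t_def idot_def sum_distrib_left)
      also have "\<dots> = (\<Sum>l\<in>UNIV. \<Sum>i<d. int (c i) * (z l * p i l))" by (rule sum.swap)
      also have "\<dots> = (\<Sum>l\<in>UNIV. z l * (\<Sum>i<d. int (c i) * p i l))"
        by (simp add: sum_distrib_left mult_ac)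
      finally have t: "t = (\<Sum>l\<in>UNIV. z l * (\<Sum>i<d. int (c i) * p i l))" .
      show ?thesis unfolding t idot_def by (simp add: sum_subtractf sum.distrib algebra_simps)
    qed
    also have "int P dvd \<dots>"
      using X by (intro dvd_sum dvd_mult) (simp add: gap_point_def mod_eq_dvd_iff[symmetric])
    finally show ?thesis .
  qed
  then have "echar P (idot z X) = echar P (idot z p0) * echar P t"
    using echar_cong[OF P] by (simp add: echar_add[symmetric])
  then have "cmod (echar P (idot z X) - echar P (idot z p0)) = cmod (echar P (idot z p0) * (echar P t - 1))"
    by (simp add: right_diff_distrib)
  then have e2: "cmod (echar P (idot z X) - echar P (idot z p0)) = cmod (echar P t - 1)"
    by (simp add: norm_mult)
  obtain m where m: "\<And>i. i < d \<Longrightarrow> \<bar>real_of_int (idot z (p i)) - real_of_int (m i) * real P\<bar> \<le> \<theta> * real P"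
    using near unfolding near_multiple_def by metis
  have "\<bar>real_of_int t - real_of_int (\<Sum>i<d. int (c i) * m i) * real P\<bar> =
     \<bar>\<Sum>i<d. real (c i) * (real_of_int (idot z (p i)) - real_of_int (m i) * real P)\<bar>"
    by (simp add: t_def sum_distrib_right right_diff_distrib sum_subtractf mult.assoc)
  also have "\<dots> \<le> (\<Sum>i<d. real L * (\<theta> * real P))"
  proof (rule order_trans[OF sum_abs], rule sum_mono)
    fix i assume "i \<in> {..<d}"
    then show "\<bar>real (c i) * (real_of_int (idot z (p i)) - real_of_int (m i) * real P)\<bar> \<le> real L * (\<theta> * real P)"
      unfolding abs_mult using m[of i] c[of i] by (intro mult_mono) auto
  qed
  also have "\<dots> = (real d * real L * \<theta>) * real P" by simp
  finally have "cmod (echar P t - 1) \<le> 2 * pi * (real d * real L * \<theta>)" by (rule norm_echar_minus_1[OF P])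
  also have "\<dots> \<le> 2 * pi * (1 / 64)" using \<theta>(2) by (intro mult_left_mono) auto
  also have "\<dots> \<le> 1 / 8" using pi_less_4 by simp
  finally show ?thesis unfolding e1 e2 .
qed

text \<open>The cells are cubes of side \<open>\<delta>\<close> in the coordinates other than \<open>i0\<close>. A target is the set of points of
  \<open>(1/P) \<int>^n\<close> over the middle third of a cell that are within \<open>\<kappa>\<close> of the graph of \<open>g\<close>. The hypothesis named
  \<open>big\<close> compares the number of points of the progression with the density of a target. At least half of the targets are
  hit, and one node is chosen in each of them; the middle thirds keep the nodes apart. The frequencies are a
  Bohr set of the same generators.\<close>

theorem scale_nodes:
  fixes i0 :: "'n::finite" and g :: "real^'n \<Rightarrow> real" and lo :: "'n \<Rightarrow> real"
  assumes R: "R \<ge> 1" and d: "d \<ge> 1"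
    and \<eta>: "0 < \<eta>" "13 * real (CARD('n) + d) * \<eta> \<le> 1"
    and I: "(2 / 3) ^ I * real R < 1"
    and \<eta>2: "(2 * real R + 1) * real I * (26 * real (CARD('n) + d) * \<eta>) ^ d \<le> 1"
    and H: "4 * (8 * real R + 1) ^ CARD('n) * (real (CARD('n) + d) + 1) * 4 ^ d * (2 / 3) ^ (d * H) \<le> 1"
    and L: "64 * real d * real L * \<eta> \<le> 1"
    and \<delta>: "0 < \<delta>" "\<delta> \<le> 1" and \<kappa>: "0 < \<kappa>" "\<kappa> \<le> 1 / 4"
    and big: "8 \<le> real L ^ d * ((\<delta> / 4) ^ (CARD('n) - 1) * \<kappa>)"
    and g: "\<And>x x'. (\<And>i. i \<noteq> i0 \<Longrightarrow> x $ i = x' $ i) \<Longrightarrow> g x = g x'"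
    and \<rho>: "0 < \<rho>" "\<rho> \<le> 1 / 16"
  shows "\<exists>Y Z. finite Y \<and> (\<forall>y\<in>Y. \<bar>y $ i0 - g y\<bar> \<le> \<kappa>) \<and>
     (\<forall>y\<in>Y. \<forall>i. i \<noteq> i0 \<longrightarrow> lo i + \<delta> / 3 \<le> y $ i \<and> y $ i \<le> lo i + real mm * \<delta> - \<delta> / 3) \<and>
     (\<forall>y\<in>Y. \<forall>y'\<in>Y. y \<noteq> y' \<longrightarrow> (\<exists>i. i \<noteq> i0 \<and> 2 * \<delta> / 3 \<le> \<bar>y $ i - y' $ i\<bar>)) \<and>
     real mm ^ (CARD('n) - 1) \<le> 2 * real (card Y) \<and>
     finite Z \<and> (\<forall>z\<in>Z. norm z \<le> real R / 4) \<and>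
     (\<forall>z\<in>Z. \<forall>z'\<in>Z. z \<noteq> z' \<longrightarrow> 1 \<le> norm (z - z')) \<and>
     (real R / (4 * real CARD('n))) ^ CARD('n) * (\<eta> / 4) ^ d \<le> real (card Z) \<and>
     (\<forall>z\<in>Z. \<exists>\<omega>. cmod \<omega> = 1 \<and> (\<forall>y\<in>Y. cmod (cis (2 * pi * (z \<bullet> y)) - \<omega>) \<le> 1 / 8)) \<and>
     (\<forall>a v. norm v = 1 \<longrightarrow> card {z\<in>Z. \<exists>t::real. norm (a + t *\<^sub>R v - z) < \<rho>} \<le> 3 ^ (H + (CARD('n) + d)))"
proof -
  define n where "n = CARD('n)"
  have n1: "1 \<le> n" using zero_less_card_finite[where 'a='n] by (simp add: n_def Suc_leI)
  \<comment> \<open>The prime only has to be large: it makes the lattice of possible nodes fine compared with all other scales.\<close>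
  obtain P where P: "prime P" "max L (nat \<lceil>(real R + 1) / \<eta> + 36 / \<delta> + 1 / \<kappa>\<rceil>) < P"
    using bigger_prime by blast
  have P0: "P > 0" using P(1) prime_gt_0_nat by blast
  have LP: "L \<le> P" using P(2) by simp
  have "(real R + 1) / \<eta> + 36 / \<delta> + 1 / \<kappa> \<le> real P" using P(2) by linarith
  moreover have "0 \<le> (real R + 1) / \<eta>" "0 \<le> 36 / \<delta>" "0 \<le> 1 / \<kappa>" using \<eta>(1) \<delta> \<kappa> by auto
  ultimately have PR: "(real R + 1) / \<eta> \<le> real P" and P\<delta>: "36 / \<delta> \<le> real P" and P\<kappa>: "1 / \<kappa> \<le> real P" by linarith+
  define Q where "Q = ((- {i0}) \<rightarrow>\<^sub>E {..<mm})"
  define lq where "lq q i = lo i + real (q i) * \<delta> + \<delta> / 3" for q :: "'n \<Rightarrow> nat" and i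
  define pt where "pt X = (1 / real P) *\<^sub>R int_vec X" for X :: "'n \<Rightarrow> int"
  define T where "T q = {x. (\<forall>i. i \<noteq> i0 \<longrightarrow> lq q i * real P \<le> of_int (x i) \<and> of_int (x i) \<le> (lq q i + \<delta> / 3) * real P) \<and>
      \<bar>real_of_int (x i0) - g (pt x) * real P\<bar> \<le> \<kappa> * real P}" for q
  define Ym where "Ym q = (\<lambda>x l. x l mod int P) ` T q" for q
  have finQ: "finite Q" unfolding Q_def by (intro finite_PiE) auto
  have cardQ: "card Q = mm ^ (n - 1)"
    unfolding Q_def n_def by (subst card_PiE) (auto simp: Compl_eq_Diff_UNIV card_Diff_singleton)
  have Ybox: "Ym q \<subseteq> residue_box P" for q using P0 by (auto simp: Ym_def residue_box_iff)
  have Ycard: "8 * real P ^ CARD('n) \<le> real L ^ d * real (card (Ym q))" for q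
  proof -
    have "(3 / 4 * (\<delta> / 3)) ^ (CARD('n) - 1) * \<kappa> * real P ^ CARD('n) \<le> real (card (Ym q))"
      unfolding Ym_def T_def
    proof (rule card_targets_ge)
      show "12 \<le> \<delta> / 3 * real P" "1 \<le> \<kappa> * real P" using P\<delta> P\<kappa> \<delta> \<kappa> by (simp_all add: field_simps)
      show "g (pt x) = g (pt x')" if "\<And>i. i \<noteq> i0 \<Longrightarrow> x i = x' i" for x x'
        by (rule g) (use that in \<open>simp add: pt_def\<close>)
    qed (use \<delta> \<kappa> in auto)
    then have "real L ^ d * ((\<delta> / 4) ^ (CARD('n) - 1) * \<kappa> * real P ^ CARD('n)) \<le> real L ^ d * real (card (Ym q))"
      by (intro mult_left_mono) auto
    moreover have "8 * real P ^ CARD('n) \<le> real L ^ d * ((\<delta> / 4) ^ (CARD('n) - 1) * \<kappa>) * real P ^ CARD('n)"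
      using big by (intro mult_right_mono) auto
    ultimately show ?thesis by (simp add: mult.assoc)
  qed
  have "\<exists>p0 p. real (card Q) \<le> 2 * real (card {q\<in>Q. \<exists>c\<in>{..<d} \<rightarrow>\<^sub>E {..<L}. gap_point P d p0 p c \<in> Ym q}) \<and>
     (\<forall>a u. u a = 1 \<and> (\<forall>l. \<bar>u l\<bar> \<le> 1) \<longrightarrow> card (tube_points P \<eta> d p R a u) \<le> 3 ^ (H + (CARD('n) + d)))"
    by (rule exists_good_generators[OF P(1) LP d finQ Ybox Ycard PR R \<eta> I \<eta>2 H])
  then obtain p0 p where pp1: "real (card Q) \<le> 2 * real (card {q\<in>Q. \<exists>c\<in>{..<d} \<rightarrow>\<^sub>E {..<L}. gap_point P d p0 p c \<in> Ym q})"
    and pp2: "\<forall>a u. u a = 1 \<and> (\<forall>l. \<bar>u l\<bar> \<le> 1) \<longrightarrow> card (tube_points P \<eta> d p R a u) \<le> 3 ^ (H + (CARD('n) + d))"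
    by (elim exE conjE)
  define Qh where "Qh = {q\<in>Q. \<exists>c\<in>{..<d} \<rightarrow>\<^sub>E {..<L}. gap_point P d p0 p c \<in> Ym q}"
  have "\<exists>X c. X \<in> T q \<and> c \<in> {..<d} \<rightarrow>\<^sub>E {..<L} \<and> (\<forall>l. X l mod int P = gap_point P d p0 p c l)" if "q \<in> Qh" for q
  proof -
    obtain c where c: "c \<in> {..<d} \<rightarrow>\<^sub>E {..<L}" "gap_point P d p0 p c \<in> Ym q" using \<open>q \<in> Qh\<close> by (auto simp: Qh_def)
    then obtain X where "X \<in> T q" "gap_point P d p0 p c = (\<lambda>l. X l mod int P)" by (auto simp: Ym_def)
    then show ?thesis using c(1) by metis
  qed
  then obtain X c where Xc: "\<And>q. q \<in> Qh \<Longrightarrow> X q \<in> T q" "\<And>q. q \<in> Qh \<Longrightarrow> c q \<in> {..<d} \<rightarrow>\<^sub>E {..<L}"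
    "\<And>q l. q \<in> Qh \<Longrightarrow> X q l mod int P = gap_point P d p0 p (c q) l" by metis
  define y where "y q = pt (X q)" for q
  have yl: "y q $ l = real_of_int (X q l) / real P" for q l by (simp add: y_def pt_def)
  have yi0: "\<bar>y q $ i0 - g (y q)\<bar> \<le> \<kappa>" if "q \<in> Qh" for q
  proof -
    have "\<bar>real_of_int (X q i0) - g (y q) * real P\<bar> \<le> \<kappa> * real P" using Xc(1)[OF that] by (simp add: T_def y_def)
    then have "\<bar>(y q $ i0 - g (y q)) * real P\<bar> \<le> \<kappa> * real P" unfolding yl using P0 by (simp add: left_diff_distrib)
    then show ?thesis using P0 by (simp add: abs_mult)
  qed
  have yi: "lq q i \<le> y q $ i \<and> y q $ i \<le> lq q i + \<delta> / 3" if "q \<in> Qh" "i \<noteq> i0" for q i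
  proof -
    have "lq q i * real P \<le> of_int (X q i) \<and> of_int (X q i) \<le> (lq q i + \<delta> / 3) * real P"
      using Xc(1)[OF that(1)] that(2) by (simp add: T_def)
    then show ?thesis unfolding yl using P0 by (simp add: pos_le_divide_eq pos_divide_le_eq)
  qed
  have sep: "\<exists>i. i \<noteq> i0 \<and> 2 * \<delta> / 3 \<le> \<bar>y q $ i - y q' $ i\<bar>" if q: "q \<in> Qh" "q' \<in> Qh" "q \<noteq> q'" for q q'
  proof -
    have "q \<in> Q" "q' \<in> Q" using q by (auto simp: Qh_def)
    then obtain i where i: "i \<noteq> i0" "q i \<noteq> q' i" using q(3) unfolding Q_def by (metis Compl_iff PiE_ext singletonI)
    have "1 \<le> \<bar>real (q i) - real (q' i)\<bar>" using i(2) by linarith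
    then have "1 * \<delta> \<le> \<bar>real (q i) - real (q' i)\<bar> * \<delta>" using \<delta> by (intro mult_right_mono) auto
    then have "\<delta> \<le> \<bar>real (q i) * \<delta> - real (q' i) * \<delta>\<bar>" using \<delta> by (simp add: abs_mult left_diff_distrib[symmetric])
    then have "2 * \<delta> / 3 \<le> \<bar>y q $ i - y q' $ i\<bar>" using yi[OF q(1) i(1)] yi[OF q(2) i(1)] unfolding lq_def by linarith
    then show ?thesis using i(1) by blast
  qed
  define Y where "Y = y ` Qh"
  have finQh: "finite Qh" using finQ by (simp add: Qh_def)
  have injy: "inj_on y Qh"
  proof (rule inj_onI, rule ccontr)
    fix q q' assume "q \<in> Qh" "q' \<in> Qh" "y q = y q'" "q \<noteq> q'"
    then show False using sep[of q q'] \<delta> by auto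
  qed
  have cardY: "card Y = card Qh" unfolding Y_def by (rule card_image[OF injy])
  define r where "r = R div (4 * n)"
  have rR: "4 * n * r \<le> R" by (simp add: r_def)
  have "\<eta> \<le> 1"
  proof -
    have "1 * \<eta> \<le> 13 * real (CARD('n) + d) * \<eta>" using \<eta>(1) d by (intro mult_right_mono) auto
    then show ?thesis using \<eta>(2) by linarith
  qed
  then obtain Z0 :: "('n \<Rightarrow> int) set" where Z0: "finite Z0" "\<forall>z\<in>Z0. \<forall>l. \<bar>z l\<bar> \<le> int r"
    "\<forall>z\<in>Z0. \<forall>i<d. near_multiple P (\<eta> / 2) (idot z (p i))" "real (r + 1) ^ CARD('n) * (\<eta> / 2 / 2) ^ d \<le> real (card Z0)"
    using bohr_set_large[OF P0, of "\<eta> / 2" r d p] \<eta>(1) by auto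
  define Z where "Z = int_vec ` Z0"
  have cardZ: "card Z = card Z0" unfolding Z_def by (rule card_image) (rule inj_on_subset[OF inj_int_vec], simp)
  have 1: "norm z \<le> real R / 4" if "z \<in> Z" for z
  proof -
    obtain x where x: "x \<in> Z0" "z = int_vec x" using \<open>z \<in> Z\<close> by (auto simp: Z_def)
    have "norm z \<le> (\<Sum>l\<in>UNIV. \<bar>z $ l\<bar>)" by (rule norm_le_l1_cart)
    also have "\<dots> \<le> (\<Sum>l\<in>(UNIV :: 'n set). real r)"
    proof (rule sum_mono)
      fix l
      have "\<bar>x l\<bar> \<le> int r" using Z0(2) x(1) by blast
      then show "\<bar>z $ l\<bar> \<le> real r" unfolding x(2) int_vec_nth by linarith
    qed
    also have "\<dots> = real (n * r)" by (simp add: n_def)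
    also have "\<dots> \<le> real R / 4" using rR by (simp flip: of_nat_mult)
    finally show ?thesis .
  qed
  have 2: "1 \<le> norm (z - z')" if z: "z \<in> Z" "z' \<in> Z" "z \<noteq> z'" for z z'
  proof -
    obtain x x' where x: "z = int_vec x" "z' = int_vec x'" using z by (auto simp: Z_def)
    then have "x \<noteq> x'" using z(3) by auto
    then obtain l where "x l \<noteq> x' l" by blast
    then have "1 \<le> \<bar>real_of_int (x l) - real_of_int (x' l)\<bar>" by linarith
    also have "\<dots> = \<bar>(z - z') $ l\<bar>" by (simp add: x)
    also have "\<dots> \<le> norm (z - z')" by (rule component_le_norm_cart)
    finally show ?thesis .
  qed
  have 3: "(real R / (4 * real CARD('n))) ^ CARD('n) * (\<eta> / 4) ^ d \<le> real (card Z)"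
  proof -
    have "R < (r + 1) * (4 * n)" using n1 dividend_less_div_times[of "4 * n" R] by (simp add: r_def)
    then have "real R \<le> real (r + 1) * (4 * real n)" by (metis less_imp_le of_nat_le_iff of_nat_mult of_nat_numeral)
    then have "real R / (4 * real n) \<le> real (r + 1)" using n1 by (simp add: divide_le_eq)
    then have "(real R / (4 * real n)) ^ n * (\<eta> / 4) ^ d \<le> real (r + 1) ^ n * (\<eta> / 4) ^ d"
      using \<eta>(1) by (intro mult_right_mono power_mono) auto
    also have "\<dots> \<le> real (card Z)"
    proof -
      have "\<eta> / 2 / 2 = \<eta> / 4" by simp
      then show ?thesis using Z0(4) unfolding cardZ n_def by (simp only:)
    qed
    finally show ?thesis unfolding n_def .
  qed
  have 4: "\<exists>\<omega>. cmod \<omega> = 1 \<and> (\<forall>y\<in>Y. cmod (cis (2 * pi * (z \<bullet> y)) - \<omega>) \<le> 1 / 8)" if "z \<in> Z" for z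
  proof -
    obtain x where x: "x \<in> Z0" "z = int_vec x" using \<open>z \<in> Z\<close> by (auto simp: Z_def)
    have "cmod (cis (2 * pi * (z \<bullet> y q)) - echar P (idot x p0)) \<le> 1 / 8" if q: "q \<in> Qh" for q
      unfolding x(2) y_def pt_def
    proof (rule gap_point_aligned[OF P0 Xc(3)[OF q]])
      show "near_multiple P (\<eta> / 2) (idot x (p i))" if "i < d" for i using Z0(3) x(1) that by blast
      show "c q i < L" if "i < d" for i using Xc(2)[OF q] that by (auto simp: PiE_iff)
      have "64 * real d * real L * (\<eta> / 2) \<le> 64 * real d * real L * \<eta>" using \<eta>(1) by (intro mult_left_mono) auto
      then show "64 * real d * real L * (\<eta> / 2) \<le> 1" using L by linarith
    qed (use \<eta>(1) in simp)
    then show ?thesis unfolding Y_def using norm_echar by blast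
  qed
  have 5: "card {z\<in>Z. \<exists>t::real. norm (a + t *\<^sub>R v - z) < \<rho>} \<le> 3 ^ (H + (CARD('n) + d))" if v: "norm v = 1" for a v :: "real^'n"
    unfolding Z_def
  proof (rule card_near_line_le[where P=P and p=p and d=d and \<eta>=\<eta> and R=R and r=r])
    show "2 * r \<le> R" using rR mult_le_mono1[of 2 "4 * n" r] n1 by linarith
  qed (use Z0 \<rho> v pp2 finite_tube_points[OF P0] in auto)
  have 6: "lo i + \<delta> / 3 \<le> y q $ i \<and> y q $ i \<le> lo i + real mm * \<delta> - \<delta> / 3" if "q \<in> Qh" "i \<noteq> i0" for q i
  proof -
    have "q i < mm" using that by (auto simp: Qh_def Q_def PiE_iff)
    then have "real (q i) + 1 \<le> real mm" by linarith
    then have "(real (q i) + 1) * \<delta> \<le> real mm * \<delta>" using \<delta> by (intro mult_right_mono) auto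
    moreover have "0 \<le> real (q i) * \<delta>" using \<delta> by simp
    ultimately show ?thesis using yi[OF that] unfolding lq_def distrib_right by linarith
  qed
  have 7: "real mm ^ (CARD('n) - 1) \<le> 2 * real (card Y)" using pp1 unfolding cardY Qh_def cardQ n_def by simp
  have f1: "finite Y" unfolding Y_def using finQh by simp
  have f2: "finite Z" unfolding Z_def using Z0(1) by simp
  have f3: "\<forall>y\<in>Y. \<bar>y $ i0 - g y\<bar> \<le> \<kappa>" by (simp add: Y_def yi0)
  have f4: "\<forall>y\<in>Y. \<forall>i. i \<noteq> i0 \<longrightarrow> lo i + \<delta> / 3 \<le> y $ i \<and> y $ i \<le> lo i + real mm * \<delta> - \<delta> / 3"
      by (simp add: Y_def 6)
  have f5: "\<forall>y\<in>Y. \<forall>y'\<in>Y. y \<noteq> y' \<longrightarrow> (\<exists>i. i \<noteq> i0 \<and> 2 * \<delta> / 3 \<le> \<bar>y $ i - y' $ i\<bar>)"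
    proof (intro ballI impI)
      fix a b assume "a \<in> Y" "b \<in> Y" "a \<noteq> b"
      then obtain q q' where "q \<in> Qh" "q' \<in> Qh" "a = y q" "b = y q'" unfolding Y_def by (elim imageE)
      then show "\<exists>i. i \<noteq> i0 \<and> 2 * \<delta> / 3 \<le> \<bar>a $ i - b $ i\<bar>" using sep[of q q'] \<open>a \<noteq> b\<close> by metis
    qed
  have f6: "\<forall>z\<in>Z. norm z \<le> real R / 4" using 1 by blast
  have f7: "\<forall>z\<in>Z. \<forall>z'\<in>Z. z \<noteq> z' \<longrightarrow> 1 \<le> norm (z - z')" using 2 by blast
  have f8: "\<forall>z\<in>Z. \<exists>\<omega>. cmod \<omega> = 1 \<and> (\<forall>y\<in>Y. cmod (cis (2 * pi * (z \<bullet> y)) - \<omega>) \<le> 1 / 8)" using 4 by blast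
  have f9: "\<forall>a v. norm v = 1 \<longrightarrow> card {z\<in>Z. \<exists>t::real. norm (a + t *\<^sub>R v - z) < \<rho>} \<le> 3 ^ (H + (CARD('n) + d))"
    using 5 by blast
  show ?thesis
    by (rule exI[of _ Y], rule exI[of _ Z], intro conjI f1 f2 f3 f4 f5 f6 f7 3 f8 f9 7)
qed

section \<open>Small perturbations with prescribed values at the nodes\<close>

subsection \<open>A bump function\<close>

lemma ramp_has_derivative:
  assumes "2 \<le> m"
  shows "((\<lambda>t::real. max 0 t ^ m) has_real_derivative real m * max 0 t ^ (m - 1)) (at t)"
proof -
  consider "t > 0" | "t < 0" | "t = 0" by linarith
  then show ?thesis
  proof cases
    case 1
    have "((\<lambda>t::real. t ^ m) has_real_derivative real m * t ^ (m - 1)) (at t)"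
      by (auto intro!: derivative_eq_intros)
    then have "((\<lambda>t::real. max 0 t ^ m) has_real_derivative real m * t ^ (m - 1)) (at t)"
      by (rule has_field_derivative_transform_within_open[where S="{0<..}"]) (use 1 in auto)
    then show ?thesis using 1 by simp
  next
    case 2
    have "((\<lambda>t::real. 0) has_real_derivative 0) (at t)" by simp
    then have "((\<lambda>t::real. max 0 t ^ m) has_real_derivative 0) (at t)"
      by (rule has_field_derivative_transform_within_open[where S="{..<0}"]) (use 2 assms in auto)
    moreover have "m - 1 \<noteq> 0" using assms by simp
    ultimately show ?thesis using 2 by (simp add: power_0_left)
  next
    case 3
    have "((\<lambda>h::real. (max 0 (0 + h) ^ m - max 0 0 ^ m) / h) \<longlongrightarrow> 0) (at 0)"
    proof (rule Lim_null_comparison)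
      show "\<forall>\<^sub>F h in at 0. norm ((max 0 (0 + h) ^ m - max 0 0 ^ m) / h) \<le> \<bar>h\<bar> ^ (m - 1)"
      proof (rule always_eventually, rule allI)
        fix h :: real
        have e: "\<bar>h\<bar> ^ m = \<bar>h\<bar> ^ (m - 1) * \<bar>h\<bar>" using assms by (metis One_nat_def Suc_1 Suc_leD Suc_pred less_eq_Suc_le power_Suc2)
        have "max 0 h ^ m \<le> \<bar>h\<bar> ^ m" by (intro power_mono) auto
        then have "max 0 h ^ m / \<bar>h\<bar> \<le> \<bar>h\<bar> ^ (m - 1)" unfolding e by (cases "h = 0") (auto simp: divide_le_eq)
        then show "norm ((max 0 (0 + h) ^ m - max 0 0 ^ m) / h) \<le> \<bar>h\<bar> ^ (m - 1)" using assms by (simp add: power_0_left)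
      qed
      have "((\<lambda>h::real. \<bar>h\<bar> ^ (m - 1)) \<longlongrightarrow> \<bar>0\<bar> ^ (m - 1)) (at 0)" by (intro tendsto_intros)
      moreover have "\<bar>0::real\<bar> ^ (m - 1) = 0" using assms by (simp add: power_0_left)
      ultimately show "((\<lambda>h::real. \<bar>h\<bar> ^ (m - 1)) \<longlongrightarrow> 0) (at 0)" by (simp only:)
    qed
    moreover have "real m * max 0 (0::real) ^ (m - 1) = 0" using assms by (simp add: power_0_left)
    ultimately show ?thesis unfolding 3 DERIV_def by (simp only:)
  qed
qed

text \<open>Finite smoothness is enough, so a power of the positive part can replace the usual exponential.\<close>

lemma Ck_on_ramp: "k < m \<Longrightarrow> Ck_on k (\<lambda>t::real. max 0 t ^ m) UNIV"
proof (induction k arbitrary: m)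
  case 0
  then show ?case by (auto simp: Ck_on_0 intro!: continuous_intros)
next
  case (Suc k)
  have D: "((\<lambda>t::real. max 0 t ^ m) has_derivative (\<lambda>h. real m * max 0 t ^ (m - 1) * h)) (at t)" for t
    using ramp_has_derivative[of m t] Suc.prems by (simp add: has_field_derivative_def)
  have fd: "frechet_derivative (\<lambda>t::real. max 0 t ^ m) (at t) = (\<lambda>h. real m * max 0 t ^ (m - 1) * h)" for t
    using frechet_derivative_at[OF D] by simp
  have "Ck_on k (\<lambda>t::real. real m * max 0 t ^ (m - 1)) UNIV"
    using Suc.prems by (intro Ck_on_linear_left[OF bounded_linear_mult_right open_UNIV] Suc.IH) simp
  moreover have "(\<lambda>t::real. max 0 t ^ m) differentiable_on UNIV"
    using D by (auto simp: differentiable_on_def intro: differentiableI)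
  ultimately show ?case by (auto simp: Ck_on_Suc fd intro!: continuous_intros)
qed

lemma Ck_on_prod:
  fixes f :: "'i \<Rightarrow> 'a::euclidean_space \<Rightarrow> real"
  assumes "open U" "\<And>i. i \<in> I \<Longrightarrow> Ck_on k (f i) U"
  shows "Ck_on k (\<lambda>x. \<Prod>i\<in>I. f i x) U"
  using assms(2)
proof (induction I rule: infinite_finite_induct)
  case (insert i I)
  have "Ck_on k (\<lambda>x. f i x *\<^sub>R (\<Prod>i\<in>I. f i x)) U"
    using insert by (intro Ck_on_scaleR[OF assms(1)]) auto
  then show ?case using insert by simp
qed (auto simp: Ck_on_const)

lemma iter_partial_zero: "iter_partial bs (\<lambda>x::'a::euclidean_space. 0::'b::real_normed_vector) x = 0"
proof -
  have "iter_partial bs (\<lambda>x::'a. 0::'b) = (\<lambda>x. 0)"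
    by (induction bs) (simp_all add: frechet_derivative_const)
  then show ?thesis by simp
qed

text \<open>The bump depends only on the coordinates other than \<open>i0\<close>, so that it can serve as a shear in direction \<open>i0\<close>.
  Its support is therefore not compact; uniform bounds follow from those on a cube by invariance.\<close>

lemma bump_exists:
  fixes i0 :: "'n::finite"
  shows "\<exists>(\<beta> :: real^'n \<Rightarrow> real) B. Ck_on k \<beta> UNIV \<and> 0 \<le> B \<and> Ck_bound k \<beta> UNIV B \<and> \<beta> 0 = 1 \<and>
     (\<forall>x x'. (\<forall>i. i \<noteq> i0 \<longrightarrow> x $ i = x' $ i) \<longrightarrow> \<beta> x = \<beta> x') \<and>
     (\<forall>x. (\<exists>i. i \<noteq> i0 \<and> 1 < \<bar>x $ i\<bar>) \<longrightarrow> \<beta> x = 0)"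
proof -
  define \<theta> where "\<theta> t = max 0 (1 - t * t) ^ (k + 1)" for t :: real
  have \<theta>C: "Ck_on k \<theta> UNIV"
  proof -
    have "Ck_on k (\<lambda>t::real. 1 + (- t) *\<^sub>R t) UNIV"
      by (intro Ck_on_add Ck_on_const Ck_on_scaleR Ck_on_bounded_linear open_UNIV bounded_linear_minus bounded_linear_ident)
    from Ck_on_compose[OF open_UNIV open_UNIV _ this Ck_on_ramp[of k "k + 1"]]
    show ?thesis by (simp add: o_def \<theta>_def[abs_def])
  qed
  define \<beta> where "\<beta> x = (\<Prod>i\<in>-{i0}. \<theta> (x $ i))" for x :: "real^'n"
  have C: "Ck_on k \<beta> UNIV" unfolding \<beta>_def[abs_def]
  proof (rule Ck_on_prod[OF open_UNIV])
    fix i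
    have "Ck_on k (\<theta> \<circ> (\<lambda>x::real^'n. x $ i)) UNIV"
      by (rule Ck_on_compose[OF open_UNIV open_UNIV _ Ck_on_bounded_linear[OF bounded_linear_vec_nth] \<theta>C]) simp
    then show "Ck_on k (\<lambda>x::real^'n. \<theta> (x $ i)) UNIV" by (simp add: o_def)
  qed
  have inv: "\<beta> x = \<beta> x'" if "\<forall>i. i \<noteq> i0 \<longrightarrow> x $ i = x' $ i" for x x'
    unfolding \<beta>_def using that by (intro prod.cong) auto
  have supp: "\<beta> x = 0" if i: "i \<noteq> i0" "1 < \<bar>x $ i\<bar>" for x i
  proof -
    have "1 * 1 < \<bar>x $ i\<bar> * \<bar>x $ i\<bar>" using i(2) by (intro mult_strict_mono) auto
    then have "1 < x $ i * x $ i" by (simp add: abs_mult_self_eq)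
    then have "\<theta> (x $ i) = 0" by (simp add: \<theta>_def)
    then show ?thesis unfolding \<beta>_def using i(1) by (intro prod_zero) auto
  qed
  define K where "K = cbox (\<chi> i. - 1) ((\<chi> i. 1) :: real^'n)"
  obtain B where B: "B \<ge> 0" "Ck_bound k \<beta> K B"
    using Ck_bound_exists[of K UNIV k \<beta>] C by (auto simp: K_def)
  have "Ck_bound k \<beta> UNIV B"
    unfolding Ck_bound_def
  proof (intro ballI)
    fix bs :: "(real^'n) list" and x :: "real^'n" assume bs: "bs \<in> multi_index k"
    show "norm (iter_partial bs \<beta> x) \<le> B"
    proof (cases "\<exists>i. i \<noteq> i0 \<and> 1 < \<bar>x $ i\<bar>")
      case True
      then obtain i where i: "i \<noteq> i0" "1 < \<bar>x $ i\<bar>" by blast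
      have "open {x :: real^'n. 1 < \<bar>x $ i\<bar>}" by (intro open_Collect_less continuous_intros)
      then have "iter_partial bs \<beta> x = iter_partial bs (\<lambda>x. 0) x"
        by (rule iter_partial_cong_open) (use i supp in auto)
      then show ?thesis using B(1) by (simp add: iter_partial_zero)
    next
      case False
      define y where "y = (x $ i0) *\<^sub>R axis i0 (1::real)"
      have eq: "(\<lambda>x. \<beta> (1 *\<^sub>R (x - y))) = \<beta>"
        by (rule ext, rule inv) (simp add: y_def axis_def)
      have "iter_partial bs \<beta> x = iter_partial bs \<beta> (1 *\<^sub>R (x - y))"
        using iter_partial_rescale[OF C bs, of 1 y x] unfolding eq by simp
      moreover have "x - y \<in> K"
      proof -
        have b: "\<bar>(x - y) $ i\<bar> \<le> 1" for i using False by (cases "i = i0") (auto simp: y_def axis_def not_less)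
        then have "- 1 \<le> (x - y) $ i \<and> (x - y) $ i \<le> 1" for i using b[of i] unfolding abs_le_iff by linarith
        then show ?thesis by (simp add: K_def mem_box_cart)
      qed
      ultimately show ?thesis using B(2) bs by (simp add: Ck_bound_def)
    qed
  qed
  moreover have "\<beta> 0 = 1" by (simp add: \<beta>_def \<theta>_def)
  ultimately show ?thesis using C B(1) inv supp by blast
qed

subsection \<open>Bumps with disjoint supports\<close>

lemma Ck_bound_cmult:
  fixes f :: "'a::euclidean_space \<Rightarrow> real"
  assumes "Ck_on k f UNIV" "Ck_bound k f UNIV B"
  shows "Ck_bound k (\<lambda>x. h * f x) UNIV (\<bar>h\<bar> * B)"
  using assms
proof (induction k arbitrary: f)
  case 0
  then show ?case by (auto simp: Ck_bound_0 abs_mult intro: mult_left_mono)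
next
  case (Suc k)
  have d: "f differentiable (at x)" for x
    using Suc.prems(1) by (simp add: Ck_on_Suc differentiable_on_eq_differentiable_at)
  have eq: "frechet_derivative (\<lambda>x. h * f x) (at x) b = h * frechet_derivative f (at x) b" for x b
    by (rule frechet_derivative_linear_left[OF bounded_linear_mult_right d])
  show ?case unfolding Ck_bound_Suc eq
    using Suc by (auto simp: Ck_on_Suc Ck_bound_Suc abs_mult intro: mult_left_mono)
qed

text \<open>At each point at most one bump is alive in a neighbourhood, so that the sum has the same $C^k$ bound as a single
  bump. By \<open>iter_partial_rescale\<close> the latter is governed by the product of the height and \<open>c ^ k\<close>.\<close>

lemma disjoint_bumps:
  fixes \<beta> :: "real^'n::finite \<Rightarrow> real" and h :: "real^'n \<Rightarrow> real"
  assumes \<beta>: "Ck_on k \<beta> UNIV" "Ck_bound k \<beta> UNIV B" "0 \<le> B"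
      "\<And>x. (\<exists>i. i \<noteq> i0 \<and> 1 < \<bar>x $ i\<bar>) \<Longrightarrow> \<beta> x = 0"
    and Y: "finite Y" "\<And>y y'. y \<in> Y \<Longrightarrow> y' \<in> Y \<Longrightarrow> y \<noteq> y' \<Longrightarrow> \<exists>i. i \<noteq> i0 \<and> 2 / c < \<bar>y $ i - y' $ i\<bar>"
    and c: "1 \<le> c" and h: "\<And>y. y \<in> Y \<Longrightarrow> \<bar>h y\<bar> * c ^ k \<le> \<tau>" "0 \<le> \<tau>"
  shows "Ck_on k (\<lambda>x. \<Sum>y\<in>Y. h y * \<beta> (c *\<^sub>R (x - y))) UNIV"
    and "Ck_bound k (\<lambda>x. \<Sum>y\<in>Y. h y * \<beta> (c *\<^sub>R (x - y))) UNIV (\<tau> * B)"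
    and "\<And>y. y \<in> Y \<Longrightarrow> (\<Sum>y'\<in>Y. h y' * \<beta> (c *\<^sub>R (y - y'))) = h y * \<beta> 0"
proof -
  define f where "f y x = h y * \<beta> (c *\<^sub>R (x - y))" for y x
  have Cf: "Ck_on k (f y) UNIV" for y
    unfolding f_def by (intro Ck_on_linear_left[OF bounded_linear_mult_right open_UNIV] Ck_on_rescale \<beta>(1))
  show "Ck_on k (\<lambda>x. \<Sum>y\<in>Y. h y * \<beta> (c *\<^sub>R (x - y))) UNIV"
    using Ck_on_sum[OF open_UNIV Cf] by (simp add: f_def)
  have far: "f y x = 0" if "i \<noteq> i0" "1 / c < \<bar>x $ i - y $ i\<bar>" for y x i
  proof -
    have "1 < c * \<bar>x $ i - y $ i\<bar>" using that(2) c by (simp add: divide_less_eq mult.commute)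
    then have "1 < \<bar>(c *\<^sub>R (x - y)) $ i\<bar>" using c by (simp add: abs_mult)
    then show ?thesis using \<beta>(4) that(1) unfolding f_def by (metis mult_zero_right)
  qed
  have fb: "norm (iter_partial bs (f y) x) \<le> \<tau> * B" if y: "y \<in> Y" and bs: "bs \<in> multi_index k" for y bs x
  proof -
    have C': "Ck_on k (\<lambda>z. h y * \<beta> z) UNIV" by (intro Ck_on_linear_left[OF bounded_linear_mult_right open_UNIV] \<beta>(1))
    have "norm (iter_partial bs (\<lambda>z. h y * \<beta> z) (c *\<^sub>R (x - y))) \<le> \<bar>h y\<bar> * B"
      using Ck_bound_cmult[OF \<beta>(1,2)] bs by (auto simp: Ck_bound_def)
    moreover have "iter_partial bs (f y) x = c ^ length bs *\<^sub>R iter_partial bs (\<lambda>z. h y * \<beta> z) (c *\<^sub>R (x - y))"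
      unfolding f_def by (rule iter_partial_rescale[OF C' bs])
    moreover have "c ^ length bs \<le> c ^ k" using c bs by (intro power_increasing) (auto simp: multi_index_def)
    ultimately have "norm (iter_partial bs (f y) x) \<le> c ^ k * (\<bar>h y\<bar> * B)"
      using c \<beta>(3) by (auto simp: abs_mult intro!: mult_mono)
    also have "\<dots> = (\<bar>h y\<bar> * c ^ k) * B" by simp
    also have "\<dots> \<le> \<tau> * B" using h(1)[OF y] \<beta>(3) by (intro mult_right_mono)
    finally show ?thesis .
  qed
  show "Ck_bound k (\<lambda>x. \<Sum>y\<in>Y. h y * \<beta> (c *\<^sub>R (x - y))) UNIV (\<tau> * B)"
    unfolding Ck_bound_def f_def[symmetric]
  proof (intro ballI)
    fix bs :: "(real^'n) list" and x :: "real^'n" assume bs: "bs \<in> multi_index k"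
    define near where "near y \<longleftrightarrow> (\<forall>i. i \<noteq> i0 \<longrightarrow> \<bar>x $ i - y $ i\<bar> \<le> 1 / c)" for y
    define Y' where "Y' = {y\<in>Y. \<not> near y}"
    define U where "U = (\<Inter>y\<in>Y'. \<Union>i\<in>-{i0}. {x. 1 / c < \<bar>x $ i - y $ i\<bar>})"
    have U: "open U" unfolding U_def
      using Y(1) by (intro open_INT open_UN ballI open_Collect_less continuous_intros) (auto simp: Y'_def)
    have xU: "x \<in> U" by (auto simp: U_def Y'_def near_def not_le)
    have zero: "f y x' = 0" if "x' \<in> U" "y \<in> Y'" for x' y
      using that far unfolding U_def by blast
    have near1: "y = y'" if "y \<in> Y" "y' \<in> Y" "near y" "near y'" for y y'
    proof (rule ccontr)
      assume "y \<noteq> y'"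
      then obtain i where i: "i \<noteq> i0" "2 / c < \<bar>y $ i - y' $ i\<bar>" using Y(2) \<open>y \<in> Y\<close> \<open>y' \<in> Y\<close> by blast
      have "\<bar>x $ i - y $ i\<bar> \<le> 1 / c" "\<bar>x $ i - y' $ i\<bar> \<le> 1 / c" using \<open>near y\<close> \<open>near y'\<close> i(1) by (auto simp: near_def)
      then have "\<bar>y $ i - y' $ i\<bar> \<le> 1 / c + 1 / c" by linarith
      then show False using i(2) by simp
    qed
    show "norm (iter_partial bs (\<lambda>x. \<Sum>y\<in>Y. f y x) x) \<le> \<tau> * B"
    proof (cases "\<exists>y\<in>Y. near y")
      case True
      then obtain y where y: "y \<in> Y" "near y" by blast
      have "(\<Sum>y\<in>Y. f y x') = f y x'" if "x' \<in> U" for x'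
      proof -
        have "(\<Sum>y'\<in>Y. f y' x') = (\<Sum>y'\<in>{y}. f y' x')"
        proof (rule sum.mono_neutral_right[OF Y(1)])
          show "\<forall>y'\<in>Y - {y}. f y' x' = 0"
            using zero[OF that] near1[OF y(1) _ y(2)] by (auto simp: Y'_def)
        qed (use y in simp)
        then show ?thesis by simp
      qed
      then have "iter_partial bs (\<lambda>x. \<Sum>y\<in>Y. f y x) x = iter_partial bs (f y) x"
        by (rule iter_partial_cong_open[OF U _ xU])
      then show ?thesis using fb[OF y(1) bs] by simp
    next
      case False
      then have "(\<Sum>y\<in>Y. f y x') = 0" if "x' \<in> U" for x'
        using zero[OF that] by (intro sum.neutral) (auto simp: Y'_def)
      then have "iter_partial bs (\<lambda>x. \<Sum>y\<in>Y. f y x) x = iter_partial bs (\<lambda>x. 0) x"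
        by (rule iter_partial_cong_open[OF U _ xU])
      then show ?thesis using h(2) \<beta>(3) by (simp add: iter_partial_zero)
    qed
  qed
  show "(\<Sum>y'\<in>Y. h y' * \<beta> (c *\<^sub>R (y - y'))) = h y * \<beta> 0" if y: "y \<in> Y" for y
  proof -
    have "(\<Sum>y'\<in>Y. f y' y) = (\<Sum>y'\<in>{y}. f y' y)"
    proof (rule sum.mono_neutral_right[OF Y(1)])
      show "\<forall>y'\<in>Y - {y}. f y' y = 0"
      proof
        fix y' assume "y' \<in> Y - {y}"
        then obtain i where i: "i \<noteq> i0" "2 / c < \<bar>y $ i - y' $ i\<bar>" using Y(2)[OF y, of y'] by auto
        have "1 / c < 2 / c" using c by (simp add: divide_strict_right_mono)
        then show "f y' y = 0" using i by (intro far[of i]) auto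
      qed
    qed (use y in simp)
    then show ?thesis by (simp add: f_def)
  qed
qed

section \<open>Shears of a hypersurface\<close>

lemma Ck_on_shear:
  fixes b :: "real^'n::finite \<Rightarrow> real"
  assumes "Ck_on k b UNIV"
  shows "Ck_on k (\<lambda>x. x + (s * b x) *\<^sub>R e) UNIV"
proof -
  have "Ck_on k (\<lambda>x. b x *\<^sub>R (s *\<^sub>R e)) UNIV"
    by (intro Ck_on_scaleR[OF open_UNIV assms] Ck_on_const)
  then have "Ck_on k (\<lambda>x. x + b x *\<^sub>R (s *\<^sub>R e)) UNIV"
    by (intro Ck_on_add[OF open_UNIV Ck_on_bounded_linear[OF bounded_linear_ident]])
  then show ?thesis by (simp add: mult.commute)
qed

lemma homeomorphism_open_image:
  assumes "homeomorphism UNIV UNIV T T'" "open U"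
  shows "open (T ` U)"
proof -
  have "openin (top_of_set UNIV) (T ` U)"
    by (rule homeomorphism_imp_open_map[OF assms(1)]) (use assms(2) in simp)
  then show ?thesis by simp
qed

text \<open>A \<open>C\<^sup>k\<close> diffeomorphism of the ambient space transports the charts. Perturbing by a shear
  of the ambient space thus avoids any discussion of the stability of hypersurfaces under small perturbations.\<close>

lemma compact_hypersurface_image:
  fixes S :: "(real^'n::finite) set" and T T' :: "real^'n \<Rightarrow> real^'n"
  assumes S: "compact_hypersurface TYPE('m::finite) k S"
    and T: "Ck_on k T UNIV" "Ck_on k T' UNIV" "\<And>x. T' (T x) = x" "\<And>x. T (T' x) = x"
  shows "compact_hypersurface TYPE('m) k (T ` S)"
  unfolding compact_hypersurface_def
proof (intro conjI ballI)
  have cT: "continuous_on UNIV T" "continuous_on UNIV T'" using T Ck_on_imp_continuous by auto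
  have hT: "homeomorphism UNIV UNIV T T'"
  proof -
    have "range T = UNIV" by (rule surjI[of T T']) (rule T(4))
    moreover have "range T' = UNIV" by (rule surjI[of T' T]) (rule T(3))
    ultimately show ?thesis unfolding homeomorphism_def using cT T(3,4) by blast
  qed
  show "compact (T ` S)" using S cT(1) by (auto simp: compact_hypersurface_def intro: compact_continuous_image continuous_on_subset)
  show "T ` S \<noteq> {}" using S by (simp add: compact_hypersurface_def)
  fix q assume "q \<in> T ` S"
  then obtain p where p: "p \<in> S" "q = T p" by blast
  obtain U V \<Phi> and \<Psi> :: "(real^'m) \<times> real \<Rightarrow> real^'n" where pU: "p \<in> U" and ch: "slice_chart k S U V \<Phi> \<Psi>"
    using S p(1) unfolding compact_hypersurface_def by blast
  then obtain H where H: "H = UNIV \<or> (\<exists>b\<in>Basis. H = {u. 0 \<le> u \<bullet> b})" "\<Phi> ` (U \<inter> S) = V \<inter> (H \<times> {0})"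
    unfolding slice_chart_def by blast
  have c: "open U" "open V" "homeomorphism U V \<Phi> \<Psi>" "Ck_on k \<Phi> U" "Ck_on k \<Psi> V"
    using ch unfolding slice_chart_def by auto
  have TU: "open (T ` U)" by (rule homeomorphism_open_image[OF hT c(1)])
  have "homeomorphism (T ` U) U T' T"
    by (rule homeomorphism_symD, rule homeomorphism_of_subsets[OF hT]) auto
  then have h: "homeomorphism (T ` U) V (\<Phi> \<circ> T') (T \<circ> \<Psi>)" by (rule homeomorphism_compose[OF _ c(3)])
  have inj: "inj T" by (rule inj_on_inverseI) (rule T(3))
  have im: "(\<Phi> \<circ> T') ` (T ` U \<inter> T ` S) = \<Phi> ` (U \<inter> S)"
    unfolding image_Int[OF inj, symmetric] image_comp by (rule image_cong) (simp_all add: T(3))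
  have C1: "Ck_on k (\<Phi> \<circ> T') (T ` U)"
    by (rule Ck_on_compose[OF TU c(1) _ Ck_on_subset[OF T(2)] c(4)]) (auto simp: T(3))
  have C2: "Ck_on k (T \<circ> \<Psi>) V"
    by (rule Ck_on_compose[OF c(2) open_UNIV _ c(5) T(1)]) simp
  have sc: "slice_chart k (T ` S) (T ` U) V (\<Phi> \<circ> T') (T \<circ> \<Psi>)"
    unfolding slice_chart_def im by (intro conjI exI[of _ H] TU c(2) h C1 C2 H)
  have "q \<in> T ` U" unfolding p(2) using pU by (rule imageI)
  then show "\<exists>U V \<Phi> (\<Psi> :: (real^'m) \<times> real \<Rightarrow> real^'n). q \<in> U \<and> slice_chart k (T ` S) U V \<Phi> \<Psi>"
    using sc by blast
qed

text \<open>The tangent space at a point cannot contain all coordinate axes. If it does not contain the axis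
  \<open>i0\<close>, then the map \<open>(u, t) \<mapsto> \<psi> u + t e\<close>, where \<open>e\<close> is the unit vector of that axis, has an invertible
  derivative. By the open mapping property the hypersurface meets all nearby lines parallel to the axis. The
  point of intersection may vary discontinuously with the line.\<close>

lemma transversal_patch:
  fixes S :: "(real^'n::finite) set"
  assumes S: "compact_hypersurface TYPE('m::finite) k S" and k: "1 \<le> k" and dim: "CARD('m) + 1 = CARD('n)"
  obtains i0 W and \<psi> :: "real^'m \<Rightarrow> real^'n" and \<rho> c r x0 s U
  where "open W" "Ck_on k \<psi> W" "open U" "Ck_on k \<rho> U" "\<psi> ` W \<subseteq> U" "\<And>u. u \<in> W \<Longrightarrow> \<rho> (\<psi> u) = u"
    "0 < r" "cball c (2 * r) \<subseteq> W" "\<psi> ` cball c (2 * r) \<subseteq> S"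
    "0 < s" "\<forall>x :: real^'n. (\<forall>i. i \<noteq> i0 \<longrightarrow> \<bar>x $ i - x0 $ i\<bar> \<le> s) \<longrightarrow> (\<exists>u\<in>cball c r. \<forall>i. i \<noteq> i0 \<longrightarrow> \<psi> u $ i = x $ i)"
proof -
  obtain p where p: "p \<in> S" using S by (auto simp: compact_hypersurface_def)
  obtain U W E \<rho> v0 and \<psi> :: "real^'m \<Rightarrow> real^'n" and H r0 where ch: "local_patch S U W E \<psi> \<rho>" "Ck_on k \<psi> W"
    "0 < r0" "cball v0 r0 \<subseteq> W" "v0 \<in> H" "E = W \<inter> H" "H = UNIV \<or> (\<exists>b\<in>Basis. H = {u. 0 \<le> u \<bullet> b})" "Ck_on k \<rho> U"
    by (rule hypersurface_chart[OF S k p]) (rule that)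
  have l: "open U" "open W" "\<psi> ` W \<subseteq> U" "\<And>u. u \<in> W \<Longrightarrow> \<rho> (\<psi> u) = u" "\<psi> ` E = U \<inter> S" "Ck_on 1 \<psi> W" "Ck_on 1 \<rho> U"
    using ch(1) by (auto simp: local_patch_def)
  obtain c r1 where r1: "0 < r1" "cball c r1 \<subseteq> cball v0 r0 \<inter> H"
    using convex_cball_Int_halfspace(3)[OF ch(7,5,3)] by blast
  define r where "r = r1 / 2"
  have r: "0 < r" "cball c (2 * r) \<subseteq> W" "cball c (2 * r) \<subseteq> E" using r1 ch(4,6) by (auto simp: r_def)
  have cW: "c \<in> W" using r by auto
  define D where "D = frechet_derivative \<psi> (at c)"
  have dD: "(\<psi> has_derivative D) (at c)" unfolding D_def using Ck_on_has_derivative'[OF l(6,2) cW] by simp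
  have linD: "linear D" by (rule has_derivative_linear[OF dD])
  have inD: "inj D" unfolding D_def
    by (rule injI) (metis left_inverse_derivative[OF l(2,1,3,6,7,4) cW])
  have "\<exists>i0. axis i0 1 \<notin> range D"
  proof (rule ccontr)
    assume "\<not> ?thesis"
    then have "(Basis :: (real^'n) set) \<subseteq> range D" by (auto simp: Basis_vec_def)
    then have "UNIV \<subseteq> range D" using span_minimal[of Basis "range D"] linear_subspace_image[OF linD subspace_UNIV] by simp
    then have "dim (UNIV :: (real^'n) set) \<le> dim (range D)" by (intro dim_subset)
    also have "\<dots> \<le> dim (UNIV :: (real^'m) set)" by (rule dim_image_le[OF linD])
    finally show False using dim by simp
  qed
  then obtain i0 where i0: "axis i0 (1::real) \<notin> range D" by blast
  define e where "e = (axis i0 1 :: real^'n)"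
  define F where "F z = \<psi> (fst z) + snd z *\<^sub>R e" for z :: "(real^'m) \<times> real"
  define F' where "F' z = D (fst z) + snd z *\<^sub>R e" for z :: "(real^'m) \<times> real"
  have linF': "linear F'" unfolding F'_def
    by (intro linearI) (simp_all add: linear_add[OF linD] linear_cmul[OF linD] algebra_simps)
  have injF': "inj F'"
    unfolding linear_injective_0[OF linF']
  proof (intro allI impI)
    fix z assume z: "F' z = 0"
    have "snd z = 0"
    proof (rule ccontr)
      assume nz: "snd z \<noteq> 0"
      have "e = D ((- 1 / snd z) *\<^sub>R fst z)"
      proof -
        have "D (fst z) = - (snd z *\<^sub>R e)" using z by (simp add: F'_def eq_neg_iff_add_eq_0)
        then show ?thesis unfolding linear_cmul[OF linD] using nz by simp
      qed
      then show False using i0 by (auto simp: e_def)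
    qed
    moreover from this have "D (fst z) = D 0" using z by (simp add: F'_def linear_0[OF linD])
    then have "fst z = 0" by (rule injD[OF inD])
    ultimately show "z = 0" by (simp add: prod_eq_iff)
  qed
  have "dim (range F') = dim (UNIV :: ((real^'m) \<times> real) set)"
    by (rule dim_image_eq[OF linF']) (use injF' in auto)
  also have "\<dots> = DIM(real^'n)" using dim by simp
  finally have "surj F'"
    using dim_eq_full[of "range F'"] linear_subspace_image[OF linF' subspace_UNIV] span_eq_iff[of "range F'"] by simp
  then obtain G where G: "linear G" "F' \<circ> G = id"
    using linear_surjective_right_inverse[OF linF'] by blast
  define x0 where "x0 = \<psi> c"
  have dF: "(F has_derivative F') (at (c, 0))"
  proof -
    have "((\<lambda>z. \<psi> (fst z)) has_derivative (\<lambda>z. D (fst z))) (at (c, 0))"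
      by (rule has_derivative_compose[where f=fst and g=\<psi>]) (use dD in \<open>auto intro!: derivative_eq_intros\<close>)
    then show ?thesis unfolding F_def[abs_def] F'_def[abs_def] by (auto intro!: derivative_eq_intros)
  qed
  have contF: "continuous_on (W \<times> UNIV) F"
    unfolding F_def[abs_def]
    by (intro continuous_intros continuous_on_compose2[OF Ck_on_imp_continuous[OF l(6)]]) auto
  have "F (c, 0) \<in> interior (F ` (ball c r \<times> UNIV))"
  proof (rule sussmann_open_mapping[of "W \<times> UNIV" F "(c, 0)" F' G])
    show "open (W \<times> (UNIV :: real set))" using l(2) by (simp add: open_Times)
    show "bounded_linear G" using G(1) linear_conv_bounded_linear by blast
    show "F' \<circ> G = id" by (rule G(2))
    show "ball c r \<times> (UNIV :: real set) \<subseteq> W \<times> UNIV" using r by force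
    show "(c, 0) \<in> interior (ball c r \<times> (UNIV :: real set))"
      using r(1) by (simp add: interior_open open_Times)
  qed (use contF cW dF in auto)
  then obtain s0 where s0: "0 < s0" "ball x0 s0 \<subseteq> F ` (ball c r \<times> UNIV)"
    by (auto simp: mem_interior F_def x0_def)
  define s where "s = s0 / (2 * real CARD('n))"
  have s: "0 < s" using s0(1) by (simp add: s_def)
  have key: "\<exists>u\<in>cball c r. \<forall>i. i \<noteq> i0 \<longrightarrow> \<psi> u $ i = x $ i" if x: "\<And>i. i \<noteq> i0 \<Longrightarrow> \<bar>x $ i - x0 $ i\<bar> \<le> s" for x :: "real^'n"
  proof -
    define y where "y = (\<chi> i. if i = i0 then x0 $ i else x $ i)"
    have "norm (y - x0) \<le> (\<Sum>i\<in>UNIV. \<bar>(y - x0) $ i\<bar>)" by (rule norm_le_l1_cart)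
    also have "\<dots> \<le> (\<Sum>i\<in>(UNIV :: 'n set). s)" using x s by (intro sum_mono) (auto simp: y_def)
    also have "\<dots> < s0" using s0(1) by (simp add: s_def)
    finally have "y \<in> ball x0 s0" by (simp add: dist_norm norm_minus_commute)
    then obtain z where "z \<in> ball c r \<times> UNIV" "y = F z" using s0(2) by blast
    then obtain u t where u: "u \<in> ball c r" "y = \<psi> u + t *\<^sub>R e"
      using that[of "fst z" "snd z"] by (auto simp: F_def)
    have "\<psi> u $ i = x $ i" if "i \<noteq> i0" for i
    proof -
      have "y $ i = \<psi> u $ i" using that unfolding u(2) by (simp add: e_def axis_def)
      then show ?thesis using that by (simp add: y_def)
    qed
    then show ?thesis using u(1) by (intro bexI[of _ u]) auto
  qed
  have "\<psi> ` cball c (2 * r) \<subseteq> S" using r(3) l(5) by blast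
  note sub = this
  have "\<forall>x :: real^'n. (\<forall>i. i \<noteq> i0 \<longrightarrow> \<bar>x $ i - x0 $ i\<bar> \<le> s) \<longrightarrow> (\<exists>u\<in>cball c r. \<forall>i. i \<noteq> i0 \<longrightarrow> \<psi> u $ i = x $ i)"
    using key by blast
  then show thesis by (intro that[of W \<psi> U \<rho> r c s i0 x0] l(1,2,3,4) ch(2,8) r(1,2) sub s)
qed

text \<open>The caps are images of small balls under the parametrization. Their lower bound comes from a positive lower bound
  for the area element, and a Lipschitz constant of the parametrization keeps them inside the given balls.\<close>

lemma cap_exists:
  fixes S :: "(real^'n::finite) set" and \<phi> :: "real^'m::finite \<Rightarrow> real^'n"
  assumes \<sigma>: "is_surface_measure TYPE('m) S \<sigma>"
    and W: "open W" "Ck_on 1 \<phi> W" and U: "open U" "Ck_on 1 \<rho> U" "\<phi> ` W \<subseteq> U" "\<And>u. u \<in> W \<Longrightarrow> \<rho> (\<phi> u) = u"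
    and r: "0 < r" "cball c (2 * r) \<subseteq> W" "\<phi> ` cball c (2 * r) \<subseteq> S"
  shows "\<exists>v0>0. \<exists>t0>0. \<forall>t. 0 < t \<longrightarrow> t \<le> t0 \<longrightarrow> (\<forall>u\<in>cball c r. \<exists>cap\<in>sets borel. cap \<subseteq> ball (\<phi> u) t \<and>
     ennreal (v0 * t ^ CARD('m)) \<le> emeasure \<sigma> cap \<and> emeasure \<sigma> cap < \<infinity>)"
proof -
  define K where "K = cball c (2 * r)"
  have K: "compact K" "convex K" "K \<noteq> {}" using r(1) by (auto simp: K_def)
  have KW: "K \<subseteq> W" using r(2) by (simp add: K_def)
  have inj: "inj (frechet_derivative \<phi> (at u))" if "u \<in> W" for u
    using left_inverse_derivative[OF W(1) U(1,3) W(2) U(2,4) that] by (metis injI)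
  have der: "(\<phi> has_derivative frechet_derivative \<phi> (at u)) (at u)" if "u \<in> W" for u
    using Ck_on_has_derivative'[OF W(2,1) that] by simp
  have par: "Ck_parametrization 1 S K \<phi>"
    unfolding Ck_parametrization_def
  proof (intro conjI ballI)
    show "K \<subseteq> closure (interior K)" using r(1) by (simp add: K_def interior_cball closure_ball)
    show "Ck_map 1 \<phi> K" unfolding Ck_map_def using W KW by blast
    show "inj_on \<phi> K" using U(4) KW by (intro inj_on_inverseI[of _ \<rho>]) blast
  qed (use K r inj KW in \<open>auto simp: K_def\<close>)
  have areac: "continuous_on K (area_element \<phi>)" using continuous_on_subset[OF continuous_on_area_element[OF W(2)] KW] .
  have areap: "0 < area_element \<phi> u" if "u \<in> K" for u
    using inj der has_derivative_linear KW that by (intro area_element_pos) blast+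
  obtain ua where ua: "ua \<in> K" "\<And>u. u \<in> K \<Longrightarrow> area_element \<phi> ua \<le> area_element \<phi> u"
    using continuous_attains_inf[OF K(1,3) areac] by blast
  obtain ub where ub: "ub \<in> K" "\<And>u. u \<in> K \<Longrightarrow> area_element \<phi> u \<le> area_element \<phi> ub"
    using continuous_attains_sup[OF K(1,3) areac] by blast
  define a where "a = area_element \<phi> ua"
  have a0: "a > 0" using areap[OF ua(1)] by (simp add: a_def)
  obtain B where B: "B \<ge> 0" "Ck_bound 1 \<phi> K B" using Ck_bound_exists[OF K(1) KW W(2)] by blast
  define M where "M = real CARD('m) * B + 1"
  have M0: "M > 0" using B(1) by (simp add: M_def add_nonneg_pos)
  have lip: "norm (\<phi> x - \<phi> y) \<le> M * norm (x - y)" if "x \<in> K" "y \<in> K" for x y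
  proof (rule differentiable_bound[OF K(2) _ _ that])
    show "(\<phi> has_derivative frechet_derivative \<phi> (at u)) (at u within K)" if "u \<in> K" for u
      using der KW that has_derivative_at_withinI by blast
    show "onorm (frechet_derivative \<phi> (at u)) \<le> M" if "u \<in> K" for u
    proof (rule onorm_le)
      fix h
      have lin: "linear (frechet_derivative \<phi> (at u))" using der[of u] KW \<open>u \<in> K\<close> has_derivative_linear by blast
      have "frechet_derivative \<phi> (at u) h = (\<Sum>b\<in>Basis. (h \<bullet> b) *\<^sub>R frechet_derivative \<phi> (at u) b)"
      proof -
        have "frechet_derivative \<phi> (at u) (\<Sum>b\<in>Basis. (h \<bullet> b) *\<^sub>R b) = (\<Sum>b\<in>Basis. (h \<bullet> b) *\<^sub>R frechet_derivative \<phi> (at u) b)"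
          using lin by (simp add: linear_sum linear_cmul)
        then show ?thesis by (simp add: euclidean_representation)
      qed
      also have "norm \<dots> \<le> (\<Sum>b\<in>(Basis :: (real^'m) set). norm h * B)"
      proof (rule sum_norm_le)
        fix b :: "real^'m" assume b: "b \<in> Basis"
        have "norm (frechet_derivative \<phi> (at u) b) \<le> B"
          using B(2) b \<open>u \<in> K\<close> by (simp add: One_nat_def Ck_bound_Suc Ck_bound_0)
        then show "norm ((h \<bullet> b) *\<^sub>R frechet_derivative \<phi> (at u) b) \<le> norm h * B"
          unfolding norm_scaleR using Basis_le_norm[OF b, of h] by (intro mult_mono) auto
      qed
      also have "\<dots> = real CARD('m) * B * norm h" by simp
      also have "\<dots> \<le> M * norm h" unfolding M_def by (intro mult_right_mono) auto
      finally show "norm (frechet_derivative \<phi> (at u) h) \<le> M * norm h" .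
    qed
  qed
  define v0 where "v0 = a * (unit_ball_vol (real CARD('m)) * (1 / (2 * M)) ^ CARD('m))"
  have v0: "v0 > 0" using a0 M0 by (simp add: v0_def)
  have "\<exists>cap\<in>sets borel. cap \<subseteq> ball (\<phi> u) t \<and> ennreal (v0 * t ^ CARD('m)) \<le> emeasure \<sigma> cap \<and> emeasure \<sigma> cap < \<infinity>"
    if t: "0 < t" "t \<le> M * r" and u: "u \<in> cball c r" for t u
  proof -
    define C where "C = cball u (t / (2 * M))"
    define cap where "cap = \<phi> ` C"
    have t2: "t / (2 * M) \<le> r" "0 < t / (2 * M)" using t M0 r(1) by (auto simp: field_simps)
    have CK: "C \<subseteq> K"
    proof
      fix x assume "x \<in> C"
      then have "dist u x \<le> r" using t2(1) by (simp add: C_def)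
      then show "x \<in> K" using u dist_triangle[of c x u] by (simp add: K_def)
    qed
    have uK: "u \<in> K" using CK t2(2) by (auto simp: C_def)
    have "compact cap" unfolding cap_def
      by (rule compact_continuous_image[OF continuous_on_subset[OF Ck_on_imp_continuous[OF W(2)]]]) (use CK KW in \<open>auto simp: C_def\<close>)
    then have capb: "cap \<in> sets borel" by (rule borel_compact)
    have "cap \<subseteq> ball (\<phi> u) t"
    proof
      fix x assume "x \<in> cap"
      then obtain z where z: "z \<in> C" "x = \<phi> z" by (auto simp: cap_def)
      have "norm (\<phi> u - \<phi> z) \<le> M * norm (u - z)" using z(1) CK uK by (intro lip) auto
      also have "\<dots> \<le> M * (t / (2 * M))" using z(1) M0 by (intro mult_left_mono) (auto simp: C_def dist_norm)
      also have "\<dots> < t" using M0 t(1) by simp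
      finally show "x \<in> ball (\<phi> u) t" by (simp add: z(2) dist_norm)
    qed
    moreover have em: "emeasure \<sigma> cap = (\<integral>\<^sup>+x. indicator C x * ennreal (area_element \<phi> x) \<partial>lborel)"
    proof -
      have "cap \<subseteq> \<phi> ` K" using CK by (auto simp: cap_def)
      then have "emeasure \<sigma> cap = (\<integral>\<^sup>+x. indicator (K \<inter> \<phi> -` cap) x * ennreal (area_element \<phi> x) \<partial>lborel)"
        using \<sigma> par capb by (auto simp: is_surface_measure_def)
      moreover have "K \<inter> \<phi> -` cap = C"
        using par CK by (auto simp: cap_def Ck_parametrization_def inj_on_def)
      ultimately show ?thesis by simp
    qed
    have volC: "emeasure lborel C = ennreal (unit_ball_vol (real CARD('m)) * (t / (2 * M)) ^ CARD('m))"
      unfolding C_def using t2(2) by (simp add: emeasure_cball)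
    have "ennreal (v0 * t ^ CARD('m)) \<le> emeasure \<sigma> cap"
    proof -
      have "v0 * t ^ CARD('m) = a * (unit_ball_vol (real CARD('m)) * (t / (2 * M)) ^ CARD('m))"
        by (simp add: v0_def power_divide)
      then have "ennreal (v0 * t ^ CARD('m)) = ennreal a * emeasure lborel C"
        using a0 t2(2) by (simp add: volC ennreal_mult)
      also have "\<dots> = (\<integral>\<^sup>+x. ennreal a * indicator C x \<partial>lborel)" by (simp add: nn_integral_cmult_indicator C_def)
      also have "\<dots> \<le> emeasure \<sigma> cap" unfolding em
        using ua(2) CK by (intro nn_integral_mono) (auto simp: indicator_def a_def intro!: ennreal_leI)
      finally show ?thesis .
    qed
    moreover have "emeasure \<sigma> cap < \<infinity>"
    proof -
      have "emeasure \<sigma> cap \<le> (\<integral>\<^sup>+x. ennreal (area_element \<phi> ub) * indicator C x \<partial>lborel)" unfolding em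
        using ub(2) CK by (intro nn_integral_mono) (auto simp: indicator_def intro!: ennreal_leI)
      also have "\<dots> = ennreal (area_element \<phi> ub) * emeasure lborel C" by (simp add: nn_integral_cmult_indicator C_def)
      also have "\<dots> < \<infinity>" by (simp add: volC ennreal_mult_less_top)
      finally show ?thesis .
    qed
    ultimately show ?thesis using capb by blast
  qed
  moreover have "0 < M * r" using M0 r(1) by simp
  ultimately show ?thesis using v0 by blast
qed

section \<open>Choice of the parameters\<close>

text \<open>The orders of growth that enter the choice of the parameters, where \<open>x\<close> is the binary logarithm of the radius, \<open>u\<close>
  is the exponent of the final bound up to constants, and \<open>e\<close> is the number of generators up to rounding. They satisfy
  \<open>e x * u x = x\<close> for \<open>x > 1\<close>.\<close>

lemma scale_asymptotics:
  fixes C D E n1 n2 :: real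
  assumes D: "0 < D" and n2: "0 < n2"
  defines "u \<equiv> (\<lambda>x::real. sqrt (x * ln x))" and "e \<equiv> (\<lambda>x::real. sqrt (x / ln x))"
  shows "eventually (\<lambda>x. 1 \<le> e x) at_top"
    and "eventually (\<lambda>x. 2 * e x \<le> u x) at_top"
    and "eventually (\<lambda>x. 2 * e x \<le> x) at_top"
    and "eventually (\<lambda>x. C \<le> u x) at_top"
    and "eventually (\<lambda>x. C * (D + x) * (64 / 81) powr x \<le> 1) at_top"
    and "eventually (\<lambda>x. C + 2 * ln x + 4 * e x + D * (ln (x * (x + 1)) + E) \<le> x * ln 2) at_top"
    and "eventually (\<lambda>x. 2 * e x * ln (104 * (n1 + x)) \<le> 5 * u x) at_top"
    and "eventually (\<lambda>x. ln (6 * x) \<le> u x) at_top"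
    and "eventually (\<lambda>x. n2 * (ln (x * (x + 1)) + E) \<le> u x) at_top"
    and "eventually (\<lambda>x. ln (8 * x\<^sup>2) \<le> u x) at_top"
proof -
  show "eventually (\<lambda>x. 1 \<le> e x) at_top"  unfolding e_def by real_asymp
  show "eventually (\<lambda>x. 2 * e x \<le> u x) at_top"  unfolding e_def u_def by real_asymp
  show "eventually (\<lambda>x. 2 * e x \<le> x) at_top"  unfolding e_def by real_asymp
  show "eventually (\<lambda>x. C \<le> u x) at_top"  unfolding u_def by real_asymp
  show "eventually (\<lambda>x. C * (D + x) * (64 / 81) powr x \<le> 1) at_top" by real_asymp
  show "eventually (\<lambda>x. C + 2 * ln x + 4 * e x + D * (ln (x * (x + 1)) + E) \<le> x * ln 2) at_top"
    unfolding e_def using D by real_asymp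
  show "eventually (\<lambda>x. 2 * e x * ln (104 * (n1 + x)) \<le> 5 * u x) at_top"
    unfolding e_def u_def by real_asymp
  show "eventually (\<lambda>x. ln (6 * x) \<le> u x) at_top" unfolding u_def by real_asymp
  show "eventually (\<lambda>x. n2 * (ln (x * (x + 1)) + E) \<le> u x) at_top"
    unfolding u_def using n2 by real_asymp
  show "eventually (\<lambda>x. ln (8 * x\<^sup>2) \<le> u x) at_top" unfolding u_def by real_asymp
qed

lemma le_exp_of_ln_le: "0 < (a::real) \<Longrightarrow> ln a \<le> b \<Longrightarrow> a \<le> exp b"
  using exp_le_cancel_iff[of "ln a" b] by simp

lemma root_powr: "0 < (a::real) \<Longrightarrow> 0 < d \<Longrightarrow> (a powr (1 / real d)) ^ d = a"
  by (simp add: powr_power)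

lemma ln_5_le: "ln (5::real) \<le> 2"
proof -
  have "2 \<le> exp (1::real)" using exp_ge_add_one_self[of 1] by simp
  have "1 + 1/2 \<le> exp (1/2::real)" by (rule exp_ge_add_one_self)
  then have "(3/2) ^ 4 \<le> exp (1/2::real) ^ 4" by (intro power_mono) auto
  also have "\<dots> = exp 2" by (simp add: exp_of_nat_mult[symmetric])
  finally have "5 \<le> exp (2::real)" by (simp add: power_divide)
  then show ?thesis using ln_mono[of 5 "exp 2"] by simp
qed

text \<open>With \<open>R = 2 ^ j\<close>, the conditions of \<open>scale_nodes\<close> force \<open>\<eta> ^ d\<close> to be about \<open>1 / R\<close> and allow \<open>L ^ d\<close> to be
  about \<open>R\<close>, up to factors \<open>d ^ d\<close> and powers of \<open>j\<close>. The number of points in a tube is bounded by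
  \<open>3 ^ (H + (n + d))\<close>, and \<open>H\<close> must be at least a multiple of \<open>j / d\<close>. The losses \<open>d ^ d\<close> and \<open>3 ^ H\<close> are of the
  same order if \<open>d\<close> is about \<open>sqrt (j / ln j)\<close>; this is the source of the factor
  \<open>exp (C * sqrt (log R * log (log R)))\<close>. A target has volume about \<open>\<delta> ^ (n - 1) * \<kappa>\<close> with \<open>\<kappa>\<close> about \<open>\<delta> ^ k\<close>, as required
  by a perturbation of class $C^k$, and must have volume about \<open>1 / R\<close>. Hence \<open>\<delta> ^ (n - 1 + k)\<close> is about
  \<open>1 / R\<close>, and the number of nodes, about \<open>1 / \<delta> ^ (n - 1)\<close>, is the power of \<open>R\<close> in the theorem. The factor
  \<open>1 / j\<^sup>2\<close> makes the perturbations of different scales summable, and the cells fill an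
  interval of length \<open>s / (j * (j + 1)) = s / j - s / (j + 1)\<close>, so that these intervals are disjoint.\<close>

lemma scale_parameters:
  fixes n k :: nat and s :: real
  assumes n: "2 \<le> n" and k: "2 \<le> k" and s: "0 < s" "s \<le> 1"
  shows "\<forall>\<^sub>F j in sequentially. \<exists>d I H L mm \<eta> \<delta> \<kappa>. 1 \<le> d \<and> 0 < \<eta> \<and> 13 * real (n + d) * \<eta> \<le> 1 \<and>
    (2 / 3) ^ I * real (2 ^ j) < 1 \<and> (2 * real (2 ^ j) + 1) * real I * (26 * real (n + d) * \<eta>) ^ d \<le> 1 \<and>
    4 * (8 * real (2 ^ j) + 1) ^ n * (real (n + d) + 1) * 4 ^ d * (2 / 3) ^ (d * H) \<le> 1 \<and>
    64 * real d * real L * \<eta> \<le> 1 \<and> 0 < \<delta> \<and> \<delta> \<le> 1 \<and> 0 < \<kappa> \<and> \<kappa> \<le> 1 / 4 \<and>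
    8 \<le> real L ^ d * ((\<delta> / 4) ^ (n - 1) * \<kappa>) \<and> 1 \<le> mm \<and> real mm * \<delta> \<le> s / (real j * (real j + 1)) \<and>
    \<kappa> * (4 / \<delta>) ^ k \<le> 1 / (real j)\<^sup>2 \<and> 1 / 2 ^ j \<le> \<delta> \<and>
    2 * (4 * real n) ^ n * (2 ^ j) powr (real (n - 1) / real (n - 1 + k)) * 3 ^ (H + (n + d)) * (4 / \<eta>) ^ d
      \<le> exp ((4 * real n + 23) * sqrt (real j * ln (real j))) * 2 ^ j * real mm ^ (n - 1)"
proof -
  define D where "D = n - 1 + k"
  have D0: "0 < real D" "1 \<le> real D" using n by (auto simp: D_def)
  define c where "c = 2 * (4 * real n) ^ n"
  have c1: "1 \<le> c" 
  proof -
    have "1 \<le> (4 * real n) ^ n" using n by (intro one_le_power) auto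
    then show ?thesis by (simp add: c_def)
  qed
  note ev = scale_asymptotics[OF D0(1), of "real (n - 1)", THEN eventually_compose_filterlim[OF _ filterlim_real_sequentially]]
  have n1: "0 < real (n - 1)" and pn: "0 < real n + 1" using n by simp_all
  show ?thesis
    using ev(1)[OF n1] ev(2)[OF n1] ev(3)[OF n1] ev(4)[OF n1, of "real n + 6 + ln c"]
      scale_asymptotics(5)[OF pn zero_less_one, of "4 * 9 ^ n", THEN eventually_compose_filterlim[OF _ filterlim_real_sequentially]]
      ev(6)[OF n1, of "real D * ln 4 + ln 8" "- ln s"] ev(7)[OF n1, of "real n"] ev(8)[OF n1]
      ev(9)[OF n1, of "ln 8 - ln s"] ev(10)[OF n1] eventually_ge_at_top[of 2]
  proof eventually_elim
    case (elim j)
    define x where "x = real j"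
    define u where "u = sqrt (x * ln x)"
    define e where "e = sqrt (x / ln x)"
    define R where "R = (2::real) ^ j"
    have x2: "2 \<le> x" using elim by (simp add: x_def)
    have lnx: "0 < ln x" using x2 by simp
    have x21: "1 \<le> x\<^sup>2" using x2 by (intro one_le_power) auto
    have a: "1 \<le> e" "2 * e \<le> u" "2 * e \<le> x" "real n + 6 + ln c \<le> u"
      "4 * 9 ^ n * (real n + 1 + x) * (64 / 81) powr x \<le> 1"
      "real D * ln 4 + ln 8 + 2 * ln x + 4 * e + real D * (ln (x * (x + 1)) + - ln s) \<le> x * ln 2"
      "2 * e * ln (104 * (real n + x)) \<le> 5 * u" "ln (6 * x) \<le> u"
      "real (n - 1) * (ln (x * (x + 1)) + (ln 8 - ln s)) \<le> u" "ln (8 * x\<^sup>2) \<le> u"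
      using elim unfolding x_def u_def e_def by (simp_all only: )
    have lnc: "0 \<le> ln c" using c1 by simp
    have eu: "e * u = x" using x2 lnx by (simp add: e_def u_def real_sqrt_mult[symmetric])
    have R1: "1 \<le> R" "0 < R" by (simp_all add: R_def)
    have lnR: "ln R = x * ln 2" by (simp add: R_def x_def ln_realpow)
    have Rx: "R = 2 powr x" by (simp add: R_def x_def powr_realpow)
    define d where "d = nat \<lceil>e\<rceil>"
    have d: "1 \<le> d" "e \<le> real d" "real d \<le> 2 * e" using a(1) unfolding d_def by linarith+
    have d0: "0 < real d" "0 < d" using d(1) by auto
    have dx: "real d \<le> x" using d(3) a(3) by linarith
    then have dj: "d \<le> j" by (simp add: x_def)
    have xd: "x / real d \<le> u" "u / 2 \<le> x / real d"
    proof -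
      have "x \<le> u * real d" using mult_right_mono[OF d(2), of u] a eu by (simp add: mult.commute)
      then show "x / real d \<le> u" using d0 by (simp add: divide_le_eq)
      have "u * real d \<le> u * (2 * e)" using d(3) a by (intro mult_left_mono) auto
      also have "\<dots> = 2 * x" by (simp add: eu[symmetric])
      finally have "u * real d \<le> 2 * x" .
      then show "u / 2 \<le> x / real d" using d0 by (simp add: le_divide_eq)
    qed
    define I where "I = 2 * j"
    have I1: "1 \<le> real I" using x2 by (simp add: I_def x_def)
    define W where "W = (2 * R + 1) * real I"
    have W: "R \<le> W" "W \<le> R * (6 * x)" "0 < W"
    proof -
      have "R * 1 \<le> W" unfolding W_def using R1 I1 by (intro mult_mono) auto
      then show "R \<le> W" "0 < W" using R1 by simp_all
      have "W \<le> (3 * R) * real I" unfolding W_def using R1 by (intro mult_right_mono) auto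
      then show "W \<le> R * (6 * x)" by (simp add: I_def x_def)
    qed
    \<comment> \<open>The choice \<open>26 * (n + d) * \<eta> = 1 / X\<close> turns the second condition on \<open>\<eta>\<close> into an equality.\<close>
    define X where "X = W powr (1 / real d)"
    have Xd: "X ^ d = W" unfolding X_def using W(3) d0 by (intro root_powr) auto
    have X8: "8 \<le> X"
    proof -
      have "3 \<le> x / real d" using xd(2) a(4) lnc by linarith
      then have "2 powr 3 \<le> 2 powr (x / real d)" by (intro powr_mono) auto
      also have "\<dots> = R powr (1 / real d)" by (simp add: Rx powr_powr)
      also have "\<dots> \<le> X" unfolding X_def using W R1 by (intro powr_mono2) auto
      finally show ?thesis by (simp add: powr_numeral)
    qed
    define nd where "nd = real (n + d)"
    have nd: "0 < nd" "real d \<le> nd" "nd \<le> real n + x" using d0 dx by (auto simp: nd_def)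
    define \<eta> where "\<eta> = 1 / (26 * nd * X)"
    have \<eta>0: "0 < \<eta>" using nd X8 by (simp add: \<eta>_def)
    have \<eta>1: "13 * nd * \<eta> \<le> 1" using nd X8 by (simp add: \<eta>_def field_simps)
    have \<eta>2: "26 * nd * \<eta> = 1 / X" using nd X8 by (simp add: \<eta>_def field_simps)
    have c\<eta>: "(2 * R + 1) * real I * (26 * nd * \<eta>) ^ d \<le> 1"
      unfolding \<eta>2 power_divide Xd using W(3) by (simp add: W_def)
    have cI: "(2 / 3) ^ I * R < 1"
    proof -
      have "(2 / 3) ^ I * R = (8 / 9 :: real) ^ j"
        by (simp add: I_def R_def power_mult power_mult_distrib[symmetric] power2_eq_square)
      also have "\<dots> < 1" using x2 power_strict_decreasing[of 0 j "8 / 9 :: real"] by (simp add: x_def)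
      finally show ?thesis .
    qed
    define q where "q = 1 / (64 * real d * \<eta>)"
    have q: "2 * X / 5 \<le> q"
    proof -
      have "q = 26 / 64 * (nd / real d) * X" using d0 nd X8 by (simp add: q_def \<eta>_def)
      moreover have "26 / 64 * 1 * X \<le> 26 / 64 * (nd / real d) * X"
        using nd d0 X8 by (intro mult_right_mono mult_left_mono) auto
      ultimately show ?thesis using X8 by linarith
    qed
    define L where "L = nat \<lfloor>q\<rfloor>"
    have L: "real L \<le> q" "X / 5 \<le> real L" unfolding L_def using q X8 by linarith+
    have cL: "64 * real d * real L * \<eta> \<le> 1" 
      using mult_left_mono[OF L(1), of "64 * real d * \<eta>"] d0 \<eta>0 by (simp add: q_def mult_ac)
    have Ld: "R / 5 ^ d \<le> real L ^ d"
    proof -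
      have "R / 5 ^ d \<le> (X / 5) ^ d" unfolding power_divide Xd using W by (simp add: divide_right_mono)
      also have "\<dots> \<le> real L ^ d" using L X8 by (intro power_mono) auto
      finally show ?thesis .
    qed
    \<comment> \<open>The value of \<open>(\<delta> / 4) ^ D\<close>: large enough for the progression to hit targets of this size.\<close>
    define p where "p = 8 * x\<^sup>2 * 5 ^ d / R"
    have p0: "0 < p" using x2 R1 by (simp add: p_def)
    have p1: "1 \<le> 8 * x\<^sup>2 * 5 ^ d"
      using mult_mono[of 1 "8 * x\<^sup>2" 1 "5 ^ d"] x21 one_le_power[of "5::real" d] by simp
    define \<delta> where "\<delta> = 4 * p powr (1 / real D)"
    have \<delta>0: "0 < \<delta>" using p0 by (simp add: \<delta>_def)
    have \<delta>D: "(\<delta> / 4) ^ D = p" unfolding \<delta>_def using p0 D0 by (simp add: root_powr)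
    define \<kappa> where "\<kappa> = (\<delta> / 4) ^ k / x\<^sup>2"
    have \<kappa>0: "0 < \<kappa>" using \<delta>0 x2 by (simp add: \<kappa>_def)
    have big: "8 \<le> real L ^ d * ((\<delta> / 4) ^ (n - 1) * \<kappa>)"
    proof -
      have "(\<delta> / 4) ^ (n - 1) * \<kappa> = p / x\<^sup>2" by (simp add: \<kappa>_def \<delta>D[symmetric] D_def power_add)
      moreover have "R / 5 ^ d * (p / x\<^sup>2) = 8" using x2 R1 by (simp add: p_def)
      moreover have "R / 5 ^ d * (p / x\<^sup>2) \<le> real L ^ d * (p / x\<^sup>2)" using Ld p0 by (intro mult_right_mono) auto
      ultimately show ?thesis by simp
    qed
    define \<l> where "\<l> = s / (x * (x + 1))"
    have xx: "0 < x * (x + 1)" "1 \<le> x * (x + 1)" using x2 mult_mono[of 1 x 1 "x + 1"] by auto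
    have l0: "0 < \<l>" "\<l> \<le> 1" using s xx by (auto simp: \<l>_def divide_le_eq)
    have lnl: "ln \<l> = ln s - ln (x * (x + 1))" unfolding \<l>_def using s(1) xx(1) by (intro ln_divide_pos) auto
    have d5: "real d * ln 5 \<le> 4 * e" using mult_mono[OF d(3) ln_5_le] d0 a by simp
    have lnp: "ln p = ln 8 + 2 * ln x + real d * ln 5 - x * ln 2"
    proof -
      have "ln p = ln (8 * x\<^sup>2 * 5 ^ d) - ln R" unfolding p_def using x2 R1 by (intro ln_divide_pos) auto
      also have "ln (8 * x\<^sup>2 * 5 ^ d) = ln (8 * x\<^sup>2) + ln (5 ^ d)" using x2 by (intro ln_mult_pos) auto
      also have "ln (8 * x\<^sup>2) = ln 8 + ln (x\<^sup>2)" using x2 by (intro ln_mult_pos) auto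
      finally show ?thesis using x2 by (simp add: lnR ln_realpow)
    qed
    have \<delta>l: "\<delta> \<le> \<l>"
    proof -
      have "ln p \<le> real D * (ln \<l> - ln 4)" using a(6) d5 unfolding lnp lnl by (simp add: algebra_simps)
      then have "ln p / real D \<le> ln \<l> - ln 4" using D0 by (simp add: divide_le_eq mult.commute)
      moreover have "ln \<delta> = ln 4 + ln p / real D" unfolding \<delta>_def using p0 by (simp add: ln_mult_pos ln_powr)
      ultimately have "ln \<delta> \<le> ln \<l>" by linarith
      then show ?thesis using \<delta>0 l0 by (simp add: ln_le_cancel_iff)
    qed
    then have \<delta>1: "\<delta> \<le> 1" using l0 by linarith
    have \<kappa>1: "\<kappa> \<le> 1 / 4"
    proof -
      have "(\<delta> / 4) ^ k \<le> (\<delta> / 4) ^ 1" using \<delta>0 \<delta>1 k by (intro power_decreasing) auto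
      then have "(\<delta> / 4) ^ k \<le> 1 / 4" using \<delta>1 by simp
      moreover have "(\<delta> / 4) ^ k / x\<^sup>2 \<le> (\<delta> / 4) ^ k / 1" using x2 \<delta>0 by (intro divide_left_mono) (auto simp: one_le_power)
      ultimately show ?thesis unfolding \<kappa>_def by linarith
    qed
    have c\<kappa>: "\<kappa> * (4 / \<delta>) ^ k \<le> 1 / x\<^sup>2"
      using \<delta>0 x2 by (simp add: \<kappa>_def power_divide)
    have R\<delta>: "1 / R \<le> \<delta>"
    proof -
      have "1 / R \<le> p" unfolding p_def using R1 p1 by (intro divide_right_mono) auto
      then have "(1 / R) powr (1 / real D) \<le> p powr (1 / real D)" using R1 by (intro powr_mono2) auto
      moreover have "(1 / R) powr 1 \<le> (1 / R) powr (1 / real D)" using R1 D0 by (intro powr_mono') auto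
      ultimately have "1 / R \<le> p powr (1 / real D)" using R1 by simp
      then show ?thesis using powr_ge_zero[of p "1 / real D"] unfolding \<delta>_def by linarith
    qed
    define mm where "mm = nat \<lfloor>\<l> / \<delta>\<rfloor>"
    have l\<delta>: "1 \<le> \<l> / \<delta>" using \<delta>l \<delta>0 by simp
    have mq: "1 \<le> mm \<and> real mm \<le> y \<and> y / 2 \<le> real mm" if "1 \<le> y" "mm = nat \<lfloor>y\<rfloor>" for y
    proof -
      have "1 \<le> mm" "real mm \<le> y" "y < real mm + 1" using that by linarith+
      then show ?thesis by linarith
    qed
    have mm: "1 \<le> mm" "real mm \<le> \<l> / \<delta>" "\<l> / \<delta> / 2 \<le> real mm"
      using mq[OF l\<delta> mm_def] by blast+
    have cm: "real mm * \<delta> \<le> \<l>" using mm(2) \<delta>0 by (simp add: le_divide_eq)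
    \<comment> \<open>As \<open>(2 / 3) ^ 2 < 1 / 2\<close>, the factor \<open>(2 / 3) ^ (d * H)\<close> beats \<open>R ^ n\<close> if \<open>d * H \<ge> 2 * n * j\<close>; the additional \<open>4 * j\<close> beats \<open>4 ^ d\<close> and the constants.\<close>
    define H where "H = nat \<lceil>(2 * real n + 4) * (x / real d)\<rceil>"
    have xd0: "0 \<le> (2 * real n + 4) * (x / real d)" using x2 d0 by simp
    have H: "(2 * real n + 4) * (x / real d) \<le> real H" "real H \<le> (2 * real n + 4) * (x / real d) + 1"
      unfolding H_def using xd0 by linarith+
    have H2: "real H \<le> (2 * real n + 4) * u + 1" using H(2) mult_left_mono[OF xd(1), of "2 * real n + 4"] by linarith
    have dH: "(2 * n + 4) * j \<le> d * H"
    proof -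
      have "(2 * real n + 4) * x = real d * ((2 * real n + 4) * (x / real d))" using d0 by simp
      also have "\<dots> \<le> real d * real H" using H(1) by (intro mult_left_mono) auto
      finally have "real ((2 * n + 4) * j) \<le> real (d * H)" by (simp add: x_def)
      then show ?thesis by (simp only: of_nat_le_iff)
    qed
    have cH: "4 * (8 * R + 1) ^ n * (nd + 1) * 4 ^ d * (2 / 3) ^ (d * H) \<le> 1"
    proof -
      have "(8 * R + 1) ^ n \<le> (9 * R) ^ n" using R1 by (intro power_mono) auto
      moreover have "(4::real) ^ d \<le> 4 ^ j" using dj by (intro power_increasing) auto
      moreover have "(2 / 3 :: real) ^ (d * H) \<le> (2 / 3) ^ ((2 * n + 4) * j)" using dH by (intro power_decreasing) auto
      ultimately have "4 * (8 * R + 1) ^ n * (nd + 1) * 4 ^ d * (2 / 3) ^ (d * H)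
          \<le> 4 * (9 * R) ^ n * (real n + 1 + x) * 4 ^ j * (2 / 3) ^ ((2 * n + 4) * j)"
        using R1 nd by (intro mult_mono) auto
      also have "\<dots> = 4 * 9 ^ n * (real n + 1 + x) * ((8 / 9) ^ n) ^ j * (64 / 81) ^ j"
      proof -
        have "R ^ n = (2 ^ n) ^ j" by (simp add: R_def power_mult[symmetric] mult.commute)
        moreover have "(2 / 3 :: real) ^ ((2 * n + 4) * j) = ((4 / 9) ^ n) ^ j * (16 / 81) ^ j"
          by (simp add: power_mult power_add power_mult_distrib power_divide)
        moreover have "((8 / 9 :: real) ^ n) ^ j = (2 ^ n) ^ j * ((4 / 9) ^ n) ^ j"
          by (simp add: power_mult_distrib[symmetric])
        moreover have "(64 / 81 :: real) ^ j = 4 ^ j * (16 / 81) ^ j" by (simp add: power_mult_distrib[symmetric])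
        ultimately show ?thesis by (simp add: power_mult_distrib mult_ac)
      qed
      also have "\<dots> \<le> 4 * 9 ^ n * (real n + 1 + x) * 1 * (64 / 81) ^ j"
        using x2 by (intro mult_right_mono mult_left_mono power_le_one) auto
      also have "\<dots> \<le> 1" using a(5) by (simp add: x_def powr_realpow)
      finally show ?thesis .
    qed
    have fin: "c * R powr (real (n - 1) / real D) * 3 ^ (H + (n + d)) * (4 / \<eta>) ^ d
      \<le> exp ((4 * real n + 23) * u) * R * real mm ^ (n - 1)"
    proof -
      define \<alpha> where "\<alpha> = real (n - 1) / real D"
      have \<alpha>: "0 \<le> \<alpha>" "\<alpha> \<le> 1" using D0 by (auto simp: \<alpha>_def D_def)
      have F1: "c \<le> exp u" using a(4) c1 by (intro le_exp_of_ln_le) auto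
      have F2: "3 ^ (H + (n + d)) \<le> exp ((4 * real n + 12) * u)"
      proof (rule le_exp_of_ln_le)
        have "ln (3::real) \<le> 2" using ln_5_le ln_mono[of 3 "5::real"] by linarith
        then have "ln (3 ^ (H + (n + d)) :: real) \<le> real (H + (n + d)) * 2"
          unfolding ln_realpow by (intro mult_left_mono) auto
        also have "\<dots> = 2 * real H + 2 * real n + 2 * real d" by simp
        also have "\<dots> \<le> 2 * ((2 * real n + 4) * u) + 4 * u" using H2 a(2,4) d(3) lnc by linarith
        also have "\<dots> = (4 * real n + 12) * u" by (simp add: algebra_simps)
        finally show "ln (3 ^ (H + (n + d)) :: real) \<le> (4 * real n + 12) * u" .
      qed simp
      have F3: "(104 * nd) ^ d \<le> exp (5 * u)"
      proof (rule le_exp_of_ln_le)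
        have l: "0 \<le> ln (104 * nd)" using nd d by (simp add: nd_def)
        have "ln ((104 * nd) ^ d) = real d * ln (104 * nd)" by (rule ln_realpow)
        also have "\<dots> \<le> 2 * e * ln (104 * (real n + x))"
          using d(3) nd l a(1) by (intro mult_mono ln_mono) auto
        finally show "ln ((104 * nd) ^ d) \<le> 5 * u" using a(7) by linarith
      qed (use nd in simp)
      have F4: "6 * x \<le> exp u" using a(8) x2 by (intro le_exp_of_ln_le) auto
      have F5: "(8 / \<l>) ^ (n - 1) \<le> exp u"
      proof (rule le_exp_of_ln_le)
        have "ln ((8 / \<l>) ^ (n - 1)) = real (n - 1) * ln (8 / \<l>)" using l0 by (simp add: ln_realpow)
        also have "ln (8 / \<l>) = ln (x * (x + 1)) + (ln 8 - ln s)" using l0 by (simp add: ln_divide_pos lnl)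
        finally show "ln ((8 / \<l>) ^ (n - 1)) \<le> u" using a(9) by simp
      qed (use l0 in simp)
      have F6: "(8 * x\<^sup>2 * 5 ^ d) powr \<alpha> \<le> exp (3 * u)"
      proof -
        have "(8 * x\<^sup>2 * 5 ^ d) powr \<alpha> \<le> (8 * x\<^sup>2 * 5 ^ d) powr 1" using p1 \<alpha> by (intro powr_mono) auto
        also have "\<dots> = 8 * x\<^sup>2 * 5 ^ d" using p1 by simp
        also have "\<dots> \<le> exp (3 * u)"
        proof (rule le_exp_of_ln_le)
          have "ln (8 * x\<^sup>2 * 5 ^ d) = ln (8 * x\<^sup>2) + real d * ln 5" using x2 by (simp add: ln_mult_pos ln_realpow)
          then show "ln (8 * x\<^sup>2 * 5 ^ d) \<le> 3 * u" using a(10,2) d5 by linarith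
        qed (use p1 in linarith)
        finally show ?thesis .
      qed
      have \<eta>d: "(4 / \<eta>) ^ d \<le> exp (5 * u) * (R * exp u)"
      proof -
        have "4 / \<eta> = 104 * nd * X" by (simp add: \<eta>_def)
        then have "(4 / \<eta>) ^ d = (104 * nd) ^ d * W" by (simp only: power_mult_distrib Xd)
        also have "\<dots> \<le> exp (5 * u) * (R * exp u)"
          using F3 order_trans[OF W(2) mult_left_mono[OF F4, of R]] R1 W(3) by (intro mult_mono) simp_all
        finally show ?thesis .
      qed
      have R\<alpha>: "R powr \<alpha> \<le> exp (4 * u) * real mm ^ (n - 1)"
      proof -
        have "(\<delta> / 4) ^ (n - 1) = p powr \<alpha>"
          unfolding \<delta>_def using p0 by (simp add: powr_power \<alpha>_def)
        also have "\<dots> = (8 * x\<^sup>2 * 5 ^ d) powr \<alpha> / R powr \<alpha>" unfolding p_def by (rule powr_divide)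
        finally have "R powr \<alpha> * (\<delta> / 4) ^ (n - 1) = (8 * x\<^sup>2 * 5 ^ d) powr \<alpha>" using R1 by simp
        moreover have "(\<l> / \<delta> / 2) ^ (n - 1) \<le> real mm ^ (n - 1)" using mm(3) l0 \<delta>0 by (intro power_mono) auto
        moreover have "1 = (8 / \<l>) ^ (n - 1) * (\<delta> / 4) ^ (n - 1) * (\<l> / \<delta> / 2) ^ (n - 1)"
          using l0 \<delta>0 by (simp add: power_mult_distrib[symmetric])
        then have "R powr \<alpha> = (R powr \<alpha> * (\<delta> / 4) ^ (n - 1)) * (8 / \<l>) ^ (n - 1) * (\<l> / \<delta> / 2) ^ (n - 1)"
          by (metis mult.assoc mult.commute mult.right_neutral)
        ultimately have "R powr \<alpha> \<le> exp (3 * u) * exp u * real mm ^ (n - 1)"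
          using F5 F6 l0 \<delta>0 by (auto intro!: mult_mono)
        then show ?thesis by (simp add: exp_add[symmetric])
      qed
      have "c * R powr \<alpha> * 3 ^ (H + (n + d)) * (4 / \<eta>) ^ d \<le>
         exp u * (exp (4 * u) * real mm ^ (n - 1)) * exp ((4 * real n + 12) * u) * (exp (5 * u) * (R * exp u))"
        using F1 F2 R\<alpha> \<eta>d c1 \<eta>0 by (intro mult_mono) auto
      also have "\<dots> = (exp u * exp (4 * u) * exp ((4 * real n + 12) * u) * exp (5 * u) * exp u) * R * real mm ^ (n - 1)"
        by (simp only: mult_ac)
      also have "exp u * exp (4 * u) * exp ((4 * real n + 12) * u) * exp (5 * u) * exp u = exp ((4 * real n + 23) * u)"
        unfolding exp_add[symmetric] by (simp add: algebra_simps)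
      finally show ?thesis by (simp add: \<alpha>_def)
    qed
    have R': "real (2 ^ j) = R" by (simp add: R_def)
    show ?case unfolding R' R_def[symmetric]
      using d(1) \<eta>0 \<eta>1 cI c\<eta> cH cL \<delta>0 \<delta>1 \<kappa>0 \<kappa>1 big mm(1) cm c\<kappa> R\<delta> fin
      unfolding nd_def c_def D_def \<l>_def x_def u_def
      by (intro exI[of _ d] exI[of _ I] exI[of _ H] exI[of _ L] exI[of _ mm] exI[of _ \<eta>] exI[of _ \<delta>] exI[of _ \<kappa>] conjI)
  qed
qed

section \<open>The configuration at one dyadic scale\<close>

text \<open>
  The nodes \<open>Y\<close> and frequencies \<open>Z\<close> for the radius \<open>2 ^ j\<close>, where \<open>\<delta>\<close> is the side of the cells and \<open>M\<close> bounds the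
  number of frequencies near a line. The last line is the only place where all parameters meet: up to constants that
  depend on the hypersurface, it is the inequality of the theorem.\<close>

definition scale_config ::
  "'n::finite \<Rightarrow> (real^'n \<Rightarrow> real) \<Rightarrow> real^'n \<Rightarrow> real \<Rightarrow> real \<Rightarrow> nat \<Rightarrow> nat \<Rightarrow>
   (real^'n) set \<Rightarrow> (real^'n) set \<Rightarrow> real \<Rightarrow> real \<Rightarrow> bool" where
  "scale_config i0 g x0 s \<rho> k j Y Z \<delta> M \<longleftrightarrow>
     1 / 2 ^ j \<le> \<delta> \<and> \<delta> \<le> 1 \<and> finite Y \<and> Y \<noteq> {} \<and> finite Z \<and> Z \<noteq> {} \<and>
     (\<forall>y\<in>Y. \<bar>y $ i0 - g y\<bar> * (4 / \<delta>) ^ k \<le> 1 / (real j)\<^sup>2) \<and>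
     (\<forall>y\<in>Y. \<forall>i. i \<noteq> i0 \<longrightarrow> x0 $ i + s / (real j + 1) + \<delta> / 3 \<le> y $ i \<and> y $ i \<le> x0 $ i + s / real j - \<delta> / 3) \<and>
     (\<forall>y\<in>Y. \<forall>y'\<in>Y. y \<noteq> y' \<longrightarrow> (\<exists>i. i \<noteq> i0 \<and> 2 * \<delta> / 3 \<le> \<bar>y $ i - y' $ i\<bar>)) \<and>
     (\<forall>z\<in>Z. norm z \<le> 2 ^ j / 4) \<and> (\<forall>z\<in>Z. \<forall>z'\<in>Z. z \<noteq> z' \<longrightarrow> 1 \<le> norm (z - z')) \<and>
     (\<forall>z\<in>Z. \<exists>\<omega>. cmod \<omega> = 1 \<and> (\<forall>y\<in>Y. cmod (cis (2 * pi * (z \<bullet> y)) - \<omega>) \<le> 1 / 8)) \<and>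
     (\<forall>a v. norm v = 1 \<longrightarrow> real (card {z\<in>Z. \<exists>t::real. norm (a + t *\<^sub>R v - z) < \<rho>}) \<le> M) \<and> 0 \<le> M \<and>
     M * (2 ^ j) powr (real (CARD('n) - 1) / real (CARD('n) - 1 + k)) * (2 ^ j) ^ (CARD('n) - 1)
       \<le> exp ((4 * real CARD('n) + 23) * sqrt (real j * ln (real j))) * real (card Y) * real (card Z)"

lemma scale_config_exists:
  fixes i0 :: "'n::finite" and g :: "real^'n \<Rightarrow> real" and x0 :: "real^'n"
  assumes n: "2 \<le> CARD('n)" and k: "2 \<le> k" and s: "0 < s" "s \<le> 1"
    and g: "\<And>x x'. (\<And>i. i \<noteq> i0 \<Longrightarrow> x $ i = x' $ i) \<Longrightarrow> g x = g x'"
    and \<rho>: "0 < \<rho>" "\<rho> \<le> 1 / 16"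
  shows "\<forall>\<^sub>F j in sequentially. \<exists>Y Z \<delta> M. scale_config i0 g x0 s \<rho> k j Y Z \<delta> M"
  using scale_parameters[OF n k s] eventually_ge_at_top[of 1]
proof eventually_elim
  case (elim j)
  define n where "n = CARD('n)"
  define E where "E = exp ((4 * real n + 23) * sqrt (real j * ln (real j)))"
  define R where "R = (2::real) ^ j"
  define \<alpha> where "\<alpha> = real (n - 1) / real (n - 1 + k)"
  from elim(1) obtain d I H L mm \<eta> \<delta> \<kappa> where p: "1 \<le> d" "0 < \<eta>" "13 * real (CARD('n) + d) * \<eta> \<le> 1"
    "(2 / 3) ^ I * real (2 ^ j) < 1" "(2 * real (2 ^ j) + 1) * real I * (26 * real (CARD('n) + d) * \<eta>) ^ d \<le> 1"
    "4 * (8 * real (2 ^ j) + 1) ^ CARD('n) * (real (CARD('n) + d) + 1) * 4 ^ d * (2 / 3) ^ (d * H) \<le> 1"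
    "64 * real d * real L * \<eta> \<le> 1" "0 < \<delta>" "\<delta> \<le> 1" "0 < \<kappa>" "\<kappa> \<le> 1 / 4"
    "8 \<le> real L ^ d * ((\<delta> / 4) ^ (CARD('n) - 1) * \<kappa>)"
    and q: "1 \<le> mm" "real mm * \<delta> \<le> s / (real j * (real j + 1))" "\<kappa> * (4 / \<delta>) ^ k \<le> 1 / (real j)\<^sup>2" "1 / 2 ^ j \<le> \<delta>"
    "2 * (4 * real n) ^ n * R powr \<alpha> * 3 ^ (H + (n + d)) * (4 / \<eta>) ^ d \<le> E * R * real mm ^ (n - 1)"
    unfolding n_def E_def R_def \<alpha>_def by blast
  have j1: "(1::nat) \<le> 2 ^ j" by simp
  obtain Y Z where Y: "finite Y" "\<forall>y\<in>Y. \<bar>y $ i0 - g y\<bar> \<le> \<kappa>"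
     "\<forall>y\<in>Y. \<forall>i. i \<noteq> i0 \<longrightarrow> x0 $ i + s / (real j + 1) + \<delta> / 3 \<le> y $ i \<and> y $ i \<le> x0 $ i + s / (real j + 1) + real mm * \<delta> - \<delta> / 3"
     "\<forall>y\<in>Y. \<forall>y'\<in>Y. y \<noteq> y' \<longrightarrow> (\<exists>i. i \<noteq> i0 \<and> 2 * \<delta> / 3 \<le> \<bar>y $ i - y' $ i\<bar>)"
     "real mm ^ (CARD('n) - 1) \<le> 2 * real (card Y)"
    and Z: "finite Z" "\<forall>z\<in>Z. norm z \<le> real (2 ^ j) / 4" "\<forall>z\<in>Z. \<forall>z'\<in>Z. z \<noteq> z' \<longrightarrow> 1 \<le> norm (z - z')"
     "(real (2 ^ j) / (4 * real CARD('n))) ^ CARD('n) * (\<eta> / 4) ^ d \<le> real (card Z)"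
     "\<forall>z\<in>Z. \<exists>\<omega>. cmod \<omega> = 1 \<and> (\<forall>y\<in>Y. cmod (cis (2 * pi * (z \<bullet> y)) - \<omega>) \<le> 1 / 8)"
     "\<forall>a v. norm v = 1 \<longrightarrow> card {z\<in>Z. \<exists>t::real. norm (a + t *\<^sub>R v - z) < \<rho>} \<le> 3 ^ (H + (CARD('n) + d))"
    by (rule scale_nodes[where ?i0.0 = i0 and g = g and lo = "\<lambda>i. x0 $ i + s / (real j + 1)" and mm = mm,
          OF j1 p _ \<rho>, THEN exE], rule g, blast, elim exE conjE, rule that; assumption)
  have R0: "0 < R" by (simp add: R_def)
  have n0: "0 < real n" using n by (simp add: n_def)
  have zz: "0 < (R / (4 * real n)) ^ n * (\<eta> / 4) ^ d" using R0 n0 p(2) by simp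
  have cZ: "(R / (4 * real n)) ^ n * (\<eta> / 4) ^ d \<le> real (card Z)" using Z(4) by (simp add: R_def n_def)
  have cY: "real mm ^ (n - 1) / 2 \<le> real (card Y)" using Y(5) by (simp add: n_def)
  have mm0: "0 < real mm ^ (n - 1)" using q(1) by simp
  have "real (card Z) \<noteq> 0" "real (card Y) \<noteq> 0" using cZ zz cY mm0 by linarith+
  then have ne: "Z \<noteq> {}" "Y \<noteq> {}" by auto
  define M where "M = (3::real) ^ (H + (n + d))"
  have key: "M * R powr \<alpha> * R ^ (n - 1) \<le> E * real (card Y) * real (card Z)"
  proof -
    define c where "c = (4 * real n) ^ n"
    have c0: "0 < c" using n0 by (simp add: c_def)
    have \<eta>\<eta>: "(4 / \<eta>) ^ d * (\<eta> / 4) ^ d = 1" using p(2) by (simp add: power_mult_distrib[symmetric])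
    have RR: "R ^ n = R * R ^ (n - 1)" using n by (simp add: n_def power_eq_if)
    have "M * R powr \<alpha> * R ^ (n - 1) = (2 * c * R powr \<alpha> * M * (4 / \<eta>) ^ d) * (R ^ (n - 1) * (\<eta> / 4) ^ d / (2 * c))"
      using \<eta>\<eta> c0 by (simp add: mult_ac)
    also have "\<dots> \<le> (E * R * real mm ^ (n - 1)) * (R ^ (n - 1) * (\<eta> / 4) ^ d / (2 * c))"
      using q(5) c0 R0 p(2) by (intro mult_right_mono) (auto simp: c_def M_def)
    also have "\<dots> = E * (real mm ^ (n - 1) / 2) * ((R / (4 * real n)) ^ n * (\<eta> / 4) ^ d)"
      by (simp add: RR power_divide c_def mult_ac)
    also have "\<dots> \<le> E * real (card Y) * real (card Z)"
      using cY cZ zz by (intro mult_mono) (auto simp: E_def)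
    finally show ?thesis .
  qed
  have j0: "0 < real j" using elim(2) by simp
  have ends: "s / (real j + 1) + real mm * \<delta> \<le> s / real j"
  proof -
    have "s / (x + 1) + s / (x * (x + 1)) = s / x" if "0 < x" for x
    proof -
      have "s / (x + 1) + s / (x * (x + 1)) = (s * x + s) / (x * (x + 1))" using that by (simp add: add_divide_distrib)
      also have "s * x + s = s * (x + 1)" by (simp add: algebra_simps)
      also have "s * (x + 1) / (x * (x + 1)) = s / x" using that by simp
      finally show ?thesis .
    qed
    note this[OF j0]
    with q(2) show ?thesis by linarith
  qed
  have box: "\<forall>y\<in>Y. \<forall>i. i \<noteq> i0 \<longrightarrow> x0 $ i + s / (real j + 1) + \<delta> / 3 \<le> y $ i \<and> y $ i \<le> x0 $ i + s / real j - \<delta> / 3"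
  proof (intro ballI allI impI conjI)
    fix y i assume "y \<in> Y" "i \<noteq> i0"
    then have "x0 $ i + s / (real j + 1) + \<delta> / 3 \<le> y $ i" "y $ i \<le> x0 $ i + s / (real j + 1) + real mm * \<delta> - \<delta> / 3"
      using Y(3) by blast+
    then show "x0 $ i + s / (real j + 1) + \<delta> / 3 \<le> y $ i" "y $ i \<le> x0 $ i + s / real j - \<delta> / 3" using ends by linarith+
  qed
  have small: "\<forall>y\<in>Y. \<bar>y $ i0 - g y\<bar> * (4 / \<delta>) ^ k \<le> 1 / (real j)\<^sup>2"
  proof
    fix y assume "y \<in> Y"
    then have "\<bar>y $ i0 - g y\<bar> * (4 / \<delta>) ^ k \<le> \<kappa> * (4 / \<delta>) ^ k" using Y(2) p(8) by (intro mult_right_mono) auto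
    then show "\<bar>y $ i0 - g y\<bar> * (4 / \<delta>) ^ k \<le> 1 / (real j)\<^sup>2" using q(3) by linarith
  qed
  have tube: "\<forall>a v. norm v = 1 \<longrightarrow> real (card {z\<in>Z. \<exists>t::real. norm (a + t *\<^sub>R v - z) < \<rho>}) \<le> M"
  proof (intro allI impI)
    fix a v :: "real^'n" assume "norm v = 1"
    then have "card {z\<in>Z. \<exists>t::real. norm (a + t *\<^sub>R v - z) < \<rho>} \<le> 3 ^ (H + (n + d))" using Z(6) by (simp add: n_def)
    then have "real (card {z\<in>Z. \<exists>t::real. norm (a + t *\<^sub>R v - z) < \<rho>}) \<le> real (3 ^ (H + (n + d)))" by (simp only: of_nat_le_iff)
    then show "real (card {z\<in>Z. \<exists>t::real. norm (a + t *\<^sub>R v - z) < \<rho>}) \<le> M" by (simp add: M_def)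
  qed
  have Zn: "\<forall>z\<in>Z. norm z \<le> 2 ^ j / 4" using Z(2) by simp
  have M0: "0 \<le> M" by (simp add: M_def)
  show ?case
    by (rule exI[of _ Y], rule exI[of _ Z], rule exI[of _ \<delta>], rule exI[of _ M], unfold scale_config_def)
      (intro conjI q(4) p(9) Y(1) ne Z(1) small box Y(4) Zn Z(3,5) tube M0 key[unfolded n_def E_def R_def \<alpha>_def])
qed

section \<open>One perturbation for all scales\<close>

text \<open>At scale \<open>j\<close> the perturbation is a sum of bumps of width \<open>\<delta> j\<close> around the nodes, whose heights move the graph of
  \<open>g\<close> exactly onto the nodes; its $C^k$ bound is of order \<open>1 / j\<^sup>2\<close>. The nodes of different scales lie in
  disjoint cubes, so that the bumps of one scale vanish at the nodes of all others. Omitting finitely many scales makes the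
  sum as small as desired.\<close>

lemma node_perturbation:
  fixes i0 :: "'n::finite" and g :: "real^'n \<Rightarrow> real" and Y :: "nat \<Rightarrow> (real^'n) set"
  assumes n: "2 \<le> CARD('n)" and g: "\<And>x x'. (\<And>i. i \<noteq> i0 \<Longrightarrow> x $ i = x' $ i) \<Longrightarrow> g x = g x'"
    and j1: "1 \<le> j1" and s: "0 < s"
    and c: "\<And>j. j1 \<le> j \<Longrightarrow> scale_config i0 g x0 s \<rho> k j (Y j) (Z j) (\<delta> j) (M j)" and \<tau>: "0 < \<tau>"
  shows "\<exists>j0\<ge>j1. \<exists>b. Ck_on k b UNIV \<and> Ck_bound k b UNIV \<tau> \<and>
    (\<forall>x x'. (\<forall>i. i \<noteq> i0 \<longrightarrow> x $ i = x' $ i) \<longrightarrow> b x = b x') \<and>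
    (\<forall>j\<ge>j0. \<forall>y\<in>Y j. b y = y $ i0 - g y)"
proof -
  obtain \<beta> :: "real^'n \<Rightarrow> real" and B where \<beta>: "Ck_on k \<beta> UNIV" "0 \<le> B" "Ck_bound k \<beta> UNIV B" "\<beta> 0 = 1"
    "\<And>x x'. \<forall>i. i \<noteq> i0 \<longrightarrow> x $ i = x' $ i \<Longrightarrow> \<beta> x = \<beta> x'" "\<And>x. \<exists>i. i \<noteq> i0 \<and> 1 < \<bar>x $ i\<bar> \<Longrightarrow> \<beta> x = 0"
    using bump_exists[of k i0] by blast
  define h where "h y = y $ i0 - g y" for y
  define f where "f j x = (\<Sum>y\<in>Y j. h y * \<beta> ((4 / \<delta> j) *\<^sub>R (x - y)))" for j x
  have \<delta>: "0 < \<delta> j" "\<delta> j \<le> 1" if "j1 \<le> j" for j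
  proof -
    have "1 / 2 ^ j \<le> \<delta> j" "\<delta> j \<le> 1" using c[OF that] unfolding scale_config_def by blast+
    moreover have "0 < (1 / 2 ^ j :: real)" by simp
    ultimately show "0 < \<delta> j" "\<delta> j \<le> 1" by linarith+
  qed
  have box: "x0 $ i + s / (real j + 1) + \<delta> j / 3 \<le> y $ i" "y $ i \<le> x0 $ i + s / real j - \<delta> j / 3"
    if "j1 \<le> j" "y \<in> Y j" "i \<noteq> i0" for j y i
    using c[OF that(1)] that(2,3) unfolding scale_config_def by blast+
  have bumps: "Ck_on k (f j) UNIV" "Ck_bound k (f j) UNIV (1 / (real j)\<^sup>2 * B)" "\<And>y. y \<in> Y j \<Longrightarrow> f j y = h y"
    if j: "j1 \<le> j" for j
  proof -
    have Y: "finite (Y j)" "\<And>y y'. y \<in> Y j \<Longrightarrow> y' \<in> Y j \<Longrightarrow> y \<noteq> y' \<Longrightarrow> \<exists>i. i \<noteq> i0 \<and> 2 * \<delta> j / 3 \<le> \<bar>y $ i - y' $ i\<bar>"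
      "\<And>y. y \<in> Y j \<Longrightarrow> \<bar>h y\<bar> * (4 / \<delta> j) ^ k \<le> 1 / (real j)\<^sup>2"
      using c[OF j] unfolding scale_config_def h_def by blast+
    have sep: "\<exists>i. i \<noteq> i0 \<and> 2 / (4 / \<delta> j) < \<bar>y $ i - y' $ i\<bar>" if "y \<in> Y j" "y' \<in> Y j" "y \<noteq> y'" for y y'
    proof -
      obtain i where "i \<noteq> i0" "2 * \<delta> j / 3 \<le> \<bar>y $ i - y' $ i\<bar>" using Y(2) \<open>y \<in> Y j\<close> \<open>y' \<in> Y j\<close> \<open>y \<noteq> y'\<close> by blast
      moreover have "2 / (4 / \<delta> j) < 2 * \<delta> j / 3" using \<delta>[OF j] by simp
      ultimately show ?thesis by (intro exI[of _ i]) linarith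
    qed
    have c1: "1 \<le> 4 / \<delta> j" using \<delta>[OF j] by simp
    have t0: "0 \<le> 1 / (real j)\<^sup>2" by simp
    note D = disjoint_bumps[where ?i0.0 = i0, OF \<beta>(1,3,2) _ Y(1) _ c1 _ t0]
    show "Ck_on k (f j) UNIV" unfolding f_def[abs_def] by (rule D(1); fact \<beta>(6) sep Y(3))
    show "Ck_bound k (f j) UNIV (1 / (real j)\<^sup>2 * B)" unfolding f_def[abs_def] by (rule D(2); fact \<beta>(6) sep Y(3))
    show "f j y = h y" if y: "y \<in> Y j" for y
    proof -
      have "f j y = h y * \<beta> 0" unfolding f_def by (rule D(3); fact \<beta>(6) sep Y(3) y)
      then show ?thesis by (simp add: \<beta>(4))
    qed
  qed
  have other: "f j' y = 0" if j: "j1 \<le> j" "j1 \<le> j'" "j' \<noteq> j" and y: "y \<in> Y j" for j j' y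
    unfolding f_def
  proof (rule sum.neutral, rule ballI)
    fix y' assume y': "y' \<in> Y j'"
    obtain i where i: "i \<noteq> i0"
    proof -
      have "\<not> (\<forall>i. i = i0)"
      proof
        assume "\<forall>i. i = i0"
        then have "(UNIV :: 'n set) = {i0}" by auto
        then have "CARD('n) = card {i0}" by (rule arg_cong)
        then show False using n by simp
      qed
      then show ?thesis using that by blast
    qed
    \<comment> \<open>For larger \<open>j\<close> the interval lies entirely below, and all nodes stay away from its end points.\<close>
    have mono: "s / real b \<le> s / (real a + 1)" if "a < b" for a b :: nat
      using s that by (intro divide_left_mono) auto
    have "\<delta> j' / 3 \<le> \<bar>y $ i - y' $ i\<bar>"
    proof (cases "j < j'")
      case True
      then show ?thesis using box[OF j(1) y i] box[OF j(2) y' i] mono[OF True] \<delta>[OF j(1)] by linarith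
    next
      case False
      then have "j' < j" using j(3) by simp
      then show ?thesis using box[OF j(1) y i] box[OF j(2) y' i] mono[of j' j] \<delta>[OF j(1)] by linarith
    qed
    then have "1 < 4 / \<delta> j' * \<bar>y $ i - y' $ i\<bar>" using \<delta>[OF j(2)] by (simp add: field_simps)
    also have "4 / \<delta> j' * \<bar>y $ i - y' $ i\<bar> = \<bar>((4 / \<delta> j') *\<^sub>R (y - y')) $ i\<bar>"
      unfolding vector_scaleR_component vector_minus_component real_scaleR_def abs_mult using \<delta>[OF j(2)] by simp
    finally have "1 < \<bar>((4 / \<delta> j') *\<^sub>R (y - y')) $ i\<bar>" .
    then have "\<beta> ((4 / \<delta> j') *\<^sub>R (y - y')) = 0" using i by (intro \<beta>(6)) blast
    then show "h y' * \<beta> ((4 / \<delta> j') *\<^sub>R (y - y')) = 0" by simp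
  qed
  define t where "t j = 1 / (real j)\<^sup>2 * B" for j :: nat
  have t: "summable t"
    unfolding t_def using inverse_power_summable[of 2, where 'a = real]
    by (intro summable_mult2) (simp add: inverse_eq_divide)
  obtain N where N: "\<And>m. m \<ge> N \<Longrightarrow> norm (\<Sum>i. t (i + m)) < \<tau>" using suminf_exist_split[OF \<tau> t] by blast
  define j0 where "j0 = max N j1"
  define b where "b x = (\<Sum>i. f (i + j0) x)" for x
  have j01: "j1 \<le> i + j0" for i by (simp add: j0_def)
  have st: "summable (\<lambda>i. t (i + j0))" using t by (simp only: summable_iff_shift)
  have tb: "Ck_bound k (f (i + j0)) UNIV (t (i + j0))" for i using bumps(2)[OF j01] by (simp only: t_def)
  have C: "Ck_on k b UNIV" "Ck_bound k b UNIV (\<Sum>i. t (i + j0))"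
    using Ck_on_suminf[of k "\<lambda>i. f (i + j0)" "\<lambda>i. t (i + j0)", OF bumps(1)[OF j01] tb st]
    unfolding b_def[abs_def] by blast+
  have bt: "Ck_bound k b UNIV \<tau>" using N[of j0] by (intro Ck_bound_mono[OF C(2)]) (auto simp: j0_def)
  have inv: "b x = b x'" if e: "\<forall>i. i \<noteq> i0 \<longrightarrow> x $ i = x' $ i" for x x'
  proof -
    have "f j x = f j x'" for j
      unfolding f_def
    proof (rule sum.cong[OF refl])
      fix y
      have "\<beta> ((4 / \<delta> j) *\<^sub>R (x - y)) = \<beta> ((4 / \<delta> j) *\<^sub>R (x' - y))" using e by (intro \<beta>(5)) simp
      then show "h y * \<beta> ((4 / \<delta> j) *\<^sub>R (x - y)) = h y * \<beta> ((4 / \<delta> j) *\<^sub>R (x' - y))" by simp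
    qed
    then show ?thesis by (simp add: b_def)
  qed
  have val: "b y = h y" if j: "j0 \<le> j" and y: "y \<in> Y j" for j y
  proof -
    have j1j: "j1 \<le> j" using j by (simp add: j0_def)
    have "f (i + j0) y = (if i = j - j0 then h y else 0)" for i
      using bumps(3)[OF j1j y] other[OF j1j j01 _ y, of i] j by auto
    then have "(\<lambda>i. f (i + j0) y) = (\<lambda>i. if i = j - j0 then h y else 0)" by (rule ext)
    then show ?thesis unfolding b_def using sums_single[of "j - j0" "\<lambda>_. h y"] by (simp add: sums_iff)
  qed
  have "j1 \<le> j0" by (simp add: j0_def)
  then show ?thesis using C(1) bt inv val unfolding h_def by blast
qed

lemma small_shear_Ck_norm:
  fixes S :: "(real^'n::finite) set" and F :: "((real^'m::finite) set \<times> (real^'m \<Rightarrow> real^'n)) set"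
  assumes F: "Ck_parametrization_family k S F" and \<epsilon>: "0 < \<epsilon>" and e: "norm e = 1"
  shows "\<exists>\<tau>>0. \<forall>b. Ck_on k b UNIV \<longrightarrow> Ck_bound k b UNIV \<tau> \<longrightarrow> Ck_norm k F (\<lambda>x. b x *\<^sub>R e) \<le> ennreal \<epsilon>"
proof -
  have fin: "finite F" using F by (simp add: Ck_parametrization_family_def)
  define P where "P p m \<longleftrightarrow> 0 \<le> m \<and> (\<forall>(f :: real^'n \<Rightarrow> real^'n) B. Ck_on k f UNIV \<longrightarrow> Ck_bound k f (snd p ` fst p) B \<longrightarrow> 0 \<le> B \<longrightarrow>
      Ck_bound k (f \<circ> snd p) (fst p) (m * B))" for p :: "(real^'m) set \<times> (real^'m \<Rightarrow> real^'n)" and m :: real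
  have "\<exists>m. P p m" if "p \<in> F" for p
  proof -
    have "Ck_parametrization k S (fst p) (snd p)" using F that by (auto simp: Ck_parametrization_family_def)
    then obtain N where N: "open N" "fst p \<subseteq> N" "Ck_on k (snd p) N" "compact (fst p)"
      by (auto simp: Ck_parametrization_def Ck_map_def)
    show ?thesis using Ck_bound_compose[OF N(1) open_UNIV subset_UNIV N(4,2,3)] unfolding P_def by blast
  qed
  then obtain m where m: "\<And>p. p \<in> F \<Longrightarrow> P p (m p)" by metis
  define A where "A = 1 + sum m F"
  have m0: "0 \<le> m p" if "p \<in> F" for p using m[OF that] by (simp add: P_def)
  have A: "1 \<le> A" using m0 by (simp add: A_def sum_nonneg)
  have mA: "m p \<le> A" if "p \<in> F" for p using member_le_sum[of p F m] m0 fin that by (simp add: A_def)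
  define \<tau> where "\<tau> = \<epsilon> / A"
  have \<tau>: "0 < \<tau>" using \<epsilon> A by (simp add: \<tau>_def)
  have "Ck_norm k F (\<lambda>x. b x *\<^sub>R e) \<le> ennreal \<epsilon>" if b: "Ck_on k b UNIV" "Ck_bound k b UNIV \<tau>" for b
  proof -
    have C: "Ck_on k (\<lambda>x. b x *\<^sub>R e) UNIV"
      by (rule Ck_on_linear_left[OF bounded_linear_scaleR_left open_UNIV b(1)])
    have Cb: "Ck_bound k (\<lambda>x. b x *\<^sub>R e) UNIV \<tau>"
      by (rule Ck_bound_linear_left[OF bounded_linear_scaleR_left open_UNIV subset_UNIV b(1) _ b(2)]) (simp add: e)
    have "norm (iter_partial bs ((\<lambda>x. b x *\<^sub>R e) \<circ> \<phi>) u) \<le> \<epsilon>" if p: "(K, \<phi>) \<in> F" and u: "u \<in> K" and bs: "bs \<in> multi_index k" for K \<phi> u bs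
    proof -
      have "Ck_bound k (\<lambda>x. b x *\<^sub>R e) (\<phi> ` K) \<tau>" using Cb by (auto simp: Ck_bound_def)
      then have "Ck_bound k ((\<lambda>x. b x *\<^sub>R e) \<circ> \<phi>) K (m (K, \<phi>) * \<tau>)" using m[OF p] C \<tau> unfolding P_def by simp
      then have "norm (iter_partial bs ((\<lambda>x. b x *\<^sub>R e) \<circ> \<phi>) u) \<le> m (K, \<phi>) * \<tau>" using u bs by (auto simp: Ck_bound_def)
      also have "\<dots> \<le> A * \<tau>" using mA[OF p] \<tau> by (intro mult_right_mono) auto
      also have "\<dots> = \<epsilon>" using A by (simp add: \<tau>_def)
      finally show ?thesis .
    qed
    then show ?thesis unfolding Ck_norm_def by (auto intro!: SUP_least ennreal_leI)
  qed
  then show ?thesis using \<tau> by blast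
qed

section \<open>The counterexample at one scale\<close>

text \<open>It follows that the constant in the Mizohata--Takeuchi inequality, which bounds the weighted norm by the X-ray
  transform of the weight, is at least \<open>R powr \<alpha> / c\<close> for weights in the ball of radius \<open>R\<close>.\<close>

definition MT_counterexample :: "(real^'n) measure \<Rightarrow> real \<Rightarrow> real \<Rightarrow> real \<Rightarrow> bool" where
  "MT_counterexample \<sigma> \<alpha> R c \<longleftrightarrow> (\<exists>f w. f \<in> square_integrable \<sigma> \<and>
     w \<in> borel_measurable borel \<and> (\<forall>x. 0 \<le> w x) \<and> (\<forall>x. x \<notin> ball 0 R \<longrightarrow> w x = 0) \<and>
     xray_sup_norm w < \<infinity> \<and> 0 < weighted_L2_norm_sq w (fourier_extension \<sigma> f) \<and>
     weighted_L2_norm_sq w (fourier_extension \<sigma> f) < \<infinity> \<and>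
     ennreal (R powr \<alpha>) * xray_sup_norm w * L2_norm_sq \<sigma> f * inverse (weighted_L2_norm_sq w (fourier_extension \<sigma> f))
     \<le> ennreal c)"

text \<open>The radius of the caps is the largest one, up to a constant, over which phases at frequencies in the ball of radius
  \<open>2 ^ j\<close> do not vary. Everything that depends on the hypersurface is collected in the factor \<open>K\<close>.\<close>

lemma scale_counterexample:
  fixes i0 :: "'n::finite" and \<sigma> :: "(real^'n) measure"
  assumes n: "2 \<le> CARD('n)" and c: "scale_config i0 g x0 s \<rho> k j Y Z \<delta> M" and \<sigma>: "sets \<sigma> = sets borel"
    and v0: "0 < v0"
    and cap: "\<And>y. y \<in> Y \<Longrightarrow> \<exists>cap\<in>sets borel. cap \<subseteq> ball y (1 / (16 * pi * 2 ^ j)) \<and>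
      ennreal (v0 * (1 / (16 * pi * 2 ^ j)) ^ (CARD('n) - 1)) \<le> emeasure \<sigma> cap \<and> emeasure \<sigma> cap < \<infinity>"
    and \<rho>: "0 < \<rho>" "\<rho> \<le> 1 / 16" "2 * pi * (\<rho> * B) \<le> 1 / 8" and B: "\<And>y. y \<in> Y \<Longrightarrow> norm y \<le> B"
  defines "K \<equiv> 8 * \<rho> * (16 * pi) ^ (CARD('n) - 1) / (v0 * measure lborel (ball (0::real^'n) \<rho>))"
  shows "MT_counterexample \<sigma> (real (CARD('n) - 1) / real (CARD('n) - 1 + k)) (2 ^ j) (K * exp ((4 * real CARD('n) + 23) * sqrt (real j * ln (real j))))"
proof -
  define R where "R = (2::real) ^ j"
  define m where "m = CARD('n) - 1"
  define E where "E = exp ((4 * real CARD('n) + 23) * sqrt (real j * ln (real j)))"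
  define a where "a = R powr (real (CARD('n) - 1) / real (CARD('n) - 1 + k))"
  have R: "1 \<le> R" by (simp add: R_def)
  have c\<delta>: "1 / R \<le> \<delta>" using c unfolding scale_config_def R_def by blast
  have Y: "finite Y" "Y \<noteq> {}" using c unfolding scale_config_def by blast+
  have Z: "finite Z" "Z \<noteq> {}" using c unfolding scale_config_def by blast+
  have sep: "\<exists>i. i \<noteq> i0 \<and> 2 * \<delta> / 3 \<le> \<bar>y $ i - y' $ i\<bar>" if "y \<in> Y" "y' \<in> Y" "y \<noteq> y'" for y y'
    using c that unfolding scale_config_def by blast
  have Zn: "norm z \<le> R / 4" if "z \<in> Z" for z using c that unfolding scale_config_def R_def by blast
  have Zs: "1 \<le> norm (z - z')" if "z \<in> Z" "z' \<in> Z" "z \<noteq> z'" for z z' using c that unfolding scale_config_def by blast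
  have ph: "\<exists>\<omega>. cmod \<omega> = 1 \<and> (\<forall>y\<in>Y. cmod (cis (2 * pi * (z \<bullet> y)) - \<omega>) \<le> 1 / 8)" if "z \<in> Z" for z
    using c that unfolding scale_config_def by blast
  have tube: "real (card {z\<in>Z. \<exists>t::real. norm (p + t *\<^sub>R v - z) < \<rho>}) \<le> M" if "norm v = 1" for p v
    using c that unfolding scale_config_def by blast
  have M: "0 \<le> M" "M * a * R ^ m \<le> E * real (card Y) * real (card Z)"
    using c unfolding scale_config_def a_def R_def m_def E_def by blast+
  define t where "t = 1 / (16 * pi * R)"
  have t0: "0 < t" using R by (simp add: t_def)
  define v where "v = v0 * t ^ m"
  have v: "0 < v" using v0 t0 by (simp add: v_def)
  obtain cap where cp: "\<And>y. y \<in> Y \<Longrightarrow> cap y \<in> sets borel" "\<And>y. y \<in> Y \<Longrightarrow> cap y \<subseteq> ball y t"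
    "\<And>y. y \<in> Y \<Longrightarrow> ennreal v \<le> emeasure \<sigma> (cap y)" "\<And>y. y \<in> Y \<Longrightarrow> emeasure \<sigma> (cap y) < \<infinity>"
  proof -
    have "\<forall>y\<in>Y. \<exists>c. c \<in> sets borel \<and> c \<subseteq> ball y t \<and> ennreal v \<le> emeasure \<sigma> c \<and> emeasure \<sigma> c < \<infinity>"
      using cap unfolding t_def v_def R_def m_def by blast
    from bchoice[OF this] show thesis using that by blast
  qed
  have disj: "disjoint_family_on cap Y"
    unfolding disjoint_family_on_def
  proof (intro ballI impI)
    fix y y' assume y: "y \<in> Y" "y' \<in> Y" "y \<noteq> y'"
    have "False" if x: "x \<in> cap y" "x \<in> cap y'" for x
    proof -
      obtain i where i: "2 * \<delta> / 3 \<le> \<bar>y $ i - y' $ i\<bar>" using sep[OF y] by blast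
      have "dist y x < t" "dist y' x < t" using cp(2)[OF y(1)] cp(2)[OF y(2)] x by auto
      then have "dist y y' < 2 * t" using dist_triangle2[of y y' x] by linarith
      moreover have "\<bar>(y - y') $ i\<bar> \<le> dist y y'" unfolding dist_norm by (rule component_le_norm_cart)
      moreover have "2 * t \<le> 1 / R * (2 / 3)"
      proof -
        have "3 \<le> 16 * pi" using pi_gt3 by linarith
        then show ?thesis using R by (simp add: t_def field_simps)
      qed
      ultimately show False using i c\<delta> by simp
    qed
    then show "cap y \<inter> cap y' = {}" by blast
  qed
  have Bt: "2 * pi * (R * t) \<le> 1 / 8" using R by (simp add: t_def)
  have ZR: "norm z + \<rho> \<le> R" if "z \<in> Z" for z using Zn[OF that] \<rho>(2) R by linarith
  have Z2: "2 * \<rho> \<le> norm (z - z')" if "z \<in> Z" "z' \<in> Z" "z \<noteq> z'" for z z' using Zs[OF that] \<rho>(2) by linarith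
  have R0: "0 \<le> R" using R by simp
  obtain f w where fw: "f \<in> square_integrable \<sigma>" "w \<in> borel_measurable borel" "\<forall>x. 0 \<le> w x"
    "\<forall>x. x \<notin> ball 0 R \<longrightarrow> w x = 0" "xray_sup_norm w \<le> ennreal (2 * \<rho> * M)"
    "L2_norm_sq \<sigma> f \<le> ennreal (real (card Y) / v)"
    "ennreal ((real (card Y) / 2)\<^sup>2 * (real (card Z) * measure lborel (ball (0::real^'n) \<rho>))) \<le> weighted_L2_norm_sq w (fourier_extension \<sigma> f)"
    "weighted_L2_norm_sq w (fourier_extension \<sigma> f) < \<infinity>"
    using aligned_counterexample[where y = "\<lambda>y. y", OF \<sigma> Y cp(1,2) disj v cp(3,4) Z(1) ZR Z2 \<rho>(1) ph B \<rho>(3) Bt R0 tube]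
    by blast
  define N where "N = real (card Y)"
  define q where "q = real (card Z)"
  define V where "V = measure lborel (ball (0::real^'n) \<rho>)"
  have N: "0 < N" "0 < q" using Y Z by (simp_all add: N_def q_def card_gt_0_iff)
  have V: "0 < V" using \<rho>(1) by (simp add: V_def content_ball_pos)
  define W0 where "W0 = (N / 2)\<^sup>2 * (q * V)"
  have W0: "0 < W0" using N V by (simp add: W0_def)
  define W where "W = weighted_L2_norm_sq w (fourier_extension \<sigma> f)"
  have W: "ennreal W0 \<le> W" "W < \<infinity>" using fw(7,8) unfolding W_def W0_def N_def q_def V_def by blast+
  have a0: "0 \<le> a" by (simp add: a_def)
  have iW: "inverse W \<le> ennreal (1 / W0)"
  proof -
    obtain w0 where w0: "W = ennreal w0" "0 \<le> w0" using W(2) by (cases W) auto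
    have le: "W0 \<le> w0" using W(1) w0 by (simp add: ennreal_le_iff)
    then have "inverse W = ennreal (inverse w0)" using W0 unfolding w0(1) by (intro inverse_ennreal) simp
    also have "\<dots> \<le> ennreal (1 / W0)" using le W0 by (intro ennreal_leI) (simp add: inverse_eq_divide frac_le)
    finally show ?thesis .
  qed
  have "ennreal a * xray_sup_norm w * L2_norm_sq \<sigma> f * inverse W \<le> ennreal a * ennreal (2 * \<rho> * M) * ennreal (N / v) * ennreal (1 / W0)"
    using fw(5,6) iW unfolding N_def by (intro mult_mono) auto
  also have "\<dots> = ennreal (a * (2 * \<rho> * M) * (N / v) * (1 / W0))"
  proof -
    have "ennreal a1 * ennreal a2 * ennreal a3 * ennreal a4 = ennreal (a1 * a2 * a3 * a4)"
      if "0 \<le> a1" "0 \<le> a2" "0 \<le> a3" "0 \<le> a4" for a1 a2 a3 a4 using that by (simp add: ennreal_mult)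
    moreover have "0 \<le> 2 * \<rho> * M" "0 \<le> N / v" "0 \<le> 1 / W0" using M(1) \<rho>(1) N v W0 by simp_all
    ultimately show ?thesis using a0 by blast
  qed
  also have "\<dots> \<le> ennreal (K * E)"
  proof (rule ennreal_leI)
    have tm: "t ^ m = 1 / ((16 * pi) ^ m * R ^ m)" by (simp add: t_def power_mult_distrib power_divide)
    have "a * (2 * \<rho> * M) * (N / v) * (1 / W0) = 8 * \<rho> * (16 * pi) ^ m / (v0 * V) * (M * a * R ^ m / (N * q))"
      using N V v0 R unfolding v_def W0_def tm by (simp add: power2_eq_square field_simps)
    also have "\<dots> \<le> 8 * \<rho> * (16 * pi) ^ m / (v0 * V) * E"
    proof (rule mult_left_mono)
      show "M * a * R ^ m / (N * q) \<le> E" using M(2) N by (simp add: divide_le_eq N_def q_def mult.assoc)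
    qed (use \<rho>(1) v0 V in simp)
    finally show "a * (2 * \<rho> * M) * (N / v) * (1 / W0) \<le> K * E" by (simp add: K_def m_def V_def)
  qed
  finally have fin: "ennreal a * xray_sup_norm w * L2_norm_sq \<sigma> f * inverse W \<le> ennreal (K * E)" .
  have "0 < W" using W(1) W0 by (metis ennreal_less_zero_iff order_less_le_trans)
  moreover have "xray_sup_norm w < \<infinity>" using fw(5) by (metis ennreal_less_top infinity_ennreal_def order_le_less_trans)
  ultimately show ?thesis
    using fw(1,2,3,4) W(2) fin unfolding MT_counterexample_def W_def a_def E_def R_def by blast
qed

section \<open>From dyadic radii to all radii\<close>

lemma one_le_twice_ln_2: "1 \<le> 2 * ln (2::real)"
proof -
  have "2 * ln 2 = ln (2 * 2 :: real)" by (subst ln_mult_pos) auto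
  moreover have "1 \<le> ln (4::real)" using exp_le ln_mono[of "exp 1" "4::real"] by simp
  ultimately show ?thesis by simp
qed

text \<open>The constant \<open>K\<close> depends on the perturbed hypersurface, whereas the constant of the theorem must not. It is absorbed by an
  increase of the constant in the exponent, for large radii.\<close>

lemma dyadic_exponent:
  fixes K C :: real
  assumes "0 < K" "0 \<le> C"
  shows "\<forall>\<^sub>F j in sequentially. 2 * K * exp (C * sqrt (real j * ln (real j)))
    \<le> exp ((2 * C + 1) * sqrt (real j * ln 2 * ln (real j * ln 2)))"
proof -
  have e1: "\<forall>\<^sub>F x in at_top. ln (2 * K) \<le> sqrt (x * ln 2 * ln (x * ln (2::real)))" by real_asymp
  have e2: "\<forall>\<^sub>F x in at_top. sqrt (x * ln x) \<le> 2 * sqrt (x * ln 2 * ln (x * ln (2::real)))"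
    using eventually_ge_at_top[of 4]
  proof eventually_elim
    case (elim x)
    have l2: "1 / 2 \<le> ln (2::real)" using one_le_twice_ln_2 by simp
    have x2: "1 < x / 2" "x / 2 \<le> x * ln 2" using elim mult_left_mono[OF l2, of x] by simp_all
    have "1 \<le> x * ln 2" using x2 by linarith
    then have l: "0 \<le> ln (x * ln 2)" by simp
    have "ln x \<le> ln ((x / 2) * (x / 2))" using elim mult_right_mono[of 4 x x] by (intro ln_mono) auto
    also have "\<dots> = 2 * ln (x / 2)" using x2 by (subst ln_mult_pos) auto
    also have "\<dots> \<le> 2 * ln (x * ln 2)" using x2 by (intro mult_left_mono ln_mono) auto
    also have "\<dots> \<le> 4 * ln 2 * ln (x * ln 2)" using l l2 by (intro mult_right_mono) auto
    finally have "x * ln x \<le> x * (4 * ln 2 * ln (x * ln 2))" using elim by (intro mult_left_mono) auto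
    then have "sqrt (x * ln x) \<le> sqrt (4 * (x * ln 2 * ln (x * ln 2)))" by (simp add: mult_ac)
    also have "\<dots> = sqrt 4 * sqrt (x * ln 2 * ln (x * ln 2))" by (rule real_sqrt_mult)
    finally show ?case by simp
  qed
  show ?thesis
    using eventually_compose_filterlim[OF e1 filterlim_real_sequentially]
      eventually_compose_filterlim[OF e2 filterlim_real_sequentially]
  proof eventually_elim
    case (elim j)
    define b where "b = sqrt (real j * ln 2 * ln (real j * ln 2))"
    have "2 * K = exp (ln (2 * K))" using assms(1) by simp
    then have "2 * K * exp (C * sqrt (real j * ln (real j))) = exp (ln (2 * K) + C * sqrt (real j * ln (real j)))"
      by (metis exp_add)
    also have "\<dots> \<le> exp (b + C * (2 * b))"
      using elim assms(2) unfolding b_def[symmetric] by (simp add: add_mono mult_left_mono)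
    also have "b + C * (2 * b) = (2 * C + 1) * b" by (simp add: algebra_simps)
    finally show ?case by (simp add: b_def)
  qed
qed

lemma dyadic_floor:
  assumes "1 \<le> (R::real)"
  shows "\<exists>j::nat. 2 ^ j \<le> R \<and> R < 2 ^ Suc j"
proof -
  have ex: "\<exists>j. R < 2 ^ j" using real_arch_pow[of 2 R] by simp
  define j where "j = (LEAST j. R < 2 ^ j)"
  have j: "R < 2 ^ j" "\<And>i. i < j \<Longrightarrow> \<not> R < 2 ^ i"
    unfolding j_def by (rule LeastI_ex[OF ex], rule not_less_Least)
  have "j \<noteq> 0" using j(1) assms by (cases j) auto
  then obtain i where "j = Suc i" by (cases j) auto
  then show ?thesis using j by (intro exI[of _ i]) (auto simp: not_less)
qed

text \<open>A counterexample for the largest power of 2 below \<open>R\<close> also serves for \<open>R\<close>.\<close>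

lemma all_radii:
  fixes \<sigma> :: "(real^'n::finite) measure" and K C \<alpha> :: real
  assumes K: "0 < K" and C: "1 \<le> C" and \<alpha>: "0 \<le> \<alpha>" "\<alpha> \<le> 1"
    and dy: "\<forall>\<^sub>F j in sequentially. MT_counterexample \<sigma> \<alpha> (2 ^ j) (K * exp (C * sqrt (real j * ln (real j))))"
  shows "\<exists>R0\<ge>1. \<forall>R\<ge>R0. MT_counterexample \<sigma> \<alpha> R ((2 * C + 1) * exp ((2 * C + 1) * sqrt (ln R * ln (ln R))))"
proof -
  have C0: "0 \<le> C" using C by simp
  obtain N where N: "\<And>j. N \<le> j \<Longrightarrow> 2 * K * exp (C * sqrt (real j * ln (real j)))
    \<le> exp ((2 * C + 1) * sqrt (real j * ln 2 * ln (real j * ln 2)))"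
    using dyadic_exponent[OF K C0] unfolding eventually_sequentially by blast
  obtain N' where N': "\<And>j. N' \<le> j \<Longrightarrow> MT_counterexample \<sigma> \<alpha> (2 ^ j) (K * exp (C * sqrt (real j * ln (real j))))"
    using dy unfolding eventually_sequentially by blast
  define J where "J = max (max N N') 2"
  show ?thesis
  proof (rule exI[of _ "2 ^ J"], intro conjI allI impI)
    fix R :: real assume R: "2 ^ J \<le> R"
    have "(1::real) \<le> 2 ^ J" by simp
    then have R1: "1 \<le> R" using R by linarith
    obtain j where j: "2 ^ j \<le> R" "R < 2 ^ Suc j" using dyadic_floor[OF R1] by blast
    have "(2::real) ^ J < 2 ^ Suc j" using R j(2) by linarith
    then have "J < Suc j" by (simp only: power_strict_increasing_iff one_less_numeral_iff semiring_norm)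
    then have J: "J \<le> j" by simp
    obtain f w where fw: "f \<in> square_integrable \<sigma>" "w \<in> borel_measurable borel" "\<forall>x. 0 \<le> w x"
      "\<forall>x. x \<notin> ball 0 (2 ^ j) \<longrightarrow> w x = 0" "xray_sup_norm w < \<infinity>"
      "0 < weighted_L2_norm_sq w (fourier_extension \<sigma> f)" "weighted_L2_norm_sq w (fourier_extension \<sigma> f) < \<infinity>"
      "ennreal ((2 ^ j) powr \<alpha>) * xray_sup_norm w * L2_norm_sq \<sigma> f * inverse (weighted_L2_norm_sq w (fourier_extension \<sigma> f))
      \<le> ennreal (K * exp (C * sqrt (real j * ln (real j))))"
      using N'[of j] J unfolding MT_counterexample_def by (auto simp: J_def)
    have supp: "\<forall>x. x \<notin> ball 0 R \<longrightarrow> w x = 0" using fw(4) j(1) by auto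
    have Ra: "R powr \<alpha> \<le> 2 * (2 ^ j) powr \<alpha>"
    proof -
      have "R powr \<alpha> \<le> (2 * 2 ^ j) powr \<alpha>" using j R1 \<alpha> by (intro powr_mono2) auto
      also have "\<dots> = 2 powr \<alpha> * (2 ^ j) powr \<alpha>" by (simp add: powr_mult)
      also have "\<dots> \<le> 2 powr 1 * (2 ^ j) powr \<alpha>" using \<alpha> by (intro mult_right_mono powr_mono) auto
      finally show ?thesis by simp
    qed
    have lnR: "real j * ln 2 \<le> ln R"
    proof -
      have "ln (2 ^ j) \<le> ln R" using j(1) by (intro ln_mono) auto
      then show ?thesis by (simp add: ln_realpow)
    qed
    have jl: "1 \<le> real j * ln 2"
    proof -
      have "1 \<le> 2 * ln (2::real)" by (rule one_le_twice_ln_2)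
      also have "\<dots> \<le> real j * ln 2" using J by (intro mult_right_mono) (auto simp: J_def)
      finally show ?thesis .
    qed
    have "real j * ln 2 * ln (real j * ln 2) \<le> ln R * ln (ln R)"
      using lnR jl by (intro mult_mono ln_mono) auto
    then have sq: "sqrt (real j * ln 2 * ln (real j * ln 2)) \<le> sqrt (ln R * ln (ln R))" by simp
    define X where "X = xray_sup_norm w * L2_norm_sq \<sigma> f * inverse (weighted_L2_norm_sq w (fourier_extension \<sigma> f))"
    have "ennreal (R powr \<alpha>) * X \<le> ennreal (2 * (2 ^ j) powr \<alpha>) * X" using Ra by (intro mult_right_mono ennreal_leI) auto
    also have "\<dots> = ennreal 2 * (ennreal ((2 ^ j) powr \<alpha>) * X)" by (simp add: ennreal_mult mult.assoc)
    also have "\<dots> \<le> ennreal 2 * ennreal (K * exp (C * sqrt (real j * ln (real j))))"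
      by (rule mult_left_mono[OF _ zero_le]) (use fw(8) in \<open>simp only: X_def mult.assoc\<close>)
    also have "\<dots> = ennreal (2 * K * exp (C * sqrt (real j * ln (real j))))"
      unfolding mult.assoc by (rule ennreal_mult[symmetric]) (use K in auto)
    also have "\<dots> \<le> ennreal ((2 * C + 1) * exp ((2 * C + 1) * sqrt (ln R * ln (ln R))))"
    proof (rule ennreal_leI)
      have "2 * K * exp (C * sqrt (real j * ln (real j))) \<le> exp ((2 * C + 1) * sqrt (real j * ln 2 * ln (real j * ln 2)))"
        by (rule N) (use J in \<open>simp add: J_def\<close>)
      also have "\<dots> \<le> exp ((2 * C + 1) * sqrt (ln R * ln (ln R)))" using sq C by (simp add: mult_left_mono)
      also have "\<dots> \<le> (2 * C + 1) * exp ((2 * C + 1) * sqrt (ln R * ln (ln R)))"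
        using mult_right_mono[of 1 "2 * C + 1" "exp ((2 * C + 1) * sqrt (ln R * ln (ln R)))"] C by simp
      finally show "2 * K * exp (C * sqrt (real j * ln (real j))) \<le> (2 * C + 1) * exp ((2 * C + 1) * sqrt (ln R * ln (ln R)))" .
    qed
    finally have fin: "ennreal (R powr \<alpha>) * xray_sup_norm w * L2_norm_sq \<sigma> f * inverse (weighted_L2_norm_sq w (fourier_extension \<sigma> f))
      \<le> ennreal ((2 * C + 1) * exp ((2 * C + 1) * sqrt (ln R * ln (ln R))))"
      by (simp only: X_def mult.assoc)
    show "MT_counterexample \<sigma> \<alpha> R ((2 * C + 1) * exp ((2 * C + 1) * sqrt (ln R * ln (ln R))))"
      unfolding MT_counterexample_def by (intro exI[of _ f] exI[of _ w] conjI fw(1,2,3,5,6,7) supp fin)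
  qed simp
qed

section \<open>The theorem\<close>

text \<open>The perturbed hypersurface is the image of the given one under the shear \<open>x \<mapsto> x + b x * e\<close>, where \<open>e\<close> is the unit vector
  of a transversal axis \<open>i0\<close> and \<open>b\<close> is independent of that coordinate; so the inverse is \<open>x \<mapsto> x - b x * e\<close>. The point of the
  hypersurface with the same coordinates as a node, except for \<open>i0\<close>, is moved to the node.\<close>

lemma perturbed_hypersurface:
  fixes S :: "(real^'n) set" and F :: "((real^'m::finite) set \<times> (real^'m \<Rightarrow> real^'n)) set"
  assumes n: "2 \<le> CARD('n)" and m: "CARD('m) = CARD('n) - 1" and k: "2 \<le> k"
    and S: "compact_hypersurface TYPE('m) k S" and F: "Ck_parametrization_family k S F" and \<epsilon>: "0 < \<epsilon>"
  shows "\<exists>\<eta>. Ck_map k \<eta> S \<and> Ck_norm k F \<eta> \<le> ennreal \<epsilon> \<and> compact_hypersurface TYPE('m) k ((\<lambda>x. x + \<eta> x) ` S) \<and>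
    (\<exists>K>0. \<forall>\<^sub>F j in sequentially. MT_counterexample (surface_measure TYPE('m) ((\<lambda>x. x + \<eta> x) ` S)) (real (CARD('n) - 1) / real (CARD('n) - 1 + k)) (2 ^ j) (K * exp ((4 * real CARD('n) + 23) * sqrt (real j * ln (real j)))))"
proof -
  have k1: "1 \<le> k" and dim: "CARD('m) + 1 = CARD('n)" using k m n by simp_all
  obtain i0 W and \<psi> :: "real^'m \<Rightarrow> real^'n" and \<rho>' c r x0 s' U
    where P: "open W" "Ck_on k \<psi> W" "open U" "Ck_on k \<rho>' U" "\<psi> ` W \<subseteq> U" "\<And>u. u \<in> W \<Longrightarrow> \<rho>' (\<psi> u) = u"
    "0 < r" "cball c (2 * r) \<subseteq> W" "\<psi> ` cball c (2 * r) \<subseteq> S" "0 < s'"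
    and near': "\<forall>x :: real^'n. (\<forall>i. i \<noteq> i0 \<longrightarrow> \<bar>x $ i - x0 $ i\<bar> \<le> s') \<longrightarrow> (\<exists>u\<in>cball c r. \<forall>i. i \<noteq> i0 \<longrightarrow> \<psi> u $ i = x $ i)"
    by (rule transversal_patch[OF S k1 dim]) (rule that)
  define s where "s = min s' 1"
  have s: "0 < s" "s \<le> 1" using P(10) by (auto simp: s_def)
  \<comment> \<open>Any choice of the points of intersection serves, since nodes near the graph of \<open>g\<close> are found over each point of the cube separately.\<close>
  define u where "u x = (SOME u. u \<in> cball c r \<and> (\<forall>i. i \<noteq> i0 \<longrightarrow> \<psi> u $ i = x $ i))" for x :: "real^'n"
  define g where "g x = \<psi> (u x) $ i0" for x
  have u: "u x \<in> cball c r" "\<And>i. i \<noteq> i0 \<Longrightarrow> \<psi> (u x) $ i = x $ i"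
    if "\<And>i. i \<noteq> i0 \<Longrightarrow> \<bar>x $ i - x0 $ i\<bar> \<le> s" for x
  proof -
    have "\<exists>u\<in>cball c r. \<forall>i. i \<noteq> i0 \<longrightarrow> \<psi> u $ i = x $ i"
    proof (rule near'[rule_format])
      show "\<bar>x $ i - x0 $ i\<bar> \<le> s'" if "i \<noteq> i0" for i
        using \<open>\<And>i. i \<noteq> i0 \<Longrightarrow> \<bar>x $ i - x0 $ i\<bar> \<le> s\<close>[OF that] by (simp add: s_def)
    qed
    then have "\<exists>u. u \<in> cball c r \<and> (\<forall>i. i \<noteq> i0 \<longrightarrow> \<psi> u $ i = x $ i)" by blast
    from someI_ex[OF this] show "u x \<in> cball c r" "\<And>i. i \<noteq> i0 \<Longrightarrow> \<psi> (u x) $ i = x $ i" unfolding u_def by blast+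
  qed
  have g: "g x = g x'" if "\<And>i. i \<noteq> i0 \<Longrightarrow> x $ i = x' $ i" for x x'
  proof -
    have "(\<lambda>u. u \<in> cball c r \<and> (\<forall>i. i \<noteq> i0 \<longrightarrow> \<psi> u $ i = x $ i)) = (\<lambda>u. u \<in> cball c r \<and> (\<forall>i. i \<noteq> i0 \<longrightarrow> \<psi> u $ i = x' $ i))"
      using that by (intro ext) auto
    then have "u x = u x'" unfolding u_def by (rule arg_cong)
    then show ?thesis by (simp add: g_def)
  qed
  have "bounded S" using S by (auto simp: compact_hypersurface_def compact_imp_bounded)
  then obtain B0 where B0: "0 < B0" "\<And>x. x \<in> S \<Longrightarrow> norm x \<le> B0" unfolding bounded_pos by blast
  \<comment> \<open>The radius must be fixed before the perturbation is known; the perturbation moves the points in question by at most one.\<close>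
  define \<rho> where "\<rho> = 1 / (16 * pi * (B0 + 1))"
  have \<rho>: "0 < \<rho>" "\<rho> \<le> 1 / 16" "2 * pi * (\<rho> * (B0 + 1)) \<le> 1 / 8"
  proof -
    show "0 < \<rho>" using B0(1) by (simp add: \<rho>_def)
    have "1 * 1 \<le> pi * (B0 + 1)" using B0(1) pi_gt3 by (intro mult_mono) auto
    then show "\<rho> \<le> 1 / 16" using B0(1) unfolding \<rho>_def by (intro divide_left_mono) auto
    show "2 * pi * (\<rho> * (B0 + 1)) \<le> 1 / 8" using B0(1) by (simp add: \<rho>_def field_simps)
  qed
  have ev: "\<forall>\<^sub>F j in sequentially. \<exists>Y Z \<delta> M. scale_config i0 g x0 s \<rho> k j Y Z \<delta> M"
    by (rule scale_config_exists[OF n k s _ \<rho>(1,2)], rule g, blast)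
  obtain j1 where "\<And>j. j1 \<le> j \<Longrightarrow> \<exists>Y Z \<delta> M. scale_config i0 g x0 s \<rho> k j Y Z \<delta> M"
    using ev unfolding eventually_sequentially by blast
  then have "\<forall>j. \<exists>p. max j1 1 \<le> j \<longrightarrow> scale_config i0 g x0 s \<rho> k j (fst p) (fst (snd p)) (fst (snd (snd p))) (snd (snd (snd p)))"
    by (simp add: split_paired_Ex)
  then obtain p where p: "\<And>j. max j1 1 \<le> j \<Longrightarrow>
      scale_config i0 g x0 s \<rho> k j (fst (p j)) (fst (snd (p j))) (fst (snd (snd (p j)))) (snd (snd (snd (p j))))"
    using choice by (metis (no_types, lifting))
  define Y where "Y j = fst (p j)" for j
  define \<delta>' where "\<delta>' j = fst (snd (snd (p j)))" for j
  have p': "scale_config i0 g x0 s \<rho> k j (Y j) ((\<lambda>j. fst (snd (p j))) j) (\<delta>' j) ((\<lambda>j. snd (snd (snd (p j)))) j)"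
    if "max j1 1 \<le> j" for j using p[OF that] by (simp add: Y_def \<delta>'_def)
  define e where "e = (axis i0 1 :: real^'n)"
  obtain \<tau> where \<tau>: "0 < \<tau>" "\<And>b. Ck_on k b UNIV \<Longrightarrow> Ck_bound k b UNIV \<tau> \<Longrightarrow> Ck_norm k F (\<lambda>x. b x *\<^sub>R e) \<le> ennreal \<epsilon>"
    using small_shear_Ck_norm[OF F \<epsilon>, of e] by (auto simp: e_def)
  have j11: "1 \<le> max j1 1" by simp
  have "\<exists>j0\<ge>max j1 1. \<exists>b. Ck_on k b UNIV \<and> Ck_bound k b UNIV \<tau> \<and>
    (\<forall>x x'. (\<forall>i. i \<noteq> i0 \<longrightarrow> x $ i = x' $ i) \<longrightarrow> b x = b x') \<and>
    (\<forall>j\<ge>j0. \<forall>y\<in>Y j. b y = y $ i0 - g y)"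
    by (rule node_perturbation[OF n _ j11 s(1) p' \<tau>(1)], rule g, blast)
  then obtain j0 b where j0: "max j1 1 \<le> j0" and b: "Ck_on k b UNIV" "Ck_bound k b UNIV \<tau>"
    "\<forall>x x'. (\<forall>i. i \<noteq> i0 \<longrightarrow> x $ i = x' $ i) \<longrightarrow> b x = b x'" "\<forall>j\<ge>j0. \<forall>y\<in>Y j. b y = y $ i0 - g y"
    by (elim exE conjE) (rule that)
  define \<eta> where "\<eta> x = b x *\<^sub>R e" for x
  define T where "T x = x + \<eta> x" for x
  define T' where "T' x = x + (- 1 * b x) *\<^sub>R e" for x
  have inv: "b (x + t *\<^sub>R e) = b x" for x t
    using b(3) by (simp add: e_def axis_def)
  have TT: "T' (T x) = x" "T (T' x) = x" for x
    unfolding T_def T'_def \<eta>_def inv by (simp_all add: scaleR_left.minus)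
  have CT: "Ck_on k T UNIV" "Ck_on k T' UNIV"
    using Ck_on_shear[OF b(1), of 1 e] Ck_on_shear[OF b(1), of "- 1" e]
    by (simp_all add: T_def[abs_def] T'_def[abs_def] \<eta>_def)
  have C\<eta>: "Ck_on k \<eta> UNIV" unfolding \<eta>_def[abs_def] by (rule Ck_on_linear_left[OF bounded_linear_scaleR_left open_UNIV b(1)])
  define S' where "S' = T ` S"
  have S': "compact_hypersurface TYPE('m) k S'" unfolding S'_def by (rule compact_hypersurface_image[OF S CT TT])
  define \<sigma> where "\<sigma> = surface_measure TYPE('m) S'"
  have \<sigma>: "is_surface_measure TYPE('m) S' \<sigma>" unfolding \<sigma>_def by (rule surface_measure[OF S' k1])
  have \<sigma>b: "sets \<sigma> = sets borel" using \<sigma> by (simp add: is_surface_measure_def)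
  have "\<exists>v0>0. \<exists>t0>0. \<forall>t. 0 < t \<longrightarrow> t \<le> t0 \<longrightarrow> (\<forall>u\<in>cball c r. \<exists>cap\<in>sets borel. cap \<subseteq> ball ((T \<circ> \<psi>) u) t \<and>
     ennreal (v0 * t ^ CARD('m)) \<le> emeasure \<sigma> cap \<and> emeasure \<sigma> cap < \<infinity>)"
  proof (rule cap_exists[OF \<sigma> P(1)])
    have hT: "homeomorphism UNIV UNIV T T'"
      unfolding homeomorphism_def using TT Ck_on_imp_continuous[OF CT(1)] Ck_on_imp_continuous[OF CT(2)] surjI[of T T'] surjI[of T' T]
      by blast
    show "Ck_on 1 (T \<circ> \<psi>) W"
      by (rule Ck_on_compose[OF P(1) open_UNIV subset_UNIV Ck_on_le[OF P(2) k1] Ck_on_le[OF CT(1) k1]])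
    show o: "open (T ` U)" by (rule homeomorphism_open_image[OF hT P(3)])
    show "Ck_on 1 (\<rho>' \<circ> T') (T ` U)"
      by (rule Ck_on_compose[OF o P(3) _ Ck_on_subset[OF Ck_on_le[OF CT(2) k1] subset_UNIV] Ck_on_le[OF P(4) k1]]) (auto simp: TT)
    show "(T \<circ> \<psi>) ` W \<subseteq> T ` U" using P(5) by auto
    show "(\<rho>' \<circ> T') ((T \<circ> \<psi>) u) = u" if "u \<in> W" for u using P(6)[OF that] by (simp add: TT)
    show "0 < r" "cball c (2 * r) \<subseteq> W" by (fact P(7) P(8))+
    show "(T \<circ> \<psi>) ` cball c (2 * r) \<subseteq> S'" using P(9) by (auto simp: S'_def)
  qed
  then obtain v0 t0 where v0: "0 < v0" and t0: "0 < t0" and cap: "\<forall>t. 0 < t \<longrightarrow> t \<le> t0 \<longrightarrow> (\<forall>u\<in>cball c r. \<exists>cap\<in>sets borel. cap \<subseteq> ball ((T \<circ> \<psi>) u) t \<and>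
     ennreal (v0 * t ^ CARD('m)) \<le> emeasure \<sigma> cap \<and> emeasure \<sigma> cap < \<infinity>)"
    by (elim exE conjE) (rule that)
  define K where "K = 8 * \<rho> * (16 * pi) ^ (CARD('n) - 1) / (v0 * measure lborel (ball (0::real^'n) \<rho>))"
  have "0 < measure lborel (ball (0::real^'n) \<rho>)" using \<rho>(1) by (simp add: content_ball_pos)
  then have K: "0 < K" using \<rho>(1) v0 by (simp add: K_def)
  obtain J where J: "1 / t0 < 2 ^ J" using real_arch_pow[of 2 "1 / t0"] by auto
  have main: "MT_counterexample \<sigma> (real (CARD('n) - 1) / real (CARD('n) - 1 + k)) (2 ^ j) (K * exp ((4 * real CARD('n) + 23) * sqrt (real j * ln (real j))))"
    if j: "max j0 J \<le> j" for j
  proof -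
    have j1j: "max j1 1 \<le> j" and j0j: "j0 \<le> j" and jJ: "J \<le> j" using j j0 by auto
    have j1: "1 \<le> real j" using j1j by simp
    note sc = p[OF j1j]
    define \<delta> where "\<delta> = fst (snd (snd (p j)))"
    have \<delta>: "1 / 2 ^ j \<le> \<delta>" "\<delta> \<le> 1" using sc unfolding scale_config_def \<delta>_def by blast+
    have \<delta>0: "0 < \<delta>" 
    proof -
      have "0 < (1 / 2 ^ j :: real)" by simp
      then show ?thesis using \<delta>(1) by linarith
    qed
    have y: "y = (T \<circ> \<psi>) (u y)" "u y \<in> cball c r" "norm y \<le> B0 + 1" if yY: "y \<in> Y j" for y
    proof -
      have box: "x0 $ i + s / (real j + 1) + \<delta> / 3 \<le> y $ i" "y $ i \<le> x0 $ i + s / real j - \<delta> / 3" if "i \<noteq> i0" for i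
        using sc yY that unfolding scale_config_def \<delta>_def Y_def by blast+
      have s0: "0 \<le> s / (real j + 1)" "s / real j \<le> s" using s(1) j1 by (auto simp: divide_le_eq mult_left_mono)
      have "\<bar>y $ i - x0 $ i\<bar> \<le> s" if "i \<noteq> i0" for i using box[OF that] s0 \<delta>0 by linarith
      note uy = u[OF this]
      show "u y \<in> cball c r" by (rule uy(1))
      define x where "x = \<psi> (u y)"
      have bx: "b x = y $ i0 - x $ i0"
      proof -
        have "b x = b y" using b(3) uy(2) by (simp add: x_def)
        also have "\<dots> = y $ i0 - g y" using b(4) j0j yY by blast
        finally show ?thesis by (simp add: g_def x_def)
      qed
      have "T x $ i = y $ i" for i
        using uy(2)[of i] bx by (cases "i = i0") (auto simp: T_def \<eta>_def e_def axis_def x_def)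
      then have Tx: "T x = y" by (simp add: vec_eq_iff)
      then show "y = (T \<circ> \<psi>) (u y)" by (simp add: x_def)
      have hb: "\<bar>y $ i0 - g y\<bar> * (4 / \<delta>) ^ k \<le> 1 / (real j)\<^sup>2"
        using sc yY unfolding scale_config_def \<delta>_def Y_def by blast
      have "1 \<le> (4 / \<delta>) ^ k" using \<delta>(2) \<delta>0 by (intro one_le_power) auto
      then have "\<bar>y $ i0 - g y\<bar> * 1 \<le> \<bar>y $ i0 - g y\<bar> * (4 / \<delta>) ^ k" by (intro mult_left_mono) auto
      moreover have "1 / (real j)\<^sup>2 \<le> 1" using j1 by (simp add: one_le_power)
      ultimately have "\<bar>b x\<bar> \<le> 1" using hb bx by (simp add: g_def x_def)
      then have "norm (\<eta> x) \<le> 1" by (simp add: \<eta>_def e_def)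
      moreover have "u y \<in> cball c (2 * r)" using uy(1) P(7) by auto
      then have "x \<in> S" using P(9) by (auto simp: x_def)
      then have "norm x \<le> B0" by (rule B0(2))
      ultimately show "norm y \<le> B0 + 1" using norm_triangle_ineq[of x "\<eta> x"] unfolding Tx[symmetric] T_def by linarith
    qed
    define t where "t = 1 / (16 * pi * 2 ^ j)"
    have t: "0 < t" "t \<le> t0"
    proof -
      show "0 < t" by (simp add: t_def)
      have "1 / t0 < 2 ^ j" using J power_increasing[OF jJ, of "2::real"] by linarith
      then have "1 / 2 ^ j < t0" using t0 by (simp add: field_simps)
      moreover have "1 * 2 ^ j \<le> 16 * pi * 2 ^ j" using pi_gt3 by (intro mult_right_mono) auto
      then have "t \<le> 1 / 2 ^ j" unfolding t_def by (intro divide_left_mono) auto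
      ultimately show "t \<le> t0" by linarith
    qed
    have cps: "\<exists>cap\<in>sets borel. cap \<subseteq> ball y (1 / (16 * pi * 2 ^ j)) \<and>
      ennreal (v0 * (1 / (16 * pi * 2 ^ j)) ^ (CARD('n) - 1)) \<le> emeasure \<sigma> cap \<and> emeasure \<sigma> cap < \<infinity>" if "y \<in> Y j" for y
      using cap[rule_format, OF t y(2)[OF that]] unfolding y(1)[OF that, symmetric] t_def m .
    show ?thesis unfolding K_def
      by (rule scale_counterexample[OF n sc \<sigma>b v0 cps \<rho>]) (auto simp: Y_def intro: y(3)[unfolded Y_def])
  qed
  have "Ck_map k \<eta> S" using C\<eta> unfolding Ck_map_def by blast
  moreover have "Ck_norm k F \<eta> \<le> ennreal \<epsilon>" using \<tau>(2)[OF b(1,2)] by (simp add: \<eta>_def[abs_def])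
  moreover have im: "(\<lambda>x. x + \<eta> x) ` S = S'" by (simp add: S'_def T_def[abs_def])
  moreover have "\<forall>\<^sub>F j in sequentially. MT_counterexample \<sigma> (real (CARD('n) - 1) / real (CARD('n) - 1 + k)) (2 ^ j) (K * exp ((4 * real CARD('n) + 23) * sqrt (real j * ln (real j))))"
    using main by (rule eventually_sequentiallyI)
  ultimately show ?thesis
    using S' K unfolding \<sigma>_def by (intro exI[of _ \<eta>]) (simp only: im, blast)
qed

theorem mainTheorem1:
  fixes S :: "(real^'n) set" and k :: nat
  assumes n_ge_2: "2 \<le> CARD('n)"
    and m_eq: "CARD('m::finite) = CARD('n) - 1"
    and k_ge_2: "2 \<le> k"
    and hypersurface: "compact_hypersurface TYPE('m) k S"
  shows "\<exists>C\<ge>1. \<forall>F :: ((real^'m) set \<times> (real^'m \<Rightarrow> real^'n)) set.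
    Ck_parametrization_family k S F \<longrightarrow>
    (\<forall>\<epsilon>>0. \<exists>\<eta> S' \<sigma>. Ck_map k \<eta> S \<and> Ck_norm k F \<eta> \<le> ennreal \<epsilon> \<and>
       S' = (\<lambda>x. x + \<eta> x) ` S \<and> compact_hypersurface TYPE('m) k S' \<and>
       \<sigma> = surface_measure TYPE('m) S' \<and>
       (\<exists>R0\<ge>1. \<forall>R\<ge>R0. \<exists>f w.
          f \<in> square_integrable \<sigma> \<and>
          w \<in> borel_measurable borel \<and> (\<forall>x. 0 \<le> w x) \<and> (\<forall>x. x \<notin> ball 0 R \<longrightarrow> w x = 0) \<and>
          xray_sup_norm w < \<infinity> \<and>
          0 < weighted_L2_norm_sq w (fourier_extension \<sigma> f) \<and>
          weighted_L2_norm_sq w (fourier_extension \<sigma> f) < \<infinity> \<and>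
          ennreal (R powr (real (CARD('n) - 1) / real (CARD('n) - 1 + k))) * xray_sup_norm w *
            L2_norm_sq \<sigma> f * inverse (weighted_L2_norm_sq w (fourier_extension \<sigma> f))
          \<le> ennreal (C * exp (C * sqrt (ln R * ln (ln R))))))"
proof (rule exI[of _ "2 * (4 * real CARD('n) + 23) + 1"], intro conjI allI impI)
  show "1 \<le> 2 * (4 * real CARD('n) + 23) + 1" by simp
  fix F :: "((real^'m) set \<times> (real^'m \<Rightarrow> real^'n)) set" and \<epsilon> :: real
  assume F: "Ck_parametrization_family k S F" and \<epsilon>: "0 < \<epsilon>"
  have C1: "1 \<le> 4 * real CARD('n) + 23" by simp
  have \<alpha>: "0 \<le> real (CARD('n) - 1) / real (CARD('n) - 1 + k)" "real (CARD('n) - 1) / real (CARD('n) - 1 + k) \<le> 1"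
    using k_ge_2 by (simp_all add: divide_le_eq)
  obtain \<eta> K where \<eta>: "Ck_map k \<eta> S" "Ck_norm k F \<eta> \<le> ennreal \<epsilon>" "compact_hypersurface TYPE('m) k ((\<lambda>x. x + \<eta> x) ` S)"
    and K: "0 < K" and dy: "\<forall>\<^sub>F j in sequentially. MT_counterexample (surface_measure TYPE('m) ((\<lambda>x. x + \<eta> x) ` S))
      (real (CARD('n) - 1) / real (CARD('n) - 1 + k)) (2 ^ j) (K * exp ((4 * real CARD('n) + 23) * sqrt (real j * ln (real j))))"
    using perturbed_hypersurface[OF n_ge_2 m_eq k_ge_2 hypersurface F \<epsilon>] by (elim exE conjE) (rule that)
  obtain R0 where R0: "1 \<le> R0" "\<forall>R\<ge>R0. MT_counterexample (surface_measure TYPE('m) ((\<lambda>x. x + \<eta> x) ` S))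
      (real (CARD('n) - 1) / real (CARD('n) - 1 + k)) R
      ((2 * (4 * real CARD('n) + 23) + 1) * exp ((2 * (4 * real CARD('n) + 23) + 1) * sqrt (ln R * ln (ln R))))"
    using all_radii[OF K C1 \<alpha> dy] by blast
  show "\<exists>\<eta> S' \<sigma>. Ck_map k \<eta> S \<and> Ck_norm k F \<eta> \<le> ennreal \<epsilon> \<and>
       S' = (\<lambda>x. x + \<eta> x) ` S \<and> compact_hypersurface TYPE('m) k S' \<and>
       \<sigma> = surface_measure TYPE('m) S' \<and>
       (\<exists>R0\<ge>1. \<forall>R\<ge>R0. \<exists>f w.
          f \<in> square_integrable \<sigma> \<and>
          w \<in> borel_measurable borel \<and> (\<forall>x. 0 \<le> w x) \<and> (\<forall>x. x \<notin> ball 0 R \<longrightarrow> w x = 0) \<and>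
          xray_sup_norm w < \<infinity> \<and>
          0 < weighted_L2_norm_sq w (fourier_extension \<sigma> f) \<and>
          weighted_L2_norm_sq w (fourier_extension \<sigma> f) < \<infinity> \<and>
          ennreal (R powr (real (CARD('n) - 1) / real (CARD('n) - 1 + k))) * xray_sup_norm w *
            L2_norm_sq \<sigma> f * inverse (weighted_L2_norm_sq w (fourier_extension \<sigma> f))
          \<le> ennreal ((2 * (4 * real CARD('n) + 23) + 1) * exp ((2 * (4 * real CARD('n) + 23) + 1) * sqrt (ln R * ln (ln R)))))"
    by (rule exI[of _ \<eta>], rule exI, rule exI, intro conjI, rule \<eta>(1), rule \<eta>(2), rule refl, rule \<eta>(3), rule refl,
        rule exI[of _ R0], intro conjI, rule R0(1), rule R0(2)[unfolded MT_counterexample_def])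
qed

end
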